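(* Let $1\leqslant p<2$. There exists an increasing function $m_p:(1,\infty]\to(1,\infty]$, namely the function $m_p$ given by the explicit formula in the context, such that for all planar annuli $\mathbb{A}=\{z\in\mathbb{R}^2: r<|z|<R\}$ and $\mathbb{A}^*=\{z\in\mathbb{R}^2: r_*<|z|<R_*\}$, with $0\leqslant r<R$ and $0\leqslant r_*<R_*$, the following hold. (1) If $1<p<2$, then $\mathbb{E}_p$ has a unique minimizer in the class $\overline{\mathcal{R}}^{1,p}(\mathbb{A},\mathbb{A}^* )$. Moreover, this minimizer lies in the class $\mathcal{R}^{1,p}(\mathbb{A},\mathbb{A}^* )$ (i.e. is a homeomorphism) whenever $m_p(R/r)\leqslant R_*/r_*$. (2) If $p=1$, then, for the problem of minimizing $\mathbb{E}_1$ over $\overline{\mathcal{R}}^{1,1}(\mathbb{A},\mathbb{A}^* )$: - if $R_*/r_*<m_1(R/r)$, a unique minimizer exists, and it lies in $\overline{\mathcal{R}}^{1,1}(\mathbb{A},\mathbb{A}^* )\setminus\mathcal{R}^{1,1}(\mathbb{A},\mathbb{A}^* )$; - if $m_1(R/r)\leqslant R_*/r_*\leqslant m_1^{-1}(R/r)$, a unique minimizer exists, and it lies in $\mathcal{R}^{1,1}(\mathbb{A},\mathbb{A}^* )$; - if $m_1^{-1}(R/r)<R_*/r_*$, no minimizer exists in $\overline{\mathcal{R}}^{1,1}(\mathbb{A},\mathbb{A}^* )$.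
   Context: Annuli with inner radius $0$ (punctured disks) are allowed; $R/r=\infty$ if $r=0$ and $R_*/r_*=\infty$ if $r_*=0$. - $\mathbb{E}_p[h]=\int_{\mathbb{A}}|Dh(x)|^p\,dx$, where $|Dh|^2=\operatorname{Tr}[D^*h\cdot Dh]$ is the squared Hilbert–Schmidt norm of the differential matrix. - $\mathcal{H}^{1,p}(\mathbb{A},\mathbb{A}^* )$ is the class of orientation-preserving homeomorphisms $h$ from $\mathbb{A}$ onto $\mathbb{A}^*$ which lie in the Sobolev space $W^{1,p}(\mathbb{A},\mathbb{R}^2)$ and preserve the order of the boundary components: $|h(x)|\to r_*$ as $|x|\to r$ and $|h(x)|\to R_*$ as $|x|\to R$. - $\mathcal{R}^{1,p}(\mathbb{A},\mathbb{A}^* )=\{h\in\mathcal{H}^{1,p}(\mathbb{A},\mathbb{A}^* ): h(x)=H(|x|)\frac{x}{|x|}\}$ (for some real-valued function $H$). - $\overline{\mathcal{R}}^{1,p}(\mathbb{A},\mathbb{A}^* )$ is the class of $h\in W^{1,p}(\mathbb{A},\mathbb{R}^2)$ of the form $h(x)=H(|x|)\frac{x}{|x|}$ with $H:[r,R]\to[r_*,R_*]$, $H(r)=r_*$, $H(R)=R_*$ and $\dot H\geqslant 0$, where the dot denotes the derivative. - The function $m_p$: for $t\in(0,1/2)$ let $$\phi_p(t)=\frac{1-(2-p)t}{2\sqrt{t}\sqrt{1-t}\,\bigl(1-pt-(2-p)\sqrt{t}\sqrt{1-t}\bigr)},$$ which is positive on $(0,1/2)$, and let $\Phi_p(t)=\int_0^t\phi_p(\tau)\,d\tau$;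 this is a strictly increasing function from $[0,1/2)$ onto $[0,\infty)$, with inverse $\Phi_p^{-1}:[0,\infty)\to[0,1/2)$. Then $$\log m_p(x)=\int_1^{x}\frac{\sqrt{\Phi_p^{-1}(\log s)}}{s\sqrt{1-\Phi_p^{-1}(\log s)}}\,ds\quad\text{for } x\in(1,\infty),\qquad m_p(\infty)=\infty .$$ $m_1^{-1}$ denotes the inverse function of $m_1$. *)

theory Defs
  imports "HOL-Complex_Analysis.Winding_Numbers"
begin

text \<open>The Euclidean plane is the type \<^typ>\<open>complex\<close>, with its norm, inner product and
  Lebesgue measure as a two-dimensional real Euclidean space.\<close>

section \<open>Sobolev spaces\<close>

primrec Ck :: "nat \<Rightarrow> ('a::real_normed_vector \<Rightarrow> 'b::real_normed_vector) \<Rightarrow> bool" where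
  "Ck 0 f \<longleftrightarrow> continuous_on UNIV f"
| "Ck (Suc k) f \<longleftrightarrow>
     (\<forall>x. f differentiable (at x)) \<and> (\<forall>v. Ck k (\<lambda>x. frechet_derivative f (at x) v))"

definition test_functions :: "'a::euclidean_space set \<Rightarrow> ('a \<Rightarrow> real) set" where
  "test_functions \<Omega> =
     {\<phi>. (\<forall>k. Ck k \<phi>) \<and> (\<exists>K. compact K \<and> K \<subseteq> \<Omega> \<and> (\<forall>x. x \<notin> K \<longrightarrow> \<phi> x = 0))}"

definition locally_integrable ::
  "'a::euclidean_space set \<Rightarrow> ('a \<Rightarrow> 'b::euclidean_space) \<Rightarrow> bool" where
  "locally_integrable \<Omega> u \<longleftrightarrow> (\<forall>K. compact K \<and> K \<subseteq> \<Omega> \<longrightarrow> u absolutely_integrable_on K)"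

definition has_weak_partial ::
  "'a::euclidean_space set \<Rightarrow> ('a \<Rightarrow> 'b::euclidean_space) \<Rightarrow> 'a \<Rightarrow> ('a \<Rightarrow> 'b) \<Rightarrow> bool" where
  "has_weak_partial \<Omega> u b g \<longleftrightarrow>
     locally_integrable \<Omega> u \<and> locally_integrable \<Omega> g \<and>
     (\<forall>\<phi>\<in>test_functions \<Omega>.
        (LINT x|lebesgue_on \<Omega>. frechet_derivative \<phi> (at x) b *\<^sub>R u x) =
        - (LINT x|lebesgue_on \<Omega>. \<phi> x *\<^sub>R g x))"

text \<open>For open \<open>\<Omega>\<close> the weak partial derivative is determined up to a null set, so the choice
  made here does not affect integrals.\<close>

definition weak_partial ::
  "'a::euclidean_space set \<Rightarrow> ('a \<Rightarrow> 'b::euclidean_space) \<Rightarrow> 'a \<Rightarrow> ('a \<Rightarrow> 'b)" where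
  "weak_partial \<Omega> u b = (SOME g. has_weak_partial \<Omega> u b g)"

definition Lp_space ::
  "real \<Rightarrow> 'a::euclidean_space set \<Rightarrow> ('a \<Rightarrow> 'b::euclidean_space) set" where
  "Lp_space p \<Omega> = {u \<in> borel_measurable (lebesgue_on \<Omega>).
     integrable (lebesgue_on \<Omega>) (\<lambda>x. norm (u x) powr p)}"

definition sobolev_W1 ::
  "real \<Rightarrow> 'a::euclidean_space set \<Rightarrow> ('a \<Rightarrow> 'b::euclidean_space) set" where
  "sobolev_W1 p \<Omega> = {u \<in> Lp_space p \<Omega>.
     \<forall>b\<in>Basis. \<exists>g\<in>Lp_space p \<Omega>. has_weak_partial \<Omega> u b g}"

text \<open>Pointwise Hilbert-Schmidt norm of the weak differential: the trace of \<open>D\<^sup>* D\<close> in the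
  standard orthonormal basis is the sum of the squared lengths of the partial derivatives.\<close>

definition HS_norm_weak_deriv ::
  "'a::euclidean_space set \<Rightarrow> ('a \<Rightarrow> 'b::euclidean_space) \<Rightarrow> 'a \<Rightarrow> real" where
  "HS_norm_weak_deriv \<Omega> h x = sqrt (\<Sum>b\<in>Basis. (norm (weak_partial \<Omega> h b x))\<^sup>2)"

definition energy ::
  "real \<Rightarrow> 'a::euclidean_space set \<Rightarrow> ('a \<Rightarrow> 'b::euclidean_space) \<Rightarrow> real" where
  "energy p \<Omega> h = (LINT x|lebesgue_on \<Omega>. HS_norm_weak_deriv \<Omega> h x powr p)"


section \<open>Annuli and classes of mappings between them\<close>

definition annulus :: "real \<Rightarrow> real \<Rightarrow> complex set" where
  "annulus r R = {z. r < norm z \<and> norm z < R}"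

definition radii_ratio :: "real \<Rightarrow> real \<Rightarrow> ereal" where
  "radii_ratio r R = (if r = 0 then \<infinity> else ereal (R / r))"

text \<open>A planar homeomorphism preserves orientation if its local degree is \<open>1\<close>, i.e. the image of
  a small positively oriented circle winds once, positively, around the image of the centre.\<close>

definition orientation_preserving_on :: "complex set \<Rightarrow> (complex \<Rightarrow> complex) \<Rightarrow> bool" where
  "orientation_preserving_on S h \<longleftrightarrow>
     (\<forall>z \<rho>. 0 < \<rho> \<and> cball z \<rho> \<subseteq> S \<longrightarrow> winding_number (h \<circ> circlepath z \<rho>) (h z) = 1)"

text \<open>In all classes below, the domain is \<^term>\<open>annulus r R\<close>, the target is
  \<^term>\<open>annulus rs Rs\<close>, and membership depends only on the values of a mapping on the
  domain annulus.\<close>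

definition sobolev_homeos ::
  "real \<Rightarrow> real \<Rightarrow> real \<Rightarrow> real \<Rightarrow> real \<Rightarrow> (complex \<Rightarrow> complex) set" where
  "sobolev_homeos p r R rs Rs =
     {h \<in> sobolev_W1 p (annulus r R).
        (\<exists>g. homeomorphism (annulus r R) (annulus rs Rs) h g) \<and>
        orientation_preserving_on (annulus r R) h \<and>
        ((\<lambda>x. norm (h x)) \<longlongrightarrow> rs) (filtercomap norm (at_right r)) \<and>
        ((\<lambda>x. norm (h x)) \<longlongrightarrow> Rs) (filtercomap norm (at_left R))}"

definition radial_on :: "complex set \<Rightarrow> (real \<Rightarrow> real) \<Rightarrow> (complex \<Rightarrow> complex) \<Rightarrow> bool" where
  "radial_on S H h \<longleftrightarrow> (\<forall>x\<in>S. h x = H (norm x) *\<^sub>R (x /\<^sub>R norm x))"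

definition radial_homeos ::
  "real \<Rightarrow> real \<Rightarrow> real \<Rightarrow> real \<Rightarrow> real \<Rightarrow> (complex \<Rightarrow> complex) set" where
  "radial_homeos p r R rs Rs =
     {h \<in> sobolev_homeos p r R rs Rs. \<exists>H. radial_on (annulus r R) H h}"

text \<open>The profile \<open>H\<close> is the continuous representative on \<open>[r, R]\<close>; without continuity the
  boundary conditions would not constrain the mapping on the open annulus.\<close>

definition radial_monotone_maps ::
  "real \<Rightarrow> real \<Rightarrow> real \<Rightarrow> real \<Rightarrow> real \<Rightarrow> (complex \<Rightarrow> complex) set" where
  "radial_monotone_maps p r R rs Rs =
     {h \<in> sobolev_W1 p (annulus r R).
        \<exists>H. radial_on (annulus r R) H h \<and>
            continuous_on {r..R} H \<and> H \<in> {r..R} \<rightarrow> {rs..Rs} \<and> H r = rs \<and> H R = Rs \<and>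
            (AE t in lebesgue_on {r<..<R}. \<exists>D\<ge>0. (H has_real_derivative D) (at t))}"

text \<open>Uniqueness is meant for mappings on the domain \<open>S\<close>; values outside \<open>S\<close> are irrelevant.\<close>

definition is_unique_minimizer ::
  "'a set \<Rightarrow> (('a \<Rightarrow> 'b) \<Rightarrow> real) \<Rightarrow> ('a \<Rightarrow> 'b) set \<Rightarrow> ('a \<Rightarrow> 'b) \<Rightarrow> bool" where
  "is_unique_minimizer S E \<C> h \<longleftrightarrow>
     is_arg_min E (\<lambda>g. g \<in> \<C>) h \<and>
     (\<forall>g. is_arg_min E (\<lambda>g. g \<in> \<C>) g \<longrightarrow> (\<forall>x\<in>S. g x = h x))"


section \<open>The critical function\<close>

definition phi :: "real \<Rightarrow> real \<Rightarrow> real" where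
  "phi p t = (1 - (2 - p) * t) /
     (2 * sqrt t * sqrt (1 - t) * (1 - p * t - (2 - p) * sqrt t * sqrt (1 - t)))"

definition Phi :: "real \<Rightarrow> real \<Rightarrow> real" where
  "Phi p t = integral {0..t} (phi p)"

text \<open>\<^term>\<open>Phi p\<close> maps \<open>[0, 1/2)\<close> bijectively onto \<open>[0, \<infinity>)\<close> for \<open>1 \<le> p < 2\<close>.\<close>

definition Phi_inv :: "real \<Rightarrow> real \<Rightarrow> real" where
  "Phi_inv p = the_inv_into {0..<1/2} (Phi p)"

text \<open>Only arguments in \<open>(1, \<infinity>]\<close> are meaningful.\<close>

definition crit :: "real \<Rightarrow> ereal \<Rightarrow> ereal" where
  "crit p x = (if x = \<infinity> then \<infinity> else
     ereal (exp (integral {1..real_of_ereal x}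
       (\<lambda>s. sqrt (Phi_inv p (ln s)) / (s * sqrt (1 - Phi_inv p (ln s)))))))"

definition crit_inv :: "real \<Rightarrow> ereal \<Rightarrow> ereal" where
  "crit_inv p = the_inv_into {1<..} (crit p)"

end

theory Submission
  imports Defs "HOL-Real_Asymp.Real_Asymp"
begin

text \<open>Write \<open>H\<close> for the profile of a radial mapping. At a point of norm \<open>\<rho>\<close> the differential has the
  entries \<open>H'\<close> in the radial and \<open>H / \<rho>\<close> in the tangential direction, so the energy is
  \<open>2 \<pi> \<integral> (H'\<^sup>2 + (H / \<rho>)\<^sup>2)\<^bsup>p/2\<^esup> \<rho> d\<rho>\<close>.

  The integrand is a convex function of the gradient, so a solution \<open>H0\<close> of the Euler-Lagrange equation
  \<open>flux' = hoop\<close>, where \<open>flux = |Dh0|\<^bsup>p-2\<^esup> H0' \<rho>\<close> and \<open>hoop = |Dh0|\<^bsup>p-2\<^esup> H0 / \<rho>\<close>, is a minimizer: the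
  energy of a competitor lies above the tangent plane at \<open>Dh0\<close> (\<open>norm_powr_tangent\<close>), and the linear
  term integrates to the boundary values of \<open>flux * (H - H0)\<close>, which vanish (\<open>energy_gap\<close>). In the case
  of equality the two gradients are parallel, which forces \<open>H / H0\<close> to be constant and gives uniqueness
  even for \<open>p = 1\<close>, where the integrand is not strictly convex. The solution may have a plateau
  \<open>H0 = rs\<close> next to the inner circle; there the equation becomes an inequality, which suffices because
  competitors satisfy \<open>H \<ge> rs\<close>. The competitors are only known through their weak gradients in the
  plane, so the integration by parts is carried out there, with radial test functions
  (\<open>radial_integration_by_parts\<close>, \<open>tangential_integral\<close>).

  The Euler-Lagrange equation is invariant under scaling of \<open>\<rho>\<close> and of \<open>H\<close>. Therefore the elasticity
  quotient \<open>\<lambda> = \<rho> H' / H\<close> solves, in the variable \<open>ln \<rho>\<close>, an autonomous first order equation, with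
  the stationary point \<open>1\<close> that belongs to linear profiles. Below it there is, up to translation, a single
  trajectory starting at \<open>\<lambda> = 0\<close>, which is what a plateau can be joined to; its profile is \<open>grow\<close>, and
  \<open>crit p x = grow (ln x)\<close> (\<open>crit_eq\<close>). Above it there is a single trajectory starting at
  \<open>\<lambda> = \<infinity>\<close>, with profile \<open>fast_grow\<close>. Translating a trajectory changes the ratio of the boundary values
  continuously until it reaches that of the linear map (\<open>quotient_shift_attains\<close>). So a boundary value
  problem is solved by a plateau followed by the slow trajectory if the ratio of the target radii is below
  the critical value, and by a strictly increasing piece of the slow, linear or fast trajectory up to the
  ratio \<open>fast_grow l / fast_grow 0\<close>, with \<open>l = ln (R / r)\<close>.

  For \<open>p > 1\<close> this last ratio is infinite since \<open>fast_grow 0 = 0\<close>. For \<open>p = 1\<close> the energy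
  is invariant under exchanging \<open>\<rho>\<close> and \<open>H\<close>, which makes \<open>fast_grow\<close> the inverse of the critical
  function in logarithmic coordinates (\<open>duality\<close>). Beyond it the infimum is approached by mappings that perform a jump at
  the inner circle in an ever thinner layer, and it is not attained (\<open>no_minimizer_if_jump\<close>).\<close>

section \<open>Smooth functions and cutoffs\<close>

lemma Ck_SucI:
  assumes "\<And>x. (f has_derivative f' x) (at x)" "\<And>v. Ck k (\<lambda>x. f' x v)"
  shows "Ck (Suc k) f"
proof -
  have "frechet_derivative f (at x) = f' x" for x
    using frechet_derivative_at[OF assms(1)] by metis
  then show ?thesis using assms by (auto simp: differentiable_def)
qed

lemma Ck_SucD: "Ck (Suc k) f \<Longrightarrow> Ck k f"
proof (induction k arbitrary: f)
  case 0
  then show ?case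
    by (auto intro!: continuous_at_imp_continuous_on differentiable_imp_continuous_within)
next
  case (Suc k)
  then show ?case by (metis Ck.simps(2))
qed

lemma Ck_Suc_has_derivative:
  "Ck (Suc k) f \<Longrightarrow> (f has_derivative frechet_derivative f (at x)) (at x)"
  by (simp add: frechet_derivative_works[symmetric])

lemma Ck_const: "Ck k (\<lambda>x. c)"
proof (induction k arbitrary: c)
  case (Suc k)
  show ?case by (rule Ck_SucI[where f' = "\<lambda>x v. 0"]) (auto intro: Suc)
qed simp

lemma Ck_linear: "bounded_linear f \<Longrightarrow> Ck k f"
proof (cases k)
  case (Suc j)
  assume f: "bounded_linear f"
  show ?thesis unfolding Suc
    by (rule Ck_SucI[where f' = "\<lambda>x. f"]) (auto intro: Ck_const bounded_linear_imp_has_derivative[OF f])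
qed (auto simp: linear_continuous_on)

lemma Ck_add: "Ck k f \<Longrightarrow> Ck k g \<Longrightarrow> Ck k (\<lambda>x. f x + g x)"
proof (induction k arbitrary: f g)
  case (Suc k)
  show ?case
    by (rule Ck_SucI[OF has_derivative_add[OF Ck_Suc_has_derivative Ck_Suc_has_derivative]])
      (use Suc in auto)
qed (auto intro: continuous_intros)

lemma Ck_mult:
  fixes f g :: "'a::real_normed_vector \<Rightarrow> real"
  shows "Ck k f \<Longrightarrow> Ck k g \<Longrightarrow> Ck k (\<lambda>x. f x * g x)"
proof (induction k arbitrary: f g)
  case (Suc k)
  have "Ck k f" "Ck k g" using Suc.prems Ck_SucD by auto
  then show ?case
    by (intro Ck_SucI[OF has_derivative_mult[OF Ck_Suc_has_derivative Ck_Suc_has_derivative]]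
        Ck_add Suc.IH) (use Suc.prems in auto)
qed (auto intro: continuous_intros)

text \<open>The induction on \<open>k\<close> needs an outer function of one variable: then the derivative of the composition
  is a product of two functions that are again of the admitted forms.\<close>

lemma Ck_compose:
  fixes g :: "real \<Rightarrow> real" and f :: "'a::real_normed_vector \<Rightarrow> real"
  shows "Ck k g \<Longrightarrow> Ck k f \<Longrightarrow> Ck k (\<lambda>x. g (f x))"
proof (induction k arbitrary: g f)
  case 0
  then show ?case by (auto intro: continuous_on_compose2)
next
  case (Suc k)
  have *: "((\<lambda>x. g (f x)) has_derivative
      (\<lambda>v. frechet_derivative f (at x) v * frechet_derivative g (at (f x)) 1)) (at x)" for x
  proof -
    have "((\<lambda>x. g (f x)) has_derivative
        (\<lambda>v. frechet_derivative g (at (f x)) (frechet_derivative f (at x) v))) (at x)"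
      by (rule has_derivative_compose[OF Ck_Suc_has_derivative Ck_Suc_has_derivative])
        (use Suc.prems in auto)
    moreover have lin: "linear (frechet_derivative g (at (f x)))"
      using Suc.prems by (simp add: linear_frechet_derivative)
    have "(\<lambda>v. frechet_derivative g (at (f x)) (frechet_derivative f (at x) v)) =
        (\<lambda>v. frechet_derivative f (at x) v * frechet_derivative g (at (f x)) 1)"
    proof
      fix v
      show "frechet_derivative g (at (f x)) (frechet_derivative f (at x) v) =
          frechet_derivative f (at x) v * frechet_derivative g (at (f x)) 1"
        using linear_scale[OF lin, of "frechet_derivative f (at x) v" 1]
        unfolding real_scaleR_def mult_1_right .
    qed
    ultimately show ?thesis by (simp only:)
  qed
  have "Ck k f" using Suc.prems Ck_SucD by auto
  then have "Ck k (\<lambda>x. frechet_derivative g (at (f x)) 1)"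
    using Suc.IH[of "\<lambda>y. frechet_derivative g (at y) 1" f] Suc.prems by simp
  then show ?case
    by (intro Ck_SucI[OF *] Ck_mult) (use Suc.prems in simp)
qed

lemma Ck_prod:
  fixes f :: "'i \<Rightarrow> 'a::real_normed_vector \<Rightarrow> real"
  assumes "\<And>i. i \<in> I \<Longrightarrow> Ck k (f i)"
  shows "Ck k (\<lambda>x. \<Prod>i\<in>I. f i x)"
  using assms
  by (induction I rule: infinite_finite_induct) (auto simp: Ck_const intro: Ck_mult)

lemma Ck_diff:
  fixes f g :: "'a::real_normed_vector \<Rightarrow> real"
  shows "Ck k f \<Longrightarrow> Ck k g \<Longrightarrow> Ck k (\<lambda>x. f x - g x)"
  using Ck_add[of k f "\<lambda>x. -1 * g x"] Ck_mult[OF Ck_const, of k g "-1"] by simp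

lemma Ck_real_SucI:
  fixes f :: "real \<Rightarrow> real"
  assumes "\<And>x. (f has_real_derivative f' x) (at x)" "Ck k f'"
  shows "Ck (Suc k) f"
  by (rule Ck_SucI[OF has_field_derivative_imp_has_derivative[OF assms(1)]])
    (auto intro!: Ck_mult assms Ck_const)

lemma Ck_poly: "Ck k (poly (p :: real poly))"
proof (induction k arbitrary: p)
  case (Suc k)
  show ?case by (rule Ck_real_SucI[OF poly_DERIV Suc])
qed (auto intro!: continuous_intros)

text \<open>The family of all \<open>p(1/x) exp (-1/x)\<close>, \<open>p\<close> a polynomial, is closed under differentiation,
  which makes each of its members infinitely often differentiable at \<open>0\<close>.\<close>

definition flat :: "real poly \<Rightarrow> real \<Rightarrow> real" where
  "flat p x = (if x > 0 then poly p (inverse x) * exp (- inverse x) else 0)"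

lemma poly_exp_tendsto_0: "((\<lambda>y. poly p y * exp (- y)) \<longlongrightarrow> (0::real)) at_top"
proof -
  have "((\<lambda>y::real. \<Sum>i\<le>degree p. coeff p i * (y ^ i / exp y)) \<longlongrightarrow> (\<Sum>i\<le>degree p. coeff p i * 0)) at_top"
    by (intro tendsto_intros tendsto_power_div_exp_0)
  then show ?thesis
    by (simp add: poly_altdef exp_minus divide_inverse sum_distrib_right mult.assoc)
qed

lemma flat_has_derivative:
  "(flat p has_real_derivative flat ([:0,0,1:] * (p - pderiv p)) x) (at x)"
proof -
  consider "x > 0" | "x < 0" | "x = 0" by linarith
  then show ?thesis
  proof cases
    case 1
    have "((\<lambda>x. poly p (inverse x) * exp (- inverse x)) has_real_derivative
        flat ([:0,0,1:] * (p - pderiv p)) x) (at x)"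
      using 1 by (auto intro!: derivative_eq_intros simp: flat_def power2_eq_square algebra_simps)
    then show ?thesis
      by (rule has_field_derivative_transform_within_open[of _ _ _ "{0<..}"])
        (use 1 in \<open>auto simp: flat_def\<close>)
  next
    case 2
    have "((\<lambda>x. 0) has_real_derivative flat ([:0,0,1:] * (p - pderiv p)) x) (at x)"
      using 2 by (auto simp: flat_def)
    then show ?thesis
      by (rule has_field_derivative_transform_within_open[of _ _ _ "{..<0}"])
        (use 2 in \<open>auto simp: flat_def\<close>)
  next
    case 3
    \<comment> \<open>\<open>pCons 0 p\<close> accounts for the factor \<open>1 / h\<close> of the difference quotient.\<close>
    have "((\<lambda>h. poly (pCons 0 p) (inverse h) * exp (- inverse h)) \<longlongrightarrow> 0) (at_right 0)"
      by (rule filterlim_compose[OF poly_exp_tendsto_0 filterlim_inverse_at_top_right])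
    then have "((\<lambda>h. flat p h / h) \<longlongrightarrow> 0) (at_right 0)"
      by (rule Lim_transform_eventually)
        (auto simp: flat_def eventually_at_right_field divide_inverse algebra_simps intro!: exI[of _ 1])
    moreover have "((\<lambda>h. flat p h / h) \<longlongrightarrow> 0) (at_left 0)"
      by (rule Lim_transform_eventually[OF tendsto_const])
        (auto simp: flat_def eventually_at_left_field intro!: exI[of _ "-1"])
    ultimately have "((\<lambda>h. flat p h / h) \<longlongrightarrow> 0) (at 0)"
      using filterlim_split_at by blast
    then show ?thesis
      using 3 by (simp add: has_field_derivative_iff flat_def)
  qed
qed

lemma Ck_flat: "Ck k (flat p)"
proof (induction k arbitrary: p)
  case 0
  show ?case
    by (auto intro!: continuous_at_imp_continuous_on DERIV_isCont[OF flat_has_derivative])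
next
  case (Suc k)
  show ?case by (rule Ck_real_SucI[OF flat_has_derivative Suc])
qed

definition bump :: "real \<Rightarrow> real" where
  "bump x = flat 1 x * flat 1 (1 - x)"

lemma Ck_bump: "Ck k bump"
proof -
  have "Ck k (\<lambda>x::real. 1 - x)"
    by (intro Ck_diff Ck_const Ck_linear bounded_linear_ident)
  then have "Ck k (\<lambda>x. flat 1 (1 - x))"
    by (rule Ck_compose[OF Ck_flat])
  then show ?thesis
    unfolding bump_def[abs_def] by (rule Ck_mult[OF Ck_flat])
qed

lemma continuous_on_bump: "continuous_on S bump"
  using Ck_bump[of 0] by (auto intro: continuous_on_subset)

lemma bump_nonneg: "bump x \<ge> 0" and bump_zero: "x \<le> 0 \<or> x \<ge> 1 \<Longrightarrow> bump x = 0"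
  by (auto simp: bump_def flat_def)

lemma bump_integral_pos: "integral {0..1} bump > 0"
proof -
  have "bump (1/2) > 0" by (auto simp: bump_def flat_def)
  then have "\<not> (\<forall>x\<in>{0..1}. bump x = 0)"
    by (intro notI) (drule bspec[of _ _ "1/2"], auto)
  then have "integral {0..1} bump \<noteq> 0"
    using integral_eq_0_iff[of 0 1 bump] continuous_on_bump bump_nonneg by simp
  moreover have "integral {0..1} bump \<ge> 0"
    by (rule integral_nonneg) (auto intro: integrable_continuous_real continuous_on_bump bump_nonneg)
  ultimately show ?thesis by simp
qed

definition smooth_step :: "real \<Rightarrow> real" where
  "smooth_step x = integral {0..x} bump / integral {0..1} bump"

lemma smooth_step_has_derivative:
  "(smooth_step has_real_derivative bump x / integral {0..1} bump) (at x)"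
proof (cases "x > -1")
  case True
  have eq: "integral {0..u} bump = integral {-1..u} bump" if "u > -1" for u
  proof (cases "u \<ge> 0")
    case True
    have "integral {-1..0} bump = integral {-1..0} (\<lambda>x::real. 0)"
      by (rule Henstock_Kurzweil_Integration.integral_cong) (auto simp: bump_zero)
    then show ?thesis
      using True Henstock_Kurzweil_Integration.integral_combine[where a="-1" and c=0 and b=u and f=bump]
      by (simp add: integrable_continuous_real continuous_on_bump)
  next
    case False
    have "integral {-1..u} bump = integral {-1..u} (\<lambda>x::real. 0)"
      by (rule Henstock_Kurzweil_Integration.integral_cong) (use False in \<open>auto simp: bump_zero\<close>)
    then show ?thesis using False by simp
  qed
  have "((\<lambda>u. integral {-1..u} bump) has_real_derivative bump x) (at x within {-1..x+1})"
    by (rule integral_has_real_derivative[OF continuous_on_bump]) (use True in auto)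
  then have "((\<lambda>u. integral {-1..u} bump) has_real_derivative bump x) (at x)"
    using True by (simp add: at_within_Icc_at)
  then have "((\<lambda>u. integral {0..u} bump) has_real_derivative bump x) (at x)"
    by (rule has_field_derivative_transform_within_open[of _ _ _ "{-1<..}"])
      (use True eq in auto)
  then show ?thesis unfolding smooth_step_def[abs_def] by (rule DERIV_cdivide)
next
  case False
  have "((\<lambda>u. 0) has_real_derivative bump x / integral {0..1} bump) (at x)"
    using False by (simp add: bump_zero)
  then show ?thesis
    by (rule has_field_derivative_transform_within_open[of _ _ _ "{..<0}"])
      (use False in \<open>auto simp: smooth_step_def\<close>)
qed

lemma Ck_smooth_step: "Ck k smooth_step"
proof -
  have "Ck (Suc k) smooth_step"
    by (rule Ck_real_SucI[OF smooth_step_has_derivative])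
      (use Ck_mult[OF Ck_bump Ck_const] in \<open>simp add: divide_inverse\<close>)
  then show ?thesis by (rule Ck_SucD)
qed

lemma smooth_step_0: "x \<le> 0 \<Longrightarrow> smooth_step x = 0"
  by (cases "x = 0") (auto simp: smooth_step_def)

lemma smooth_step_1: "x \<ge> 1 \<Longrightarrow> smooth_step x = 1"
proof -
  assume x: "x \<ge> 1"
  have "integral {1..x} bump = integral {1..x} (\<lambda>x::real. 0)"
    by (rule Henstock_Kurzweil_Integration.integral_cong) (auto simp: bump_zero)
  then show ?thesis
    using Henstock_Kurzweil_Integration.integral_combine[where a=0 and c=1 and b=x and f=bump] bump_integral_pos x
    by (simp add: smooth_step_def integrable_continuous_real continuous_on_bump)
qed

lemma smooth_step_mono: "x \<le> y \<Longrightarrow> smooth_step x \<le> smooth_step y"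
  using smooth_step_has_derivative bump_nonneg bump_integral_pos
  by (intro DERIV_nonneg_imp_nondecreasing[of x y smooth_step]) (meson divide_nonneg_pos)+

lemma smooth_step_range: "0 \<le> smooth_step x" "smooth_step x \<le> 1"
  using smooth_step_mono[of "min x 0" x] smooth_step_mono[of x "max x 1"]
  by (auto simp: smooth_step_0 smooth_step_1)

lemma integrable_compact_support:
  fixes f :: "'a::euclidean_space \<Rightarrow> 'b::euclidean_space"
  assumes "continuous_on UNIV f" "compact K" "\<And>x. x \<notin> K \<Longrightarrow> f x = 0"
  shows "integrable lborel f"
proof -
  have "(\<lambda>x. indicator K x *\<^sub>R f x) = f"
    using assms(3) by (fastforce simp: indicator_def)
  then show ?thesis
    using borel_integrable_compact[of K f] assms by (metis continuous_on_subset subset_UNIV)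
qed

text \<open>The integral of a directional derivative is the limit of the integrals of the difference
  quotients, and these vanish because the Lebesgue measure is translation invariant.\<close>

lemma integral_directional_derivative_eq_0:
  fixes F :: "'a::euclidean_space \<Rightarrow> 'b::euclidean_space"
  assumes F': "\<And>x. (F has_derivative F' x) (at x)"
    and cont: "continuous_on UNIV (\<lambda>x. F' x b)"
    and K: "compact K" "\<And>x. x \<notin> K \<Longrightarrow> F x = 0" "\<And>x. x \<notin> K \<Longrightarrow> F' x b = 0"
  shows "(LINT x|lborel. F' x b) = 0"
proof -
  have contF: "continuous_on UNIV F"
    using F' by (auto intro!: continuous_at_imp_continuous_on has_derivative_continuous)
  have intF: "integrable lborel F"
    by (rule integrable_compact_support[OF contF K(1,2)])
  obtain C0 where C0: "\<And>x. x \<in> K \<Longrightarrow> norm (F' x b) \<le> C0"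
    using compact_imp_bounded[OF compact_continuous_image[OF continuous_on_subset[OF cont] K(1)]]
    unfolding bounded_iff by auto
  define C where "C = max C0 0"
  have C: "norm (F' x b) \<le> C" for x
    using C0[of x] K(3)[of x] by (cases "x \<in> K") (auto simp: C_def)
  obtain B where B: "\<And>x. x \<in> K \<Longrightarrow> norm x \<le> B"
    using compact_imp_bounded[OF K(1)] unfolding bounded_iff by auto
  define h where "h n = inverse (real (Suc n))" for n
  have h: "h n > 0" "h n \<le> 1" for n by (auto simp: h_def field_simps)
  have h0: "h \<longlonglongrightarrow> 0" unfolding h_def by (rule LIMSEQ_inverse_real_of_nat)
  define d where "d n x = (F (x + h n *\<^sub>R b) - F x) /\<^sub>R h n" for n x
  have ray: "((\<lambda>s. F (x + s *\<^sub>R b)) has_vector_derivative F' (x + s *\<^sub>R b) b) (at s)" for x s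
  proof -
    have "((\<lambda>s. F (x + s *\<^sub>R b)) has_derivative (\<lambda>t. F' (x + s *\<^sub>R b) (t *\<^sub>R b))) (at s)"
      by (rule has_derivative_compose[OF _ F', of "\<lambda>s. x + s *\<^sub>R b"])
        (auto intro!: derivative_eq_intros)
    then show ?thesis
      unfolding has_vector_derivative_def
      using linear_scale[OF has_derivative_linear[OF F'[of "x + s *\<^sub>R b"]]] by simp
  qed
  have bound: "norm (d n x) \<le> C" for n x
  proof -
    have "norm (F (x + h n *\<^sub>R b) - F (x + 0 *\<^sub>R b)) \<le> C * norm (h n - 0)"
    proof (rule differentiable_bound[where S = "{0..h n}" and f = "\<lambda>s. F (x + s *\<^sub>R b)"
          and f' = "\<lambda>s t. t *\<^sub>R F' (x + s *\<^sub>R b) b"])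
      show "((\<lambda>s. F (x + s *\<^sub>R b)) has_derivative (\<lambda>t. t *\<^sub>R F' (x + s *\<^sub>R b) b)) (at s within {0..h n})"
        if "s \<in> {0..h n}" for s
        using ray[of x s] has_derivative_at_withinI unfolding has_vector_derivative_def by blast
      show "onorm (\<lambda>t. t *\<^sub>R F' (x + s *\<^sub>R b) b) \<le> C" for s
        by (rule onorm_le) (use C in \<open>simp add: mult.commute[of C] mult_left_mono\<close>)
    qed (use h[of n] in auto)
    moreover have "norm (d n x) = norm (F (x + h n *\<^sub>R b) - F x) / h n"
      using h[of n] by (simp add: d_def divide_inverse_commute)
    ultimately show ?thesis using h[of n] by (simp add: pos_divide_le_eq)
  qed
  have supp: "d n x = 0" if "x \<notin> cball 0 (B + norm b)" for n x
  proof -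
    have x: "norm x > B + norm b" using that by simp
    then have "x \<notin> K" using B[of x] by (smt (verit) norm_ge_zero)
    moreover have "norm (x + h n *\<^sub>R b) \<ge> norm x - h n * norm b"
      using norm_diff_ineq[of x "h n *\<^sub>R b"] h[of n] by simp
    then have "norm (x + h n *\<^sub>R b) > B"
      using x h[of n] mult_right_mono[of "h n" 1 "norm b"] by auto
    then have "x + h n *\<^sub>R b \<notin> K" using B by force
    ultimately show ?thesis using K(2) by (simp add: d_def)
  qed
  have bi: "norm (d n x) \<le> indicator (cball 0 (B + norm b)) x *\<^sub>R C" for n x
    using bound[of n x] supp[of x n] by (auto simp: indicator_def split: if_splits)
  have "(\<lambda>n. LINT x|lborel. d n x) \<longlonglongrightarrow> (LINT x|lborel. F' x b)"
  proof (rule integral_dominated_convergence[where w = "\<lambda>x. indicator (cball 0 (B + norm b)) x *\<^sub>R C"])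
    show "(\<lambda>x. F' x b) \<in> borel_measurable lborel"
      using borel_measurable_continuous_onI[OF cont] by simp
    have "continuous_on UNIV (d n)" for n
      unfolding d_def by (intro continuous_intros continuous_on_compose2[OF contF]) auto
    then show "d n \<in> borel_measurable lborel" for n
      by (simp add: borel_measurable_continuous_onI)
    show "integrable lborel (\<lambda>x. indicator (cball 0 (B + norm b)) x *\<^sub>R C)"
      by (rule borel_integrable_compact) auto
    show "AE x in lborel. (\<lambda>n. d n x) \<longlonglongrightarrow> F' x b"
    proof (rule AE_I2)
      fix x
      have "((\<lambda>s. (F (x + s *\<^sub>R b) - F x) /\<^sub>R s) \<longlongrightarrow> F' x b) (at 0)"
      proof (subst Lim_null, rule tendsto_norm_zero_cancel, rule Lim_transform_eventually)
        show "((\<lambda>s. norm (F (x + (0 + s) *\<^sub>R b) - F (x + 0 *\<^sub>R b) - s *\<^sub>R F' (x + 0 *\<^sub>R b) b) / norm s) \<longlongrightarrow> 0) (at 0)"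
          using ray[of x 0] unfolding has_vector_derivative_def has_derivative_at by blast
        have "norm (F (x + s *\<^sub>R b) - F x - s *\<^sub>R F' x b) / norm s = norm ((F (x + s *\<^sub>R b) - F x) /\<^sub>R s - F' x b)"
          if "s \<noteq> 0" for s
        proof -
          have "(F (x + s *\<^sub>R b) - F x) /\<^sub>R s - F' x b = (F (x + s *\<^sub>R b) - F x - s *\<^sub>R F' x b) /\<^sub>R s"
            using that by (simp add: scaleR_diff_right)
          then show ?thesis by (simp add: divide_inverse_commute)
        qed
        then show "eventually (\<lambda>s. norm (F (x + (0 + s) *\<^sub>R b) - F (x + 0 *\<^sub>R b) - s *\<^sub>R F' (x + 0 *\<^sub>R b) b) / norm s
            = norm ((F (x + s *\<^sub>R b) - F x) /\<^sub>R s - F' x b)) (at 0)"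
          by (auto simp: eventually_at intro!: exI[of _ 1])
      qed
      moreover have "filterlim h (at 0) sequentially"
        using h0 h(1) by (auto simp: filterlim_at eventually_sequentially less_imp_neq[symmetric])
      ultimately show "(\<lambda>n. d n x) \<longlonglongrightarrow> F' x b"
        unfolding d_def by (rule filterlim_compose)
    qed
    show "AE x in lborel. norm (d n x) \<le> indicator (cball 0 (B + norm b)) x *\<^sub>R C" for n
      using bi by simp
  qed
  moreover have "(LINT x|lborel. d n x) = 0" for n
  proof -
    have F1: "F \<in> borel_measurable borel" using intF by auto
    have "integrable lborel (\<lambda>x. F (h n *\<^sub>R b + x))"
      using integrable_distr_eq[of "(+) (h n *\<^sub>R b)" lborel borel F] F1 intF lborel_distr_plus[of "h n *\<^sub>R b"]
      by simp
    moreover have "(LINT x|lborel. F (h n *\<^sub>R b + x)) = (LINT x|lborel. F x)"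
      using integral_distr[of "(+) (h n *\<^sub>R b)" lborel borel F] F1 lborel_distr_plus[of "h n *\<^sub>R b"]
      by simp
    ultimately show ?thesis unfolding d_def using intF by (simp add: add.commute)
  qed
  ultimately show ?thesis by (simp add: LIMSEQ_const_iff)
qed

lemma test_function_has_derivative:
  "\<phi> \<in> test_functions \<Omega> \<Longrightarrow> (\<phi> has_derivative frechet_derivative \<phi> (at x)) (at x)"
  by (auto simp: test_functions_def intro: Ck_Suc_has_derivative[of 0])

lemma continuous_on_test_function: "\<phi> \<in> test_functions \<Omega> \<Longrightarrow> continuous_on S \<phi>"
  unfolding test_functions_def using Ck.simps(1)[of \<phi>] continuous_on_subset by blast

lemma continuous_on_test_function_derivative:
  assumes "\<phi> \<in> test_functions \<Omega>"
  shows "continuous_on S (\<lambda>x. frechet_derivative \<phi> (at x) b)"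
proof -
  have "Ck (Suc 0) \<phi>" using assms by (auto simp: test_functions_def)
  then have "continuous_on UNIV (\<lambda>x. frechet_derivative \<phi> (at x) b)" by simp
  then show ?thesis by (rule continuous_on_subset) simp
qed

lemma test_function_support:
  assumes \<phi>: "\<phi> \<in> test_functions \<Omega>"
  obtains K where "compact K" "K \<subseteq> \<Omega>" "\<And>x. x \<notin> K \<Longrightarrow> \<phi> x = 0"
    "\<And>x b. x \<notin> K \<Longrightarrow> frechet_derivative \<phi> (at x) b = 0"
proof -
  obtain K where K: "compact K" "K \<subseteq> \<Omega>" "\<And>x. x \<notin> K \<Longrightarrow> \<phi> x = 0"
    using assms by (auto simp: test_functions_def)
  have "frechet_derivative \<phi> (at x) b = 0" if "x \<notin> K" for x b
  proof -
    have "(\<phi> has_derivative (\<lambda>b. 0)) (at x)"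
      by (rule has_derivative_transform_within_open[of "\<lambda>x. 0" _ _ _ "- K"])
        (use that K in \<open>auto simp: compact_imp_closed open_Compl\<close>)
    from frechet_derivative_at[OF this] show ?thesis by metis
  qed
  then show thesis using that[OF K] by blast
qed

lemma lint_lebesgue_on:
  fixes f :: "'a::euclidean_space \<Rightarrow> 'b::euclidean_space"
  assumes "\<Omega> \<in> sets borel" "f \<in> borel_measurable borel" "\<And>x. x \<notin> \<Omega> \<Longrightarrow> f x = 0"
  shows "(LINT x|lebesgue_on \<Omega>. f x) = (LINT x|lborel. f x)"
proof -
  have "(\<lambda>x. indicator \<Omega> x *\<^sub>R f x) = f"
    using assms(3) by (fastforce simp: indicator_def)
  then show ?thesis
    using assms by (simp add: integral_restrict_space integral_completion)
qed

lemma continuous_on_zero_extension: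
  fixes f :: "'a::euclidean_space \<Rightarrow> 'b::euclidean_space"
  assumes "open \<Omega>" "continuous_on \<Omega> f" "compact K" "K \<subseteq> \<Omega>" "\<And>x. x \<notin> K \<Longrightarrow> f x = 0"
  shows "continuous_on UNIV f"
proof -
  have "continuous_on (- K) f"
    by (rule continuous_on_eq[of _ "\<lambda>x. 0"]) (use assms in auto)
  then have "continuous_on (\<Omega> \<union> - K) f"
    using assms by (intro continuous_on_open_Un) (auto simp: compact_imp_closed open_Compl)
  moreover have "\<Omega> \<union> - K = UNIV" using assms by auto
  ultimately show ?thesis by simp
qed

lemma locally_integrable_continuous:
  fixes f :: "'a::euclidean_space \<Rightarrow> 'b::euclidean_space"
  assumes "continuous_on \<Omega> f"
  shows "locally_integrable \<Omega> f"
  unfolding locally_integrable_def set_integrable_def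
proof (intro allI impI, elim conjE)
  fix K assume K: "compact K" "K \<subseteq> \<Omega>"
  then have *: "integrable lborel (\<lambda>x. indicator K x *\<^sub>R f x)"
    using assms by (intro borel_integrable_compact) (auto intro: continuous_on_subset)
  then show "integrable lebesgue (\<lambda>x. indicator K x *\<^sub>R f x)"
    by (subst integrable_completion) auto
qed

text \<open>For a test function \<open>\<phi>\<close> the function \<open>\<phi> u\<close>, extended by \<open>0\<close>, is differentiable on the whole space
  and has compact support, so the integral of its directional derivative vanishes.\<close>

lemma has_weak_partial_C1:
  fixes u :: "'a::euclidean_space \<Rightarrow> 'b::euclidean_space"
  assumes \<Omega>: "open \<Omega>" and u': "\<And>x. x \<in> \<Omega> \<Longrightarrow> (u has_derivative u' x) (at x)"
    and cont: "continuous_on \<Omega> (\<lambda>x. u' x b)"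
  shows "has_weak_partial \<Omega> u b (\<lambda>x. u' x b)"
  unfolding has_weak_partial_def
proof (intro conjI ballI)
  have contu: "continuous_on \<Omega> u"
    using u' by (auto intro!: continuous_at_imp_continuous_on has_derivative_continuous)
  show "locally_integrable \<Omega> u" "locally_integrable \<Omega> (\<lambda>x. u' x b)"
    using contu cont by (auto intro: locally_integrable_continuous)
  fix \<phi> :: "'a \<Rightarrow> real" assume \<phi>: "\<phi> \<in> test_functions \<Omega>"
  obtain K where K: "compact K" "K \<subseteq> \<Omega>" "\<And>x. x \<notin> K \<Longrightarrow> \<phi> x = 0"
    "\<And>x b. x \<notin> K \<Longrightarrow> frechet_derivative \<phi> (at x) b = 0"
    using test_function_support[OF \<phi>] by metis
  let ?A = "\<lambda>x. frechet_derivative \<phi> (at x) b *\<^sub>R u x"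
  let ?B = "\<lambda>x. \<phi> x *\<^sub>R u' x b"
  note cont_intros = continuous_on_scaleR continuous_on_test_function[OF \<phi>]
    continuous_on_test_function_derivative[OF \<phi>] contu cont
  have cA: "continuous_on UNIV ?A"
    by (rule continuous_on_zero_extension[OF \<Omega> _ K(1,2)]) (intro cont_intros, simp add: K)
  have cB: "continuous_on UNIV ?B"
    by (rule continuous_on_zero_extension[OF \<Omega> _ K(1,2)]) (intro cont_intros, simp add: K)
  have iA: "integrable lborel ?A" and iB: "integrable lborel ?B"
    by (rule integrable_compact_support[OF cA K(1)] integrable_compact_support[OF cB K(1)],
        use K in simp)+
  define F' where "F' x v = (if x \<in> K then frechet_derivative \<phi> (at x) v *\<^sub>R u x + \<phi> x *\<^sub>R u' x v else 0)"
    for x v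
  have F'b: "F' x b = ?A x + ?B x" for x
    using K by (auto simp: F'_def)
  have "((\<lambda>x. \<phi> x *\<^sub>R u x) has_derivative F' x) (at x)" for x
  proof (cases "x \<in> K")
    case True
    have "((\<lambda>x. \<phi> x *\<^sub>R u x) has_derivative
        (\<lambda>v. \<phi> x *\<^sub>R u' x v + frechet_derivative \<phi> (at x) v *\<^sub>R u x)) (at x)"
      by (rule has_derivative_scaleR[OF test_function_has_derivative[OF \<phi>]]) (use True K u' in auto)
    then show ?thesis using True by (simp add: F'_def[abs_def] add.commute)
  next
    case False
    have "((\<lambda>x. \<phi> x *\<^sub>R u x) has_derivative (\<lambda>v. 0)) (at x)"
      by (rule has_derivative_transform_within_open[of "\<lambda>x. 0" _ _ _ "- K"])
        (use False K in \<open>auto simp: compact_imp_closed open_Compl\<close>)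
    then show ?thesis using False by (simp add: F'_def[abs_def])
  qed
  then have "(LINT x|lborel. F' x b) = 0"
  proof (rule integral_directional_derivative_eq_0[OF _ _ K(1)])
    show "continuous_on UNIV (\<lambda>x. F' x b)"
      unfolding F'b by (intro continuous_intros cA cB)
  qed (use K in \<open>auto simp: F'_def\<close>)
  then have "(LINT x|lborel. ?A x) + (LINT x|lborel. ?B x) = 0"
    unfolding F'b using iA iB by simp
  moreover have "(LINT x|lebesgue_on \<Omega>. ?A x) = (LINT x|lborel. ?A x)"
    "(LINT x|lebesgue_on \<Omega>. ?B x) = (LINT x|lborel. ?B x)"
    using \<Omega> K(2,3,4) cA cB by (intro lint_lebesgue_on; force simp: borel_measurable_continuous_onI)+
  ultimately show "(LINT x|lebesgue_on \<Omega>. ?A x) = - (LINT x|lebesgue_on \<Omega>. ?B x)"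
    by (simp add: eq_neg_iff_add_eq_0)
qed

lemma integrable_test_function_times:
  fixes g :: "'a::euclidean_space \<Rightarrow> 'b::euclidean_space" and \<phi> :: "'a \<Rightarrow> real"
  assumes g: "locally_integrable \<Omega> g" and \<Omega>: "\<Omega> \<in> sets borel"
    and K: "compact K" "K \<subseteq> \<Omega>" "\<And>x. x \<notin> K \<Longrightarrow> \<phi> x = 0" and cont: "continuous_on UNIV \<phi>"
  shows "integrable (lebesgue_on \<Omega>) (\<lambda>x. \<phi> x *\<^sub>R g x)"
    "(LINT x|lebesgue_on \<Omega>. \<phi> x *\<^sub>R g x) = (LINT x|lebesgue. \<phi> x *\<^sub>R indicator K x *\<^sub>R g x)"
    "integrable lebesgue (\<lambda>x. \<phi> x *\<^sub>R indicator K x *\<^sub>R g x)"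
proof -
  obtain B where B: "\<And>x. x \<in> K \<Longrightarrow> norm (\<phi> x) \<le> B"
    using compact_imp_bounded[OF compact_continuous_image[OF continuous_on_subset[OF cont] K(1)]]
    unfolding bounded_iff by auto
  have gK: "integrable lebesgue (\<lambda>x. indicator K x *\<^sub>R g x)"
    using g K by (auto simp: locally_integrable_def set_integrable_def)
  have meas: "\<phi> \<in> borel_measurable lebesgue"
    using borel_measurable_continuous_onI[OF cont] by (simp add: measurable_completion)
  have gKm: "(\<lambda>x. indicator K x *\<^sub>R g x) \<in> borel_measurable lebesgue"
    using gK by (rule borel_measurable_integrable)
  show *: "integrable lebesgue (\<lambda>x. \<phi> x *\<^sub>R indicator K x *\<^sub>R g x)"
  proof (rule Bochner_Integration.integrable_bound[OF integrable_scaleR_right[OF gK, of B]])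
    show "(\<lambda>x. \<phi> x *\<^sub>R indicator K x *\<^sub>R g x) \<in> borel_measurable lebesgue"
      using meas gKm by (rule borel_measurable_scaleR)
    show "AE x in lebesgue. norm (\<phi> x *\<^sub>R indicator K x *\<^sub>R g x) \<le> norm (B *\<^sub>R indicator K x *\<^sub>R g x)"
    proof (rule AE_I2)
      fix x
      have "\<bar>\<phi> x\<bar> * norm (g x) \<le> \<bar>B\<bar> * norm (g x)" if "x \<in> K"
        using B[OF that] by (intro mult_right_mono) auto
      then show "norm (\<phi> x *\<^sub>R indicator K x *\<^sub>R g x) \<le> norm (B *\<^sub>R indicator K x *\<^sub>R g x)"
        by (auto simp: indicator_def)
    qed
  qed
  have eq: "(\<lambda>x. indicator \<Omega> x *\<^sub>R \<phi> x *\<^sub>R g x) = (\<lambda>x. \<phi> x *\<^sub>R indicator K x *\<^sub>R g x)"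
    using K(2,3) by (fastforce simp: indicator_def)
  have \<Omega>': "\<Omega> \<inter> space lebesgue \<in> sets lebesgue" using \<Omega> by simp
  show "integrable (lebesgue_on \<Omega>) (\<lambda>x. \<phi> x *\<^sub>R g x)"
    unfolding integrable_restrict_space[OF \<Omega>'] eq by (fact *)
  show "(LINT x|lebesgue_on \<Omega>. \<phi> x *\<^sub>R g x) = (LINT x|lebesgue. \<phi> x *\<^sub>R indicator K x *\<^sub>R g x)"
    unfolding integral_restrict_space[OF \<Omega>'] eq ..
qed

text \<open>Test functions that converge to the indicator function of the box: in each coordinate they
  rise from \<open>0\<close> to \<open>1\<close> within the distance \<open>1 / n\<close> of either end.\<close>

definition smooth_box :: "'a::euclidean_space \<Rightarrow> 'a \<Rightarrow> nat \<Rightarrow> 'a \<Rightarrow> real" where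
  "smooth_box a b n x = (\<Prod>i\<in>Basis. smooth_step (real n * (x \<bullet> i - a \<bullet> i)) * smooth_step (real n * (b \<bullet> i - x \<bullet> i)))"

lemma smooth_box:
  fixes a b :: "'a::euclidean_space"
  shows Ck_smooth_box: "Ck k (smooth_box a b n)"
    and smooth_box_nonneg: "0 \<le> smooth_box a b n x" and smooth_box_le_1: "smooth_box a b n x \<le> 1"
    and smooth_box_0: "x \<notin> box a b \<Longrightarrow> smooth_box a b n x = 0"
    and smooth_box_tendsto: "(\<lambda>n. smooth_box a b n x) \<longlonglongrightarrow> indicator (box a b) x"
proof -
  have "Ck k (\<lambda>x. smooth_step (real n * (x \<bullet> i - a \<bullet> i)))" for i
    by (rule Ck_compose[OF Ck_smooth_step])
      (intro Ck_mult Ck_const Ck_diff Ck_linear bounded_linear_inner_left)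
  moreover have "Ck k (\<lambda>x. smooth_step (real n * (b \<bullet> i - x \<bullet> i)))" for i
    by (rule Ck_compose[OF Ck_smooth_step])
      (intro Ck_mult Ck_const Ck_diff Ck_linear bounded_linear_inner_left)
  ultimately show "Ck k (smooth_box a b n)"
    unfolding smooth_box_def[abs_def] by (intro Ck_prod Ck_mult)
  show "0 \<le> smooth_box a b n x"
    unfolding smooth_box_def[abs_def] by (intro prod_nonneg mult_nonneg_nonneg smooth_step_range)
  show "smooth_box a b n x \<le> 1"
    unfolding smooth_box_def[abs_def] by (intro prod_le_1 conjI mult_nonneg_nonneg mult_le_one smooth_step_range)
  show *: "smooth_box a b n x = 0" if xb: "x \<notin> box a b" for n
  proof -
    obtain i where "i \<in> Basis" "x \<bullet> i - a \<bullet> i \<le> 0 \<or> b \<bullet> i - x \<bullet> i \<le> 0"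
      using xb unfolding mem_box by (metis diff_le_0_iff_le linorder_not_less)
    then show ?thesis
      unfolding smooth_box_def[abs_def]
      by (intro prod_zero bexI[of _ i]) (auto simp: smooth_step_0 mult_nonneg_nonpos)
  qed
  show "(\<lambda>n. smooth_box a b n x) \<longlonglongrightarrow> indicator (box a b) x"
  proof (cases "x \<in> box a b")
    case True
    have ev: "eventually (\<lambda>n. smooth_step (real n * y) = 1) sequentially" if y: "y > 0" for y
    proof -
      obtain m :: nat where "1 < real m * y" using reals_Archimedean3[OF y] by blast
      then have "1 \<le> real n * y" if "n \<ge> m" for n
        using that \<open>y > 0\<close> mult_right_mono[of "real m" "real n" y] by linarith
      then show ?thesis unfolding eventually_sequentially by (intro exI[of _ m]) (auto simp: smooth_step_1)
    qed
    have "eventually (\<lambda>n. \<forall>i\<in>Basis. smooth_step (real n * (x \<bullet> i - a \<bullet> i)) = 1 \<and>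
        smooth_step (real n * (b \<bullet> i - x \<bullet> i)) = 1) sequentially"
      using True by (intro eventually_ball_finite ballI eventually_conj ev) (auto simp: mem_box)
    then have "eventually (\<lambda>n. smooth_box a b n x = 1) sequentially"
      by eventually_elim (simp add: smooth_box_def)
    then show ?thesis using True by (simp add: tendsto_eventually)
  qed (simp add: *)
qed

lemma integral_cbox_eq_0_if_test_functions:
  fixes g :: "'a::euclidean_space \<Rightarrow> 'b::euclidean_space"
  assumes g: "locally_integrable \<Omega> g" and \<Omega>: "open \<Omega>"
    and 0: "\<And>\<phi>. \<phi> \<in> test_functions \<Omega> \<Longrightarrow> (LINT x|lebesgue_on \<Omega>. \<phi> x *\<^sub>R g x) = 0"
    and sub: "cbox a b \<subseteq> \<Omega>"
  shows "integral (cbox a b) g = 0"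
proof -
  define \<phi> where "\<phi> = smooth_box a b"
  note \<phi> = smooth_box[where a = a and b = b, folded \<phi>_def]
  have supp: "\<phi> n x = 0" if "x \<notin> cbox a b" for n x
    using \<phi>(4) that box_subset_cbox by blast
  have "\<phi> n \<in> test_functions \<Omega>" for n
    unfolding test_functions_def using \<phi>(1) sub supp by (auto intro!: exI[of _ "cbox a b"])
  then have z: "(LINT x|lebesgue. \<phi> n x *\<^sub>R indicator (cbox a b) x *\<^sub>R g x) = 0"
    "integrable lebesgue (\<lambda>x. \<phi> n x *\<^sub>R indicator (cbox a b) x *\<^sub>R g x)" for n
    using integrable_test_function_times[OF g _ compact_cbox sub, of "\<phi> n"] supp 0[of "\<phi> n"] \<phi>(1)[of 0 n] \<Omega>
    by auto
  have gK: "integrable lebesgue (\<lambda>x. indicator (cbox a b) x *\<^sub>R g x)"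
    using g sub by (auto simp: locally_integrable_def set_integrable_def)
  have ind: "indicator (box a b) x *\<^sub>R indicator (cbox a b) x *\<^sub>R g x = indicator (box a b) x *\<^sub>R g x" for x
    using box_subset_cbox[of a b] by (auto simp: indicator_def)
  have "(\<lambda>n. LINT x|lebesgue. \<phi> n x *\<^sub>R indicator (cbox a b) x *\<^sub>R g x) \<longlonglongrightarrow>
      (LINT x|lebesgue. indicator (box a b) x *\<^sub>R indicator (cbox a b) x *\<^sub>R g x)"
  proof (rule integral_dominated_convergence[OF _ _ integrable_norm[OF gK]])
    show "(\<lambda>x. indicator (box a b) x *\<^sub>R indicator (cbox a b) x *\<^sub>R g x) \<in> borel_measurable lebesgue"
      by (rule borel_measurable_scaleR[OF _ borel_measurable_integrable[OF gK]]) (intro borel_measurable_indicator sets_completionI_sets, simp)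
    show "AE x in lebesgue. (\<lambda>n. \<phi> n x *\<^sub>R indicator (cbox a b) x *\<^sub>R g x)
        \<longlonglongrightarrow> indicator (box a b) x *\<^sub>R indicator (cbox a b) x *\<^sub>R g x"
      by (intro AE_I2 tendsto_intros \<phi>)
    show "AE x in lebesgue. norm (\<phi> n x *\<^sub>R indicator (cbox a b) x *\<^sub>R g x)
        \<le> norm (indicator (cbox a b) x *\<^sub>R g x)" for n
      using \<phi>(2,3) by (intro AE_I2) (auto simp: abs_mult intro!: mult_right_mono mult_left_le_one_le)
  qed (use z in auto)
  then have "(LINT x|lebesgue. indicator (box a b) x *\<^sub>R g x) = 0"
    by (simp only: z(1) LIMSEQ_const_iff ind)
  moreover have "g absolutely_integrable_on box a b"
    using g sub by (auto simp: locally_integrable_def absolutely_integrable_on_open_interval)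
  ultimately have "integral (box a b) g = 0"
    using set_lebesgue_integral_eq_integral(2)[of "box a b" g]
    by (simp add: set_lebesgue_integral_def)
  then show ?thesis by (simp add: integral_open_interval)
qed

text \<open>The integrals of \<open>g\<close> over all boxes in \<open>\<Omega>\<close> vanish, since indicator functions of boxes are limits of
  test functions. By Lebesgue differentiation \<open>g\<close> vanishes almost everywhere.\<close>

lemma AE_eq_0_if_test_functions:
  fixes g :: "'a::euclidean_space \<Rightarrow> 'b::euclidean_space"
  assumes g: "locally_integrable \<Omega> g" and \<Omega>: "open \<Omega>"
    and 0: "\<And>\<phi>. \<phi> \<in> test_functions \<Omega> \<Longrightarrow> (LINT x|lebesgue_on \<Omega>. \<phi> x *\<^sub>R g x) = 0"
  shows "AE x in lebesgue_on \<Omega>. g x = 0"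
proof -
  have local: "negligible {x \<in> cbox a b. g x \<noteq> 0}" if C: "cbox a b \<subseteq> \<Omega>" for a b
  proof -
    define f where "f x = (if x \<in> cbox a b then g x else 0)" for x
    have f: "f integrable_on cbox c d" "integral (cbox c d) f = 0" for c d
    proof -
      obtain u v where uv: "cbox a b \<inter> cbox c d = cbox u v"
        using Int_interval[of a b c d] by blast
      have sub: "cbox u v \<subseteq> \<Omega>" using uv C by blast
      then have "g absolutely_integrable_on cbox u v"
        using g by (auto simp: locally_integrable_def)
      then have "g integrable_on cbox u v" using set_lebesgue_integral_eq_integral(1) by blast
      then show "f integrable_on cbox c d"
        unfolding f_def integrable_restrict_Int uv .
      show "integral (cbox c d) f = 0"
        unfolding f_def integral_restrict_Int uv
        by (rule integral_cbox_eq_0_if_test_functions[OF g \<Omega> 0 sub])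
    qed
    obtain N where N: "negligible N" "\<And>x e. \<lbrakk>x \<notin> N; 0 < e\<rbrakk> \<Longrightarrow> \<exists>d>0. \<forall>h. 0 < h \<and> h < d \<longrightarrow>
        norm (integral (cbox x (x + h *\<^sub>R One)) f /\<^sub>R h ^ DIM('a) - f x) < e"
      using integrable_ccontinuous_explicit[OF f(1)] by blast
    have "f x = 0" if "x \<notin> N" for x
    proof (rule ccontr)
      assume "f x \<noteq> 0"
      then have "norm (f x) > 0" by simp
      from N(2)[OF that this] obtain d where "d > 0" "\<forall>h. 0 < h \<and> h < d \<longrightarrow>
          norm (integral (cbox x (x + h *\<^sub>R One)) f /\<^sub>R h ^ DIM('a) - f x) < norm (f x)"
        by blast
      then show False by (auto simp: f(2) dest: spec[of _ "d / 2"])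
    qed
    then have "x \<in> N" if "x \<in> cbox a b" "g x \<noteq> 0" for x
      using that unfolding f_def by metis
    then have "{x \<in> cbox a b. g x \<noteq> 0} \<subseteq> N" by blast
    then show ?thesis using N(1) negligible_subset by blast
  qed
  obtain D where D: "countable D" "D \<subseteq> Pow \<Omega>" "\<And>X. X \<in> D \<Longrightarrow> \<exists>a b. X = cbox a b" "\<Union>D = \<Omega>"
    using open_countable_Union_open_cbox[OF \<Omega>] by metis
  have "negligible (\<Union>X\<in>D. {x \<in> X. g x \<noteq> 0})"
    using D local by (intro negligible_countable_Union) (auto, blast)
  moreover have "(\<Union>X\<in>D. {x \<in> X. g x \<noteq> 0}) = {x \<in> \<Omega>. g x \<noteq> 0}"
    using D(4) by auto
  ultimately have "{x \<in> \<Omega>. g x \<noteq> 0} \<in> null_sets lebesgue"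
    by (simp add: negligible_iff_null_sets)
  then have "AE x in lebesgue. x \<in> \<Omega> \<longrightarrow> g x = 0"
    by (rule AE_I') auto
  then show ?thesis using \<Omega> by (subst AE_restrict_space_iff) auto
qed

text \<open>The energy is defined by an arbitrary choice of weak partial derivatives; uniqueness allows it to be
  computed from any weak gradient.\<close>

lemma has_weak_partial_unique:
  fixes u :: "'a::euclidean_space \<Rightarrow> 'b::euclidean_space"
  assumes 1: "has_weak_partial \<Omega> u b g1" and 2: "has_weak_partial \<Omega> u b g2" and \<Omega>: "open \<Omega>"
  shows "AE x in lebesgue_on \<Omega>. g1 x = g2 x"
proof -
  have g: "locally_integrable \<Omega> g1" "locally_integrable \<Omega> g2"
    using 1 2 by (auto simp: has_weak_partial_def)
  then have "locally_integrable \<Omega> (\<lambda>x. g1 x - g2 x)"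
    by (auto simp: locally_integrable_def)
  then have "AE x in lebesgue_on \<Omega>. g1 x - g2 x = 0"
  proof (rule AE_eq_0_if_test_functions[OF _ \<Omega>])
    fix \<phi> :: "'a \<Rightarrow> real" assume \<phi>: "\<phi> \<in> test_functions \<Omega>"
    obtain K where K: "compact K" "K \<subseteq> \<Omega>" "\<And>x. x \<notin> K \<Longrightarrow> \<phi> x = 0"
      using test_function_support[OF \<phi>] by metis
    note K = K continuous_on_test_function[OF \<phi>, of UNIV]
    have "(LINT x|lebesgue_on \<Omega>. \<phi> x *\<^sub>R g1 x) = (LINT x|lebesgue_on \<Omega>. \<phi> x *\<^sub>R g2 x)"
      using 1 2 \<phi> unfolding has_weak_partial_def by (metis neg_equal_iff_equal)
    then show "(LINT x|lebesgue_on \<Omega>. \<phi> x *\<^sub>R (g1 x - g2 x)) = 0"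
      using integrable_test_function_times(1)[OF g(1) _ K] integrable_test_function_times(1)[OF g(2) _ K] \<Omega>
      by (simp add: scaleR_diff_right)
  qed
  then show ?thesis by simp
qed

text \<open>Pairs carry the Euclidean norm, so pairs of partial derivatives represent differentials with the
  Hilbert-Schmidt inner product.\<close>

lemma HS_norm_weak_deriv_AE:
  fixes u :: "complex \<Rightarrow> complex"
  assumes \<Omega>: "open \<Omega>" and g: "has_weak_partial \<Omega> u 1 g1" "has_weak_partial \<Omega> u \<i> g2"
  shows "AE x in lebesgue_on \<Omega>. HS_norm_weak_deriv \<Omega> u x = norm (g1 x, g2 x)"
proof -
  have "has_weak_partial \<Omega> u 1 (weak_partial \<Omega> u 1)" "has_weak_partial \<Omega> u \<i> (weak_partial \<Omega> u \<i>)"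
    unfolding weak_partial_def
    using someI[of "has_weak_partial \<Omega> u 1", OF g(1)] someI[of "has_weak_partial \<Omega> u \<i>", OF g(2)]
    by auto
  from has_weak_partial_unique[OF this(1) g(1) \<Omega>] has_weak_partial_unique[OF this(2) g(2) \<Omega>]
  show ?thesis
    by eventually_elim (simp add: HS_norm_weak_deriv_def norm_Pair Basis_complex_def)
qed

lemma energy_eq:
  fixes u :: "complex \<Rightarrow> complex"
  assumes \<Omega>: "open \<Omega>" and g: "has_weak_partial \<Omega> u 1 g1" "has_weak_partial \<Omega> u \<i> g2"
    and int: "integrable (lebesgue_on \<Omega>) (\<lambda>x. norm (g1 x, g2 x) powr p)"
  shows "energy p \<Omega> u = (LINT x|lebesgue_on \<Omega>. norm (g1 x, g2 x) powr p)"
proof -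
  have \<Omega>': "\<Omega> \<inter> space lebesgue \<in> sets lebesgue" using \<Omega> by simp
  have AE: "AE x in lebesgue_on \<Omega>. HS_norm_weak_deriv \<Omega> u x = norm (g1 x, g2 x)"
    by (rule HS_norm_weak_deriv_AE[OF \<Omega> g])
  then have "AE x in lebesgue. x \<in> \<Omega> \<longrightarrow> HS_norm_weak_deriv \<Omega> u x = norm (g1 x, g2 x)"
    by (simp only: AE_restrict_space_iff[OF \<Omega>'])
  then obtain N where N: "N \<in> null_sets lebesgue"
    "{x. \<not> (x \<in> \<Omega> \<longrightarrow> HS_norm_weak_deriv \<Omega> u x = norm (g1 x, g2 x))} \<subseteq> N"
    unfolding eventually_ae_filter by auto
  have i1: "(\<lambda>x. norm (g1 x, g2 x) powr p) absolutely_integrable_on \<Omega>"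
    using int unfolding set_integrable_def integrable_restrict_space[OF \<Omega>'] .
  have "(\<lambda>x. HS_norm_weak_deriv \<Omega> u x powr p) absolutely_integrable_on \<Omega>"
    by (rule absolutely_integrable_spike[OF i1, of N]) (use N in \<open>auto simp: negligible_iff_null_sets\<close>)
  then have i2: "integrable (lebesgue_on \<Omega>) (\<lambda>x. HS_norm_weak_deriv \<Omega> u x powr p)"
    unfolding set_integrable_def integrable_restrict_space[OF \<Omega>'] .
  show ?thesis unfolding energy_def
    by (rule integral_cong_AE) (use i2 int AE in \<open>auto intro: borel_measurable_integrable\<close>)
qed

lemma norm_Pair_powr_le:
  assumes "p \<ge> 0"
  shows "norm (a, b) powr p \<le> 2 powr p * (norm a powr p + norm b powr p)"
proof -
  have "norm (a, b) \<le> 2 * max (norm a) (norm b)"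
    using norm_Pair_le[of a b] by linarith
  then have "norm (a, b) powr p \<le> (2 * max (norm a) (norm b)) powr p"
    using assms by (intro powr_mono2) auto
  also have "\<dots> = 2 powr p * max (norm a) (norm b) powr p"
    by (simp add: powr_mult)
  also have "\<dots> \<le> 2 powr p * (norm a powr p + norm b powr p)"
    by (intro mult_left_mono) (auto simp: max_def)
  finally show ?thesis .
qed

lemma sobolev_W1_gradient:
  fixes u :: "complex \<Rightarrow> complex"
  assumes u: "u \<in> sobolev_W1 p \<Omega>" and "p \<ge> 0"
  obtains g1 g2 where "has_weak_partial \<Omega> u 1 g1" "has_weak_partial \<Omega> u \<i> g2"
    "g1 \<in> borel_measurable (lebesgue_on \<Omega>)" "g2 \<in> borel_measurable (lebesgue_on \<Omega>)"
    "integrable (lebesgue_on \<Omega>) (\<lambda>x. norm (g1 x, g2 x) powr p)"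
proof -
  obtain g1 g2 where g: "has_weak_partial \<Omega> u 1 g1" "g1 \<in> Lp_space p \<Omega>"
      "has_weak_partial \<Omega> u \<i> g2" "g2 \<in> Lp_space p \<Omega>"
    using u by (auto simp: sobolev_W1_def Basis_complex_def)
  then have m: "g1 \<in> borel_measurable (lebesgue_on \<Omega>)" "g2 \<in> borel_measurable (lebesgue_on \<Omega>)"
    and i: "integrable (lebesgue_on \<Omega>) (\<lambda>x. norm (g1 x) powr p)" "integrable (lebesgue_on \<Omega>) (\<lambda>x. norm (g2 x) powr p)"
    by (auto simp: Lp_space_def)
  have "integrable (lebesgue_on \<Omega>) (\<lambda>x. norm (g1 x, g2 x) powr p)"
  proof (rule Bochner_Integration.integrable_bound)
    show "integrable (lebesgue_on \<Omega>) (\<lambda>x. 2 powr p * (norm (g1 x) powr p + norm (g2 x) powr p))"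
      using i by auto
    show "(\<lambda>x. norm (g1 x, g2 x) powr p) \<in> borel_measurable (lebesgue_on \<Omega>)"
      unfolding norm_Pair using m by measurable
    show "AE x in lebesgue_on \<Omega>. norm (norm (g1 x, g2 x) powr p)
        \<le> norm (2 powr p * (norm (g1 x) powr p + norm (g2 x) powr p))"
      using norm_Pair_powr_le[OF \<open>p \<ge> 0\<close>] by (intro AE_I2) (simp add: abs_of_nonneg)
  qed
  then show thesis using that g m by blast
qed

section \<open>Integration in polar coordinates\<close>

lemma emeasure_norm_le:
  "emeasure lborel {z::complex. norm z \<le> x} = ennreal (pi * (max 0 x)\<^sup>2)"
proof (cases "x \<ge> 0")
  case True
  have "{z::complex. norm z \<le> x} = cball 0 x" by auto
  then show ?thesis
    using emeasure_cball[OF True, of "0::complex"] True by (simp add: unit_ball_vol_2)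
next
  case False
  then have "{z::complex. norm z \<le> x} = {}" by (smt (verit) empty_Collect_eq norm_ge_zero)
  then show ?thesis using False by simp
qed

text \<open>The image of the planar Lebesgue measure under the norm has density \<open>2 \<pi> t\<close>, since a disk of
  radius \<open>x\<close> has area \<open>\<pi> x\<^sup>2\<close>.\<close>

lemma distr_norm_lborel:
  "distr (lborel :: complex measure) borel norm = density lborel (\<lambda>t. ennreal (max 0 (2 * pi * t)))"
  (is "?M = ?N")
proof (rule measure_eqI_generator_eq[where E = "range atMost" and \<Omega> = UNIV and A = "\<lambda>i. {..real i}"])
  show "Int_stable (range (atMost :: real \<Rightarrow> real set))"
    by (auto simp: Int_stable_def)
  have *: "emeasure ?M {..x} = ennreal (pi * (max 0 x)\<^sup>2)" for x
    using emeasure_norm_le[of x] by (simp add: emeasure_distr vimage_def)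
  have "emeasure ?N {..x} = ennreal (pi * (max 0 x)\<^sup>2)" for x
  proof -
    have "emeasure ?N {..x} = (\<integral>\<^sup>+ t. ennreal (max 0 (2 * pi * t)) * indicator {..x} t \<partial>lborel)"
      by (simp add: emeasure_density)
    also have "\<dots> = (\<integral>\<^sup>+ t. ennreal (2 * pi * t) * indicator {0..max 0 x} t \<partial>lborel)"
      by (rule nn_integral_cong) (auto simp: indicator_def max_def ennreal_neg zero_le_mult_iff mult_nonneg_nonpos split: if_splits)
    also have "\<dots> = ennreal (pi * (max 0 x)\<^sup>2 - pi * 0\<^sup>2)"
      by (rule nn_integral_FTC_Icc) (auto intro!: derivative_eq_intros)
    finally show ?thesis by simp
  qed
  then show "emeasure ?M X = emeasure ?N X" if "X \<in> range atMost" for X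
    using that * by auto
  show "(\<Union>i. {..real i}) = UNIV" using real_arch_simple by auto
  show "emeasure ?M {..real i} \<noteq> \<infinity>" for i by (simp add: *)
qed (auto simp: borel_eq_atMost)

lemma
  fixes f :: "real \<Rightarrow> real"
  assumes f: "f \<in> borel_measurable borel"
  shows integrable_norm_lborel: "integrable lborel (\<lambda>x::complex. f (norm x)) \<longleftrightarrow>
      integrable lborel (\<lambda>t. max 0 (2 * pi * t) * f t)"
    and integral_norm_lborel: "(LINT x|lborel. f (norm (x::complex))) =
      (LINT t|lborel. max 0 (2 * pi * t) * f t)"
proof -
  show "integrable lborel (\<lambda>x::complex. f (norm x)) \<longleftrightarrow> integrable lborel (\<lambda>t. max 0 (2 * pi * t) * f t)"
    using integrable_distr_eq[of norm "lborel :: complex measure" borel f] f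
    by (simp add: distr_norm_lborel integrable_density)
  show "(LINT x|lborel. f (norm (x::complex))) = (LINT t|lborel. max 0 (2 * pi * t) * f t)"
    using integral_distr[of norm "lborel :: complex measure" borel f] f
    by (simp add: distr_norm_lborel integral_density)
qed

text \<open>Half-open, so that adjacent shells are disjoint and that a shell is the pointwise limit of the cutoffs
  introduced below.\<close>

definition shell :: "real \<Rightarrow> real \<Rightarrow> complex set" where
  "shell s t = {x. s < norm x \<and> norm x \<le> t}"

definition closed_shell :: "real \<Rightarrow> real \<Rightarrow> complex set" where
  "closed_shell s t = {x. s \<le> norm x \<and> norm x \<le> t}"

lemma compact_closed_shell: "compact (closed_shell s t)"
proof -
  have "closed_shell s t = cball 0 t - ball 0 s" by (auto simp: closed_shell_def)
  then show ?thesis by (simp add: compact_diff)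
qed

lemma shell_subset: "shell s t \<subseteq> closed_shell s t"
  by (auto simp: shell_def closed_shell_def)

lemma sets_shell [measurable]: "shell s t \<in> sets borel" "closed_shell s t \<in> sets borel"
  unfolding shell_def closed_shell_def by measurable

lemma set_integral_closed_shell_radial:
  fixes G :: "real \<Rightarrow> real"
  assumes G: "continuous_on {s..t} G" and s: "0 \<le> s"
  shows "(LINT x:closed_shell s t|lebesgue. G (norm x)) = 2 * pi * integral {s..t} (\<lambda>\<rho>. \<rho> * G \<rho>)"
proof -
  define f where "f \<rho> = indicator {s..t} \<rho> * G \<rho>" for \<rho>
  have f: "f \<in> borel_measurable borel"
    using borel_measurable_continuous_on_indicator[OF _ G] by (simp add: f_def[abs_def])
  have "(\<lambda>x::complex. f (norm x)) \<in> borel_measurable borel"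
    using f by measurable
  then have "(LINT x:closed_shell s t|lebesgue. G (norm x)) = (LINT x|lborel. f (norm (x::complex)))"
    unfolding set_lebesgue_integral_def
    by (subst integral_completion[symmetric]) (auto simp: f_def closed_shell_def indicator_def intro!: Bochner_Integration.integral_cong)
  also have "\<dots> = (LINT \<rho>|lborel. max 0 (2 * pi * \<rho>) * f \<rho>)"
    by (rule integral_norm_lborel[OF f])
  also have "\<dots> = (LINT \<rho>:{s..t}|lborel. 2 * pi * (\<rho> * G \<rho>))"
    unfolding set_lebesgue_integral_def
    using s by (intro Bochner_Integration.integral_cong) (auto simp: f_def indicator_def max_def zero_le_mult_iff)
  also have "\<dots> = integral {s..t} (\<lambda>\<rho>. 2 * pi * (\<rho> * G \<rho>))"
    by (rule set_borel_integral_eq_integral(2))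
      (auto intro!: borel_integrable_atLeastAtMost' continuous_intros G)
  finally show ?thesis by simp
qed

lemma continuous_on_clamp_real:
  fixes G :: "real \<Rightarrow> real"
  assumes "continuous_on {s..t} G" "s \<le> t"
  shows "continuous_on UNIV (\<lambda>x. G (max s (min t x)))"
  by (rule continuous_on_compose2[OF assms(1)]) (use assms(2) in \<open>auto intro!: continuous_intros\<close>)

lemma set_integrable_radial_times:
  fixes f :: "complex \<Rightarrow> real"
  assumes f: "set_integrable lebesgue S f" and S: "S \<subseteq> closed_shell s t"
    and G: "continuous_on {s..t} G"
  shows "set_integrable lebesgue S (\<lambda>x. G (norm x) * f x)"
proof (cases "s \<le> t")
  case True
  let ?G = "\<lambda>x. G (max s (min t x))"
  have cont: "continuous_on UNIV ?G" by (rule continuous_on_clamp_real[OF G True])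
  have "bounded (G ` {s..t})"
    by (intro compact_imp_bounded compact_continuous_image G) simp
  then obtain C where "\<forall>y\<in>G ` {s..t}. norm y \<le> C" unfolding bounded_iff by blast
  then have C: "\<And>\<rho>. \<rho> \<in> {s..t} \<Longrightarrow> norm (G \<rho>) \<le> C" by blast
  have fm: "(\<lambda>x. indicator S x *\<^sub>R f x) \<in> borel_measurable lebesgue"
    using f unfolding set_integrable_def by (rule borel_measurable_integrable)
  have Gm: "(\<lambda>x::complex. ?G (norm x)) \<in> borel_measurable lebesgue"
    by (intro measurable_completion) (use cont in \<open>auto intro!: borel_measurable_continuous_onI continuous_on_compose2[OF cont] continuous_intros\<close>)
  have "set_integrable lebesgue S (\<lambda>x. ?G (norm x) * f x)"
    unfolding set_integrable_def
  proof (rule Bochner_Integration.integrable_bound)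
    show "integrable lebesgue (\<lambda>x. C *\<^sub>R indicator S x *\<^sub>R f x)"
      using f unfolding set_integrable_def by (rule integrable_scaleR_right)
    have "(\<lambda>x. indicator S x *\<^sub>R (?G (norm x) * f x)) = (\<lambda>x. ?G (norm x) * (indicator S x *\<^sub>R f x))"
      by auto
    then show "(\<lambda>x. indicator S x *\<^sub>R (?G (norm x) * f x)) \<in> borel_measurable lebesgue"
      using borel_measurable_times[OF Gm fm] by simp
    show "AE x in lebesgue. norm (indicator S x *\<^sub>R (?G (norm x) * f x)) \<le> norm (C *\<^sub>R indicator S x *\<^sub>R f x)"
    proof (rule AE_I2)
      fix x :: complex
      have "\<bar>?G (norm x)\<bar> \<le> \<bar>C\<bar>" using C[of "max s (min t (norm x))"] True by force
      then have "\<bar>?G (norm x)\<bar> * \<bar>f x\<bar> \<le> \<bar>C\<bar> * \<bar>f x\<bar>" by (intro mult_right_mono) auto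
      then show "norm (indicator S x *\<^sub>R (?G (norm x) * f x)) \<le> norm (C *\<^sub>R indicator S x *\<^sub>R f x)"
        by (auto simp: indicator_def abs_mult)
    qed
  qed
  moreover have "(\<lambda>x. indicator S x *\<^sub>R (?G (norm x) * f x)) = (\<lambda>x. indicator S x *\<^sub>R (G (norm x) * f x))"
    using S by (auto simp: indicator_def closed_shell_def fun_eq_iff)
  ultimately show ?thesis unfolding set_integrable_def by simp
next
  case False
  then have "S = {}" using S by (auto simp: closed_shell_def)
  then show ?thesis by (simp add: set_integrable_def)
qed

section \<open>Radial cutoffs\<close>

definition step_derivative :: "real \<Rightarrow> real" where
  "step_derivative x = bump x / integral {0..1} bump"

lemma step_derivative: "(smooth_step has_real_derivative step_derivative x) (at x)"
  "step_derivative x \<ge> 0" "x \<notin> {0..1} \<Longrightarrow> step_derivative x = 0" "continuous_on S step_derivative"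
  using smooth_step_has_derivative bump_nonneg bump_integral_pos bump_zero continuous_on_bump[of S]
  by (auto simp: step_derivative_def[abs_def] intro!: continuous_intros)

text \<open>The weight is the derivative of \<open>smooth_step (n (\<rho>\<^sup>2 - m\<^sup>2))\<close>: it is non-negative, has
  integral \<open>1\<close> for large \<open>n\<close>, and lives where \<open>0 \<le> \<rho>\<^sup>2 - m\<^sup>2 \<le> 1 / n\<close>.\<close>

lemma approximate_identity:
  fixes F :: "real \<Rightarrow> real"
  assumes F: "continuous_on {s..t} F" and m: "0 < m" "s \<le> m" "m < t" and s: "0 \<le> s"
  shows "(\<lambda>n. integral {s..t} (\<lambda>\<rho>. real n * step_derivative (real n * (\<rho>\<^sup>2 - m\<^sup>2)) * (2 * \<rho>) * F \<rho>)) \<longlonglongrightarrow> F m"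
proof (rule LIMSEQ_I)
  fix e :: real assume "e > 0"
  define w where "w n \<rho> = real n * step_derivative (real n * (\<rho>\<^sup>2 - m\<^sup>2)) * (2 * \<rho>)" for n \<rho>
  have contw: "continuous_on {s..t} (w n)" for n
    unfolding w_def by (intro continuous_intros continuous_on_compose2[OF step_derivative(4)[of UNIV]]) auto
  have st: "s < t" using m by simp
  have w0: "w n \<rho> \<ge> 0" if "\<rho> \<in> {s..t}" for n \<rho>
    using that s step_derivative(2) by (auto simp: w_def)
  have wint: "integral {s..t} (w n) = smooth_step (real n * (t\<^sup>2 - m\<^sup>2)) - smooth_step (real n * (s\<^sup>2 - m\<^sup>2))" for n
  proof (rule integral_unique, rule fundamental_theorem_of_calculus)
    show "((\<lambda>\<rho>. smooth_step (real n * (\<rho>\<^sup>2 - m\<^sup>2))) has_vector_derivative w n \<rho>) (at \<rho> within {s..t})" for \<rho>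
    proof -
      have "((\<lambda>\<rho>. real n * (\<rho>\<^sup>2 - m\<^sup>2)) has_real_derivative real n * (2 * \<rho>)) (at \<rho>)"
        by (auto intro!: derivative_eq_intros)
      from DERIV_chain2[OF step_derivative(1) this]
      have "((\<lambda>\<rho>. smooth_step (real n * (\<rho>\<^sup>2 - m\<^sup>2))) has_real_derivative w n \<rho>) (at \<rho>)"
        by (simp add: w_def mult_ac)
      then show ?thesis
        by (metis has_field_derivative_at_within has_real_derivative_iff_has_vector_derivative)
    qed
  qed (use st in simp)
  have "continuous (at m within {s..t}) F" using F m by (simp add: continuous_on_eq_continuous_within)
  then obtain d where d: "d > 0" "\<And>\<rho>. \<rho> \<in> {s..t} \<Longrightarrow> \<bar>\<rho> - m\<bar> < d \<Longrightarrow> \<bar>F \<rho> - F m\<bar> < e / 2"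
    unfolding continuous_within_eps_delta dist_real_def using \<open>e > 0\<close> by (meson half_gt_zero)
  obtain N1 :: nat where N1: "1 < real N1 * (t\<^sup>2 - m\<^sup>2)"
    using reals_Archimedean3[of "t\<^sup>2 - m\<^sup>2"] m by (auto simp: power_strict_mono)
  obtain N2 :: nat where N2: "1 < real N2 * (m * d)"
    using reals_Archimedean3[of "m * d"] m d by auto
  show "\<exists>N. \<forall>n\<ge>N. norm (integral {s..t} (\<lambda>\<rho>. real n * step_derivative (real n * (\<rho>\<^sup>2 - m\<^sup>2)) * (2 * \<rho>) * F \<rho>) - F m) < e"
  proof (intro exI allI impI)
    fix n assume n: "n \<ge> max N1 N2"
    have "real N1 * (t\<^sup>2 - m\<^sup>2) \<le> real n * (t\<^sup>2 - m\<^sup>2)" "real N2 * (m * d) \<le> real n * (m * d)"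
      using n m d by (auto intro!: mult_right_mono simp: power_mono)
    then have n1: "real n * (t\<^sup>2 - m\<^sup>2) \<ge> 1" and n2: "real n * (m * d) > 1" using N1 N2 by linarith+
    have n0: "real n > 0" using n2 by (cases n) auto
    have "real n * (s\<^sup>2 - m\<^sup>2) \<le> 0" using m s by (intro mult_nonneg_nonpos) (auto simp: power_mono)
    then have one: "integral {s..t} (w n) = 1"
      using n1 by (simp add: wint smooth_step_0 smooth_step_1)
    have conc: "w n \<rho> * \<bar>F \<rho> - F m\<bar> \<le> w n \<rho> * (e / 2)" if \<rho>: "\<rho> \<in> {s..t}" for \<rho>
    proof (cases "w n \<rho> = 0")
      case False
      then have "real n * (\<rho>\<^sup>2 - m\<^sup>2) \<in> {0..1}" using step_derivative(3) by (auto simp: w_def)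
      then have a: "\<rho>\<^sup>2 \<ge> m\<^sup>2" "real n * (\<rho>\<^sup>2 - m\<^sup>2) \<le> 1" using n0 by (auto simp: zero_le_mult_iff)
      then have "\<rho> \<ge> m" using \<rho> s m power2_le_imp_le[of m \<rho>] by auto
      then have "m * (\<rho> - m) \<le> \<rho>\<^sup>2 - m\<^sup>2"
        using mult_right_mono[of m "\<rho> + m" "\<rho> - m"] \<rho> s m by (simp add: power2_eq_square algebra_simps)
      then have "real n * (m * (\<rho> - m)) < real n * (m * d)"
        using a n2 n0 by (smt (verit) mult_left_mono)
      then have "\<bar>\<rho> - m\<bar> < d" using n0 m \<open>\<rho> \<ge> m\<close> by simp
      then show ?thesis using d(2)[OF \<rho>] w0[OF \<rho>, of n] by (intro mult_left_mono) auto
    qed simp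
    have i: "(\<lambda>\<rho>. w n \<rho> * F \<rho>) integrable_on {s..t}" "w n integrable_on {s..t}"
      by (intro integrable_continuous_real continuous_intros contw F)+
    have "integral {s..t} (\<lambda>\<rho>. w n \<rho> * F \<rho>) - F m = integral {s..t} (\<lambda>\<rho>. w n \<rho> * F \<rho>) - integral {s..t} (\<lambda>\<rho>. w n \<rho> * F m)"
      by (simp add: one)
    also have "\<dots> = integral {s..t} (\<lambda>\<rho>. w n \<rho> * F \<rho> - w n \<rho> * F m)"
      by (intro Henstock_Kurzweil_Integration.integral_diff[symmetric] i integrable_on_mult_left)
    finally have eq: "integral {s..t} (\<lambda>\<rho>. w n \<rho> * F \<rho>) - F m = integral {s..t} (\<lambda>\<rho>. w n \<rho> * (F \<rho> - F m))"
      by (simp add: right_diff_distrib)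
    have "norm (integral {s..t} (\<lambda>\<rho>. w n \<rho> * (F \<rho> - F m))) \<le> integral {s..t} (\<lambda>\<rho>. w n \<rho> * (e / 2))"
      by (rule integral_norm_bound_integral)
        (use conc w0 in \<open>auto simp: abs_mult intro!: integrable_continuous_real continuous_intros contw F\<close>)
    also have "\<dots> = e / 2" by (simp add: one)
    finally show "norm (integral {s..t} (\<lambda>\<rho>. real n * step_derivative (real n * (\<rho>\<^sup>2 - m\<^sup>2)) * (2 * \<rho>) * F \<rho>) - F m) < e"
      using \<open>e > 0\<close> eq unfolding w_def by simp
  qed
qed

text \<open>A function of \<open>v = |x|\<^sup>2\<close> rather than of \<open>|x|\<close>, so that it gives a smooth function of \<open>x\<close>.
  Both steps start just outside their radius, so the limit for \<open>n \<rightarrow> \<infinity>\<close> is the indicator function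
  of the half-open shell.\<close>

definition ring_cutoff :: "real \<Rightarrow> real \<Rightarrow> nat \<Rightarrow> real \<Rightarrow> real" where
  "ring_cutoff s t n v = smooth_step (real n * (v - s\<^sup>2)) - smooth_step (real n * (v - t\<^sup>2))"

lemma smooth_step_tendsto: "(\<lambda>n. smooth_step (real n * y)) \<longlonglongrightarrow> (if y > 0 then 1 else 0)"
proof (cases "y > 0")
  case True
  obtain m :: nat where m: "1 < real m * y" using reals_Archimedean3[OF True] by blast
  have "smooth_step (real n * y) = 1" if "n \<ge> m" for n
    using that True m mult_right_mono[of "real m" "real n" y] by (intro smooth_step_1) linarith
  then have "eventually (\<lambda>n. smooth_step (real n * y) = 1) sequentially"
    unfolding eventually_sequentially by blast
  then show ?thesis using True by (simp add: tendsto_eventually)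
next
  case False
  then have "smooth_step (real n * y) = 0" for n
    by (intro smooth_step_0) (simp add: mult_nonneg_nonpos)
  then show ?thesis using False by simp
qed

lemma ring_cutoff_tendsto:
  assumes "0 \<le> s" "s \<le> t" "0 \<le> \<rho>"
  shows "(\<lambda>n. ring_cutoff s t n (\<rho>\<^sup>2)) \<longlonglongrightarrow> indicator {s<..t} \<rho>"
proof -
  have *: "\<rho>\<^sup>2 - a\<^sup>2 > 0 \<longleftrightarrow> \<rho> > a" if "0 \<le> a" for a
    using assms that by (metis diff_gt_0_iff_gt power2_less_imp_less power_strict_mono zero_less_numeral)
  have "(\<lambda>n. ring_cutoff s t n (\<rho>\<^sup>2)) \<longlonglongrightarrow> (if \<rho>\<^sup>2 - s\<^sup>2 > 0 then 1 else 0) - (if \<rho>\<^sup>2 - t\<^sup>2 > 0 then 1 else 0)"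
    unfolding ring_cutoff_def by (intro tendsto_diff smooth_step_tendsto)
  also have "(if \<rho>\<^sup>2 - s\<^sup>2 > 0 then 1 else 0) - (if \<rho>\<^sup>2 - t\<^sup>2 > 0 then 1 else 0) = (indicator {s<..t} \<rho> :: real)"
    using assms *[of s] *[of t] by (auto simp: indicator_def)
  finally show ?thesis .
qed

lemma ring_cutoff_bound: "\<bar>ring_cutoff s t n v\<bar> \<le> 1"
  using smooth_step_range[of "real n * (v - s\<^sup>2)"] smooth_step_range[of "real n * (v - t\<^sup>2)"]
  unfolding ring_cutoff_def by linarith

lemma Ck_ring_cutoff: "Ck k (ring_cutoff s t n)"
proof -
  have "Ck k (\<lambda>v. smooth_step (real n * (v - a)))" for a
    by (rule Ck_compose[OF Ck_smooth_step])
      (intro Ck_mult Ck_diff Ck_const Ck_linear bounded_linear_ident)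
  then show ?thesis unfolding ring_cutoff_def[abs_def] by (intro Ck_diff)
qed

lemma ring_cutoff_has_derivative:
  "(ring_cutoff s t n has_real_derivative
     real n * step_derivative (real n * (v - s\<^sup>2)) - real n * step_derivative (real n * (v - t\<^sup>2))) (at v)"
proof -
  have "((\<lambda>v. smooth_step (real n * (v - a))) has_real_derivative real n * step_derivative (real n * (v - a))) (at v)" for a
  proof -
    have "((\<lambda>v. real n * (v - a)) has_real_derivative real n) (at v)"
      by (auto intro!: derivative_eq_intros)
    from DERIV_chain2[OF step_derivative(1) this] show ?thesis by (simp add: mult.commute)
  qed
  then show ?thesis unfolding ring_cutoff_def[abs_def] by (intro DERIV_diff)
qed

lemma ring_cutoff_0:
  assumes "s \<le> t" "0 \<le> s" and "v \<le> s\<^sup>2 \<or> real n * (v - t\<^sup>2) \<ge> 1"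
  shows "ring_cutoff s t n v = 0"
proof -
  have st: "s\<^sup>2 \<le> t\<^sup>2" using assms by (simp add: power_mono)
  consider "v \<le> s\<^sup>2" | "real n * (v - t\<^sup>2) \<ge> 1" using assms by blast
  then show ?thesis
  proof cases
    case 1
    then show ?thesis unfolding ring_cutoff_def using st
      by (simp add: smooth_step_0 mult_nonneg_nonpos)
  next
    case 2
    have "real n * (v - t\<^sup>2) \<le> real n * (v - s\<^sup>2)" using st by (intro mult_left_mono) auto
    with 2 show ?thesis unfolding ring_cutoff_def by (simp add: smooth_step_1)
  qed
qed

text \<open>The hypothesis \<open>weak\<close> says that \<open>\<rho> f\<close>, averaged over circles, is the weak derivative of
  \<open>\<rho> A\<close> up to the term \<open>\<rho> B\<close>. Testing it with \<open>Q\<close> times the ring cutoffs and letting the cutoffs become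
  sharp produces the boundary terms, by the approximate identity. Smooth test functions admit
  polynomial weights \<open>Q\<close> directly; continuously differentiable weights are approximated by polynomials later.\<close>

lemma radial_divergence_polynomial:
  fixes f :: "complex \<Rightarrow> real" and A B :: "real \<Rightarrow> real" and Q :: "real poly"
  assumes s: "0 < s" "s \<le> t" "t < T"
    and f: "set_integrable lebesgue (closed_shell s T) f"
    and A: "continuous_on {s..T} A" and B: "continuous_on {s..T} B"
    and weak: "\<And>\<eta> \<eta>'. \<lbrakk>\<And>k. Ck k \<eta>; \<And>v. (\<eta> has_real_derivative \<eta>' v) (at v); continuous_on UNIV \<eta>';
        \<And>v. v \<notin> {s\<^sup>2..T\<^sup>2} \<Longrightarrow> \<eta> v = 0\<rbrakk> \<Longrightarrow>
      (LINT x:closed_shell s T|lebesgue. \<eta> ((norm x)\<^sup>2) * f x) =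
      - 2 * pi * integral {s..T} (\<lambda>\<rho>. 2 * \<eta>' (\<rho>\<^sup>2) * \<rho>\<^sup>2 * A \<rho> + \<eta> (\<rho>\<^sup>2) * \<rho> * B \<rho>)"
  shows "(LINT x:shell s t|lebesgue. poly Q ((norm x)\<^sup>2) * f x) =
    2 * pi * (t * A t * poly Q (t\<^sup>2) - s * A s * poly Q (s\<^sup>2) -
      integral {s..t} (\<lambda>\<rho>. 2 * poly (pderiv Q) (\<rho>\<^sup>2) * \<rho>\<^sup>2 * A \<rho> + poly Q (\<rho>\<^sup>2) * \<rho> * B \<rho>))"
proof -
  define \<eta> where "\<eta> n v = ring_cutoff s t n v * poly Q v" for n v
  define d where "d n v m = real n * step_derivative (real n * (v - m\<^sup>2))" for n v m
  define \<eta>' where "\<eta>' n v = (d n v s - d n v t) * poly Q v + ring_cutoff s t n v * poly (pderiv Q) v" for n v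
  define G where "G \<rho> = 2 * poly (pderiv Q) (\<rho>\<^sup>2) * \<rho>\<^sup>2 * A \<rho> + poly Q (\<rho>\<^sup>2) * \<rho> * B \<rho>" for \<rho>
  define F where "F \<rho> = \<rho> * A \<rho> * poly Q (\<rho>\<^sup>2)" for \<rho>
  have sT: "s < T" "s \<le> T" "0 < t" using s by auto
  have tT: "T\<^sup>2 - t\<^sup>2 > 0" using s by (simp add: power_strict_mono)
  have Ck\<eta>: "Ck k (\<eta> n)" for k n
    unfolding \<eta>_def[abs_def] by (intro Ck_mult Ck_ring_cutoff Ck_poly)
  have cd: "continuous_on S (\<lambda>v. d n v m)" for S n m
    unfolding d_def by (intro continuous_intros continuous_on_compose2[OF step_derivative(4)[of UNIV]]) auto
  have cr: "continuous_on S (ring_cutoff s t n)" for S n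
    using Ck_ring_cutoff[of 0] continuous_on_subset by (metis Ck.simps(1) subset_UNIV)
  have d\<eta>: "(\<eta> n has_real_derivative \<eta>' n v) (at v)" for n v
    unfolding \<eta>_def[abs_def] \<eta>'_def d_def
    by (rule DERIV_cong[OF DERIV_mult[OF ring_cutoff_has_derivative poly_DERIV]]) simp
  have c\<eta>': "continuous_on UNIV (\<eta>' n)" for n
    unfolding \<eta>'_def[abs_def] by (intro continuous_intros cd cr)
  obtain N :: nat where N: "1 < real N * (T\<^sup>2 - t\<^sup>2)" using reals_Archimedean3[OF tT] by blast
  have supp: "\<eta> n v = 0" if n: "n \<ge> N" and v: "v \<notin> {s\<^sup>2..T\<^sup>2}" for n v
  proof -
    have "real n * (v - t\<^sup>2) \<ge> 1" if "v > T\<^sup>2"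
    proof -
      have "real N * (T\<^sup>2 - t\<^sup>2) \<le> real n * (v - t\<^sup>2)" using n that tT by (intro mult_mono) auto
      then show ?thesis using N by simp
    qed
    then show ?thesis using v s unfolding \<eta>_def by (subst ring_cutoff_0) auto
  qed
  have cc: "continuous_on S (\<lambda>\<rho>. h (\<rho>\<^sup>2))" if "continuous_on UNIV h" for h :: "real \<Rightarrow> real" and S
    by (rule continuous_on_compose2[OF that]) (auto intro!: continuous_intros)
  have cF: "continuous_on {s..T} F" and cG: "continuous_on {s..T} G"
    unfolding F_def[abs_def] G_def[abs_def] by (intro continuous_intros A B)+
  have I1: "integral {s..T} (\<lambda>\<rho>. 2 * \<eta>' n (\<rho>\<^sup>2) * \<rho>\<^sup>2 * A \<rho> + \<eta> n (\<rho>\<^sup>2) * \<rho> * B \<rho>) =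
      integral {s..T} (\<lambda>\<rho>. d n (\<rho>\<^sup>2) s * (2 * \<rho>) * F \<rho>) - integral {s..T} (\<lambda>\<rho>. d n (\<rho>\<^sup>2) t * (2 * \<rho>) * F \<rho>)
      + integral {s..T} (\<lambda>\<rho>. ring_cutoff s t n (\<rho>\<^sup>2) * G \<rho>)" for n
  proof -
    have i: "(\<lambda>\<rho>. d n (\<rho>\<^sup>2) m * (2 * \<rho>) * F \<rho>) integrable_on {s..T}" for m
      by (intro integrable_continuous_real continuous_intros cc[OF cd] cF)
    have j: "(\<lambda>\<rho>. ring_cutoff s t n (\<rho>\<^sup>2) * G \<rho>) integrable_on {s..T}"
      by (intro integrable_continuous_real continuous_intros cc[OF cr] cG)
    have "(\<lambda>\<rho>. 2 * \<eta>' n (\<rho>\<^sup>2) * \<rho>\<^sup>2 * A \<rho> + \<eta> n (\<rho>\<^sup>2) * \<rho> * B \<rho>) =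
      (\<lambda>\<rho>. (d n (\<rho>\<^sup>2) s * (2 * \<rho>) * F \<rho> - d n (\<rho>\<^sup>2) t * (2 * \<rho>) * F \<rho>) + ring_cutoff s t n (\<rho>\<^sup>2) * G \<rho>)"
      by (rule ext) (simp add: \<eta>'_def \<eta>_def F_def G_def algebra_simps power2_eq_square)
    then show ?thesis
      using i j by (simp add: Henstock_Kurzweil_Integration.integral_add Henstock_Kurzweil_Integration.integral_diff integrable_diff)
  qed
  have L3: "(\<lambda>n. integral {s..T} (\<lambda>\<rho>. ring_cutoff s t n (\<rho>\<^sup>2) * G \<rho>)) \<longlonglongrightarrow> integral {s..t} G"
  proof -
    have "(\<lambda>n. integral {s..T} (\<lambda>\<rho>. ring_cutoff s t n (\<rho>\<^sup>2) * G \<rho>)) \<longlonglongrightarrow> integral {s..T} (\<lambda>\<rho>. indicator {s<..t} \<rho> * G \<rho>)"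
    proof (rule dominated_convergence(2)[where h = "\<lambda>\<rho>. \<bar>G \<rho>\<bar>"])
      show "(\<lambda>\<rho>. ring_cutoff s t n (\<rho>\<^sup>2) * G \<rho>) integrable_on {s..T}" for n
        by (intro integrable_continuous_real continuous_intros cc[OF cr] cG)
      show "(\<lambda>\<rho>. \<bar>G \<rho>\<bar>) integrable_on {s..T}"
        by (intro integrable_continuous_real continuous_intros cG)
      show "norm (ring_cutoff s t n (\<rho>\<^sup>2) * G \<rho>) \<le> \<bar>G \<rho>\<bar>" for n \<rho>
        using ring_cutoff_bound by (simp add: abs_mult mult_left_le_one_le)
      show "(\<lambda>n. ring_cutoff s t n (\<rho>\<^sup>2) * G \<rho>) \<longlonglongrightarrow> indicator {s<..t} \<rho> * G \<rho>" if "\<rho> \<in> {s..T}" for \<rho>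
        using that s by (intro tendsto_intros ring_cutoff_tendsto) auto
    qed
    also have "integral {s..T} (\<lambda>\<rho>. indicator {s<..t} \<rho> * G \<rho>) = integral {s..T} (\<lambda>\<rho>. if \<rho> \<in> {s..t} then G \<rho> else 0)"
      by (rule integral_spike[of "{s}"]) (auto simp: indicator_def)
    also have "\<dots> = integral ({s..t} \<inter> {s..T}) G"
      using integral_restrict_Int[of "{s..T}" "{s..t}" G] by simp
    also have "{s..t} \<inter> {s..T} = {s..t}" using s by auto
    finally show ?thesis .
  qed
  have "(\<lambda>n. - 2 * pi * integral {s..T} (\<lambda>\<rho>. 2 * \<eta>' n (\<rho>\<^sup>2) * \<rho>\<^sup>2 * A \<rho> + \<eta> n (\<rho>\<^sup>2) * \<rho> * B \<rho>))
      \<longlonglongrightarrow> - 2 * pi * (F s - F t + integral {s..t} G)"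
    unfolding I1 d_def using s
    by (intro tendsto_intros L3 approximate_identity cF) auto
  then have R: "(\<lambda>n. LINT x:closed_shell s T|lebesgue. \<eta> n ((norm x)\<^sup>2) * f x)
      \<longlonglongrightarrow> - 2 * pi * (F s - F t + integral {s..t} G)"
  proof (rule Lim_transform_eventually)
    show "eventually (\<lambda>n. - 2 * pi * integral {s..T} (\<lambda>\<rho>. 2 * \<eta>' n (\<rho>\<^sup>2) * \<rho>\<^sup>2 * A \<rho> + \<eta> n (\<rho>\<^sup>2) * \<rho> * B \<rho>)
        = (LINT x:closed_shell s T|lebesgue. \<eta> n ((norm x)\<^sup>2) * f x)) sequentially"
      unfolding eventually_sequentially
      by (intro exI[of _ N] allI impI weak[symmetric] Ck\<eta> d\<eta> c\<eta>' supp)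
  qed
  have fQ: "set_integrable lebesgue (closed_shell s T) (\<lambda>x. poly Q ((norm x)\<^sup>2) * f x)"
    by (rule set_integrable_radial_times[OF f order.refl]) (intro continuous_intros)
  note fQ' = fQ[unfolded set_integrable_def]
  have L: "(\<lambda>n. LINT x:closed_shell s T|lebesgue. \<eta> n ((norm x)\<^sup>2) * f x)
      \<longlonglongrightarrow> (LINT x|lebesgue. indicator {s<..t} (norm x) *\<^sub>R indicator (closed_shell s T) x *\<^sub>R (poly Q ((norm x)\<^sup>2) * f x))"
    unfolding set_lebesgue_integral_def
  proof (rule integral_dominated_convergence[OF _ _ integrable_norm[OF fQ']])
    show m: "(\<lambda>x. indicator {s<..t} (norm x) *\<^sub>R indicator (closed_shell s T) x *\<^sub>R (poly Q ((norm x)\<^sup>2) * f x)) \<in> borel_measurable lebesgue"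
    proof (rule borel_measurable_scaleR[OF _ borel_measurable_integrable[OF fQ']])
      have "(\<lambda>x::complex. indicator {s<..t} (norm x) :: real) \<in> borel_measurable borel"
        by measurable
      then show "(\<lambda>x::complex. indicator {s<..t} (norm x) :: real) \<in> borel_measurable lebesgue"
        by (simp add: measurable_completion)
    qed
    have "set_integrable lebesgue (closed_shell s T) (\<lambda>x. \<eta> n ((norm x)\<^sup>2) * f x)" for n
      by (rule set_integrable_radial_times[OF f order.refl])
        (unfold \<eta>_def, intro continuous_intros cc[OF cr])
    then show "(\<lambda>x. indicator (closed_shell s T) x *\<^sub>R (\<eta> n ((norm x)\<^sup>2) * f x)) \<in> borel_measurable lebesgue" for n
      unfolding set_integrable_def by (rule borel_measurable_integrable)
    show "AE x in lebesgue. (\<lambda>n. indicator (closed_shell s T) x *\<^sub>R (\<eta> n ((norm x)\<^sup>2) * f x))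
       \<longlonglongrightarrow> indicator {s<..t} (norm x) *\<^sub>R indicator (closed_shell s T) x *\<^sub>R (poly Q ((norm x)\<^sup>2) * f x)"
    proof (rule AE_I2)
      fix x :: complex
      have "(\<lambda>n. ring_cutoff s t n ((norm x)\<^sup>2) *\<^sub>R indicator (closed_shell s T) x *\<^sub>R (poly Q ((norm x)\<^sup>2) * f x))
       \<longlonglongrightarrow> indicator {s<..t} (norm x) *\<^sub>R indicator (closed_shell s T) x *\<^sub>R (poly Q ((norm x)\<^sup>2) * f x)"
        using s by (intro tendsto_intros ring_cutoff_tendsto) auto
      then show "(\<lambda>n. indicator (closed_shell s T) x *\<^sub>R (\<eta> n ((norm x)\<^sup>2) * f x))
       \<longlonglongrightarrow> indicator {s<..t} (norm x) *\<^sub>R indicator (closed_shell s T) x *\<^sub>R (poly Q ((norm x)\<^sup>2) * f x)"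
        by (simp add: \<eta>_def mult_ac)
    qed
    show "AE x in lebesgue. norm (indicator (closed_shell s T) x *\<^sub>R (\<eta> n ((norm x)\<^sup>2) * f x))
        \<le> norm (indicator (closed_shell s T) x *\<^sub>R (poly Q ((norm x)\<^sup>2) * f x))" for n
      using ring_cutoff_bound[of s t n]
      by (intro AE_I2) (auto simp: \<eta>_def indicator_def abs_mult mult_left_le_one_le mult.assoc)
  qed
  have "(\<lambda>x. indicator {s<..t} (norm x) *\<^sub>R indicator (closed_shell s T) x *\<^sub>R (poly Q ((norm x)\<^sup>2) * f x))
      = (\<lambda>x. indicator (shell s t) x *\<^sub>R (poly Q ((norm x)\<^sup>2) * f x))"
    using s by (auto simp: indicator_def shell_def closed_shell_def fun_eq_iff)
  then have "(LINT x:shell s t|lebesgue. poly Q ((norm x)\<^sup>2) * f x) = - 2 * pi * (F s - F t + integral {s..t} G)"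
    using LIMSEQ_unique[OF L R] by (simp add: set_lebesgue_integral_def)
  then show ?thesis unfolding F_def G_def[abs_def] by (simp add: algebra_simps)
qed

section \<open>The weak gradient of a radial mapping\<close>

lemma weak_partial_inner:
  fixes u :: "'a::euclidean_space \<Rightarrow> 'b::euclidean_space"
  assumes u: "has_weak_partial \<Omega> u b g" and \<Omega>: "\<Omega> \<in> sets borel" and \<phi>: "\<phi> \<in> test_functions \<Omega>"
  shows "integrable (lebesgue_on \<Omega>) (\<lambda>x. frechet_derivative \<phi> (at x) b * (u x \<bullet> w))"
    "integrable (lebesgue_on \<Omega>) (\<lambda>x. \<phi> x * (g x \<bullet> w))"
    "(LINT x|lebesgue_on \<Omega>. \<phi> x * (g x \<bullet> w)) =
      - (LINT x|lebesgue_on \<Omega>. frechet_derivative \<phi> (at x) b * (u x \<bullet> w))"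
proof -
  obtain K where K: "compact K" "K \<subseteq> \<Omega>" "\<And>x. x \<notin> K \<Longrightarrow> \<phi> x = 0"
    "\<And>x b. x \<notin> K \<Longrightarrow> frechet_derivative \<phi> (at x) b = 0"
    using test_function_support[OF \<phi>] by metis
  have li: "locally_integrable \<Omega> u" "locally_integrable \<Omega> g"
    using u by (auto simp: has_weak_partial_def)
  have 1: "integrable (lebesgue_on \<Omega>) (\<lambda>x. frechet_derivative \<phi> (at x) b *\<^sub>R u x)"
    by (rule integrable_test_function_times(1)[OF li(1) \<Omega> K(1,2)])
      (use K(4) continuous_on_test_function_derivative[OF \<phi>] in auto)
  have 2: "integrable (lebesgue_on \<Omega>) (\<lambda>x. \<phi> x *\<^sub>R g x)"
    by (rule integrable_test_function_times(1)[OF li(2) \<Omega> K(1,2)])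
      (use K(3) continuous_on_test_function[OF \<phi>] in auto)
  show "integrable (lebesgue_on \<Omega>) (\<lambda>x. frechet_derivative \<phi> (at x) b * (u x \<bullet> w))"
    using integrable_inner_left[of w, OF 1] by simp
  show "integrable (lebesgue_on \<Omega>) (\<lambda>x. \<phi> x * (g x \<bullet> w))"
    using integrable_inner_left[of w, OF 2] by simp
  have "(LINT x|lebesgue_on \<Omega>. \<phi> x *\<^sub>R g x) = - (LINT x|lebesgue_on \<Omega>. frechet_derivative \<phi> (at x) b *\<^sub>R u x)"
    using u \<phi> by (auto simp: has_weak_partial_def)
  then have "(LINT x|lebesgue_on \<Omega>. \<phi> x *\<^sub>R g x) \<bullet> w =
      - ((LINT x|lebesgue_on \<Omega>. frechet_derivative \<phi> (at x) b *\<^sub>R u x) \<bullet> w)"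
    by (simp add: inner_minus_left)
  then show "(LINT x|lebesgue_on \<Omega>. \<phi> x * (g x \<bullet> w)) =
      - (LINT x|lebesgue_on \<Omega>. frechet_derivative \<phi> (at x) b * (u x \<bullet> w))"
    using integral_inner_left[of w, OF 1] integral_inner_left[of w, OF 2] by simp
qed

lemma open_annulus: "open (annulus r R)"
  unfolding annulus_def by (intro open_Collect_conj open_Collect_less continuous_intros)

lemma closed_shell_subset_annulus: "r < s \<Longrightarrow> T < R \<Longrightarrow> closed_shell s T \<subseteq> annulus r R"
  by (auto simp: closed_shell_def annulus_def)

lemma norm_square_complex: "(norm (x::complex))\<^sup>2 = Re x * Re x + Im x * Im x"
  using cmod_power2[of x] by (simp add: power2_eq_square)

lemma has_derivative_norm_square:
  "((\<lambda>x::complex. (norm x)\<^sup>2) has_derivative (\<lambda>v. 2 * (x \<bullet> v))) (at x)"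
proof -
  have "((\<lambda>x::complex. x \<bullet> x) has_derivative (\<lambda>v. x \<bullet> v + v \<bullet> x)) (at x)"
    by (auto intro!: derivative_eq_intros)
  then show ?thesis by (simp add: power2_norm_eq_inner inner_commute)
qed

lemma norm_square_notin_if_notin_shell:
  fixes x :: complex
  assumes "x \<notin> closed_shell s T" "0 \<le> s" "s \<le> T"
  shows "(norm x)\<^sup>2 \<notin> {s\<^sup>2..T\<^sup>2}"
proof -
  have "norm x < s \<or> T < norm x" using assms by (auto simp: closed_shell_def)
  then have "(norm x)\<^sup>2 < s\<^sup>2 \<or> T\<^sup>2 < (norm x)\<^sup>2"
    using assms power_strict_mono[of "norm x" s 2] power_strict_mono[of T "norm x" 2] by auto
  then show ?thesis by auto
qed

lemma radial_test_function:
  fixes m :: "complex \<Rightarrow> real"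
  assumes \<eta>: "\<And>k. Ck k \<eta>" "\<forall>v. v \<notin> {s\<^sup>2..T\<^sup>2} \<longrightarrow> \<eta> v = 0" and m: "\<And>k. Ck k m"
    and rs: "r < s" "T < R" "0 < s" "s < T"
  shows "(\<lambda>x. \<eta> ((norm x)\<^sup>2) * m x) \<in> test_functions (annulus r R)"
proof -
  have "Ck k (\<lambda>x::complex. (norm x)\<^sup>2)" for k
    unfolding norm_square_complex
    by (intro Ck_add Ck_mult Ck_linear bounded_linear_Re bounded_linear_Im)
  then have "Ck k (\<lambda>x. \<eta> ((norm x)\<^sup>2) * m x)" for k
    by (intro Ck_mult m Ck_compose[OF \<eta>(1)])
  moreover have "\<eta> ((norm x)\<^sup>2) = 0" if "x \<notin> closed_shell s T" for x :: complex
    using \<eta>(2) norm_square_notin_if_notin_shell[OF that] rs by simp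
  ultimately show ?thesis
    unfolding test_functions_def
    using compact_closed_shell closed_shell_subset_annulus[OF rs(1,2)]
    by (auto intro!: exI[of _ "closed_shell s T"])
qed

lemma set_integral_restrict:
  fixes f :: "'a::euclidean_space \<Rightarrow> real"
  assumes "K \<subseteq> \<Omega>" "\<Omega> \<in> sets borel" "\<forall>x. x \<notin> K \<longrightarrow> f x = 0"
  shows "(LINT x|lebesgue_on \<Omega>. f x) = (LINT x:K|lebesgue. f x)"
    "integrable (lebesgue_on \<Omega>) f \<Longrightarrow> set_integrable lebesgue K f"
proof -
  have \<Omega>: "\<Omega> \<inter> space lebesgue \<in> sets lebesgue" using assms by simp
  have eq: "(\<lambda>x. indicator \<Omega> x *\<^sub>R f x) = (\<lambda>x. indicator K x *\<^sub>R f x)"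
    using assms by (fastforce simp: indicator_def)
  show "(LINT x|lebesgue_on \<Omega>. f x) = (LINT x:K|lebesgue. f x)"
    unfolding set_lebesgue_integral_def integral_restrict_space[OF \<Omega>] eq ..
  show "integrable (lebesgue_on \<Omega>) f \<Longrightarrow> set_integrable lebesgue K f"
    unfolding set_integrable_def integrable_restrict_space[OF \<Omega>] eq .
qed

text \<open>With \<open>g1\<close> and \<open>g2\<close> the partial derivatives of \<open>h\<close>, these are the diagonal entries of the
  differential in the orthonormal basis consisting of \<open>x / |x|\<close> and the direction orthogonal to it. Both
  are linear in \<open>(g1, g2)\<close>; the second one is the trace minus the first.\<close>

definition radial_part :: "(complex \<Rightarrow> complex) \<Rightarrow> (complex \<Rightarrow> complex) \<Rightarrow> complex \<Rightarrow> real" where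
  "radial_part g1 g2 x = (Re x * (g1 x \<bullet> x) + Im x * (g2 x \<bullet> x)) / (norm x)\<^sup>2"

definition tangential_part :: "(complex \<Rightarrow> complex) \<Rightarrow> (complex \<Rightarrow> complex) \<Rightarrow> complex \<Rightarrow> real" where
  "tangential_part g1 g2 x = Re (g1 x) + Im (g2 x) - radial_part g1 g2 x"

context
  fixes r R s T :: real and H :: "real \<Rightarrow> real" and h g1 g2 :: "complex \<Rightarrow> complex"
  assumes rs: "0 \<le> r" "r < s" "s < T" "T < R"
    and h: "radial_on (annulus r R) H h"
    and g1: "has_weak_partial (annulus r R) h 1 g1" and g2: "has_weak_partial (annulus r R) h \<i> g2"
    and H: "continuous_on {r<..<R} H"
begin

lemma radial_weak_identity:
  fixes m :: "complex \<Rightarrow> real" and \<eta> :: "real \<Rightarrow> real"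
  assumes \<eta>: "\<And>k. Ck k \<eta>" "\<forall>v. v \<notin> {s\<^sup>2..T\<^sup>2} \<longrightarrow> \<eta> v = 0" "\<And>v. (\<eta> has_real_derivative \<eta>' v) (at v)"
    and m: "\<And>k. Ck k m" "\<And>x. (m has_derivative m' x) (at x)"
    and g: "has_weak_partial (annulus r R) h b g"
  shows "set_integrable lebesgue (closed_shell s T) (\<lambda>x. \<eta> ((norm x)\<^sup>2) * m x * (g x \<bullet> w))"
    "set_integrable lebesgue (closed_shell s T) (\<lambda>x.
        (2 * \<eta>' ((norm x)\<^sup>2) * (x \<bullet> b) * m x + \<eta> ((norm x)\<^sup>2) * m' x b) * (H (norm x) / norm x * (x \<bullet> w)))"
    "(LINT x:closed_shell s T|lebesgue. \<eta> ((norm x)\<^sup>2) * m x * (g x \<bullet> w)) =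
      - (LINT x:closed_shell s T|lebesgue.
        (2 * \<eta>' ((norm x)\<^sup>2) * (x \<bullet> b) * m x + \<eta> ((norm x)\<^sup>2) * m' x b) * (H (norm x) / norm x * (x \<bullet> w)))"
proof -
  define \<phi> where "\<phi> x = \<eta> ((norm x)\<^sup>2) * m x" for x :: complex
  have \<phi>: "\<phi> \<in> test_functions (annulus r R)"
    unfolding \<phi>_def[abs_def] using rs by (intro radial_test_function[OF \<eta>(1,2) m(1)]) auto
  have out: "\<eta> ((norm x)\<^sup>2) = 0" if "x \<notin> closed_shell s T" for x :: complex
    using \<eta>(2) norm_square_notin_if_notin_shell[OF that] rs by simp
  have der: "(\<phi> has_derivative (\<lambda>v. \<eta> ((norm x)\<^sup>2) * m' x v + (2 * (x \<bullet> v) * \<eta>' ((norm x)\<^sup>2)) * m x)) (at x)" for x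
    unfolding \<phi>_def[abs_def]
    by (rule has_derivative_mult[OF DERIV_compose_FDERIV[OF \<eta>(3) has_derivative_norm_square] m(2)])
  have fr: "frechet_derivative \<phi> (at x) b = 2 * \<eta>' ((norm x)\<^sup>2) * (x \<bullet> b) * m x + \<eta> ((norm x)\<^sup>2) * m' x b" for x
    unfolding frechet_derivative_at[OF der[of x], symmetric] by (simp add: algebra_simps)
  have fr0: "frechet_derivative \<phi> (at x) b = 0" if "x \<notin> closed_shell s T" for x
  proof -
    have "(\<phi> has_derivative (\<lambda>v. 0)) (at x)"
      by (rule has_derivative_transform_within_open[of "\<lambda>x. 0" _ _ _ "- closed_shell s T"])
        (use that out in \<open>auto simp: compact_imp_closed compact_closed_shell open_Compl \<phi>_def\<close>)
    from frechet_derivative_at[OF this] show ?thesis by metis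
  qed
  have \<Omega>: "annulus r R \<in> sets borel" using open_annulus by simp
  have sub: "closed_shell s T \<subseteq> annulus r R" using rs by (intro closed_shell_subset_annulus)
  note W = weak_partial_inner[OF g \<Omega> \<phi>, of w]
  have \<phi>0: "\<forall>x. x \<notin> closed_shell s T \<longrightarrow> \<phi> x * (g x \<bullet> w) = 0" using out by (simp add: \<phi>_def)
  have \<phi>1: "\<forall>x. x \<notin> closed_shell s T \<longrightarrow> frechet_derivative \<phi> (at x) b * (h x \<bullet> w) = 0" using fr0 by simp
  have hx: "h x \<bullet> w = H (norm x) / norm x * (x \<bullet> w)" if "x \<in> closed_shell s T" for x
    using h sub that unfolding radial_on_def by (auto simp: divide_inverse)
  have e1: "indicator (closed_shell s T) x *\<^sub>R (frechet_derivative \<phi> (at x) b * (h x \<bullet> w)) =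
      indicator (closed_shell s T) x *\<^sub>R ((2 * \<eta>' ((norm x)\<^sup>2) * (x \<bullet> b) * m x + \<eta> ((norm x)\<^sup>2) * m' x b) * (H (norm x) / norm x * (x \<bullet> w)))" for x
    using hx[of x] fr[of x] by (auto simp: indicator_def)
  note S1 = set_integral_restrict[where f = "\<lambda>x. \<phi> x * (g x \<bullet> w)", OF sub \<Omega> \<phi>0]
  note S2 = set_integral_restrict[where f = "\<lambda>x. frechet_derivative \<phi> (at x) b * (h x \<bullet> w)", OF sub \<Omega> \<phi>1]
  show "set_integrable lebesgue (closed_shell s T) (\<lambda>x. \<eta> ((norm x)\<^sup>2) * m x * (g x \<bullet> w))"
    using S1(2)[OF W(2)] unfolding \<phi>_def by simp
  show "set_integrable lebesgue (closed_shell s T) (\<lambda>x.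
        (2 * \<eta>' ((norm x)\<^sup>2) * (x \<bullet> b) * m x + \<eta> ((norm x)\<^sup>2) * m' x b) * (H (norm x) / norm x * (x \<bullet> w)))"
    using S2(2)[OF W(1)] unfolding set_integrable_def e1 by simp
  show "(LINT x:closed_shell s T|lebesgue. \<eta> ((norm x)\<^sup>2) * m x * (g x \<bullet> w)) =
      - (LINT x:closed_shell s T|lebesgue.
        (2 * \<eta>' ((norm x)\<^sup>2) * (x \<bullet> b) * m x + \<eta> ((norm x)\<^sup>2) * m' x b) * (H (norm x) / norm x * (x \<bullet> w)))"
    using W(3) S1(1) S2(1) unfolding set_lebesgue_integral_def e1 \<phi>_def by simp
qed

lemma set_integrable_weak_gradient:
  "set_integrable lebesgue (closed_shell s T) (\<lambda>x. g1 x \<bullet> w)"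
  "set_integrable lebesgue (closed_shell s T) (\<lambda>x. g2 x \<bullet> w)"
proof -
  have sub: "closed_shell s T \<subseteq> annulus r R" using rs by (intro closed_shell_subset_annulus)
  then have "set_integrable lebesgue (closed_shell s T) g1" "set_integrable lebesgue (closed_shell s T) g2"
    using g1 g2 compact_closed_shell by (auto simp: has_weak_partial_def locally_integrable_def)
  from integrable_inner_left[of w, OF this(1)[unfolded set_integrable_def]]
    integrable_inner_left[of w, OF this(2)[unfolded set_integrable_def]]
  show "set_integrable lebesgue (closed_shell s T) (\<lambda>x. g1 x \<bullet> w)"
    "set_integrable lebesgue (closed_shell s T) (\<lambda>x. g2 x \<bullet> w)"
    unfolding set_integrable_def by simp_all
qed

lemma continuous_on_profile: "continuous_on {s..T} H"
  using H by (rule continuous_on_subset) (use rs in auto)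

text \<open>Testing the weak derivatives with \<open>\<eta>(|x|\<^sup>2)\<close> times the monomials of degree two isolates the
  radial and the tangential entry of the differential.\<close>

lemma radial_part_weak:
  assumes \<eta>: "\<And>k. Ck k \<eta>" "\<And>v. (\<eta> has_real_derivative \<eta>' v) (at v)" "continuous_on UNIV \<eta>'"
    "\<And>v. v \<notin> {s\<^sup>2..T\<^sup>2} \<Longrightarrow> \<eta> v = 0"
  shows "(LINT x:closed_shell s T|lebesgue. \<eta> ((norm x)\<^sup>2) * ((norm x)\<^sup>2 * radial_part g1 g2 x)) =
      - 2 * pi * integral {s..T} (\<lambda>\<rho>. 2 * \<eta>' (\<rho>\<^sup>2) * \<rho>\<^sup>2 * (\<rho>\<^sup>2 * H \<rho>) + \<eta> (\<rho>\<^sup>2) * \<rho> * (3 * \<rho> * H \<rho>))"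
    and tangential_part_weak:
    "(LINT x:closed_shell s T|lebesgue. \<eta> ((norm x)\<^sup>2) * ((norm x)\<^sup>2 * tangential_part g1 g2 x)) =
      - 2 * pi * integral {s..T} (\<lambda>\<rho>. 2 * \<eta>' (\<rho>\<^sup>2) * \<rho>\<^sup>2 * 0 + \<eta> (\<rho>\<^sup>2) * \<rho> * (- \<rho> * H \<rho>))"
proof -
  let ?K = "closed_shell s T"
  define D where "D m m' b w x = (2 * \<eta>' ((norm x)\<^sup>2) * (x \<bullet> b) * m x + \<eta> ((norm x)\<^sup>2) * m' x b) * (H (norm x) / norm x * (x \<bullet> w))"
    for m :: "complex \<Rightarrow> real" and m' :: "complex \<Rightarrow> complex \<Rightarrow> real" and b w x :: complex
  have CkRI: "Ck k Re" "Ck k Im" for k by (auto intro: Ck_linear bounded_linear_Re bounded_linear_Im)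
  have dRI: "(Re has_derivative Re) (at x)" "(Im has_derivative Im) (at x)" for x
    by (auto intro: bounded_linear_imp_has_derivative bounded_linear_Re bounded_linear_Im)
  \<comment> \<open>\<open>|x|\<^sup>2\<close> times either entry is a combination of the partial derivatives with quadratic monomials
      as coefficients, and these monomials are absorbed into the test functions.\<close>
  define m1 m1' where "m1 x = Re x * Re x" and "m1' x v = Re x * Re v + Re v * Re x" for x v
  define m2 m2' where "m2 x = Re x * Im x" and "m2' x v = Re x * Im v + Re v * Im x" for x v
  define m3 m3' where "m3 x = Im x * Im x" and "m3' x v = Im x * Im v + Im v * Im x" for x v
  have m1: "Ck k m1" "(m1 has_derivative m1' x) (at x)" for k x
    unfolding m1_def[abs_def] m1'_def[abs_def]
    by (intro Ck_mult CkRI) (rule has_derivative_mult[OF dRI(1) dRI(1)])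
  have m2: "Ck k m2" "(m2 has_derivative m2' x) (at x)" for k x
    unfolding m2_def[abs_def] m2'_def[abs_def]
    by (intro Ck_mult CkRI) (rule has_derivative_mult[OF dRI(1) dRI(2)])
  have m3: "Ck k m3" "(m3 has_derivative m3' x) (at x)" for k x
    unfolding m3_def[abs_def] m3'_def[abs_def]
    by (intro Ck_mult CkRI) (rule has_derivative_mult[OF dRI(2) dRI(2)])
  have \<eta>4: "\<forall>v. v \<notin> {s\<^sup>2..T\<^sup>2} \<longrightarrow> \<eta> v = 0" using \<eta>(4) by blast
  note W = radial_weak_identity[OF \<eta>(1) \<eta>4 \<eta>(2), folded D_def]
  note W11 = W[OF m1 g1, of 1] and W12 = W[OF m2 g1, of \<i>] and W21 = W[OF m2 g2, of 1] and W22 = W[OF m3 g2, of \<i>]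
  note V11 = W[OF m3 g1, of 1] and V22 = W[OF m1 g2, of \<i>]
  have pos: "norm x > 0" if "x \<in> ?K" for x using that rs by (auto simp: closed_shell_def)
  have n2: "(norm x)\<^sup>2 = (Re x)\<^sup>2 + (Im x)\<^sup>2" for x by (rule cmod_power2)
  have "(LINT x:?K|lebesgue. \<eta> ((norm x)\<^sup>2) * ((norm x)\<^sup>2 * radial_part g1 g2 x)) =
      (LINT x:?K|lebesgue. \<eta> ((norm x)\<^sup>2) * m1 x * (g1 x \<bullet> 1) + \<eta> ((norm x)\<^sup>2) * m2 x * (g1 x \<bullet> \<i>)
        + \<eta> ((norm x)\<^sup>2) * m2 x * (g2 x \<bullet> 1) + \<eta> ((norm x)\<^sup>2) * m3 x * (g2 x \<bullet> \<i>))"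
  proof (intro set_lebesgue_integral_cong allI impI)
    fix x assume x: "x \<in> ?K"
    have "(norm x)\<^sup>2 * radial_part g1 g2 x = Re x * (g1 x \<bullet> x) + Im x * (g2 x \<bullet> x)"
      using pos[OF x] by (simp add: radial_part_def)
    then show "\<eta> ((norm x)\<^sup>2) * ((norm x)\<^sup>2 * radial_part g1 g2 x) = \<eta> ((norm x)\<^sup>2) * m1 x * (g1 x \<bullet> 1) + \<eta> ((norm x)\<^sup>2) * m2 x * (g1 x \<bullet> \<i>)
        + \<eta> ((norm x)\<^sup>2) * m2 x * (g2 x \<bullet> 1) + \<eta> ((norm x)\<^sup>2) * m3 x * (g2 x \<bullet> \<i>)"
      by (simp add: m1_def m2_def m3_def inner_complex_def algebra_simps)
  qed simp
  also have "\<dots> = - (LINT x:?K|lebesgue. D m1 m1' 1 1 x + D m2 m2' 1 \<i> x + D m2 m2' \<i> 1 x + D m3 m3' \<i> \<i> x)"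
    using W11 W12 W21 W22 by (simp add: set_integral_add)
  also have "(LINT x:?K|lebesgue. D m1 m1' 1 1 x + D m2 m2' 1 \<i> x + D m2 m2' \<i> 1 x + D m3 m3' \<i> \<i> x)
     = (LINT x:?K|lebesgue. (\<lambda>\<rho>. 2 * \<eta>' (\<rho>\<^sup>2) * \<rho>^3 * H \<rho> + 3 * \<eta> (\<rho>\<^sup>2) * \<rho> * H \<rho>) (norm x))"
  proof (intro set_lebesgue_integral_cong allI impI)
    fix x assume x: "x \<in> ?K"
    let ?a = "Re x" and ?b = "Im x" and ?p = "norm x"
    have "D m1 m1' 1 1 x + D m2 m2' 1 \<i> x + D m2 m2' \<i> 1 x + D m3 m3' \<i> \<i> x =
       H ?p / ?p * (2 * \<eta>' (?p\<^sup>2) * (?a\<^sup>2 + ?b\<^sup>2)\<^sup>2 + 3 * \<eta> (?p\<^sup>2) * (?a\<^sup>2 + ?b\<^sup>2))"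
      by (simp add: D_def m1_def m1'_def m2_def m2'_def m3_def m3'_def inner_complex_def power2_eq_square algebra_simps add_divide_distrib)
    also have "\<dots> = H ?p / ?p * (2 * \<eta>' (?p\<^sup>2) * (?p\<^sup>2)\<^sup>2 + 3 * \<eta> (?p\<^sup>2) * ?p\<^sup>2)"
      by (simp only: n2)
    also have "\<dots> = 2 * \<eta>' (?p\<^sup>2) * ?p^3 * H ?p + 3 * \<eta> (?p\<^sup>2) * ?p * H ?p"
      using pos[OF x] by (simp add: field_simps power2_eq_square power3_eq_cube)
    finally show "D m1 m1' 1 1 x + D m2 m2' 1 \<i> x + D m2 m2' \<i> 1 x + D m3 m3' \<i> \<i> x =
      (\<lambda>\<rho>. 2 * \<eta>' (\<rho>\<^sup>2) * \<rho>^3 * H \<rho> + 3 * \<eta> (\<rho>\<^sup>2) * \<rho> * H \<rho>) (norm x)" by simp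
  qed simp
  also have "\<dots> = 2 * pi * integral {s..T} (\<lambda>\<rho>. \<rho> * (2 * \<eta>' (\<rho>\<^sup>2) * \<rho>^3 * H \<rho> + 3 * \<eta> (\<rho>\<^sup>2) * \<rho> * H \<rho>))"
  proof (rule set_integral_closed_shell_radial)
    have "continuous_on {s..T} (\<lambda>\<rho>. \<eta> (\<rho>\<^sup>2))" "continuous_on {s..T} (\<lambda>\<rho>. \<eta>' (\<rho>\<^sup>2))"
      using \<eta>(1)[of 0] \<eta>(3) by (auto intro!: continuous_on_compose2[of UNIV _ _ "\<lambda>\<rho>. \<rho>\<^sup>2"] continuous_intros)
    then show "continuous_on {s..T} (\<lambda>\<rho>. 2 * \<eta>' (\<rho>\<^sup>2) * \<rho>^3 * H \<rho> + 3 * \<eta> (\<rho>\<^sup>2) * \<rho> * H \<rho>)"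
      by (intro continuous_intros continuous_on_profile)
  qed (use rs in simp)
  also have "(\<lambda>\<rho>. \<rho> * (2 * \<eta>' (\<rho>\<^sup>2) * \<rho>^3 * H \<rho> + 3 * \<eta> (\<rho>\<^sup>2) * \<rho> * H \<rho>)) =
      (\<lambda>\<rho>. 2 * \<eta>' (\<rho>\<^sup>2) * \<rho>\<^sup>2 * (\<rho>\<^sup>2 * H \<rho>) + \<eta> (\<rho>\<^sup>2) * \<rho> * (3 * \<rho> * H \<rho>))"
    by (simp add: fun_eq_iff algebra_simps power2_eq_square power3_eq_cube)
  finally show "(LINT x:closed_shell s T|lebesgue. \<eta> ((norm x)\<^sup>2) * ((norm x)\<^sup>2 * radial_part g1 g2 x)) =
      - 2 * pi * integral {s..T} (\<lambda>\<rho>. 2 * \<eta>' (\<rho>\<^sup>2) * \<rho>\<^sup>2 * (\<rho>\<^sup>2 * H \<rho>) + \<eta> (\<rho>\<^sup>2) * \<rho> * (3 * \<rho> * H \<rho>))"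
    by simp
  have "(LINT x:?K|lebesgue. \<eta> ((norm x)\<^sup>2) * ((norm x)\<^sup>2 * tangential_part g1 g2 x)) =
      (LINT x:?K|lebesgue. \<eta> ((norm x)\<^sup>2) * m3 x * (g1 x \<bullet> 1) - \<eta> ((norm x)\<^sup>2) * m2 x * (g1 x \<bullet> \<i>)
        - \<eta> ((norm x)\<^sup>2) * m2 x * (g2 x \<bullet> 1) + \<eta> ((norm x)\<^sup>2) * m1 x * (g2 x \<bullet> \<i>))"
  proof (intro set_lebesgue_integral_cong allI impI)
    fix x assume x: "x \<in> ?K"
    have "(norm x)\<^sup>2 * tangential_part g1 g2 x = (norm x)\<^sup>2 * (Re (g1 x) + Im (g2 x)) - (Re x * (g1 x \<bullet> x) + Im x * (g2 x \<bullet> x))"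
      using pos[OF x] by (simp add: tangential_part_def radial_part_def right_diff_distrib)
    then show "\<eta> ((norm x)\<^sup>2) * ((norm x)\<^sup>2 * tangential_part g1 g2 x) = \<eta> ((norm x)\<^sup>2) * m3 x * (g1 x \<bullet> 1) - \<eta> ((norm x)\<^sup>2) * m2 x * (g1 x \<bullet> \<i>)
        - \<eta> ((norm x)\<^sup>2) * m2 x * (g2 x \<bullet> 1) + \<eta> ((norm x)\<^sup>2) * m1 x * (g2 x \<bullet> \<i>)"
      by (simp add: m1_def m2_def m3_def inner_complex_def n2) (simp add: algebra_simps power2_eq_square)
  qed simp
  also have "\<dots> = - (LINT x:?K|lebesgue. D m3 m3' 1 1 x - D m2 m2' 1 \<i> x - D m2 m2' \<i> 1 x + D m1 m1' \<i> \<i> x)"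
    using V11 W12 W21 V22 by (simp add: set_integral_add set_integral_diff)
  also have "(LINT x:?K|lebesgue. D m3 m3' 1 1 x - D m2 m2' 1 \<i> x - D m2 m2' \<i> 1 x + D m1 m1' \<i> \<i> x)
     = (LINT x:?K|lebesgue. (\<lambda>\<rho>. - \<eta> (\<rho>\<^sup>2) * \<rho> * H \<rho>) (norm x))"
  proof (intro set_lebesgue_integral_cong allI impI)
    fix x assume x: "x \<in> ?K"
    let ?a = "Re x" and ?b = "Im x" and ?p = "norm x"
    have "D m3 m3' 1 1 x - D m2 m2' 1 \<i> x - D m2 m2' \<i> 1 x + D m1 m1' \<i> \<i> x =
       H ?p / ?p * (- \<eta> (?p\<^sup>2) * (?a\<^sup>2 + ?b\<^sup>2))"
      by (simp add: D_def m1_def m1'_def m2_def m2'_def m3_def m3'_def inner_complex_def power2_eq_square algebra_simps add_divide_distrib)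
    also have "\<dots> = H ?p / ?p * (- \<eta> (?p\<^sup>2) * ?p\<^sup>2)"
      by (simp only: n2)
    also have "\<dots> = - \<eta> (?p\<^sup>2) * ?p * H ?p"
      using pos[OF x] by (simp add: field_simps power2_eq_square)
    finally show "D m3 m3' 1 1 x - D m2 m2' 1 \<i> x - D m2 m2' \<i> 1 x + D m1 m1' \<i> \<i> x =
      (\<lambda>\<rho>. - \<eta> (\<rho>\<^sup>2) * \<rho> * H \<rho>) (norm x)" by simp
  qed simp
  also have "\<dots> = 2 * pi * integral {s..T} (\<lambda>\<rho>. \<rho> * (- \<eta> (\<rho>\<^sup>2) * \<rho> * H \<rho>))"
  proof (rule set_integral_closed_shell_radial)
    have "continuous_on {s..T} (\<lambda>\<rho>. \<eta> (\<rho>\<^sup>2))"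
      using \<eta>(1)[of 0] by (auto intro!: continuous_on_compose2[of UNIV _ _ "\<lambda>\<rho>. \<rho>\<^sup>2"] continuous_intros)
    then show "continuous_on {s..T} (\<lambda>\<rho>. - \<eta> (\<rho>\<^sup>2) * \<rho> * H \<rho>)"
      by (intro continuous_intros continuous_on_profile)
  qed (use rs in simp)
  also have "(\<lambda>\<rho>. \<rho> * (- \<eta> (\<rho>\<^sup>2) * \<rho> * H \<rho>)) =
      (\<lambda>\<rho>. 2 * \<eta>' (\<rho>\<^sup>2) * \<rho>\<^sup>2 * 0 + \<eta> (\<rho>\<^sup>2) * \<rho> * (- \<rho> * H \<rho>))"
    by (simp add: fun_eq_iff algebra_simps power2_eq_square)
  finally show "(LINT x:closed_shell s T|lebesgue. \<eta> ((norm x)\<^sup>2) * ((norm x)\<^sup>2 * tangential_part g1 g2 x)) =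
      - 2 * pi * integral {s..T} (\<lambda>\<rho>. 2 * \<eta>' (\<rho>\<^sup>2) * \<rho>\<^sup>2 * 0 + \<eta> (\<rho>\<^sup>2) * \<rho> * (- \<rho> * H \<rho>))"
    by simp
qed

end

lemma polynomial_approximation:
  fixes S :: "real \<Rightarrow> real"
  assumes "continuous_on {a..b} S" "e > 0"
  obtains q :: "real poly" where "\<And>v. v \<in> {a..b} \<Longrightarrow> \<bar>poly q v - S v\<bar> \<le> e"
proof -
  obtain f where f: "real_polynomial_function f" "\<And>v. v \<in> {a..b} \<Longrightarrow> \<bar>S v - f v\<bar> < e"
    using Stone_Weierstrass_real_polynomial_function[OF compact_Icc assms] by blast
  obtain c n where "f = (\<lambda>v. \<Sum>i\<le>n. c i * v ^ i)"
    using f(1) real_polynomial_function_iff_sum by blast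
  then have "poly (\<Sum>i\<le>n. monom (c i) i) v = f v" for v
    by (simp add: poly_sum poly_monom)
  then show thesis using f(2)
    by (intro that[of "\<Sum>i\<le>n. monom (c i) i"]) (simp add: abs_minus_commute less_imp_le)
qed

lemma pderiv_sum: "pderiv (\<Sum>i\<in>I. f i) = (\<Sum>i\<in>I. pderiv (f i))"
  by (induction I rule: infinite_finite_induct) (auto simp: pderiv_add)

lemma polynomial_antiderivative:
  fixes q :: "real poly"
  obtains Q where "pderiv Q = q" "poly Q a = c"
proof -
  define Q0 where "Q0 = (\<Sum>i\<le>degree q. monom (coeff q i / real (Suc i)) (Suc i))"
  have "pderiv Q0 = (\<Sum>i\<le>degree q. monom (coeff q i) i)"
    by (simp add: Q0_def pderiv_sum pderiv_monom del: of_nat_Suc)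
  also have "\<dots> = q" by (rule poly_as_sum_of_monoms)
  finally have "pderiv (Q0 + [:c - poly Q0 a:]) = q" by (simp add: pderiv_add pderiv_pCons)
  moreover have "poly (Q0 + [:c - poly Q0 a:]) a = c" by simp
  ultimately show thesis using that by blast
qed

text \<open>Approximate the derivative uniformly and integrate the approximating polynomial.\<close>

lemma polynomial_approximation_C1:
  fixes S S' :: "real \<Rightarrow> real"
  assumes S: "\<And>v. v \<in> {a..b} \<Longrightarrow> (S has_real_derivative S' v) (at v within {a..b})"
    and S': "continuous_on {a..b} S'" and ab: "a \<le> b" and e: "e > 0"
  obtains Q :: "real poly" where "\<And>v. v \<in> {a..b} \<Longrightarrow> \<bar>poly Q v - S v\<bar> \<le> e"
    "\<And>v. v \<in> {a..b} \<Longrightarrow> \<bar>poly (pderiv Q) v - S' v\<bar> \<le> e"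
proof -
  define e' where "e' = e / (1 + (b - a))"
  have e': "e' > 0" "e' \<le> e" "e' * (b - a) \<le> e"
    using ab e by (auto simp: e'_def field_simps)
  obtain q where q: "\<And>v. v \<in> {a..b} \<Longrightarrow> \<bar>poly q v - S' v\<bar> \<le> e'"
    using polynomial_approximation[OF S' e'(1)] by blast
  obtain Q where Q: "pderiv Q = q" "poly Q a = S a"
    using polynomial_antiderivative by blast
  have "\<bar>poly Q v - S v\<bar> \<le> e" if v: "v \<in> {a..b}" for v
  proof -
    have "norm ((poly Q v - S v) - (poly Q a - S a)) \<le> e' * norm (v - a)"
    proof (rule field_differentiable_bound[of "{a..b}"])
      show "((\<lambda>v. poly Q v - S v) has_field_derivative (poly q z - S' z)) (at z within {a..b})"
        if "z \<in> {a..b}" for z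
        using S[OF that] Q(1) by (auto intro!: DERIV_diff has_field_derivative_at_within[OF poly_DERIV])
    qed (use q v ab in auto)
    also have "\<dots> \<le> e' * (b - a)" using v e' by (intro mult_left_mono) auto
    finally show ?thesis using Q e' by simp
  qed
  moreover have "\<bar>poly (pderiv Q) v - S' v\<bar> \<le> e" if "v \<in> {a..b}" for v
    using q[OF that] Q(1) e' by simp
  ultimately show thesis using that by blast
qed

lemma integral_tendsto_if_close:
  fixes G :: "real \<Rightarrow> real" and g :: "nat \<Rightarrow> real \<Rightarrow> real"
  assumes "\<And>n. continuous_on {s..t} (g n)" "continuous_on {s..t} G" "continuous_on {s..t} w"
    and close: "\<And>n \<rho>. \<rho> \<in> {s..t} \<Longrightarrow> \<bar>g n \<rho> - G \<rho>\<bar> \<le> inverse (real (Suc n)) * w \<rho>"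
  shows "(\<lambda>n. integral {s..t} (g n)) \<longlonglongrightarrow> integral {s..t} G"
proof -
  have i: "g n integrable_on {s..t}" "G integrable_on {s..t}" "w integrable_on {s..t}" for n
    using assms by (auto intro: integrable_continuous_real)
  have "norm (integral {s..t} (g n) - integral {s..t} G) \<le> inverse (real (Suc n)) * integral {s..t} w" for n
  proof -
    have "norm (integral {s..t} (\<lambda>\<rho>. g n \<rho> - G \<rho>)) \<le> integral {s..t} (\<lambda>\<rho>. inverse (real (Suc n)) * w \<rho>)"
      by (rule integral_norm_bound_integral) (use i close in \<open>auto intro!: integrable_diff simp del: of_nat_Suc\<close>)
    then show ?thesis using i by (simp add: Henstock_Kurzweil_Integration.integral_diff del: of_nat_Suc)
  qed
  moreover have "(\<lambda>n. inverse (real (Suc n)) * integral {s..t} w) \<longlonglongrightarrow> 0 * integral {s..t} w"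
    by (intro tendsto_mult LIMSEQ_inverse_real_of_nat tendsto_const)
  ultimately have "(\<lambda>n. integral {s..t} (g n) - integral {s..t} G) \<longlonglongrightarrow> 0"
    using Lim_null_comparison[of "\<lambda>n. integral {s..t} (g n) - integral {s..t} G"
        "\<lambda>n. inverse (real (Suc n)) * integral {s..t} w" sequentially]
    by (simp del: of_nat_Suc)
  then show ?thesis by (simp add: LIM_zero_iff)
qed

lemma set_integral_tendsto_if_close:
  fixes f :: "complex \<Rightarrow> real" and g :: "nat \<Rightarrow> real \<Rightarrow> real"
  assumes f: "set_integrable lebesgue (shell s t) f"
    and g: "\<And>n. continuous_on {s..t} (g n)" and G: "continuous_on {s..t} G"
    and close: "\<And>n \<rho>. \<rho> \<in> {s..t} \<Longrightarrow> \<bar>g n \<rho> - G \<rho>\<bar> \<le> inverse (real (Suc n))"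
  shows "(\<lambda>n. LINT x:shell s t|lebesgue. g n (norm x) * f x) \<longlonglongrightarrow> (LINT x:shell s t|lebesgue. G (norm x) * f x)"
proof -
  note i = set_integrable_radial_times[OF f shell_subset]
  have "norm ((LINT x:shell s t|lebesgue. g n (norm x) * f x) - (LINT x:shell s t|lebesgue. G (norm x) * f x))
      \<le> inverse (real (Suc n)) * (LINT x:shell s t|lebesgue. \<bar>f x\<bar>)" for n
  proof -
    have "(LINT x:shell s t|lebesgue. g n (norm x) * f x) - (LINT x:shell s t|lebesgue. G (norm x) * f x)
       = (LINT x:shell s t|lebesgue. g n (norm x) * f x - G (norm x) * f x)"
      by (rule set_integral_diff(2)[symmetric]; intro i g G)
    also have "norm \<dots> \<le> (LINT x:shell s t|lebesgue. norm (g n (norm x) * f x - G (norm x) * f x))"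
      by (rule set_integral_norm_bound) (intro set_integral_diff(1) i g G)
    also have "\<dots> \<le> (LINT x:shell s t|lebesgue. inverse (real (Suc n)) * \<bar>f x\<bar>)"
    proof (rule set_integral_mono)
      show "set_integrable lebesgue (shell s t) (\<lambda>x. norm (g n (norm x) * f x - G (norm x) * f x))"
        by (intro set_integrable_norm set_integral_diff(1) i g G)
      show "set_integrable lebesgue (shell s t) (\<lambda>x. inverse (real (Suc n)) * \<bar>f x\<bar>)"
        using f by (intro set_integrable_mult_right set_integrable_abs) simp
      fix x assume "x \<in> shell s t"
      then have "\<bar>g n (norm x) - G (norm x)\<bar> \<le> inverse (real (Suc n))"
        by (intro close) (auto simp: shell_def)
      then have "\<bar>g n (norm x) - G (norm x)\<bar> * \<bar>f x\<bar> \<le> inverse (real (Suc n)) * \<bar>f x\<bar>"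
        by (intro mult_right_mono) auto
      then show "norm (g n (norm x) * f x - G (norm x) * f x) \<le> inverse (real (Suc n)) * \<bar>f x\<bar>"
        by (simp add: abs_mult[symmetric] left_diff_distrib del: of_nat_Suc)
    qed
    finally show ?thesis by simp
  qed
  moreover have "(\<lambda>n. inverse (real (Suc n)) * (LINT x:shell s t|lebesgue. \<bar>f x\<bar>)) \<longlonglongrightarrow> 0 * (LINT x:shell s t|lebesgue. \<bar>f x\<bar>)"
    by (intro tendsto_mult LIMSEQ_inverse_real_of_nat tendsto_const)
  ultimately have "(\<lambda>n. (LINT x:shell s t|lebesgue. g n (norm x) * f x) - (LINT x:shell s t|lebesgue. G (norm x) * f x)) \<longlonglongrightarrow> 0"
    using Lim_null_comparison[of "\<lambda>n. (LINT x:shell s t|lebesgue. g n (norm x) * f x) - (LINT x:shell s t|lebesgue. G (norm x) * f x)"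
        "\<lambda>n. inverse (real (Suc n)) * (LINT x:shell s t|lebesgue. \<bar>f x\<bar>)" sequentially]
    by (simp del: of_nat_Suc)
  then show ?thesis by (simp add: LIM_zero_iff)
qed

context
  fixes r R s t :: real and H :: "real \<Rightarrow> real" and h g1 g2 :: "complex \<Rightarrow> complex"
  assumes rs: "0 \<le> r" "r < s" "s \<le> t" "t < R"
    and h: "radial_on (annulus r R) H h"
    and g1: "has_weak_partial (annulus r R) h 1 g1" and g2: "has_weak_partial (annulus r R) h \<i> g2"
    and H: "continuous_on {r<..<R} H"
begin

lemma continuous_on_profile_shell: "continuous_on {s..t} H"
  using H by (rule continuous_on_subset) (use rs in auto)

lemma set_integrable_parts:
  assumes "t \<le> T" "T < R" "s < T"
  shows "set_integrable lebesgue (closed_shell s T) (\<lambda>x. (norm x)\<^sup>2 * radial_part g1 g2 x)"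
    "set_integrable lebesgue (closed_shell s T) (\<lambda>x. (norm x)\<^sup>2 * tangential_part g1 g2 x)"
proof -
  let ?K = "closed_shell s T"
  note g = set_integrable_weak_gradient[OF rs(1,2) assms(3,2) h g1 g2 H]
  have bounded: "set_integrable lebesgue ?K (\<lambda>x. m x * f x)"
    if m: "continuous_on UNIV m" and f: "set_integrable lebesgue ?K f" for m f :: "complex \<Rightarrow> real"
  proof -
    have "bounded (m ` ?K)"
      by (intro compact_imp_bounded compact_continuous_image compact_closed_shell continuous_on_subset[OF m]) simp
    from absolutely_integrable_bounded_measurable_product[OF bilinear_times _ _ this f]
    have "(\<lambda>x. m x * f x) absolutely_integrable_on ?K"
      using sets_shell(2)[of s T]
      by (simp add: continuous_imp_measurable_on_sets_lebesgue continuous_on_subset[OF m])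
    then show ?thesis .
  qed
  have cRI: "continuous_on UNIV Re" "continuous_on UNIV Im" by (auto intro!: continuous_intros)
  have "set_integrable lebesgue ?K (\<lambda>x. Re x * Re x * (g1 x \<bullet> 1) + Re x * Im x * (g1 x \<bullet> \<i>) + Re x * Im x * (g2 x \<bullet> 1) + Im x * Im x * (g2 x \<bullet> \<i>))"
    by (intro set_integral_add(1) bounded g continuous_intros)
  moreover have eq1: "(norm x)\<^sup>2 * radial_part g1 g2 x = Re x * Re x * (g1 x \<bullet> 1) + Re x * Im x * (g1 x \<bullet> \<i>) + Re x * Im x * (g2 x \<bullet> 1) + Im x * Im x * (g2 x \<bullet> \<i>)" for x
    by (cases "x = 0") (simp, simp add: radial_part_def, simp add: inner_complex_def algebra_simps)
  ultimately show i1: "set_integrable lebesgue ?K (\<lambda>x. (norm x)\<^sup>2 * radial_part g1 g2 x)"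
    by (simp only: eq1)
  have "set_integrable lebesgue ?K (\<lambda>x. (norm x)\<^sup>2 * (g1 x \<bullet> 1) + (norm x)\<^sup>2 * (g2 x \<bullet> \<i>) - (norm x)\<^sup>2 * radial_part g1 g2 x)"
    by (intro set_integral_add(1) set_integral_diff(1) i1 bounded g continuous_intros)
  then show "set_integrable lebesgue ?K (\<lambda>x. (norm x)\<^sup>2 * tangential_part g1 g2 x)"
    by (simp add: tangential_part_def inner_complex_def algebra_simps)
qed

text \<open>Formally the left hand side is \<open>2 \<pi> \<integral> P H'\<close>. The profile \<open>H\<close> of a Sobolev mapping is given as
  a continuous function only, and the identity replaces the statement that it is absolutely continuous. It follows
  from the weak formulation by approximating the weight by polynomials in \<open>|x|\<^sup>2\<close>, together with
  their derivatives.\<close>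

lemma radial_integration_by_parts:
  assumes P: "\<And>\<rho>. \<rho> \<in> {s..t} \<Longrightarrow> (P has_real_derivative P' \<rho>) (at \<rho> within {s..t})"
    and P': "continuous_on {s..t} P'"
  shows "set_integrable lebesgue (shell s t) (\<lambda>x. P (norm x) / norm x * radial_part g1 g2 x)"
    "(LINT x:shell s t|lebesgue. P (norm x) / norm x * radial_part g1 g2 x) =
      2 * pi * (P t * H t - P s * H s - integral {s..t} (\<lambda>\<rho>. P' \<rho> * H \<rho>))"
proof -
  define T where "T = (t + R) / 2"
  have T: "t < T" "T < R" "s < T" using rs by (auto simp: T_def)
  define f where "f x = (norm x)\<^sup>2 * radial_part g1 g2 x" for x
  have fT: "set_integrable lebesgue (closed_shell s T) f"
    unfolding f_def[abs_def] using T by (intro set_integrable_parts) auto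
  have f: "set_integrable lebesgue (shell s t) f"
    by (rule set_integrable_subset[OF fT]) (use T in \<open>auto simp: shell_def closed_shell_def\<close>)
  have cHT: "continuous_on {s..T} H" using H by (rule continuous_on_subset) (use rs T in auto)
  note cH = continuous_on_profile_shell
  have cP: "continuous_on {s..t} P"
    using P by (intro DERIV_continuous_on)
  have s0: "0 < s" using rs by simp
  have st2: "s\<^sup>2 \<le> t\<^sup>2" using rs by (simp add: power_mono)
  have poly: "(LINT x:shell s t|lebesgue. poly Q ((norm x)\<^sup>2) * f x) =
    2 * pi * (t * (t\<^sup>2 * H t) * poly Q (t\<^sup>2) - s * (s\<^sup>2 * H s) * poly Q (s\<^sup>2) -
      integral {s..t} (\<lambda>\<rho>. 2 * poly (pderiv Q) (\<rho>\<^sup>2) * \<rho>\<^sup>2 * (\<rho>\<^sup>2 * H \<rho>) + poly Q (\<rho>\<^sup>2) * \<rho> * (3 * \<rho> * H \<rho>)))" for Q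
  proof (rule radial_divergence_polynomial[OF s0 rs(3) T(1) fT])
    show "(LINT x:closed_shell s T|lebesgue. \<eta> ((norm x)\<^sup>2) * f x) =
      - 2 * pi * integral {s..T} (\<lambda>\<rho>. 2 * \<eta>' (\<rho>\<^sup>2) * \<rho>\<^sup>2 * (\<rho>\<^sup>2 * H \<rho>) + \<eta> (\<rho>\<^sup>2) * \<rho> * (3 * \<rho> * H \<rho>))"
      if "\<And>k. Ck k \<eta>" "\<And>v. (\<eta> has_real_derivative \<eta>' v) (at v)" "continuous_on UNIV \<eta>'"
        "\<And>v. v \<notin> {s\<^sup>2..T\<^sup>2} \<Longrightarrow> \<eta> v = 0" for \<eta> \<eta>'
      unfolding f_def by (rule radial_part_weak[OF rs(1,2) T(3,2) h g1 g2 H]) (use that in auto)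
  qed (intro continuous_intros cHT)+
  \<comment> \<open>chosen such that \<open>S (|x|\<^sup>2) |x|\<^sup>2 = P (|x|) / |x|\<close>\<close>
  define S where "S v = P (sqrt v) / sqrt v ^ 3" for v
  define S' where "S' v = (P' (sqrt v) * sqrt v ^ 3 - P (sqrt v) * (3 * sqrt v ^ 2)) / (sqrt v ^ 3 * sqrt v ^ 3) * (inverse (sqrt v) / 2)" for v
  have sq: "sqrt v \<in> {s..t}" "0 < sqrt v" "0 < v" if v: "v \<in> {s\<^sup>2..t\<^sup>2}" for v
  proof -
    show "sqrt v \<in> {s..t}" using v rs real_le_rsqrt[of s v] real_le_lsqrt[of t v] by auto
    have "0 < s\<^sup>2" using s0 by simp
    then show "0 < v" using v by (meson atLeastAtMost_iff less_le_trans)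
    then show "0 < sqrt v" by simp
  qed
  have csq: "continuous_on {s\<^sup>2..t\<^sup>2} (\<lambda>v. k (sqrt v))" if "continuous_on {s..t} k" for k :: "real \<Rightarrow> real"
    by (rule continuous_on_compose2[OF that]) (use sq in \<open>auto intro!: continuous_intros\<close>)
  have dS: "(S has_real_derivative S' v) (at v within {s\<^sup>2..t\<^sup>2})" if v: "v \<in> {s\<^sup>2..t\<^sup>2}" for v
  proof -
    have dsq: "(sqrt has_real_derivative inverse (sqrt v) / 2) (at v within {s\<^sup>2..t\<^sup>2})"
      by (rule has_field_derivative_at_within[OF DERIV_real_sqrt]) (use sq[OF v] in simp)
    have dq: "((\<lambda>\<rho>. P \<rho> / \<rho> ^ 3) has_real_derivative
        (P' (sqrt v) * sqrt v ^ 3 - P (sqrt v) * (3 * sqrt v ^ 2)) / (sqrt v ^ 3 * sqrt v ^ 3)) (at (sqrt v) within {s..t})"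
      using sq[OF v] by (intro derivative_eq_intros DERIV_divide P refl) auto
    have "((\<lambda>v. P (sqrt v) / sqrt v ^ 3) has_real_derivative
        (P' (sqrt v) * sqrt v ^ 3 - P (sqrt v) * (3 * sqrt v ^ 2)) / (sqrt v ^ 3 * sqrt v ^ 3) * (inverse (sqrt v) / 2)) (at v within {s\<^sup>2..t\<^sup>2})"
      using DERIV_image_chain[OF has_field_derivative_subset[OF dq] dsq] sq by (auto simp: o_def image_subset_iff)
    then show ?thesis unfolding S_def[abs_def] S'_def .
  qed
  have cS: "continuous_on {s\<^sup>2..t\<^sup>2} S" using dS by (rule DERIV_continuous_on)
  have cS': "continuous_on {s\<^sup>2..t\<^sup>2} S'"
    unfolding S'_def[abs_def] using sq(3)
    by (intro continuous_intros csq cP P') force+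
  have "\<forall>n. \<exists>Q :: real poly. \<forall>v\<in>{s\<^sup>2..t\<^sup>2}. \<bar>poly Q v - S v\<bar> \<le> inverse (real (Suc n)) \<and> \<bar>poly (pderiv Q) v - S' v\<bar> \<le> inverse (real (Suc n))"
  proof
    fix n
    have "inverse (real (Suc n)) > 0" by simp
    from polynomial_approximation_C1[OF dS cS' st2 this]
    show "\<exists>Q :: real poly. \<forall>v\<in>{s\<^sup>2..t\<^sup>2}. \<bar>poly Q v - S v\<bar> \<le> inverse (real (Suc n)) \<and> \<bar>poly (pderiv Q) v - S' v\<bar> \<le> inverse (real (Suc n))"
      by metis
  qed
  then obtain Q :: "nat \<Rightarrow> real poly" where
    Q: "\<And>n v. v \<in> {s\<^sup>2..t\<^sup>2} \<Longrightarrow> \<bar>poly (Q n) v - S v\<bar> \<le> inverse (real (Suc n))"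
      "\<And>n v. v \<in> {s\<^sup>2..t\<^sup>2} \<Longrightarrow> \<bar>poly (pderiv (Q n)) v - S' v\<bar> \<le> inverse (real (Suc n))"
    by metis
  have r2: "\<rho>\<^sup>2 \<in> {s\<^sup>2..t\<^sup>2}" if "\<rho> \<in> {s..t}" for \<rho>
    using that s0 by (auto intro!: power_mono)
  have c2: "continuous_on {s..t} (\<lambda>\<rho>. k (\<rho>\<^sup>2))" if "continuous_on {s\<^sup>2..t\<^sup>2} k" for k :: "real \<Rightarrow> real"
    by (rule continuous_on_compose2[OF that]) (use r2 in \<open>auto intro!: continuous_intros\<close>)
  have L: "(\<lambda>n. LINT x:shell s t|lebesgue. poly (Q n) ((norm x)\<^sup>2) * f x) \<longlonglongrightarrow> (LINT x:shell s t|lebesgue. S ((norm x)\<^sup>2) * f x)"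
    by (rule set_integral_tendsto_if_close[OF f, where g = "\<lambda>n \<rho>. poly (Q n) (\<rho>\<^sup>2)" and G = "\<lambda>\<rho>. S (\<rho>\<^sup>2)"])
      (intro continuous_intros, rule c2[OF cS], use Q(1)[OF r2] in simp)
  have pt: "(\<lambda>n. poly (Q n) v) \<longlonglongrightarrow> S v" if v: "v \<in> {s\<^sup>2..t\<^sup>2}" for v
    using Lim_null_comparison[OF _ LIMSEQ_inverse_real_of_nat, of "\<lambda>n. poly (Q n) v - S v"] Q(1)[OF v]
    by (simp add: LIM_zero_iff)
  define g where "g n \<rho> = 2 * poly (pderiv (Q n)) (\<rho>\<^sup>2) * \<rho>\<^sup>2 * (\<rho>\<^sup>2 * H \<rho>) + poly (Q n) (\<rho>\<^sup>2) * \<rho> * (3 * \<rho> * H \<rho>)" for n \<rho>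
  define G where "G \<rho> = 2 * S' (\<rho>\<^sup>2) * \<rho>\<^sup>2 * (\<rho>\<^sup>2 * H \<rho>) + S (\<rho>\<^sup>2) * \<rho> * (3 * \<rho> * H \<rho>)" for \<rho>
  have I: "(\<lambda>n. integral {s..t} (g n)) \<longlonglongrightarrow> integral {s..t} G"
  proof (rule integral_tendsto_if_close[where w = "\<lambda>\<rho>. \<bar>2 * \<rho>\<^sup>2 * (\<rho>\<^sup>2 * H \<rho>)\<bar> + \<bar>\<rho> * (3 * \<rho> * H \<rho>)\<bar>"])
    fix n \<rho> assume \<rho>: "\<rho> \<in> {s..t}"
    let ?u = "poly (pderiv (Q n)) (\<rho>\<^sup>2) - S' (\<rho>\<^sup>2)" and ?v = "poly (Q n) (\<rho>\<^sup>2) - S (\<rho>\<^sup>2)"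
    have "g n \<rho> - G \<rho> = ?u * (2 * \<rho>\<^sup>2 * (\<rho>\<^sup>2 * H \<rho>)) + ?v * (\<rho> * (3 * \<rho> * H \<rho>))"
      by (simp add: g_def G_def algebra_simps)
    also have "\<bar>\<dots>\<bar> \<le> \<bar>?u\<bar> * \<bar>2 * \<rho>\<^sup>2 * (\<rho>\<^sup>2 * H \<rho>)\<bar> + \<bar>?v\<bar> * \<bar>\<rho> * (3 * \<rho> * H \<rho>)\<bar>"
      by (rule order_trans[OF abs_triangle_ineq]) (simp add: abs_mult)
    also have "\<dots> \<le> inverse (real (Suc n)) * \<bar>2 * \<rho>\<^sup>2 * (\<rho>\<^sup>2 * H \<rho>)\<bar> + inverse (real (Suc n)) * \<bar>\<rho> * (3 * \<rho> * H \<rho>)\<bar>"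
      by (intro add_mono mult_right_mono Q r2 \<rho>) auto
    finally show "\<bar>g n \<rho> - G \<rho>\<bar> \<le> inverse (real (Suc n)) * (\<bar>2 * \<rho>\<^sup>2 * (\<rho>\<^sup>2 * H \<rho>)\<bar> + \<bar>\<rho> * (3 * \<rho> * H \<rho>)\<bar>)"
      by (simp only: distrib_left)
  qed (unfold g_def G_def, (intro continuous_intros cH c2[OF cS] c2[OF cS'])+)
  have "(\<lambda>n. 2 * pi * (t * (t\<^sup>2 * H t) * poly (Q n) (t\<^sup>2) - s * (s\<^sup>2 * H s) * poly (Q n) (s\<^sup>2) - integral {s..t} (g n)))
     \<longlonglongrightarrow> 2 * pi * (t * (t\<^sup>2 * H t) * S (t\<^sup>2) - s * (s\<^sup>2 * H s) * S (s\<^sup>2) - integral {s..t} G)"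
    by (intro tendsto_intros I pt) (use st2 in auto)
  then have main: "(LINT x:shell s t|lebesgue. S ((norm x)\<^sup>2) * f x) =
      2 * pi * (t * (t\<^sup>2 * H t) * S (t\<^sup>2) - s * (s\<^sup>2 * H s) * S (s\<^sup>2) - integral {s..t} G)"
    using LIMSEQ_unique[OF L] unfolding poly g_def by blast
  have eqf: "S ((norm x)\<^sup>2) * f x = P (norm x) / norm x * radial_part g1 g2 x" if "x \<in> shell s t" for x
    using that s0 by (auto simp: S_def f_def shell_def power2_eq_square power3_eq_cube)
  have "set_integrable lebesgue (shell s t) (\<lambda>x. S ((norm x)\<^sup>2) * f x)"
    by (rule set_integrable_radial_times[OF f shell_subset, where G = "\<lambda>\<rho>. S (\<rho>\<^sup>2)"]) (rule c2[OF cS])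
  moreover have "(\<lambda>x. indicator (shell s t) x *\<^sub>R (S ((norm x)\<^sup>2) * f x)) =
      (\<lambda>x. indicator (shell s t) x *\<^sub>R (P (norm x) / norm x * radial_part g1 g2 x))"
    using eqf by (auto simp: indicator_def fun_eq_iff)
  ultimately show "set_integrable lebesgue (shell s t) (\<lambda>x. P (norm x) / norm x * radial_part g1 g2 x)"
    unfolding set_integrable_def by simp
  have "(LINT x:shell s t|lebesgue. P (norm x) / norm x * radial_part g1 g2 x) = (LINT x:shell s t|lebesgue. S ((norm x)\<^sup>2) * f x)"
    using eqf by (intro set_lebesgue_integral_cong) auto
  also note main
  also have "t * (t\<^sup>2 * H t) * S (t\<^sup>2) = P t * H t" using s0 rs by (simp add: S_def power2_eq_square power3_eq_cube)
  also have "s * (s\<^sup>2 * H s) * S (s\<^sup>2) = P s * H s" using s0 by (simp add: S_def power2_eq_square power3_eq_cube)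
  also have "integral {s..t} G = integral {s..t} (\<lambda>\<rho>. P' \<rho> * H \<rho>)"
  proof (rule Henstock_Kurzweil_Integration.integral_cong)
    fix \<rho> assume "\<rho> \<in> {s..t}"
    then have "\<rho> > 0" using s0 by simp
    then show "G \<rho> = P' \<rho> * H \<rho>"
      by (simp add: G_def S_def S'_def field_simps power2_eq_square power3_eq_cube)
  qed
  finally show "(LINT x:shell s t|lebesgue. P (norm x) / norm x * radial_part g1 g2 x) =
      2 * pi * (P t * H t - P s * H s - integral {s..t} (\<lambda>\<rho>. P' \<rho> * H \<rho>))" .
qed

lemma tangential_integral:
  assumes b: "continuous_on {s..t} b"
  shows "set_integrable lebesgue (shell s t) (\<lambda>x. b (norm x) * tangential_part g1 g2 x)"
    "(LINT x:shell s t|lebesgue. b (norm x) * tangential_part g1 g2 x) =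
      2 * pi * integral {s..t} (\<lambda>\<rho>. b \<rho> * H \<rho>)"
proof -
  define T where "T = (t + R) / 2"
  have T: "t < T" "T < R" "s < T" using rs by (auto simp: T_def)
  define f where "f x = (norm x)\<^sup>2 * tangential_part g1 g2 x" for x
  have fT: "set_integrable lebesgue (closed_shell s T) f"
    unfolding f_def[abs_def] using T by (intro set_integrable_parts) auto
  have f: "set_integrable lebesgue (shell s t) f"
    by (rule set_integrable_subset[OF fT]) (use T in \<open>auto simp: shell_def closed_shell_def\<close>)
  have cHT: "continuous_on {s..T} H" using H by (rule continuous_on_subset) (use rs T in auto)
  note cH = continuous_on_profile_shell
  have s0: "0 < s" using rs by simp
  have st2: "s\<^sup>2 \<le> t\<^sup>2" using rs by (simp add: power_mono)
  have poly: "(LINT x:shell s t|lebesgue. poly Q ((norm x)\<^sup>2) * f x) =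
    2 * pi * integral {s..t} (\<lambda>\<rho>. poly Q (\<rho>\<^sup>2) * \<rho> * (\<rho> * H \<rho>))" for Q
  proof -
    have "(LINT x:shell s t|lebesgue. poly Q ((norm x)\<^sup>2) * f x) =
      2 * pi * (t * 0 * poly Q (t\<^sup>2) - s * 0 * poly Q (s\<^sup>2) -
      integral {s..t} (\<lambda>\<rho>. 2 * poly (pderiv Q) (\<rho>\<^sup>2) * \<rho>\<^sup>2 * 0 + poly Q (\<rho>\<^sup>2) * \<rho> * (- \<rho> * H \<rho>)))"
    proof (rule radial_divergence_polynomial[OF s0 rs(3) T(1) fT])
      show "(LINT x:closed_shell s T|lebesgue. \<eta> ((norm x)\<^sup>2) * f x) =
        - 2 * pi * integral {s..T} (\<lambda>\<rho>. 2 * \<eta>' (\<rho>\<^sup>2) * \<rho>\<^sup>2 * 0 + \<eta> (\<rho>\<^sup>2) * \<rho> * (- \<rho> * H \<rho>))"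
        if "\<And>k. Ck k \<eta>" "\<And>v. (\<eta> has_real_derivative \<eta>' v) (at v)" "continuous_on UNIV \<eta>'"
          "\<And>v. v \<notin> {s\<^sup>2..T\<^sup>2} \<Longrightarrow> \<eta> v = 0" for \<eta> \<eta>'
        unfolding f_def by (rule tangential_part_weak[OF rs(1,2) T(3,2) h g1 g2 H]) (use that in auto)
    qed (intro continuous_intros cHT)+
    then show ?thesis by simp
  qed
  define S where "S v = b (sqrt v) / v" for v
  have sq: "sqrt v \<in> {s..t}" "0 < v" if v: "v \<in> {s\<^sup>2..t\<^sup>2}" for v
  proof -
    show "sqrt v \<in> {s..t}" using v rs real_le_rsqrt[of s v] real_le_lsqrt[of t v] by auto
    have "0 < s\<^sup>2" using s0 by simp
    then show "0 < v" using v by (meson atLeastAtMost_iff less_le_trans)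
  qed
  have "continuous_on {s\<^sup>2..t\<^sup>2} (\<lambda>v. b (sqrt v))"
    by (rule continuous_on_compose2[OF b]) (use sq in \<open>auto intro!: continuous_intros\<close>)
  then have cS: "continuous_on {s\<^sup>2..t\<^sup>2} S"
    unfolding S_def[abs_def] using sq(2) by (intro continuous_intros) force+
  have "\<forall>n. \<exists>Q :: real poly. \<forall>v\<in>{s\<^sup>2..t\<^sup>2}. \<bar>poly Q v - S v\<bar> \<le> inverse (real (Suc n))"
  proof
    fix n
    have "inverse (real (Suc n)) > 0" by simp
    from polynomial_approximation[OF cS this]
    show "\<exists>Q :: real poly. \<forall>v\<in>{s\<^sup>2..t\<^sup>2}. \<bar>poly Q v - S v\<bar> \<le> inverse (real (Suc n))"
      by metis
  qed
  then obtain Q :: "nat \<Rightarrow> real poly" where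
    Q: "\<And>n v. v \<in> {s\<^sup>2..t\<^sup>2} \<Longrightarrow> \<bar>poly (Q n) v - S v\<bar> \<le> inverse (real (Suc n))"
    by metis
  have r2: "\<rho>\<^sup>2 \<in> {s\<^sup>2..t\<^sup>2}" if "\<rho> \<in> {s..t}" for \<rho>
    using that s0 by (auto intro!: power_mono)
  have c2: "continuous_on {s..t} (\<lambda>\<rho>. k (\<rho>\<^sup>2))" if "continuous_on {s\<^sup>2..t\<^sup>2} k" for k :: "real \<Rightarrow> real"
    by (rule continuous_on_compose2[OF that]) (use r2 in \<open>auto intro!: continuous_intros\<close>)
  have L: "(\<lambda>n. LINT x:shell s t|lebesgue. poly (Q n) ((norm x)\<^sup>2) * f x) \<longlonglongrightarrow> (LINT x:shell s t|lebesgue. S ((norm x)\<^sup>2) * f x)"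
    by (rule set_integral_tendsto_if_close[OF f, where g = "\<lambda>n \<rho>. poly (Q n) (\<rho>\<^sup>2)" and G = "\<lambda>\<rho>. S (\<rho>\<^sup>2)"])
      (intro continuous_intros, rule c2[OF cS], use Q(1)[OF r2] in simp)
  have I: "(\<lambda>n. integral {s..t} (\<lambda>\<rho>. poly (Q n) (\<rho>\<^sup>2) * \<rho> * (\<rho> * H \<rho>))) \<longlonglongrightarrow> integral {s..t} (\<lambda>\<rho>. S (\<rho>\<^sup>2) * \<rho> * (\<rho> * H \<rho>))"
  proof (rule integral_tendsto_if_close[where w = "\<lambda>\<rho>. \<bar>\<rho> * (\<rho> * H \<rho>)\<bar>"])
    fix n \<rho> assume \<rho>: "\<rho> \<in> {s..t}"
    have "poly (Q n) (\<rho>\<^sup>2) * \<rho> * (\<rho> * H \<rho>) - S (\<rho>\<^sup>2) * \<rho> * (\<rho> * H \<rho>) = (poly (Q n) (\<rho>\<^sup>2) - S (\<rho>\<^sup>2)) * (\<rho> * (\<rho> * H \<rho>))"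
      by (simp add: algebra_simps)
    also have "\<bar>\<dots>\<bar> \<le> inverse (real (Suc n)) * \<bar>\<rho> * (\<rho> * H \<rho>)\<bar>"
      unfolding abs_mult[of "poly (Q n) (\<rho>\<^sup>2) - S (\<rho>\<^sup>2)"] by (intro mult_right_mono Q r2 \<rho>) auto
    finally show "\<bar>poly (Q n) (\<rho>\<^sup>2) * \<rho> * (\<rho> * H \<rho>) - S (\<rho>\<^sup>2) * \<rho> * (\<rho> * H \<rho>)\<bar> \<le> inverse (real (Suc n)) * \<bar>\<rho> * (\<rho> * H \<rho>)\<bar>" .
  qed (intro continuous_intros cH c2[OF cS])+
  have main: "(LINT x:shell s t|lebesgue. S ((norm x)\<^sup>2) * f x) = 2 * pi * integral {s..t} (\<lambda>\<rho>. S (\<rho>\<^sup>2) * \<rho> * (\<rho> * H \<rho>))"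
    using LIMSEQ_unique[OF L] tendsto_mult[OF tendsto_const I, of "2 * pi"] unfolding poly by blast
  have eqf: "S ((norm x)\<^sup>2) * f x = b (norm x) * tangential_part g1 g2 x" if "x \<in> shell s t" for x
    using that s0 by (auto simp: S_def f_def shell_def)
  have "set_integrable lebesgue (shell s t) (\<lambda>x. S ((norm x)\<^sup>2) * f x)"
    by (rule set_integrable_radial_times[OF f shell_subset, where G = "\<lambda>\<rho>. S (\<rho>\<^sup>2)"]) (rule c2[OF cS])
  moreover have "(\<lambda>x. indicator (shell s t) x *\<^sub>R (S ((norm x)\<^sup>2) * f x)) =
      (\<lambda>x. indicator (shell s t) x *\<^sub>R (b (norm x) * tangential_part g1 g2 x))"
    using eqf by (auto simp: indicator_def fun_eq_iff)
  ultimately show "set_integrable lebesgue (shell s t) (\<lambda>x. b (norm x) * tangential_part g1 g2 x)"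
    unfolding set_integrable_def by simp
  have "(LINT x:shell s t|lebesgue. b (norm x) * tangential_part g1 g2 x) = (LINT x:shell s t|lebesgue. S ((norm x)\<^sup>2) * f x)"
    using eqf by (intro set_lebesgue_integral_cong) auto
  also note main
  also have "integral {s..t} (\<lambda>\<rho>. S (\<rho>\<^sup>2) * \<rho> * (\<rho> * H \<rho>)) = integral {s..t} (\<lambda>\<rho>. b \<rho> * H \<rho>)"
  proof (rule Henstock_Kurzweil_Integration.integral_cong)
    fix \<rho> assume "\<rho> \<in> {s..t}"
    then have "\<rho> > 0" using s0 by simp
    then show "S (\<rho>\<^sup>2) * \<rho> * (\<rho> * H \<rho>) = b \<rho> * H \<rho>"
      by (simp add: S_def power2_eq_square)
  qed
  finally show "(LINT x:shell s t|lebesgue. b (norm x) * tangential_part g1 g2 x) = 2 * pi * integral {s..t} (\<lambda>\<rho>. b \<rho> * H \<rho>)" .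
qed

end

section \<open>Radial gradients\<close>

text \<open>The directional derivative of the radial mapping with profile \<open>H\<close> in the direction \<open>v\<close>.\<close>

definition radial_gradient :: "(real \<Rightarrow> real) \<Rightarrow> (real \<Rightarrow> real) \<Rightarrow> complex \<Rightarrow> complex \<Rightarrow> complex" where
  "radial_gradient H H' v x =
     ((H' (norm x) - H (norm x) / norm x) * (x \<bullet> v) / (norm x)\<^sup>2) *\<^sub>R x + (H (norm x) / norm x) *\<^sub>R v"

definition gradient_norm :: "(real \<Rightarrow> real) \<Rightarrow> (real \<Rightarrow> real) \<Rightarrow> real \<Rightarrow> real" where
  "gradient_norm H H' \<rho> = sqrt ((H' \<rho>)\<^sup>2 + (H \<rho> / \<rho>)\<^sup>2)"

lemma radial_gradient_inner:
  assumes "x \<noteq> 0"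
  shows "(radial_gradient H H' 1 x, radial_gradient H H' \<i> x) \<bullet> (g1 x, g2 x) =
    H' (norm x) * radial_part g1 g2 x + H (norm x) / norm x * tangential_part g1 g2 x"
proof -
  define k where "k = H (norm x) / norm x"
  have "(radial_gradient H H' 1 x, radial_gradient H H' \<i> x) \<bullet> (g1 x, g2 x) =
    (H' (norm x) - k) * (Re x * (g1 x \<bullet> x) + Im x * (g2 x \<bullet> x)) / (norm x)\<^sup>2 + k * (Re (g1 x) + Im (g2 x))"
    by (simp add: radial_gradient_def k_def[symmetric] inner_add_left inner_complex_def add_divide_distrib diff_divide_distrib algebra_simps)
  also have "\<dots> = (H' (norm x) - k) * radial_part g1 g2 x + k * (Re (g1 x) + Im (g2 x))"
    by (simp add: radial_part_def)
  finally show ?thesis by (simp add: tangential_part_def k_def algebra_simps)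
qed

lemma radial_gradient_parts:
  assumes "x \<noteq> 0"
  shows "radial_part (radial_gradient H H' 1) (radial_gradient H H' \<i>) x = H' (norm x)"
    "tangential_part (radial_gradient H H' 1) (radial_gradient H H' \<i>) x = H (norm x) / norm x"
proof -
  define k where "k = H (norm x) / norm x"
  define l where "l = H' (norm x)"
  have n: "(Re x)\<^sup>2 + (Im x)\<^sup>2 = (norm x)\<^sup>2" by (simp add: cmod_power2)
  have n0: "(norm x)\<^sup>2 \<noteq> 0" using assms by simp
  have a: "radial_gradient H H' 1 x \<bullet> x = l * Re x" "radial_gradient H H' \<i> x \<bullet> x = l * Im x"
    using n0 by (simp_all add: radial_gradient_def k_def[symmetric] l_def[symmetric] inner_add_left
        power2_norm_eq_inner[symmetric] left_diff_distrib diff_divide_distrib)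
  have "radial_part (radial_gradient H H' 1) (radial_gradient H H' \<i>) x = l * ((Re x)\<^sup>2 + (Im x)\<^sup>2) / (norm x)\<^sup>2"
    by (simp add: radial_part_def a power2_eq_square algebra_simps)
  then show r: "radial_part (radial_gradient H H' 1) (radial_gradient H H' \<i>) x = H' (norm x)"
    using n0 n by (simp add: l_def)
  have "Re (radial_gradient H H' 1 x) + Im (radial_gradient H H' \<i> x) = (l - k) * ((Re x)\<^sup>2 + (Im x)\<^sup>2) / (norm x)\<^sup>2 + 2 * k"
    by (simp add: radial_gradient_def k_def[symmetric] l_def[symmetric] power2_eq_square add_divide_distrib diff_divide_distrib algebra_simps)
  then show "tangential_part (radial_gradient H H' 1) (radial_gradient H H' \<i>) x = H (norm x) / norm x"
    using n0 n by (simp add: tangential_part_def r k_def l_def)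
qed

lemma norm_radial_gradient:
  assumes "x \<noteq> 0"
  shows "norm (radial_gradient H H' 1 x, radial_gradient H H' \<i> x) = gradient_norm H H' (norm x)"
  unfolding norm_eq_sqrt_inner radial_gradient_inner[OF assms] radial_gradient_parts[OF assms] gradient_norm_def
  by (simp add: power2_eq_square)

locale C1_profile =
  fixes r R :: real and H H' :: "real \<Rightarrow> real"
  assumes rR: "0 \<le> r" "r < R"
    and H_deriv: "\<And>\<rho>. r < \<rho> \<Longrightarrow> \<rho> < R \<Longrightarrow> (H has_real_derivative H' \<rho>) (at \<rho>)"
    and H'_cont: "continuous_on {r<..<R} H'"
begin

lemma H_cont: "continuous_on {r<..<R} H"
  using H_deriv by (auto intro!: continuous_at_imp_continuous_on DERIV_isCont)

lemma annulus_pos: "x \<in> annulus r R \<Longrightarrow> norm x > 0"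
  using rR by (auto simp: annulus_def)

lemma continuous_on_annulus_norm:
  fixes k :: "real \<Rightarrow> 'b::topological_space"
  shows "continuous_on {r<..<R} k \<Longrightarrow> continuous_on (annulus r R) (\<lambda>x. k (norm x))"
  by (rule continuous_on_compose2[where t = "{r<..<R}"]) (auto simp: annulus_def intro!: continuous_intros)

lemma continuous_on_radial_gradient: "continuous_on (annulus r R) (radial_gradient H H' v)"
  unfolding radial_gradient_def[abs_def]
  by (intro continuous_intros continuous_on_annulus_norm H_cont H'_cont) (use annulus_pos in force)+

lemma radial_has_derivative:
  assumes h: "radial_on (annulus r R) H h" and x: "x \<in> annulus r R"
  shows "(h has_derivative (\<lambda>v. radial_gradient H H' v x)) (at x)"
proof -
  have pos: "norm x > 0" "x \<noteq> 0" using annulus_pos[OF x] by auto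
  have rx: "r < norm x" "norm x < R" using x by (auto simp: annulus_def)
  have dn: "(norm has_derivative (\<lambda>v. v \<bullet> sgn x)) (at x)"
    using has_derivative_norm[OF pos(2)] .
  have "((\<lambda>\<rho>. H \<rho> / \<rho>) has_real_derivative (H' (norm x) * norm x - H (norm x) * 1) / (norm x * norm x)) (at (norm x))"
    by (rule DERIV_divide[OF H_deriv[OF rx] DERIV_ident]) (use pos in simp)
  from DERIV_compose_FDERIV[OF this dn]
  have "((\<lambda>y. H (norm y) / norm y) has_derivative
      (\<lambda>v. v \<bullet> sgn x * ((H' (norm x) * norm x - H (norm x) * 1) / (norm x * norm x)))) (at x)" .
  from has_derivative_scaleR[OF this has_derivative_ident]
  have "((\<lambda>y. (H (norm y) / norm y) *\<^sub>R y) has_derivative (\<lambda>v. (H (norm x) / norm x) *\<^sub>R v +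
      (v \<bullet> sgn x * ((H' (norm x) * norm x - H (norm x) * 1) / (norm x * norm x))) *\<^sub>R x)) (at x)" .
  moreover have "v \<bullet> sgn x * ((H' (norm x) * norm x - H (norm x) * 1) / (norm x * norm x)) =
      (H' (norm x) - H (norm x) / norm x) * (x \<bullet> v) / (norm x)\<^sup>2" for v
    using pos by (simp add: sgn_div_norm inner_commute field_simps power2_eq_square)
  ultimately have "((\<lambda>y. (H (norm y) / norm y) *\<^sub>R y) has_derivative (\<lambda>v. radial_gradient H H' v x)) (at x)"
    by (simp add: radial_gradient_def[abs_def] add.commute)
  then show ?thesis
    by (rule has_derivative_transform_within_open[OF _ open_annulus x])
      (use h in \<open>auto simp: radial_on_def divide_inverse\<close>)
qed

lemma radial_has_weak_partial:
  assumes h: "radial_on (annulus r R) H h"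
  shows "has_weak_partial (annulus r R) h b (radial_gradient H H' b)"
  using has_weak_partial_C1[OF open_annulus radial_has_derivative[OF h] continuous_on_radial_gradient]
  by simp

lemma gradient_norm_cont: "continuous_on {r<..<R} (gradient_norm H H')"
  unfolding gradient_norm_def[abs_def] using rR
  by (intro continuous_intros H_cont H'_cont) auto

end

section \<open>The tangent plane inequality\<close>

lemma powr_tangent:
  fixes x p :: real
  assumes "0 \<le> x" "1 \<le> p"
  shows "1 + p * (x - 1) \<le> x powr p"
proof -
  have d: "((\<lambda>y. y powr p) has_real_derivative p * y powr (p - 1)) (at y)" if "y > 0" for y
    using that by (auto intro!: derivative_eq_intros)
  consider "x = 0" | "x = 1" | "0 < x" "x < 1" | "1 < x" using assms by linarith
  then show ?thesis
  proof cases
    case 3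
    obtain z where z: "x < z" "z < 1" "1 powr p - x powr p = (1 - x) * (p * z powr (p - 1))"
      using MVT2[OF 3(2), of "\<lambda>y. y powr p" "\<lambda>y. p * y powr (p - 1)"] d 3 by force
    have "z powr (p - 1) \<le> 1" using z 3 assms powr_mono2[of "p - 1" z 1] by simp
    then have "(1 - x) * (p * z powr (p - 1)) \<le> (1 - x) * (p * 1)"
      using 3 assms by (intro mult_left_mono) auto
    then show ?thesis using z by (simp add: algebra_simps)
  next
    case 4
    obtain z where z: "1 < z" "z < x" "x powr p - 1 powr p = (x - 1) * (p * z powr (p - 1))"
      using MVT2[OF 4, of "\<lambda>y. y powr p" "\<lambda>y. p * y powr (p - 1)"] d by force
    have "1 \<le> z powr (p - 1)" using z assms powr_mono2[of "p - 1" 1 z] by simp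
    then have "(x - 1) * (p * 1) \<le> (x - 1) * (p * z powr (p - 1))"
      using 4 assms by (intro mult_left_mono) auto
    then show ?thesis using z by (simp add: algebra_simps)
  qed (use assms in auto)
qed

text \<open>The excess \<open>e\<close> of \<open>norm M powr p\<close> over its tangent plane at \<open>M0\<close> is the sum of the excess of \<open>t powr p\<close> over
  its tangent at \<open>1\<close>, for \<open>t = norm M / norm M0\<close>, and of the defect in the Cauchy-Schwarz inequality. For \<open>e = 0\<close>
  the second term shows that \<open>M\<close> and \<open>M0\<close> are parallel, also for \<open>p = 1\<close>, where the first term is always \<open>0\<close>.\<close>

lemma norm_powr_tangent:
  fixes M M0 :: "'a::real_inner"
  assumes M0: "M0 \<noteq> 0" and p: "1 \<le> p"
  defines "e \<equiv> norm M powr p - norm M0 powr p - p * (norm M0 powr (p - 2) * (M0 \<bullet> M - M0 \<bullet> M0))"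
  shows "0 \<le> e" "e = 0 \<Longrightarrow> norm M0 *\<^sub>R M = norm M *\<^sub>R M0"
proof -
  define m where "m = norm M" define m0 where "m0 = norm M0"
  have m: "m \<ge> 0" and m0: "m0 > 0" using M0 by (auto simp: m_def m0_def)
  have split: "m0 powr p = m0 powr (p - 2) * m0\<^sup>2"
    using m0 powr_add[of m0 "p - 2" 2] by (simp add: powr_numeral)
  define c where "c = p * m0 powr (p - 2)"
  have c: "c > 0" using p m0 by (simp add: c_def)
  have "m0 powr p * (m / m0) powr p = m powr p"
    using m m0 by (simp add: powr_divide)
  then have e: "e = m0 powr p * ((m / m0) powr p - (1 + p * (m / m0 - 1))) + c * (m0 * m - M0 \<bullet> M)"
    using m0 unfolding e_def c_def m_def[symmetric] m0_def[symmetric] power2_norm_eq_inner[symmetric]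
    by (simp add: right_diff_distrib[of "m0 powr p"]) (simp add: split power2_eq_square field_simps)
  have a: "0 \<le> m0 powr p * ((m / m0) powr p - (1 + p * (m / m0 - 1)))"
    using powr_tangent[of "m / m0" p] m m0 p by (intro mult_nonneg_nonneg) auto
  have b: "0 \<le> c * (m0 * m - M0 \<bullet> M)"
    using norm_cauchy_schwarz[of M0 M] c by (intro mult_nonneg_nonneg) (auto simp: m_def m0_def)
  show "0 \<le> e" using a b e by simp
  show "norm M0 *\<^sub>R M = norm M *\<^sub>R M0" if "e = 0"
  proof -
    have "c * (m0 * m - M0 \<bullet> M) = 0" using that a b e by linarith
    then have "M0 \<bullet> M = norm M0 * norm M" using c by (simp add: m_def m0_def)
    then show ?thesis by (simp add: norm_cauchy_schwarz_eq)
  qed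
qed

section \<open>The energy gap above an extremal profile\<close>

text \<open>The profile \<open>H0\<close> is constant on \<open>(r, a]\<close> and solves the Euler-Lagrange equation on \<open>[a, R)\<close>; there is no plateau if
  \<open>a = r\<close>. The equation is one-sided at \<open>a\<close>, where the derivative of the flux jumps.\<close>

locale radial_extremal = C1_profile r R H0 H0' for r R H0 H0' +
  fixes p a rs :: real
  assumes p: "1 \<le> p"
    and H0_pos: "\<And>\<rho>. r < \<rho> \<Longrightarrow> \<rho> < R \<Longrightarrow> 0 < H0 \<rho>"
    and a: "r \<le> a" "a < R"
    and plateau: "\<And>\<rho>. r < \<rho> \<Longrightarrow> \<rho> \<le> a \<Longrightarrow> H0' \<rho> = 0 \<and> H0 \<rho> = rs"
    and euler_lagrange: "\<And>\<rho>. r < \<rho> \<Longrightarrow> a \<le> \<rho> \<Longrightarrow> \<rho> < R \<Longrightarrow>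
      ((\<lambda>\<rho>. gradient_norm H0 H0' \<rho> powr (p - 2) * H0' \<rho> * \<rho>) has_real_derivative
        gradient_norm H0 H0' \<rho> powr (p - 2) * H0 \<rho> / \<rho>) (at \<rho> within {a..})"
begin

definition flux :: "real \<Rightarrow> real" where
  "flux \<rho> = gradient_norm H0 H0' \<rho> powr (p - 2) * H0' \<rho> * \<rho>"

definition hoop :: "real \<Rightarrow> real" where
  "hoop \<rho> = gradient_norm H0 H0' \<rho> powr (p - 2) * H0 \<rho> / \<rho>"

abbreviation M0 :: "complex \<Rightarrow> complex \<times> complex" where
  "M0 x \<equiv> (radial_gradient H0 H0' 1 x, radial_gradient H0 H0' \<i> x)"

lemma gradient_norm_pos: "r < \<rho> \<Longrightarrow> \<rho> < R \<Longrightarrow> 0 < gradient_norm H0 H0' \<rho>"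
  using H0_pos[of \<rho>] rR unfolding gradient_norm_def
  by (intro real_sqrt_gt_zero add_nonneg_pos) auto

lemma hoop_cont: "continuous_on {r<..<R} hoop"
  unfolding hoop_def[abs_def] using gradient_norm_pos rR
  by (intro continuous_intros gradient_norm_cont H_cont) (auto simp: less_imp_neq[symmetric])

lemma hoop_nonneg: "r < \<rho> \<Longrightarrow> \<rho> < R \<Longrightarrow> 0 \<le> hoop \<rho>"
  using H0_pos[of \<rho>] rR by (simp add: hoop_def)

lemma flux_deriv: "r < \<rho> \<Longrightarrow> a \<le> \<rho> \<Longrightarrow> \<rho> < R \<Longrightarrow> (flux has_real_derivative hoop \<rho>) (at \<rho> within {a..})"
  using euler_lagrange unfolding flux_def[abs_def] hoop_def .

lemma flux_plateau: "r < \<rho> \<Longrightarrow> \<rho> \<le> a \<Longrightarrow> flux \<rho> = 0"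
  using plateau by (simp add: flux_def)

context
  fixes H :: "real \<Rightarrow> real" and h g1 g2 :: "complex \<Rightarrow> complex"
  assumes h: "radial_on (annulus r R) H h"
    and g1: "has_weak_partial (annulus r R) h 1 g1" and g2: "has_weak_partial (annulus r R) h \<i> g2"
    and H: "continuous_on {r<..<R} H"
begin

text \<open>The linear term of the tangent plane, split into the two entries of the differential: up to
  the factor \<open>2 \<pi>\<close> its integral becomes that of \<open>flux * H' + hoop * H\<close>, which is the derivative of \<open>flux * H\<close>
  outside the plateau.\<close>

lemma M0_inner:
  assumes "x \<in> annulus r R"
  shows "gradient_norm H0 H0' (norm x) powr (p - 2) * (M0 x \<bullet> (g1 x, g2 x)) =
    flux (norm x) / norm x * radial_part g1 g2 x + hoop (norm x) * tangential_part g1 g2 x"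
proof -
  have "x \<noteq> 0" "norm x \<noteq> 0" using annulus_pos[OF assms] by auto
  then show ?thesis
    by (subst radial_gradient_inner) (simp_all add: flux_def hoop_def distrib_left)
qed

lemma pairing_integral:
  assumes s: "r < s" "a \<le> s" "s \<le> t" "t < R"
  shows "set_integrable lebesgue (shell s t) (\<lambda>x. gradient_norm H0 H0' (norm x) powr (p - 2) * (M0 x \<bullet> (g1 x, g2 x)))"
    "(LINT x:shell s t|lebesgue. gradient_norm H0 H0' (norm x) powr (p - 2) * (M0 x \<bullet> (g1 x, g2 x))) =
      2 * pi * (flux t * H t - flux s * H s)"
proof -
  have sub: "shell s t \<subseteq> annulus r R" using s by (auto simp: shell_def annulus_def)
  have d: "(flux has_real_derivative hoop \<rho>) (at \<rho> within {s..t})" if "\<rho> \<in> {s..t}" for \<rho>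
    by (rule has_field_derivative_subset[OF flux_deriv]) (use that s in auto)
  have hc: "continuous_on {s..t} hoop" by (rule continuous_on_subset[OF hoop_cont]) (use s in auto)
  note A = radial_integration_by_parts[OF rR(1) s(1,3,4) h g1 g2 H d hc]
  note B = tangential_integral[OF rR(1) s(1,3,4) h g1 g2 H hc]
  have eq: "indicator (shell s t) x *\<^sub>R (gradient_norm H0 H0' (norm x) powr (p - 2) * (M0 x \<bullet> (g1 x, g2 x))) =
     indicator (shell s t) x *\<^sub>R (flux (norm x) / norm x * radial_part g1 g2 x + hoop (norm x) * tangential_part g1 g2 x)" for x
    using M0_inner[of x] sub by (cases "x \<in> shell s t") (auto simp: indicator_def)
  show "set_integrable lebesgue (shell s t) (\<lambda>x. gradient_norm H0 H0' (norm x) powr (p - 2) * (M0 x \<bullet> (g1 x, g2 x)))"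
    unfolding set_integrable_def eq using set_integral_add(1)[OF A(1) B(1)] unfolding set_integrable_def .
  show "(LINT x:shell s t|lebesgue. gradient_norm H0 H0' (norm x) powr (p - 2) * (M0 x \<bullet> (g1 x, g2 x))) =
      2 * pi * (flux t * H t - flux s * H s)"
    unfolding set_lebesgue_integral_def eq using set_integral_add(2)[OF A(1) B(1)] A(2) B(2)
    unfolding set_lebesgue_integral_def by (simp add: algebra_simps)
qed

lemma pairing_integral_plateau:
  assumes s: "r < s" "s \<le> t" "t \<le> a"
  shows "set_integrable lebesgue (shell s t) (\<lambda>x. gradient_norm H0 H0' (norm x) powr (p - 2) * (M0 x \<bullet> (g1 x, g2 x)))"
    "(LINT x:shell s t|lebesgue. gradient_norm H0 H0' (norm x) powr (p - 2) * (M0 x \<bullet> (g1 x, g2 x))) =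
      2 * pi * integral {s..t} (\<lambda>\<rho>. hoop \<rho> * H \<rho>)"
proof -
  have t: "t < R" using s a by simp
  have sub: "shell s t \<subseteq> annulus r R" using s t by (auto simp: shell_def annulus_def)
  have hc: "continuous_on {s..t} hoop" by (rule continuous_on_subset[OF hoop_cont]) (use s t in auto)
  note B = tangential_integral[OF rR(1) s(1,2) t h g1 g2 H hc]
  have eq: "indicator (shell s t) x *\<^sub>R (gradient_norm H0 H0' (norm x) powr (p - 2) * (M0 x \<bullet> (g1 x, g2 x))) =
     indicator (shell s t) x *\<^sub>R (hoop (norm x) * tangential_part g1 g2 x)" for x
  proof (cases "x \<in> shell s t")
    case True
    then have "flux (norm x) = 0" using s by (intro flux_plateau) (auto simp: shell_def)
    then show ?thesis using M0_inner[of x] sub True by auto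
  qed simp
  show "set_integrable lebesgue (shell s t) (\<lambda>x. gradient_norm H0 H0' (norm x) powr (p - 2) * (M0 x \<bullet> (g1 x, g2 x)))"
    unfolding set_integrable_def eq using B(1) unfolding set_integrable_def .
  show "(LINT x:shell s t|lebesgue. gradient_norm H0 H0' (norm x) powr (p - 2) * (M0 x \<bullet> (g1 x, g2 x))) =
      2 * pi * integral {s..t} (\<lambda>\<rho>. hoop \<rho> * H \<rho>)"
    unfolding set_lebesgue_integral_def eq using B(2) unfolding set_lebesgue_integral_def .
qed

end

lemma M0_weak:
  assumes h0: "radial_on (annulus r R) H0 h0"
  shows "has_weak_partial (annulus r R) h0 1 (radial_gradient H0 H0' 1)"
    "has_weak_partial (annulus r R) h0 \<i> (radial_gradient H0 H0' \<i>)"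
  using radial_has_weak_partial[OF h0] by auto

text \<open>Outside the plateau this is an equality. On the plateau the flux vanishes, but \<open>hoop\<close> does not, and
  the sign comes from \<open>H \<ge> rs = H0\<close>.\<close>

lemma pairing_comparison:
  assumes h: "radial_on (annulus r R) H h"
    and g1: "has_weak_partial (annulus r R) h 1 g1" and g2: "has_weak_partial (annulus r R) h \<i> g2"
    and H: "continuous_on {r<..<R} H" and ge: "\<And>\<rho>. r < \<rho> \<Longrightarrow> \<rho> \<le> a \<Longrightarrow> rs \<le> H \<rho>"
    and h0: "radial_on (annulus r R) H0 h0" and st: "r < s" "s \<le> t" "t < R"
  defines "J \<equiv> \<lambda>M x. gradient_norm H0 H0' (norm x) powr (p - 2) * (M0 x \<bullet> M x)"
  shows "set_integrable lebesgue (shell s t) (J (\<lambda>x. (g1 x, g2 x)))" (is ?A)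
    "set_integrable lebesgue (shell s t) (J M0)" (is ?B)
    "2 * pi * (flux t * (H t - H0 t) - flux s * (H s - H0 s)) \<le>
      (LINT x:shell s t|lebesgue. J (\<lambda>x. (g1 x, g2 x)) x) - (LINT x:shell s t|lebesgue. J M0 x)" (is ?C)
proof -
  note m = M0_weak[OF h0]
  have el: "set_integrable lebesgue (shell s t) (J (\<lambda>x. (g1 x, g2 x))) \<and> set_integrable lebesgue (shell s t) (J M0) \<and>
    2 * pi * (flux t * (H t - H0 t) - flux s * (H s - H0 s)) =
      (LINT x:shell s t|lebesgue. J (\<lambda>x. (g1 x, g2 x)) x) - (LINT x:shell s t|lebesgue. J M0 x)"
    if "r < s" "a \<le> s" "s \<le> t" "t < R" for s t
    unfolding J_def
    using pairing_integral[OF h g1 g2 H that] pairing_integral[OF h0 m H_cont that]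
    by (simp add: algebra_simps)
  have pl: "set_integrable lebesgue (shell s t) (J (\<lambda>x. (g1 x, g2 x))) \<and> set_integrable lebesgue (shell s t) (J M0) \<and>
    2 * pi * (flux t * (H t - H0 t) - flux s * (H s - H0 s)) \<le>
      (LINT x:shell s t|lebesgue. J (\<lambda>x. (g1 x, g2 x)) x) - (LINT x:shell s t|lebesgue. J M0 x)"
    if st: "r < s" "s \<le> t" "t \<le> a" for s t
  proof -
    have c: "continuous_on {s..t} H" "continuous_on {s..t} H0" "continuous_on {s..t} hoop"
      by (rule continuous_on_subset[OF H] continuous_on_subset[OF H_cont] continuous_on_subset[OF hoop_cont], use st a in force)+
    have "integral {s..t} (\<lambda>\<rho>. hoop \<rho> * H0 \<rho>) \<le> integral {s..t} (\<lambda>\<rho>. hoop \<rho> * H \<rho>)"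
    proof (rule integral_le)
      fix \<rho> assume "\<rho> \<in> {s..t}"
      then have "r < \<rho>" "\<rho> \<le> a" "\<rho> < R" using st a by auto
      then show "hoop \<rho> * H0 \<rho> \<le> hoop \<rho> * H \<rho>"
        using ge[of \<rho>] plateau[of \<rho>] hoop_nonneg[of \<rho>] by (intro mult_left_mono) auto
    qed (intro integrable_continuous_real continuous_intros c)+
    moreover have "flux t = 0" "flux s = 0" using st by (auto intro: flux_plateau)
    ultimately show ?thesis
      unfolding J_def
      using pairing_integral_plateau[OF h g1 g2 H st] pairing_integral_plateau[OF h0 m H_cont st]
      by simp
  qed
  have "?A \<and> ?B \<and> ?C"
  proof -
    consider "a \<le> s" | "t \<le> a" | "s < a" "a < t" by linarith
    then show ?thesis
    proof cases
      case 1 then show ?thesis using el[of s t] st by auto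
    next
      case 2 then show ?thesis using pl[of s t] st by auto
    next
      case 3
      then have 1: "r < s" "s \<le> a" "a \<le> a" and 2: "r < a" "a \<le> a" "a \<le> t" "t < R" using st a by auto
      have u: "shell s t = shell s a \<union> shell a t" "shell s a \<inter> shell a t = {}"
        using 3 by (auto simp: shell_def)
      have i: "set_integrable lebesgue (shell s t) (J (\<lambda>x. (g1 x, g2 x)))" "set_integrable lebesgue (shell s t) (J M0)"
        unfolding u(1) using pl[OF 1] el[OF 2] by (auto intro: set_integrable_Un)
      have "(LINT x:shell s t|lebesgue. J M x) = (LINT x:shell s a|lebesgue. J M x) + (LINT x:shell a t|lebesgue. J M x)"
        if "set_integrable lebesgue (shell s a) (J M)" "set_integrable lebesgue (shell a t) (J M)" for M
        unfolding u(1) by (rule set_integral_Un[OF u(2) that])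
      then show ?thesis using i pl[OF 1] el[OF 2] by (simp add: algebra_simps)
    qed
  qed
  then show ?A ?B ?C by auto
qed

end

lemma set_integral_exhaust_annulus:
  fixes f :: "complex \<Rightarrow> real"
  assumes f: "set_integrable lebesgue (annulus r R) f" and rR: "r < R"
  shows "(\<lambda>n. LINT x:shell (r + (R - r) / (real n + 3)) (R - (R - r) / (real n + 3))|lebesgue. f x)
    \<longlonglongrightarrow> (LINT x:annulus r R|lebesgue. f x)"
proof -
  define s where "s n = r + (R - r) / (real n + 3)" for n
  define t where "t n = R - (R - r) / (real n + 3)" for n
  have z: "(\<lambda>n. (R - r) / (real n + 3)) \<longlonglongrightarrow> 0" by real_asymp
  have s: "s \<longlonglongrightarrow> r" and t: "t \<longlonglongrightarrow> R"
    using tendsto_add[OF tendsto_const z, of r] tendsto_diff[OF tendsto_const z, of R]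
    by (simp_all add: s_def[abs_def] t_def[abs_def])
  have pos: "(R - r) / (real n + 3) > 0" for n using rR by simp
  note fi = f[unfolded set_integrable_def]
  have "(\<lambda>n. LINT x|lebesgue. indicator (shell (s n) (t n)) x *\<^sub>R (indicator (annulus r R) x *\<^sub>R f x))
      \<longlonglongrightarrow> (LINT x|lebesgue. indicator (annulus r R) x *\<^sub>R f x)"
  proof (rule integral_dominated_convergence[OF borel_measurable_integrable[OF fi] _ integrable_norm[OF fi]])
    show "(\<lambda>x. indicator (shell (s n) (t n)) x *\<^sub>R (indicator (annulus r R) x *\<^sub>R f x)) \<in> borel_measurable lebesgue" for n
      by (intro borel_measurable_scaleR[OF _ borel_measurable_integrable[OF fi]] borel_measurable_indicator) simp
    show "AE x in lebesgue. (\<lambda>n. indicator (shell (s n) (t n)) x *\<^sub>R (indicator (annulus r R) x *\<^sub>R f x))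
        \<longlonglongrightarrow> indicator (annulus r R) x *\<^sub>R f x"
    proof (rule AE_I2, rule tendsto_eventually)
      fix x :: complex
      show "eventually (\<lambda>n. indicator (shell (s n) (t n)) x *\<^sub>R (indicator (annulus r R) x *\<^sub>R f x) = indicator (annulus r R) x *\<^sub>R f x) sequentially"
      proof (cases "x \<in> annulus r R")
        case True
        then have "eventually (\<lambda>n. s n < norm x) sequentially" "eventually (\<lambda>n. norm x < t n) sequentially"
          using order_tendstoD(2)[OF s, of "norm x"] order_tendstoD(1)[OF t, of "norm x"] by (auto simp: annulus_def)
        then show ?thesis by eventually_elim (simp add: shell_def)
      qed simp
    qed
    show "AE x in lebesgue. norm (indicator (shell (s n) (t n)) x *\<^sub>R (indicator (annulus r R) x *\<^sub>R f x))
        \<le> norm (indicator (annulus r R) x *\<^sub>R f x)" for n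
      by (intro AE_I2) (auto simp: indicator_def)
  qed
  moreover have "indicator (shell (s n) (t n)) x *\<^sub>R (indicator (annulus r R) x *\<^sub>R f x) =
      indicator (shell (s n) (t n)) x *\<^sub>R f x" for n x
    using pos[of n] by (auto simp: indicator_def shell_def annulus_def s_def t_def)
  ultimately show ?thesis
    unfolding set_lebesgue_integral_def s_def[symmetric] t_def[symmetric] by (simp only:)
qed

context radial_extremal
begin

context
  fixes H :: "real \<Rightarrow> real" and h g1 g2 h0 :: "complex \<Rightarrow> complex"
  assumes h: "radial_on (annulus r R) H h"
    and g1: "has_weak_partial (annulus r R) h 1 g1" and g2: "has_weak_partial (annulus r R) h \<i> g2"
    and H: "continuous_on {r<..<R} H"
    and h0: "radial_on (annulus r R) H0 h0"
begin

definition excess :: "complex \<Rightarrow> real" where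
  "excess x = norm (g1 x, g2 x) powr p - norm (M0 x) powr p -
     p * (norm (M0 x) powr (p - 2) * (M0 x \<bullet> (g1 x, g2 x) - M0 x \<bullet> M0 x))"

lemma M0_nonzero: "x \<in> annulus r R \<Longrightarrow> M0 x \<noteq> 0" "x \<in> annulus r R \<Longrightarrow> norm (M0 x) = gradient_norm H0 H0' (norm x)"
proof -
  assume x: "x \<in> annulus r R"
  then have "x \<noteq> 0" using annulus_pos by auto
  then show n: "norm (M0 x) = gradient_norm H0 H0' (norm x)" by (rule norm_radial_gradient)
  have "gradient_norm H0 H0' (norm x) > 0" using x by (intro gradient_norm_pos) (auto simp: annulus_def)
  then show "M0 x \<noteq> 0" using n by (metis less_irrefl norm_zero)
qed

lemma excess_nonneg: "x \<in> annulus r R \<Longrightarrow> 0 \<le> excess x"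
  unfolding excess_def by (rule norm_powr_tangent(1)[OF M0_nonzero(1) p])

text \<open>The boundary term \<open>B\<close> at the inner circle vanishes if the two profiles have the same value there; it
  is kept because for \<open>p = 1\<close> the comparison with a profile of larger inner boundary value is needed. The
  linear terms are integrable on the shells compactly contained in the annulus, so the inequality is proved
  there, and then the shells exhaust the annulus.\<close>

lemma energy_gap:
  assumes ge: "\<And>\<rho>. r < \<rho> \<Longrightarrow> \<rho> \<le> a \<Longrightarrow> rs \<le> H \<rho>"
    and i: "set_integrable lebesgue (annulus r R) (\<lambda>x. norm (g1 x, g2 x) powr p)"
    and i0: "set_integrable lebesgue (annulus r R) (\<lambda>x. norm (M0 x) powr p)"
    and B: "((\<lambda>\<rho>. flux \<rho> * (H \<rho> - H0 \<rho>)) \<longlongrightarrow> B) (at_right r)"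
    and B0: "((\<lambda>\<rho>. flux \<rho> * (H \<rho> - H0 \<rho>)) \<longlongrightarrow> 0) (at_left R)"
  shows "(LINT x:annulus r R|lebesgue. norm (M0 x) powr p) - 2 * pi * p * B
      \<le> (LINT x:annulus r R|lebesgue. norm (g1 x, g2 x) powr p)"
    "(LINT x:annulus r R|lebesgue. norm (g1 x, g2 x) powr p) =
       (LINT x:annulus r R|lebesgue. norm (M0 x) powr p) - 2 * pi * p * B \<Longrightarrow>
      AE x in lebesgue. x \<in> annulus r R \<longrightarrow> excess x = 0"
proof -
  define s where "s n = r + (R - r) / (real n + 3)" for n
  define t where "t n = R - (R - r) / (real n + 3)" for n
  have st: "r < s n" "s n \<le> t n" "t n < R" for n
  proof -
    have "(R - r) / (real n + 3) \<le> (R - r) / 2" using rR by (intro divide_left_mono) auto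
    moreover define d where "d = (R - r) / (real n + 3)"
    ultimately show "s n \<le> t n" unfolding s_def t_def d_def[symmetric] by simp
    show "r < s n" "t n < R" using rR by (auto simp: s_def t_def)
  qed
  have sub: "shell (s n) (t n) \<subseteq> annulus r R" for n
    using st[of n] by (auto simp: shell_def annulus_def)
  have z: "(\<lambda>n. (R - r) / (real n + 3)) \<longlonglongrightarrow> 0" by real_asymp
  have "s \<longlonglongrightarrow> r" "t \<longlonglongrightarrow> R"
    using tendsto_add[OF tendsto_const z, of r] tendsto_diff[OF tendsto_const z, of R]
    by (simp_all add: s_def[abs_def] t_def[abs_def])
  then have fs: "filterlim s (at_right r) sequentially" and ft: "filterlim t (at_left R) sequentially"
    using st by (auto simp: filterlim_at less_imp_neq[symmetric] intro!: always_eventually)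
  define w where "w M x = gradient_norm H0 H0' (norm x) powr (p - 2) * (M0 x \<bullet> M x)" for M x
  define ee where "ee x = norm (g1 x, g2 x) powr p - norm (M0 x) powr p - p * (w (\<lambda>x. (g1 x, g2 x)) x - w M0 x)" for x
  have ee: "ee x = excess x" if "x \<in> annulus r R" for x
    unfolding ee_def excess_def w_def M0_nonzero(2)[OF that] by (simp add: right_diff_distrib)
  note cmp = pairing_comparison[OF h g1 g2 H ge h0 st, folded w_def]
  define D where "D n = flux (t n) * (H (t n) - H0 (t n)) - flux (s n) * (H (s n) - H0 (s n))" for n
  have i': "set_integrable lebesgue (shell (s n) (t n)) (\<lambda>x. norm (g1 x, g2 x) powr p)"
    "set_integrable lebesgue (shell (s n) (t n)) (\<lambda>x. norm (M0 x) powr p)" for n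
    by (rule set_integrable_subset[OF i _ sub] set_integrable_subset[OF i0 _ sub], simp)+
  have iw: "set_integrable lebesgue (shell (s n) (t n)) (\<lambda>x. w (\<lambda>x. (g1 x, g2 x)) x)"
    "set_integrable lebesgue (shell (s n) (t n)) (\<lambda>x. w M0 x)" for n
    using cmp(1,2)[of n] by (simp_all add: w_def[abs_def])
  have iee: "set_integrable lebesgue (shell (s n) (t n)) ee" for n
    unfolding ee_def[abs_def] by (intro set_integral_diff(1) set_integrable_mult_right i' iw)
  have le: "(LINT x:shell (s n) (t n)|lebesgue. ee x) \<le>
      (LINT x:shell (s n) (t n)|lebesgue. norm (g1 x, g2 x) powr p) -
      (LINT x:shell (s n) (t n)|lebesgue. norm (M0 x) powr p) - 2 * pi * p * D n" for n
  proof -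
    have "(LINT x:shell (s n) (t n)|lebesgue. ee x) =
      (LINT x:shell (s n) (t n)|lebesgue. norm (g1 x, g2 x) powr p) -
      (LINT x:shell (s n) (t n)|lebesgue. norm (M0 x) powr p) -
      p * ((LINT x:shell (s n) (t n)|lebesgue. w (\<lambda>x. (g1 x, g2 x)) x) - (LINT x:shell (s n) (t n)|lebesgue. w M0 x))"
      unfolding ee_def[abs_def]
      by (simp add: set_integral_diff i' iw)
    moreover have "p * (2 * pi * D n) \<le> p * ((LINT x:shell (s n) (t n)|lebesgue. w (\<lambda>x. (g1 x, g2 x)) x) - (LINT x:shell (s n) (t n)|lebesgue. w M0 x))"
      using cmp(3)[of n] p unfolding D_def w_def by (intro mult_left_mono) auto
    ultimately show ?thesis by (simp add: mult_ac)
  qed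
  have "(\<lambda>n. flux (s n) * (H (s n) - H0 (s n))) \<longlonglongrightarrow> B" "(\<lambda>n. flux (t n) * (H (t n) - H0 (t n))) \<longlonglongrightarrow> 0"
    using filterlim_compose[OF B fs] filterlim_compose[OF B0 ft] by auto
  then have D: "D \<longlonglongrightarrow> 0 - B" unfolding D_def[abs_def] by (intro tendsto_diff)
  let ?X = "(LINT x:annulus r R|lebesgue. norm (g1 x, g2 x) powr p) -
      (LINT x:annulus r R|lebesgue. norm (M0 x) powr p) - 2 * pi * p * (0 - B)"
  have X: "(\<lambda>n. (LINT x:shell (s n) (t n)|lebesgue. norm (g1 x, g2 x) powr p) -
      (LINT x:shell (s n) (t n)|lebesgue. norm (M0 x) powr p) - 2 * pi * p * D n) \<longlonglongrightarrow> ?X"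
    unfolding s_def t_def using rR
    by (intro tendsto_intros D set_integral_exhaust_annulus[OF i] set_integral_exhaust_annulus[OF i0])
  have pos: "0 \<le> (LINT x:shell (s n) (t n)|lebesgue. ee x)" for n
    unfolding set_lebesgue_integral_def using excess_nonneg ee sub[of n]
    by (intro Bochner_Integration.integral_nonneg) (auto simp: indicator_def)
  have "0 \<le> ?X"
    by (rule LIMSEQ_le_const[OF X]) (use le pos order_trans in blast)
  then show "(LINT x:annulus r R|lebesgue. norm (M0 x) powr p) - 2 * pi * p * B
      \<le> (LINT x:annulus r R|lebesgue. norm (g1 x, g2 x) powr p)" by simp
  assume eq: "(LINT x:annulus r R|lebesgue. norm (g1 x, g2 x) powr p) =
       (LINT x:annulus r R|lebesgue. norm (M0 x) powr p) - 2 * pi * p * B"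
  have mono: "(LINT x:shell (s k) (t k)|lebesgue. ee x) \<le> (LINT x:shell (s n) (t n)|lebesgue. ee x)" if "k \<le> n" for k n
    unfolding set_lebesgue_integral_def
  proof (rule integral_mono)
    show "integrable lebesgue (\<lambda>x. indicator (shell (s k) (t k)) x *\<^sub>R ee x)"
      "integrable lebesgue (\<lambda>x. indicator (shell (s n) (t n)) x *\<^sub>R ee x)"
      using iee unfolding set_integrable_def by auto
    have "(R - r) / (real n + 3) \<le> (R - r) / (real k + 3)" using that rR by (intro divide_left_mono) auto
    then have ss: "shell (s k) (t k) \<subseteq> shell (s n) (t n)" by (auto simp: shell_def s_def t_def)
    fix x :: complex
    show "indicator (shell (s k) (t k)) x *\<^sub>R ee x \<le> indicator (shell (s n) (t n)) x *\<^sub>R ee x"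
      using ss excess_nonneg[of x] ee[of x] sub[of n] by (auto simp: indicator_def)
  qed
  have zero: "(LINT x:shell (s k) (t k)|lebesgue. ee x) = 0" for k
  proof -
    have "(LINT x:shell (s k) (t k)|lebesgue. ee x) \<le> ?X"
    proof (rule LIMSEQ_le_const[OF X], intro exI[of _ k] allI impI)
      fix n assume "k \<le> n"
      show "(LINT x:shell (s k) (t k)|lebesgue. ee x) \<le> (LINT x:shell (s n) (t n)|lebesgue. norm (g1 x, g2 x) powr p) -
      (LINT x:shell (s n) (t n)|lebesgue. norm (M0 x) powr p) - 2 * pi * p * D n"
        using mono[OF \<open>k \<le> n\<close>] le[of n] by linarith
    qed
    then show ?thesis using pos[of k] eq by simp
  qed
  have "AE x in lebesgue. indicator (shell (s k) (t k)) x *\<^sub>R ee x = 0" for k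
    using zero[of k] iee[of k] unfolding set_lebesgue_integral_def set_integrable_def
    by (subst integral_nonneg_eq_0_iff_AE[symmetric])
      (use excess_nonneg ee sub[of k] in \<open>auto simp: indicator_def intro!: AE_I2\<close>)
  then have "AE x in lebesgue. \<forall>k. indicator (shell (s k) (t k)) x *\<^sub>R ee x = 0"
    unfolding AE_all_countable by blast
  then show "AE x in lebesgue. x \<in> annulus r R \<longrightarrow> excess x = 0"
  proof eventually_elim
    case (elim x)
    show ?case
    proof
      assume x: "x \<in> annulus r R"
      have "eventually (\<lambda>n. s n < norm x) sequentially" "eventually (\<lambda>n. norm x < t n) sequentially"
        using order_tendstoD(2)[OF \<open>s \<longlonglongrightarrow> r\<close>, of "norm x"] order_tendstoD(1)[OF \<open>t \<longlonglongrightarrow> R\<close>, of "norm x"] x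
        by (auto simp: annulus_def)
      then have "eventually (\<lambda>n. x \<in> shell (s n) (t n)) sequentially"
        by eventually_elim (simp add: shell_def)
      then obtain n where "x \<in> shell (s n) (t n)"
        using eventually_happens' sequentially_bot by blast
      then show "excess x = 0" using elim ee[OF x] by (auto dest: spec[of _ n])
    qed
  qed
qed

text \<open>If the tangent plane inequality is an equality almost everywhere then the gradients of the two
  mappings are parallel, and integration by parts shows that the quotient of the profiles is
  constant. Its value is \<open>1\<close> since the profiles agree at the outer circle.\<close>

lemma profile_eq_if_excess_0:
  assumes ex: "AE x in lebesgue. x \<in> annulus r R \<longrightarrow> excess x = 0"
    and L: "(H \<longlongrightarrow> L) (at_left R)" "(H0 \<longlongrightarrow> L) (at_left R)" "L > 0"
    and s: "r < s" "s < R"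
  shows "H s = H0 s"
proof -
  have quot: "H t / H0 t = H s / H0 s" if t: "s \<le> t" "t < R" for t
  proof -
    have sub: "shell s t \<subseteq> annulus r R" using s t by (auto simp: shell_def annulus_def)
    have pos: "H0 \<rho> > 0" if "\<rho> \<in> {s..t}" for \<rho> using that s t by (intro H0_pos) auto
    \<comment> \<open>With this weight the integral computes the increment of \<open>P H = H / H0\<close>, while its integrand
      vanishes for gradients parallel to that of \<open>H0\<close>.\<close>
    define P where "P \<rho> = 1 / H0 \<rho>" for \<rho>
    define P' where "P' \<rho> = - H0' \<rho> / (H0 \<rho>)\<^sup>2" for \<rho>
    have dP: "(P has_real_derivative P' \<rho>) (at \<rho> within {s..t})" if "\<rho> \<in> {s..t}" for \<rho>
      unfolding P_def[abs_def] P'_def using pos[OF that] that s t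
      by (auto intro!: derivative_eq_intros has_field_derivative_at_within[OF H_deriv] simp: power2_eq_square)
    have c: "continuous_on {s..t} P'"
      unfolding P'_def[abs_def] using pos s t
      by (intro continuous_intros continuous_on_subset[OF H_cont] continuous_on_subset[OF H'_cont]) force+
    note A = radial_integration_by_parts[OF rR(1) s(1) t h g1 g2 H dP c]
    note B = tangential_integral[OF rR(1) s(1) t h g1 g2 H c]
    have "AE x in lebesgue. indicator (shell s t) x *\<^sub>R (P (norm x) / norm x * radial_part g1 g2 x + P' (norm x) * tangential_part g1 g2 x) = 0"
      using ex
    proof eventually_elim
      case (elim x)
      show ?case
      proof (cases "x \<in> shell s t")
        case True
        then have x: "x \<in> annulus r R" "norm x \<in> {s..t}" "x \<noteq> 0" "norm x \<noteq> 0" using sub s rR by (auto simp: shell_def)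
        let ?M = "(g1 x, g2 x)"
        have "norm (M0 x) *\<^sub>R ?M = norm ?M *\<^sub>R M0 x"
          using norm_powr_tangent(2)[OF M0_nonzero(1)[OF x(1)] p, of ?M] elim x(1) by (simp add: excess_def)
        then have g: "norm (M0 x) *\<^sub>R g1 x = norm ?M *\<^sub>R radial_gradient H0 H0' 1 x"
          "norm (M0 x) *\<^sub>R g2 x = norm ?M *\<^sub>R radial_gradient H0 H0' \<i> x" by simp_all
        have rl: "k * radial_part u v x = radial_part (\<lambda>x. k *\<^sub>R u x) (\<lambda>x. k *\<^sub>R v x) x"
          "k * tangential_part u v x = tangential_part (\<lambda>x. k *\<^sub>R u x) (\<lambda>x. k *\<^sub>R v x) x" for k u v
          by (simp_all add: radial_part_def tangential_part_def algebra_simps add_divide_distrib)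
        have local: "radial_part u v x = radial_part u' v' x" "tangential_part u v x = tangential_part u' v' x"
          if "u x = u' x" "v x = v' x" for u v u' v'
          using that by (simp_all add: radial_part_def tangential_part_def)
        have r1: "norm (M0 x) * radial_part g1 g2 x = norm ?M * H0' (norm x)"
          unfolding rl radial_gradient_parts(1)[OF x(3), of H0 H0', symmetric] using g by (intro local) auto
        have r2: "norm (M0 x) * tangential_part g1 g2 x = norm ?M * (H0 (norm x) / norm x)"
          unfolding rl radial_gradient_parts(2)[OF x(3), of H0 H0', symmetric] using g by (intro local) auto
        have n0: "norm (M0 x) \<noteq> 0" using M0_nonzero(1)[OF x(1)] by simp
        have "norm (M0 x) * (P (norm x) / norm x * radial_part g1 g2 x + P' (norm x) * tangential_part g1 g2 x)
          = P (norm x) / norm x * (norm ?M * H0' (norm x)) + P' (norm x) * (norm ?M * (H0 (norm x) / norm x))"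
          unfolding r1[symmetric] r2[symmetric] by (simp add: algebra_simps)
        also have "\<dots> = 0" using pos[OF x(2)] x(4) by (simp add: P_def P'_def power2_eq_square)
        finally show ?thesis using n0 by simp
      qed simp
    qed
    then have "(LINT x:shell s t|lebesgue. P (norm x) / norm x * radial_part g1 g2 x + P' (norm x) * tangential_part g1 g2 x) = 0"
      unfolding set_lebesgue_integral_def by (rule integral_eq_zero_AE)
    then have "2 * pi * (P t * H t - P s * H s) = 0"
      using set_integral_add(2)[OF A(1) B(1)] A(2) B(2) by (simp add: algebra_simps)
    then show ?thesis by (simp add: P_def)
  qed
  have lim1: "((\<lambda>t. H t / H0 t) \<longlongrightarrow> L / L) (at_left R)"
    using L by (intro tendsto_divide) auto
  have "eventually (\<lambda>t. H t / H0 t = H s / H0 s) (at_left R)"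
    unfolding eventually_at_left_field using s by (intro exI[of _ s] conjI allI impI quot) linarith+
  then have "((\<lambda>t. H t / H0 t) \<longlongrightarrow> H s / H0 s) (at_left R)" by (rule tendsto_eventually)
  from tendsto_unique[OF trivial_limit_at_left_real lim1 this]
  have "H s / H0 s = 1" using L(3) by simp
  then show ?thesis using H0_pos[OF s] by simp
qed

end

end

section \<open>Sobolev regularity of radial mappings\<close>

lemma integrable_nonneg_derivative:
  fixes F F' :: "real \<Rightarrow> real"
  assumes rR: "r < R" and F: "continuous_on {r..R} F"
    and F': "\<And>\<rho>. r < \<rho> \<Longrightarrow> \<rho> < R \<Longrightarrow> (F has_real_derivative F' \<rho>) (at \<rho>)"
    and cont: "continuous_on {r<..<R} F'" and nonneg: "\<And>\<rho>. r < \<rho> \<Longrightarrow> \<rho> < R \<Longrightarrow> 0 \<le> F' \<rho>"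
  shows "integrable lborel (\<lambda>\<rho>. indicator {r<..<R} \<rho> * F' \<rho>)"
    "(LINT \<rho>|lborel. indicator {r<..<R} \<rho> * F' \<rho>) = F R - F r"
proof -
  have "(F' has_integral F R - F r) {r..R}"
    by (rule fundamental_theorem_of_calculus_interior)
      (use rR F F' in \<open>auto simp: has_real_derivative_iff_has_vector_derivative[symmetric]\<close>)
  then have hi: "(F' has_integral F R - F r) {r<..<R}" by (simp add: has_integral_Icc_iff_Ioo)
  then have ai: "F' absolutely_integrable_on {r<..<R}"
    using nonneg by (intro nonnegative_absolutely_integrable_1) (auto simp: integrable_on_def)
  have m: "(\<lambda>\<rho>. indicator {r<..<R} \<rho> * F' \<rho>) \<in> borel_measurable borel"
    using borel_measurable_continuous_on_indicator[OF _ cont] by simp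
  show "integrable lborel (\<lambda>\<rho>. indicator {r<..<R} \<rho> * F' \<rho>)"
    using ai m integrable_completion[of "\<lambda>\<rho>. indicator {r<..<R} \<rho> * F' \<rho>" lborel]
    by (simp add: set_integrable_def)
  have "(LINT \<rho>|lborel. indicator {r<..<R} \<rho> * F' \<rho>) = (LINT \<rho>:{r<..<R}|lebesgue. F' \<rho>)"
    using m by (simp add: set_lebesgue_integral_def integral_completion)
  also have "\<dots> = F R - F r"
    using set_lebesgue_integral_eq_integral(2)[OF ai] hi by (simp add: integral_unique)
  finally show "(LINT \<rho>|lborel. indicator {r<..<R} \<rho> * F' \<rho>) = F R - F r" .
qed

lemma set_integral_annulus_radial:
  fixes F :: "real \<Rightarrow> real"
  assumes r: "0 \<le> r" and F: "continuous_on {r<..<R} F"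
    and int: "integrable lborel (\<lambda>\<rho>. indicator {r<..<R} \<rho> * (\<rho> * F \<rho>))"
  shows "set_integrable lebesgue (annulus r R) (\<lambda>x. F (norm x))"
    "(LINT x:annulus r R|lebesgue. F (norm x)) = 2 * pi * (LINT \<rho>|lborel. indicator {r<..<R} \<rho> * (\<rho> * F \<rho>))"
proof -
  define f where "f \<rho> = indicator {r<..<R} \<rho> * F \<rho>" for \<rho>
  have f: "f \<in> borel_measurable borel"
    using borel_measurable_continuous_on_indicator[OF _ F] by (simp add: f_def[abs_def])
  have eq1: "(\<lambda>x. indicator (annulus r R) x *\<^sub>R F (norm x)) = (\<lambda>x. f (norm x))"
    by (auto simp: f_def annulus_def indicator_def fun_eq_iff)
  have eq2: "(\<lambda>t. max 0 (2 * pi * t) * f t) = (\<lambda>t. 2 * pi * (indicator {r<..<R} t * (t * F t)))"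
    using r by (auto simp: f_def indicator_def max_def zero_le_mult_iff fun_eq_iff)
  have m: "(\<lambda>x::complex. f (norm x)) \<in> borel_measurable borel" using f by measurable
  have "integrable lborel (\<lambda>x::complex. f (norm x))"
    unfolding integrable_norm_lborel[OF f] eq2 using int by simp
  then show "set_integrable lebesgue (annulus r R) (\<lambda>x. F (norm x))"
    unfolding set_integrable_def eq1 using m by (subst integrable_completion) auto
  have "(LINT x:annulus r R|lebesgue. F (norm x)) = (LINT x|lborel. f (norm (x::complex)))"
    unfolding set_lebesgue_integral_def eq1 using m by (simp add: integral_completion)
  also have "\<dots> = 2 * pi * (LINT \<rho>|lborel. indicator {r<..<R} \<rho> * (\<rho> * F \<rho>))"
    unfolding integral_norm_lborel[OF f] eq2 by simp
  finally show "(LINT x:annulus r R|lebesgue. F (norm x)) = 2 * pi * (LINT \<rho>|lborel. indicator {r<..<R} \<rho> * (\<rho> * F \<rho>))" .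
qed

lemma integrable_powr_Ioo:
  fixes c :: real
  assumes "0 \<le> r" "r < R" "-1 < c"
  shows "integrable lborel (\<lambda>\<rho>. indicator {r<..<R} \<rho> * \<rho> powr c)"
proof (rule integrable_nonneg_derivative(1)[OF assms(2), where F = "\<lambda>\<rho>. \<rho> powr (c + 1) / (c + 1)"])
  show "continuous_on {r..R} (\<lambda>\<rho>. \<rho> powr (c + 1) / (c + 1))"
    using assms by (intro continuous_intros continuous_on_powr') auto
  show "((\<lambda>\<rho>. \<rho> powr (c + 1) / (c + 1)) has_real_derivative \<rho> powr c) (at \<rho>)" if "r < \<rho>" for \<rho>
    using that assms by (auto intro!: derivative_eq_intros)
  show "continuous_on {r<..<R} (\<lambda>\<rho>. \<rho> powr c)"
    using assms by (intro continuous_intros) auto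
qed auto

context C1_profile
begin

abbreviation grad :: "complex \<Rightarrow> complex \<times> complex" where
  "grad x \<equiv> (radial_gradient H H' 1 x, radial_gradient H H' \<i> x)"

lemma norm_grad: "x \<in> annulus r R \<Longrightarrow> norm (grad x) = gradient_norm H H' (norm x)"
  using annulus_pos by (intro norm_radial_gradient) auto

lemma annulus_sets: "annulus r R \<in> sets borel" "annulus r R \<inter> space lebesgue \<in> sets lebesgue"
  using open_annulus[of r R] by auto

text \<open>The bound in \<open>growth\<close> is integrable: \<open>H'\<close> since \<open>H\<close> is monotone and continuous up to the boundary, and
  \<open>\<rho> powr (1 - p)\<close> since \<open>p < 2\<close>, also if \<open>r = 0\<close>.\<close>

lemma radial_sobolev:
  assumes cont: "continuous_on {r..R} H" and mono: "\<And>\<rho>. r < \<rho> \<Longrightarrow> \<rho> < R \<Longrightarrow> 0 \<le> H' \<rho>"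
    and p: "1 \<le> p" "p < 2"
    and growth: "\<And>\<rho>. r < \<rho> \<Longrightarrow> \<rho> < R \<Longrightarrow> gradient_norm H H' \<rho> powr p * \<rho> \<le> K * (H' \<rho> + \<rho> powr (1 - p))"
    and h: "radial_on (annulus r R) H h"
  shows "h \<in> sobolev_W1 p (annulus r R)"
    "set_integrable lebesgue (annulus r R) (\<lambda>x. norm (grad x) powr p)"
proof -
  let ?\<Omega> = "annulus r R"
  have cg: "continuous_on {r<..<R} (\<lambda>\<rho>. gradient_norm H H' \<rho> powr p)"
    using p by (intro continuous_on_powr' gradient_norm_cont continuous_intros) (auto simp: gradient_norm_def)
  have "integrable lborel (\<lambda>\<rho>. indicator {r<..<R} \<rho> * H' \<rho>)"
    by (rule integrable_nonneg_derivative(1)[OF rR(2) cont H_deriv H'_cont mono])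
  moreover have "integrable lborel (\<lambda>\<rho>. indicator {r<..<R} \<rho> * \<rho> powr (1 - p))"
    using rR p by (intro integrable_powr_Ioo) auto
  ultimately have "integrable lborel (\<lambda>\<rho>. K * (indicator {r<..<R} \<rho> * H' \<rho> + indicator {r<..<R} \<rho> * \<rho> powr (1 - p)))"
    by (intro integrable_mult_right Bochner_Integration.integrable_add)
  then have i: "integrable lborel (\<lambda>\<rho>. indicator {r<..<R} \<rho> * (\<rho> * gradient_norm H H' \<rho> powr p))"
  proof (rule Bochner_Integration.integrable_bound)
    have "continuous_on {r<..<R} (\<lambda>\<rho>. \<rho> * gradient_norm H H' \<rho> powr p)" by (intro continuous_intros cg)
    from borel_measurable_continuous_on_indicator[OF _ this]
    show "(\<lambda>\<rho>. indicator {r<..<R} \<rho> * (\<rho> * gradient_norm H H' \<rho> powr p)) \<in> borel_measurable lborel"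
      by simp
    show "AE \<rho> in lborel. norm (indicator {r<..<R} \<rho> * (\<rho> * gradient_norm H H' \<rho> powr p))
        \<le> norm (K * (indicator {r<..<R} \<rho> * H' \<rho> + indicator {r<..<R} \<rho> * \<rho> powr (1 - p)))"
    proof (rule AE_I2)
      fix \<rho>
      have "norm (\<rho> * gradient_norm H H' \<rho> powr p) \<le> norm (K * (H' \<rho> + \<rho> powr (1 - p)))" if "r < \<rho>" "\<rho> < R"
      proof -
        have "0 \<le> \<rho> * gradient_norm H H' \<rho> powr p" using that rR by auto
        then show ?thesis using growth[OF that] by (simp add: mult.commute abs_of_nonneg)
      qed
      then show "norm (indicator {r<..<R} \<rho> * (\<rho> * gradient_norm H H' \<rho> powr p))
        \<le> norm (K * (indicator {r<..<R} \<rho> * H' \<rho> + indicator {r<..<R} \<rho> * \<rho> powr (1 - p)))"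
        by (auto simp: indicator_def)
    qed
  qed
  have "set_integrable lebesgue ?\<Omega> (\<lambda>x. gradient_norm H H' (norm x) powr p)"
    by (rule set_integral_annulus_radial(1)[OF rR(1) cg i])
  moreover have "(\<lambda>x. indicator ?\<Omega> x *\<^sub>R (gradient_norm H H' (norm x) powr p)) = (\<lambda>x. indicator ?\<Omega> x *\<^sub>R (norm (grad x) powr p))"
    using norm_grad by (auto simp: indicator_def fun_eq_iff)
  ultimately show si: "set_integrable lebesgue ?\<Omega> (\<lambda>x. norm (grad x) powr p)"
    unfolding set_integrable_def by simp
  then have si': "integrable (lebesgue_on ?\<Omega>) (\<lambda>x. norm (grad x) powr p)"
    unfolding set_integrable_def integrable_restrict_space[OF annulus_sets(2)] .
  have mg: "radial_gradient H H' b \<in> borel_measurable (lebesgue_on ?\<Omega>)" for b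
    using annulus_sets by (intro continuous_imp_measurable_on_sets_lebesgue continuous_on_radial_gradient) auto
  have Lg: "radial_gradient H H' b \<in> Lp_space p ?\<Omega>" if "\<And>x. norm (radial_gradient H H' b x) \<le> norm (grad x)" for b
  proof -
    have "integrable (lebesgue_on ?\<Omega>) (\<lambda>x. norm (radial_gradient H H' b x) powr p)"
      by (rule Bochner_Integration.integrable_bound[OF si'])
        (use mg[of b] that p in \<open>measurable, auto intro!: AE_I2 powr_mono2\<close>)
    then show ?thesis using mg by (simp add: Lp_space_def)
  qed
  have "norm (radial_gradient H H' 1 x) \<le> norm (grad x)" "norm (radial_gradient H H' \<i> x) \<le> norm (grad x)" for x
    by (simp_all add: norm_Pair real_le_rsqrt)
  then have L: "radial_gradient H H' 1 \<in> Lp_space p ?\<Omega>" "radial_gradient H H' \<i> \<in> Lp_space p ?\<Omega>"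
    by (auto intro: Lg)
  have ch: "continuous_on ?\<Omega> h"
    using radial_has_derivative[OF h] by (auto intro!: continuous_at_imp_continuous_on has_derivative_continuous)
  have "bounded (H ` {r..R})"
    by (intro compact_imp_bounded compact_continuous_image cont) simp
  then obtain C where C: "\<And>\<rho>. \<rho> \<in> {r..R} \<Longrightarrow> norm (H \<rho>) \<le> C" unfolding bounded_iff by blast
  have hC: "norm (h x) \<le> C" if "x \<in> ?\<Omega>" for x
  proof -
    have "norm (h x) = \<bar>H (norm x)\<bar>"
      using h that annulus_pos[OF that] by (simp add: radial_on_def abs_mult)
    then show ?thesis using C[of "norm x"] that by (auto simp: annulus_def)
  qed
  have mh: "h \<in> borel_measurable (lebesgue_on ?\<Omega>)"
    using annulus_sets by (intro continuous_imp_measurable_on_sets_lebesgue ch) auto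
  have "?\<Omega> \<subseteq> cball 0 R" by (auto simp: annulus_def)
  then have "bounded ?\<Omega>" using bounded_subset bounded_cball by blast
  then have lm: "?\<Omega> \<in> lmeasurable"
    using annulus_sets by (intro bounded_set_imp_lmeasurable) auto
  have "integrable (lebesgue_on ?\<Omega>) (\<lambda>x. norm (h x) powr p)"
  proof (rule Bochner_Integration.integrable_bound)
    show "integrable (lebesgue_on ?\<Omega>) (\<lambda>x. C powr p)"
      using finite_measure.integrable_const[OF finite_measure_lebesgue_on[OF lm]] .
    show "(\<lambda>x. norm (h x) powr p) \<in> borel_measurable (lebesgue_on ?\<Omega>)"
      using mh by measurable
    show "AE x in lebesgue_on ?\<Omega>. norm (norm (h x) powr p) \<le> norm (C powr p)"
      using hC p by (intro AE_I2) (auto intro!: powr_mono2)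
  qed
  then have "h \<in> Lp_space p ?\<Omega>" using mh by (simp add: Lp_space_def)
  then show "h \<in> sobolev_W1 p ?\<Omega>"
    using L radial_has_weak_partial[OF h] by (auto simp: sobolev_W1_def Basis_complex_def)
qed

end

section \<open>Radial homeomorphisms\<close>

text \<open>Deform \<open>h\<close> to the identity through the radial mappings with profiles \<open>(1 - \<tau>) H(\<rho>) + \<tau> \<rho>\<close>. All of them are
  strictly increasing, so the mappings are injective and the image of the circle avoids the image of its
  centre throughout the deformation.\<close>

lemma winding_number_radial_homeo:
  assumes r: "0 \<le> r" and H: "strict_mono_on {r<..<R} H" "continuous_on {r<..<R} H"
    and pos: "\<And>\<rho>. r < \<rho> \<Longrightarrow> \<rho> < R \<Longrightarrow> 0 < H \<rho>"
    and h: "radial_on (annulus r R) H h" and d: "0 < d" "cball z d \<subseteq> annulus r R"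
  shows "winding_number (h \<circ> circlepath z d) (h z) = 1"
proof -
  let ?c = "circlepath z d"
  define G where "G \<tau> x = ((1 - \<tau>) * H (norm x) + \<tau> * norm x) *\<^sub>R (x /\<^sub>R norm x)" for \<tau> and x :: complex
  have posA: "norm x > 0" "r < norm x" "norm x < R" if "x \<in> annulus r R" for x
    using that r by (auto simp: annulus_def)
  have c_in: "?c s \<in> annulus r R" and c_ne: "?c s \<noteq> z" for s
  proof -
    have dist: "norm (?c s - z) = d" using d by (simp add: circlepath norm_mult)
    then show "?c s \<noteq> z" using d by auto
    have "?c s \<in> cball z d" using dist by (simp add: dist_norm norm_minus_commute)
    then show "?c s \<in> annulus r R" using d by blast
  qed
  have z_in: "z \<in> annulus r R" using d by auto
  have inj: "x = y" if x: "x \<in> annulus r R" and y: "y \<in> annulus r R" and \<tau>: "\<tau> \<in> {0..1}" and eq: "G \<tau> x = G \<tau> y" for x y \<tau>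
  proof -
    define k where "k \<rho> = (1 - \<tau>) * H \<rho> + \<tau> * \<rho>" for \<rho>
    have kpos: "k \<rho> > 0" if "r < \<rho>" "\<rho> < R" for \<rho>
      unfolding k_def using that r pos[OF that] \<tau>
      by (cases "\<tau> = 0") (auto intro!: add_nonneg_pos mult_nonneg_nonneg)
    have kmono: "k \<rho> < k \<sigma>" if "r < \<rho>" "\<rho> < \<sigma>" "\<sigma> < R" for \<rho> \<sigma>
    proof -
      have "H \<rho> < H \<sigma>" using H(1) that by (auto simp: strict_mono_on_def)
      then show ?thesis unfolding k_def using \<tau> that
        by (cases "\<tau> = 0") (auto intro!: add_le_less_mono mult_left_mono)
    qed
    have n: "norm (G \<tau> x) = k (norm x)" if "x \<in> annulus r R" for x
      using kpos[of "norm x"] posA[OF that] by (simp add: G_def k_def)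
    have "k (norm x) = k (norm y)" using n[OF x] n[OF y] eq by simp
    then have nn: "norm x = norm y"
      using kmono[of "norm x" "norm y"] kmono[of "norm y" "norm x"] posA[OF x] posA[OF y]
      by (metis linorder_neqE_linordered_idom less_irrefl)
    have "k (norm x) \<noteq> 0" using kpos[of "norm x"] posA[OF x] by simp
    then show "x = y" using eq posA[OF x] posA[OF y] unfolding G_def nn k_def by simp
  qed
  have hG: "h x = G 0 x" if "x \<in> annulus r R" for x
    using h that by (simp add: radial_on_def G_def)
  have G1: "G 1 x = x" if "x \<in> annulus r R" for x using posA[OF that] by (simp add: G_def)
  have contG: "continuous_on ({0..1} \<times> annulus r R) (\<lambda>y. G (fst y) (snd y))"
  proof -
    have "(\<lambda>y. norm (snd y)) ` ({0..1} \<times> annulus r R) \<subseteq> {r<..<R}" using posA(2,3) by auto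
    moreover have "\<forall>y\<in>{0..1} \<times> annulus r R. norm (snd y) \<noteq> 0" using posA(1) by force
    ultimately show ?thesis
      unfolding G_def
      by (intro continuous_intros continuous_on_compose2[OF H(2), of _ "\<lambda>y. norm (snd y)"])
  qed
  have cc: "continuous_on S ?c" for S
    unfolding circlepath_def part_circlepath_def by (intro continuous_intros)
  have contGc: "continuous_on ({0..1} \<times> {0..1}) (\<lambda>y. G (fst y) (?c (snd y)))"
    by (rule continuous_on_compose2[OF contG, of _ "\<lambda>y. (fst y, ?c (snd y))", simplified])
      (use c_in in \<open>auto intro!: continuous_intros continuous_on_compose2[OF cc[of UNIV]]\<close>)
  have contGz: "continuous_on ({0..1} \<times> {0..1}) (\<lambda>y. G (fst y) z)"
    unfolding G_def by (intro continuous_intros)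
  have "homotopic_loops (- {0}) (\<lambda>s. (h \<circ> ?c) s - h z) (\<lambda>s. ?c s - z)"
    unfolding homotopic_loops
  proof (intro exI[of _ "\<lambda>y. G (fst y) (?c (snd y)) - G (fst y) z"] conjI ballI)
    show "continuous_on ({0..1} \<times> {0..1}) (\<lambda>y. G (fst y) (?c (snd y)) - G (fst y) z)"
      by (intro continuous_on_diff contGc contGz)
    show "(\<lambda>y. G (fst y) (?c (snd y)) - G (fst y) z) \<in> {0..1} \<times> {0..1} \<rightarrow> - {0}"
      using inj[OF c_in z_in] c_ne by fastforce
  qed (use c_in z_in in \<open>auto simp: hG G1 pathfinish_def pathstart_def circlepath\<close>)
  then have "winding_number (\<lambda>s. (h \<circ> ?c) s - h z) 0 = winding_number (\<lambda>s. ?c s - z) 0"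
    by (rule winding_number_homotopic_loops)
  then show ?thesis
    using winding_number_circlepath_centre[OF d(1), of z]
    by (simp add: winding_number_offset[of "h \<circ> ?c"] winding_number_offset[of ?c])
qed

lemma radial_homeoI:
  assumes r: "0 \<le> r" "r < R" "0 \<le> rs" and cont: "continuous_on {r..R} H" and mono: "strict_mono_on {r..R} H"
    and ends: "H r = rs" "H R = Rs"
    and h: "radial_on (annulus r R) H h" and W: "h \<in> sobolev_W1 p (annulus r R)"
  shows "h \<in> radial_homeos p r R rs Rs"
proof -
  have less: "H \<rho> < H \<sigma>" if "r \<le> \<rho>" "\<rho> < \<sigma>" "\<sigma> \<le> R" for \<rho> \<sigma>
    using mono that by (auto simp: strict_mono_on_def)
  have inj: "inj_on H {r..R}" using mono by (rule strict_mono_on_imp_inj_on)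
  have rng: "rs < H \<rho>" "H \<rho> < Rs" "0 < H \<rho>" if "r < \<rho>" "\<rho> < R" for \<rho>
    using less[of r \<rho>] less[of \<rho> R] that ends r by auto
  have img: "H ` {r..R} = {rs..Rs}"
  proof
    show "H ` {r..R} \<subseteq> {rs..Rs}"
      using rng ends less[of r R] r by (force simp: le_less)
    show "{rs..Rs} \<subseteq> H ` {r..R}"
      using IVT'[of H r _ R] cont ends r by (auto simp: image_iff) (metis atLeastAtMost_iff)
  qed
  define K where "K = the_inv_into {r..R} H"
  have KH: "K (H \<rho>) = \<rho>" if "\<rho> \<in> {r..R}" for \<rho> unfolding K_def by (rule the_inv_into_f_f[OF inj that])
  have K: "continuous_on {rs..Rs} K"
    using continuous_on_inv[OF cont compact_Icc, of K] KH img by auto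
  have HK: "H (K y) = y" "K y \<in> {r..R}" if "y \<in> {rs..Rs}" for y
  proof -
    have "y \<in> H ` {r..R}" using that img by simp
    then show "H (K y) = y" "K y \<in> {r..R}"
      unfolding K_def using f_the_inv_into_f[OF inj] the_inv_into_into[OF inj _ order_refl] by blast+
  qed
  have Krng: "r < K y" "K y < R" if "rs < y" "y < Rs" for y
    using HK[of y] that ends by (auto simp: le_less)
  define g where "g y = K (norm y) *\<^sub>R (y /\<^sub>R norm y)" for y :: complex
  have nA: "norm x > 0" "r < norm x" "norm x < R" if "x \<in> annulus r R" for x
    using that r by (auto simp: annulus_def)
  have nB: "norm y > 0" "rs < norm y" "norm y < Rs" if "y \<in> annulus rs Rs" for y
    using that r by (auto simp: annulus_def)
  have hx: "h x = H (norm x) *\<^sub>R (x /\<^sub>R norm x)" if "x \<in> annulus r R" for x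
    using h that by (simp add: radial_on_def)
  have nh: "norm (h x) = H (norm x)" if "x \<in> annulus r R" for x
    using hx[OF that] rng[of "norm x"] nA[OF that] by simp
  have ng: "norm (g y) = K (norm y)" if "y \<in> annulus rs Rs" for y
    using Krng[of "norm y"] nB[OF that] r by (simp add: g_def)
  have Hc: "continuous_on {r<..<R} H" using cont by (rule continuous_on_subset) auto
  have "homeomorphism (annulus r R) (annulus rs Rs) h g"
  proof (rule homeomorphismI)
    have "continuous_on (annulus r R) (\<lambda>x. H (norm x) *\<^sub>R (x /\<^sub>R norm x))"
      using nA by (intro continuous_intros continuous_on_compose2[OF Hc]) force+
    then show "continuous_on (annulus r R) h" by (rule continuous_on_eq) (simp add: hx)
    show "continuous_on (annulus rs Rs) g"
      unfolding g_def using nB by (intro continuous_intros continuous_on_compose2[OF K]) force+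
    show "h ` annulus r R \<subseteq> annulus rs Rs"
    proof (rule image_subsetI)
      fix x assume x: "x \<in> annulus r R"
      show "h x \<in> annulus rs Rs"
        using nh[OF x] rng[of "norm x"] nA[OF x] by (simp add: annulus_def)
    qed
    show "g ` annulus rs Rs \<subseteq> annulus r R"
    proof (rule image_subsetI)
      fix y assume y: "y \<in> annulus rs Rs"
      show "g y \<in> annulus r R"
        using ng[OF y] Krng[of "norm y"] nB[OF y] by (simp add: annulus_def)
    qed
    show "g (h x) = x" if x: "x \<in> annulus r R" for x
    proof -
      have "g (h x) = norm x *\<^sub>R (h x /\<^sub>R H (norm x))"
        using KH[of "norm x"] nA[OF x] by (simp add: g_def nh[OF x])
      also have "h x /\<^sub>R H (norm x) = x /\<^sub>R norm x"
        using rng(3)[of "norm x"] nA[OF x] by (simp add: hx[OF x])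
      finally show ?thesis using nA[OF x] by simp
    qed
    show "h (g y) = y" if y: "y \<in> annulus rs Rs" for y
    proof -
      have k: "K (norm y) > 0" using Krng[of "norm y"] nB[OF y] r by simp
      have "g y \<in> annulus r R" using ng[OF y] Krng[of "norm y"] nB[OF y] by (auto simp: annulus_def)
      then have "h (g y) = norm y *\<^sub>R (g y /\<^sub>R K (norm y))"
        using HK[of "norm y"] nB[OF y] by (simp only: hx ng[OF y]) simp
      also have "g y /\<^sub>R K (norm y) = y /\<^sub>R norm y" using k by (simp add: g_def)
      finally show ?thesis using nB[OF y] by simp
    qed
  qed
  moreover have "orientation_preserving_on (annulus r R) h"
    unfolding orientation_preserving_on_def
    using winding_number_radial_homeo[OF r(1) _ Hc rng(3) h] mono
    by (auto simp: strict_mono_on_def)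
  moreover have "((\<lambda>x. norm (h x)) \<longlongrightarrow> rs) (filtercomap norm (at_right r))"
  proof (rule Lim_transform_eventually)
    have "(H \<longlongrightarrow> H r) (at_right r)"
      using cont r by (intro continuous_on_Icc_at_rightD) auto
    then show "((\<lambda>x. H (norm x)) \<longlongrightarrow> rs) (filtercomap norm (at_right r))"
      unfolding ends by (rule filterlim_compose) (rule filterlim_filtercomap)
    have "eventually (\<lambda>\<rho>. \<rho> \<in> {r<..<R}) (at_right r)" using r by (intro eventually_at_right_real)
    then have "eventually (\<lambda>x::complex. norm x \<in> {r<..<R}) (filtercomap norm (at_right r))"
      by (rule eventually_filtercomapI)
    then show "eventually (\<lambda>x. H (norm x) = norm (h x)) (filtercomap norm (at_right r))"
      by eventually_elim (simp add: nh annulus_def)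
  qed
  moreover have "((\<lambda>x. norm (h x)) \<longlongrightarrow> Rs) (filtercomap norm (at_left R))"
  proof (rule Lim_transform_eventually)
    have "(H \<longlongrightarrow> H R) (at_left R)"
      using cont r by (intro continuous_on_Icc_at_leftD) auto
    then show "((\<lambda>x. H (norm x)) \<longlongrightarrow> Rs) (filtercomap norm (at_left R))"
      unfolding ends by (rule filterlim_compose) (rule filterlim_filtercomap)
    have "eventually (\<lambda>\<rho>. \<rho> \<in> {r<..<R}) (at_left R)" using r by (intro eventually_at_left_real)
    then have "eventually (\<lambda>x::complex. norm x \<in> {r<..<R}) (filtercomap norm (at_left R))"
      by (rule eventually_filtercomapI)
    then show "eventually (\<lambda>x. H (norm x) = norm (h x)) (filtercomap norm (at_left R))"
      by eventually_elim (simp add: nh annulus_def)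
  qed
  ultimately show ?thesis
    using W h by (auto simp: radial_homeos_def sobolev_homeos_def)
qed

section \<open>Extremal profiles are the unique minimizers\<close>

lemma energy_annulus_eq:
  fixes u :: "complex \<Rightarrow> complex"
  assumes g: "has_weak_partial (annulus r R) u 1 g1" "has_weak_partial (annulus r R) u \<i> g2"
    and int: "set_integrable lebesgue (annulus r R) (\<lambda>x. norm (g1 x, g2 x) powr p)"
  shows "energy p (annulus r R) u = (LINT x:annulus r R|lebesgue. norm (g1 x, g2 x) powr p)"
proof -
  have \<Omega>: "annulus r R \<inter> space lebesgue \<in> sets lebesgue" using open_annulus[of r R] by auto
  have "integrable (lebesgue_on (annulus r R)) (\<lambda>x. norm (g1 x, g2 x) powr p)"
    using int unfolding set_integrable_def integrable_restrict_space[OF \<Omega>] .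
  from energy_eq[OF open_annulus g this] show ?thesis
    unfolding set_lebesgue_integral_def integral_restrict_space[OF \<Omega>] .
qed

lemma radial_monotone_mapsE:
  assumes "h \<in> radial_monotone_maps p r R rs Rs" and p: "0 \<le> p"
  obtains H g1 g2 where "radial_on (annulus r R) H h" "continuous_on {r..R} H" "H \<in> {r..R} \<rightarrow> {rs..Rs}"
    "H r = rs" "H R = Rs"
    "has_weak_partial (annulus r R) h 1 g1" "has_weak_partial (annulus r R) h \<i> g2"
    "set_integrable lebesgue (annulus r R) (\<lambda>x. norm (g1 x, g2 x) powr p)"
    "energy p (annulus r R) h = (LINT x:annulus r R|lebesgue. norm (g1 x, g2 x) powr p)"
proof -
  have \<Omega>: "annulus r R \<inter> space lebesgue \<in> sets lebesgue" using open_annulus[of r R] by auto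
  have "h \<in> sobolev_W1 p (annulus r R)" using assms by (simp add: radial_monotone_maps_def)
  then obtain g1 g2 where g: "has_weak_partial (annulus r R) h 1 g1" "has_weak_partial (annulus r R) h \<i> g2"
      "integrable (lebesgue_on (annulus r R)) (\<lambda>x. norm (g1 x, g2 x) powr p)"
    using sobolev_W1_gradient[OF _ p] by metis
  then have "set_integrable lebesgue (annulus r R) (\<lambda>x. norm (g1 x, g2 x) powr p)"
    unfolding set_integrable_def integrable_restrict_space[OF \<Omega>] by simp
  then show thesis
    using that assms(1) g(1,2) energy_annulus_eq[OF g(1,2)] unfolding radial_monotone_maps_def by blast
qed

context C1_profile
begin

lemma profile_mono:
  assumes cont: "continuous_on {r..R} H" and mono: "\<And>\<rho>. r < \<rho> \<Longrightarrow> \<rho> < R \<Longrightarrow> 0 \<le> H' \<rho>"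
    and xy: "r \<le> x" "x \<le> y" "y \<le> R"
  shows "H x \<le> H y"
proof (rule DERIV_nonneg_imp_increasing_open[OF xy(2)])
  show "continuous_on {x..y} H" by (rule continuous_on_subset[OF cont]) (use xy in auto)
  show "\<exists>z. (H has_real_derivative z) (at t) \<and> 0 \<le> z" if "x < t" "t < y" for t
    using H_deriv[of t] mono[of t] that xy by auto
qed

lemma radial_monotone_mapsI:
  assumes cont: "continuous_on {r..R} H" and mono: "\<And>\<rho>. r < \<rho> \<Longrightarrow> \<rho> < R \<Longrightarrow> 0 \<le> H' \<rho>"
    and p: "1 \<le> p" "p < 2"
    and growth: "\<And>\<rho>. r < \<rho> \<Longrightarrow> \<rho> < R \<Longrightarrow> gradient_norm H H' \<rho> powr p * \<rho> \<le> K * (H' \<rho> + \<rho> powr (1 - p))"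
    and h: "radial_on (annulus r R) H h"
  shows "h \<in> radial_monotone_maps p r R (H r) (H R)"
    "energy p (annulus r R) h = (LINT x:annulus r R|lebesgue. norm (grad x) powr p)"
proof -
  note W = radial_sobolev[OF cont mono p growth h]
  have "AE t in lebesgue_on {r<..<R}. \<exists>D\<ge>0. (H has_real_derivative D) (at t)"
  proof (rule AE_I2)
    fix t assume "t \<in> space (lebesgue_on {r<..<R})"
    then have "r < t" "t < R" by (auto simp: space_restrict_space)
    then show "\<exists>D\<ge>0. (H has_real_derivative D) (at t)" using H_deriv[of t] mono[of t] by blast
  qed
  moreover have "H \<in> {r..R} \<rightarrow> {H r..H R}"
    using profile_mono[OF cont mono] by auto
  ultimately show "h \<in> radial_monotone_maps p r R (H r) (H R)"
    using W(1) h cont by (auto simp: radial_monotone_maps_def)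
  show "energy p (annulus r R) h = (LINT x:annulus r R|lebesgue. norm (grad x) powr p)"
    by (rule energy_annulus_eq[OF radial_has_weak_partial[OF h] radial_has_weak_partial[OF h] W(2)])
qed

lemma eventually_between: "eventually (\<lambda>\<rho>. r < \<rho> \<and> \<rho> < R) (at_right r)"
  "eventually (\<lambda>\<rho>. r < \<rho> \<and> \<rho> < R) (at_left R)"
  using eventually_at_right_real[OF rR(2)] eventually_at_left_real[OF rR(2)] by auto

lemma Icc_limits:
  fixes f :: "real \<Rightarrow> real"
  assumes "continuous_on {r..R} f"
  shows "(f \<longlongrightarrow> f r) (at_right r)" "(f \<longlongrightarrow> f R) (at_left R)"
  using continuous_on_Icc_at_rightD[OF assms rR(2)] continuous_on_Icc_at_leftD[OF assms rR(2)] by auto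

end

context radial_extremal
begin

context
  fixes F :: real
  assumes p2: "p < 2" and cont: "continuous_on {r..R} H0"
    and mono: "\<And>\<rho>. r < \<rho> \<Longrightarrow> \<rho> < R \<Longrightarrow> 0 \<le> H0' \<rho>"
    and F: "\<And>\<rho>. r < \<rho> \<Longrightarrow> \<rho> < R \<Longrightarrow> flux \<rho> \<le> F"
begin

text \<open>Since \<open>gradient_norm\<^sup>p \<rho> = flux H0' + hoop H0\<close>, a bounded flux yields a finite energy.\<close>

lemma extremal_growth:
  assumes \<rho>: "r < \<rho>" "\<rho> < R"
  shows "gradient_norm H0 H0' \<rho> powr p * \<rho> \<le> (F + H0 R powr p) * (H0' \<rho> + \<rho> powr (1 - p))"
proof -
  let ?g = "gradient_norm H0 H0' \<rho>"
  have g: "?g > 0" by (rule gradient_norm_pos[OF \<rho>])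
  have \<rho>0: "\<rho> > 0" using \<rho> rR by simp
  have H0: "H0 \<rho> > 0" by (rule H0_pos[OF \<rho>])
  have HR: "H0 \<rho> \<le> H0 R" by (rule profile_mono[OF cont mono]) (use \<rho> in auto)
  have fx: "0 \<le> flux \<rho>" unfolding flux_def using mono[OF \<rho>] \<rho>0 by simp
  have "?g powr p = ?g powr (p - 2) * ?g\<^sup>2"
    using powr_add[of ?g "p - 2" 2] g by (simp add: powr_numeral)
  also have "?g\<^sup>2 = (H0' \<rho>)\<^sup>2 + (H0 \<rho> / \<rho>)\<^sup>2" by (simp add: gradient_norm_def)
  finally have "?g powr p * \<rho> = flux \<rho> * H0' \<rho> + ?g powr (p - 2) * (H0 \<rho> / \<rho>)\<^sup>2 * \<rho>"
    by (simp add: flux_def power2_eq_square algebra_simps)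
  also have "?g powr (p - 2) \<le> (H0 \<rho> / \<rho>) powr (p - 2)"
  proof (rule powr_mono2')
    show "H0 \<rho> / \<rho> \<le> ?g" unfolding gradient_norm_def by (rule real_le_rsqrt) simp
  qed (use p2 H0 \<rho>0 in auto)
  then have "?g powr (p - 2) * (H0 \<rho> / \<rho>)\<^sup>2 * \<rho> \<le> (H0 \<rho> / \<rho>) powr (p - 2) * (H0 \<rho> / \<rho>)\<^sup>2 * \<rho>"
    using \<rho>0 by (intro mult_right_mono) auto
  also have "(H0 \<rho> / \<rho>) powr (p - 2) * (H0 \<rho> / \<rho>)\<^sup>2 = (H0 \<rho> / \<rho>) powr p"
    using powr_add[of "H0 \<rho> / \<rho>" "p - 2" 2] H0 \<rho>0 by (simp add: powr_numeral)
  also have "(H0 \<rho> / \<rho>) powr p * \<rho> = H0 \<rho> powr p * \<rho> powr (1 - p)"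
    using H0 \<rho>0 by (simp add: powr_divide powr_diff)
  also have "\<dots> \<le> H0 R powr p * \<rho> powr (1 - p)"
    using H0 HR p by (intro mult_right_mono powr_mono2) auto
  finally have "?g powr p * \<rho> \<le> flux \<rho> * H0' \<rho> + H0 R powr p * \<rho> powr (1 - p)" by simp
  also have "\<dots> \<le> F * H0' \<rho> + H0 R powr p * \<rho> powr (1 - p)"
    using F[OF \<rho>] mono[OF \<rho>] by (intro add_right_mono mult_right_mono)
  also have "\<dots> \<le> (F + H0 R powr p) * (H0' \<rho> + \<rho> powr (1 - p))"
  proof -
    have "0 \<le> F * \<rho> powr (1 - p)" "0 \<le> H0 R powr p * H0' \<rho>"
      using fx F[OF \<rho>] mono[OF \<rho>] by auto
    then show ?thesis by (simp add: distrib_left distrib_right)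
  qed
  finally show ?thesis .
qed

lemma flux_times_tendsto_0:
  assumes "(f \<longlongrightarrow> 0) G" "eventually (\<lambda>\<rho>. r < \<rho> \<and> \<rho> < R) G"
  shows "((\<lambda>\<rho>. flux \<rho> * f \<rho>) \<longlongrightarrow> 0) G"
proof (rule Lim_null_comparison)
  show "eventually (\<lambda>\<rho>. norm (flux \<rho> * f \<rho>) \<le> F * \<bar>f \<rho>\<bar>) G"
    using assms(2)
  proof eventually_elim
    case (elim \<rho>)
    then have "0 \<le> flux \<rho>" "flux \<rho> \<le> F" using mono[of \<rho>] rR F by (auto simp: flux_def)
    then show ?case by (simp add: abs_mult mult_right_mono)
  qed
  show "((\<lambda>\<rho>. F * \<bar>f \<rho>\<bar>) \<longlongrightarrow> 0) G"
    using tendsto_mult[OF tendsto_const tendsto_rabs_zero[OF assms(1)], of F] by simp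
qed

theorem extremal_unique_minimizer:
  assumes ends: "H0 r = rs" "H0 R = Rs" and h0: "radial_on (annulus r R) H0 h0"
  shows "is_unique_minimizer (annulus r R) (energy p (annulus r R)) (radial_monotone_maps p r R rs Rs) h0"
proof -
  note I = radial_monotone_mapsI[OF cont mono p p2 extremal_growth h0, unfolded ends]
  note W = radial_sobolev[OF cont mono p p2 extremal_growth h0]
  have Rs: "Rs > 0"
    using H0_pos[of "(r + R) / 2"] profile_mono[OF cont mono, of "(r + R) / 2" R] ends rR by simp
  have key: "energy p (annulus r R) h0 \<le> energy p (annulus r R) h \<and>
      (energy p (annulus r R) h = energy p (annulus r R) h0 \<longrightarrow> (\<forall>x\<in>annulus r R. h x = h0 x))"
    if hC: "h \<in> radial_monotone_maps p r R rs Rs" for h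
  proof -
    have p0: "0 \<le> p" using p by simp
    obtain H g1 g2 where H: "radial_on (annulus r R) H h" "continuous_on {r..R} H" "H \<in> {r..R} \<rightarrow> {rs..Rs}"
        "H r = rs" "H R = Rs"
      and g: "has_weak_partial (annulus r R) h 1 g1" "has_weak_partial (annulus r R) h \<i> g2"
      and int: "set_integrable lebesgue (annulus r R) (\<lambda>x. norm (g1 x, g2 x) powr p)"
      and E: "energy p (annulus r R) h = (LINT x:annulus r R|lebesgue. norm (g1 x, g2 x) powr p)"
      by (rule radial_monotone_mapsE[OF hC p0])
    have Hc: "continuous_on {r<..<R} H" by (rule continuous_on_subset[OF H(2)]) auto
    have ge: "rs \<le> H \<rho>" if "r < \<rho>" "\<rho> \<le> a" for \<rho>
      using H(3) that a by (auto simp: Pi_iff)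
    have "((\<lambda>\<rho>. H \<rho> - H0 \<rho>) \<longlongrightarrow> 0) (at_right r)" "((\<lambda>\<rho>. H \<rho> - H0 \<rho>) \<longlongrightarrow> 0) (at_left R)"
      using tendsto_diff[OF Icc_limits(1)[OF H(2)] Icc_limits(1)[OF cont]]
        tendsto_diff[OF Icc_limits(2)[OF H(2)] Icc_limits(2)[OF cont]] H ends by auto
    then have B: "((\<lambda>\<rho>. flux \<rho> * (H \<rho> - H0 \<rho>)) \<longlongrightarrow> 0) (at_right r)" "((\<lambda>\<rho>. flux \<rho> * (H \<rho> - H0 \<rho>)) \<longlongrightarrow> 0) (at_left R)"
      using eventually_between by (auto intro: flux_times_tendsto_0)
    note gap = energy_gap[OF H(1) g Hc h0 ge int W(2) B]
    have "\<forall>x\<in>annulus r R. h x = h0 x" if eq: "energy p (annulus r R) h = energy p (annulus r R) h0"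
    proof -
      have ex: "AE x in lebesgue. x \<in> annulus r R \<longrightarrow> excess g1 g2 x = 0"
        using gap(2) eq E I(2) by simp
      have "H \<rho> = H0 \<rho>" if "r < \<rho>" "\<rho> < R" for \<rho>
        using profile_eq_if_excess_0[OF H(1) g Hc h0 ex, of Rs \<rho>] Icc_limits(2)[OF H(2)] Icc_limits(2)[OF cont] H ends Rs that
        by simp
      then show ?thesis using H(1) h0 by (auto simp: radial_on_def annulus_def)
    qed
    then show ?thesis using gap(1) E I(2) by simp
  qed
  then show ?thesis
    using I(1) unfolding is_unique_minimizer_def is_arg_min_def by (metis less_le_not_le order_antisym_conv)
qed

end

end

section \<open>Non-existence for the exponent one\<close>

lemma gradient_norm_le: "0 < \<rho> \<Longrightarrow> gradient_norm H H' \<rho> \<le> \<bar>H' \<rho>\<bar> + \<bar>H \<rho>\<bar> / \<rho>"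
  unfolding gradient_norm_def using sqrt_sum_squares_le_sum_abs[of "H' \<rho>" "H \<rho> / \<rho>"] by (simp add: abs_divide)

lemma gradient_norm_add_le:
  assumes "0 < \<rho>"
  shows "gradient_norm (\<lambda>\<rho>. H \<rho> - D \<rho>) (\<lambda>\<rho>. H' \<rho> + D' \<rho>) \<rho> \<le> gradient_norm H H' \<rho> + \<bar>D' \<rho>\<bar> + \<bar>D \<rho>\<bar> / \<rho>"
proof -
  have "gradient_norm (\<lambda>\<rho>. H \<rho> - D \<rho>) (\<lambda>\<rho>. H' \<rho> + D' \<rho>) \<rho> = norm (Complex (H' \<rho>) (H \<rho> / \<rho>) + Complex (D' \<rho>) (- D \<rho> / \<rho>))"
    by (simp add: gradient_norm_def cmod_def diff_divide_distrib)
  also have "\<dots> \<le> norm (Complex (H' \<rho>) (H \<rho> / \<rho>)) + norm (Complex (D' \<rho>) (- D \<rho> / \<rho>))"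
    by (rule norm_triangle_ineq)
  also have "norm (Complex (D' \<rho>) (- D \<rho> / \<rho>)) \<le> \<bar>D' \<rho>\<bar> + \<bar>D \<rho>\<bar> / \<rho>"
    using cmod_le[of "Complex (D' \<rho>) (- D \<rho> / \<rho>)"] assms by (simp add: abs_divide)
  finally show ?thesis by (simp add: gradient_norm_def cmod_def)
qed

context C1_profile
begin

lemma linear_growth:
  assumes cont: "continuous_on {r..R} H" and mono: "\<And>\<rho>. r < \<rho> \<Longrightarrow> \<rho> < R \<Longrightarrow> 0 \<le> H' \<rho>"
    and 0: "0 \<le> H r" and \<rho>: "r < \<rho>" "\<rho> < R"
  shows "gradient_norm H H' \<rho> powr 1 * \<rho> \<le> (R + H R) * (H' \<rho> + \<rho> powr (1 - 1))"
proof -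
  have \<rho>0: "\<rho> > 0" using \<rho> rR by simp
  have G0: "0 \<le> H \<rho>" "H \<rho> \<le> H R"
    using profile_mono[OF cont mono, of r \<rho>] profile_mono[OF cont mono, of \<rho> R] \<rho> 0 by auto
  have "gradient_norm H H' \<rho> * \<rho> \<le> (H' \<rho> + H \<rho> / \<rho>) * \<rho>"
    using gradient_norm_le[OF \<rho>0, of H H'] G0 mono[OF \<rho>] \<rho>0 by (intro mult_right_mono) auto
  also have "\<dots> = \<rho> * H' \<rho> + H \<rho>" using \<rho>0 by (simp add: field_simps)
  also have "\<dots> \<le> R * H' \<rho> + H R" using \<rho> G0 mono[OF \<rho>] by (intro add_mono mult_right_mono) auto
  also have "\<dots> \<le> (R + H R) * (H' \<rho> + 1)"
  proof -
    have "0 \<le> H R * H' \<rho>" "0 \<le> R" using G0 mono[OF \<rho>] \<rho> \<rho>0 by auto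
    then show ?thesis by (simp add: algebra_simps)
  qed
  finally show ?thesis using \<rho>0 by (simp add: gradient_norm_def)
qed

text \<open>The competitor lowers \<open>H\<close> on the layer \<open>[r, r + e]\<close>. The radial derivative of the layer costs at most
  \<open>2 \<pi> (r + e)\<close> times the height of the jump, its tangential part at most \<open>2 \<pi> e\<close> times this height.\<close>

lemma steep_layer_competitor:
  assumes cont: "continuous_on {r..R} H" and mono: "\<And>\<rho>. r < \<rho> \<Longrightarrow> \<rho> < R \<Longrightarrow> 0 \<le> H' \<rho>"
    and rs: "0 \<le> rs" "rs < H r" and e: "0 < e" "e < R - r"
  obtains h where "h \<in> radial_monotone_maps 1 r R rs (H R)"
    "energy 1 (annulus r R) h \<le> (LINT x:annulus r R|lebesgue. norm (grad x)) + 2 * pi * (r + 2 * e) * (H r - rs)"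
proof -
  have one_less_two: "(1::real) < 2" by simp
  define d where "d = H r - rs"
  \<comment> \<open>The square of \<open>\<eta>\<close> is used, which makes the layer continuously differentiable.\<close>
  define \<eta> where "\<eta> \<rho> = max 0 (1 - (\<rho> - r) / e)" for \<rho>
  define D where "D \<rho> = d * (\<eta> \<rho>)\<^sup>2" for \<rho>
  define D' where "D' \<rho> = d * (2 * \<eta> \<rho> / e)" for \<rho>
  define G where "G \<rho> = H \<rho> - D \<rho>" for \<rho>
  define G' where "G' \<rho> = H' \<rho> + D' \<rho>" for \<rho>
  have d: "d > 0" using rs by (simp add: d_def)
  have sq: "((\<lambda>y::real. (max 0 y)\<^sup>2) has_real_derivative 2 * max 0 y) (at y)" for y
  proof -
    consider "y > 0" | "y < 0" | "y = 0" by linarith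
    then show ?thesis
    proof cases
      case 1
      have "((\<lambda>y::real. y\<^sup>2) has_real_derivative 2 * max 0 y) (at y)"
        using 1 by (auto intro!: derivative_eq_intros)
      then show ?thesis
        by (rule has_field_derivative_transform_within_open[of _ _ _ "{0<..}"]) (use 1 in auto)
    next
      case 2
      have "((\<lambda>y::real. 0) has_real_derivative 2 * max 0 y) (at y)" using 2 by simp
      then show ?thesis
        by (rule has_field_derivative_transform_within_open[of _ _ _ "{..<0}"]) (use 2 in auto)
    next
      case 3
      have "((\<lambda>h::real. (max 0 h)\<^sup>2 / h) \<longlongrightarrow> 0) (at 0)"
      proof (rule Lim_null_comparison)
        show "eventually (\<lambda>h::real. norm ((max 0 h)\<^sup>2 / h) \<le> \<bar>h\<bar>) (at 0)"
          by (intro always_eventually allI) (auto simp: max_def power2_eq_square)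
        show "((\<lambda>h::real. \<bar>h\<bar>) \<longlongrightarrow> 0) (at 0)" by (intro tendsto_rabs_zero tendsto_ident_at)
      qed
      then show ?thesis using 3 by (simp add: has_field_derivative_iff)
    qed
  qed
  have dD: "(D has_real_derivative - D' \<rho>) (at \<rho>)" for \<rho>
  proof -
    have "((\<lambda>\<rho>. 1 - (\<rho> - r) / e) has_real_derivative - 1 / e) (at \<rho>)"
      using e by (auto intro!: derivative_eq_intros)
    from DERIV_cmult[OF DERIV_chain2[OF sq this], of d]
    show ?thesis by (simp add: D_def[abs_def] D'_def \<eta>_def mult_ac)
  qed
  have cD: "continuous_on S D" for S
    using dD by (auto intro!: continuous_at_imp_continuous_on DERIV_isCont)
  have cD': "continuous_on S D'" for S
    unfolding D'_def \<eta>_def by (intro continuous_intros) (use e in auto)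
  have D0: "0 \<le> D \<rho>" "0 \<le> D' \<rho>" for \<rho> using d e by (auto simp: D_def D'_def \<eta>_def)
  have DD: "D \<rho> \<le> e * D' \<rho>" if "r < \<rho>" for \<rho>
  proof -
    have "\<eta> \<rho> \<le> 1" "0 \<le> \<eta> \<rho>" using that e by (auto simp: \<eta>_def)
    then have "(\<eta> \<rho>)\<^sup>2 \<le> 2 * \<eta> \<rho>" by (simp add: power2_eq_square mult_right_mono)
    then show ?thesis using d e by (simp add: D_def D'_def)
  qed
  have \<rho>D: "\<rho> * D' \<rho> \<le> (r + e) * D' \<rho>" for \<rho>
  proof (cases "\<rho> \<le> r + e")
    case True
    then show ?thesis using D0(2)[of \<rho>] by (intro mult_right_mono)
  next
    case False
    then have "\<eta> \<rho> = 0" using e by (simp add: \<eta>_def field_simps)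
    then show ?thesis by (simp add: D'_def)
  qed
  interpret G: C1_profile r R G G'
  proof
    show "(G has_real_derivative G' \<rho>) (at \<rho>)" if "r < \<rho>" "\<rho> < R" for \<rho>
      unfolding G_def[abs_def] G'_def using DERIV_diff[OF H_deriv[OF that] dD[of \<rho>]] by simp
    show "continuous_on {r<..<R} G'" unfolding G'_def[abs_def] by (intro continuous_intros H'_cont cD')
  qed (use rR in auto)
  have cG: "continuous_on {r..R} G" unfolding G_def[abs_def] by (intro continuous_intros cont cD)
  have G'0: "0 \<le> G' \<rho>" if "r < \<rho>" "\<rho> < R" for \<rho> using mono[OF that] D0(2)[of \<rho>] by (simp add: G'_def)
  have Gr: "G r = rs" by (simp add: G_def D_def \<eta>_def d_def)
  have "\<eta> R = 0" using e by (simp add: \<eta>_def field_simps)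
  then have GR: "G R = H R" by (simp add: G_def D_def)
  have growth: "gradient_norm G G' \<rho> powr 1 * \<rho> \<le> (R + H R) * (G' \<rho> + \<rho> powr (1 - 1))" if "r < \<rho>" "\<rho> < R" for \<rho>
    using G.linear_growth[OF cG G'0 _ that] rs Gr GR by simp
  define h where "h x = G (norm x) *\<^sub>R (x /\<^sub>R norm x)" for x :: complex
  have h: "radial_on (annulus r R) G h" by (simp add: radial_on_def h_def)
  note I = G.radial_monotone_mapsI[OF cG G'0 order_refl one_less_two growth h]
  have growthH: "gradient_norm H H' \<rho> powr 1 * \<rho> \<le> (R + H R) * (H' \<rho> + \<rho> powr (1 - 1))" if "r < \<rho>" "\<rho> < R" for \<rho>
    using linear_growth[OF cont mono _ that] rs by simp
  have si: "set_integrable lebesgue (annulus r R) (\<lambda>x. norm (grad x))"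
    using radial_sobolev(2)[OF cont mono order_refl one_less_two growthH, of "\<lambda>x. H (norm x) *\<^sub>R (x /\<^sub>R norm x)"]
    by (simp add: radial_on_def)
  have siG: "set_integrable lebesgue (annulus r R) (\<lambda>x. norm (G.grad x))"
    using G.radial_sobolev(2)[OF cG G'0 order_refl one_less_two growth h] by simp
  have iD': "integrable lborel (\<lambda>\<rho>. indicator {r<..<R} \<rho> * D' \<rho>)" "(LINT \<rho>|lborel. indicator {r<..<R} \<rho> * D' \<rho>) = d"
  proof -
    note J = integrable_nonneg_derivative[of r R "\<lambda>\<rho>. - D \<rho>" D']
    have c: "continuous_on {r..R} (\<lambda>\<rho>. - D \<rho>)" by (intro continuous_intros cD)
    have f: "((\<lambda>\<rho>. - D \<rho>) has_real_derivative D' \<rho>) (at \<rho>)" for \<rho> using DERIV_minus[OF dD[of \<rho>]] by simp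
    show "integrable lborel (\<lambda>\<rho>. indicator {r<..<R} \<rho> * D' \<rho>)"
      by (rule J(1)) (use rR c f cD' D0 in auto)
    have "(LINT \<rho>|lborel. indicator {r<..<R} \<rho> * D' \<rho>) = - D R - - D r"
      by (rule J(2)) (use rR c f cD' D0 in auto)
    also have "\<dots> = d" using \<open>\<eta> R = 0\<close> by (simp add: D_def \<eta>_def)
    finally show "(LINT \<rho>|lborel. indicator {r<..<R} \<rho> * D' \<rho>) = d" .
  qed
  define W where "W \<rho> = (r + 2 * e) * D' \<rho> / \<rho>" for \<rho>
  have cW: "continuous_on {r<..<R} W"
    unfolding W_def using rR by (intro continuous_intros cD') auto
  have Weq: "(\<lambda>\<rho>. indicator {r<..<R} \<rho> * (\<rho> * W \<rho>)) = (\<lambda>\<rho>. (r + 2 * e) * (indicator {r<..<R} \<rho> * D' \<rho>))"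
    using rR by (auto simp: W_def indicator_def fun_eq_iff)
  have iW: "integrable lborel (\<lambda>\<rho>. indicator {r<..<R} \<rho> * (\<rho> * W \<rho>))"
    unfolding Weq using iD'(1) by simp
  have W: "set_integrable lebesgue (annulus r R) (\<lambda>x. W (norm x))"
    "(LINT x:annulus r R|lebesgue. W (norm x)) = 2 * pi * ((r + 2 * e) * d)"
    using set_integral_annulus_radial[OF rR(1) cW iW] iD' unfolding Weq by auto
  have "energy 1 (annulus r R) h = (LINT x:annulus r R|lebesgue. norm (G.grad x))"
    using I(2) by simp
  also have "\<dots> \<le> (LINT x:annulus r R|lebesgue. norm (grad x) + W (norm x))"
  proof (rule set_integral_mono[OF siG])
    show "set_integrable lebesgue (annulus r R) (\<lambda>x. norm (grad x) + W (norm x))"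
      by (rule set_integral_add(1)[OF si W(1)])
    fix x assume x: "x \<in> annulus r R"
    let ?p = "norm x"
    have n: "?p > 0" "r < ?p" using annulus_pos[OF x] x by (auto simp: annulus_def)
    have "norm (G.grad x) \<le> norm (grad x) + \<bar>D' ?p\<bar> + \<bar>D ?p\<bar> / ?p"
      unfolding norm_grad[OF x] G.norm_grad[OF x]
      using gradient_norm_add_le[OF n(1), of H D H' D'] unfolding G_def[abs_def] G'_def[abs_def] .
    also have "\<bar>D' ?p\<bar> + \<bar>D ?p\<bar> / ?p = (?p * D' ?p + D ?p) / ?p"
      using n D0[of ?p] by (simp add: field_simps)
    then have "norm (grad x) + \<bar>D' ?p\<bar> + \<bar>D ?p\<bar> / ?p = norm (grad x) + (?p * D' ?p + D ?p) / ?p" by simp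
    also have "\<dots> \<le> norm (grad x) + W ?p"
    proof -
      have "?p * D' ?p + D ?p \<le> (r + 2 * e) * D' ?p"
        using \<rho>D[of ?p] DD[OF n(2)] by (simp add: algebra_simps)
      then show ?thesis unfolding W_def using n by (simp add: divide_right_mono)
    qed
    finally show "norm (G.grad x) \<le> norm (grad x) + W ?p" .
  qed
  also have "\<dots> = (LINT x:annulus r R|lebesgue. norm (grad x)) + 2 * pi * ((r + 2 * e) * d)"
    using set_integral_add(2)[OF si W(1)] W(2) by simp
  finally have "energy 1 (annulus r R) h \<le> (LINT x:annulus r R|lebesgue. norm (grad x)) + 2 * pi * (r + 2 * e) * (H r - rs)"
    by (simp add: d_def mult.assoc)
  then show thesis using that[of h] I(1) Gr GR by simp
qed

end

context radial_extremal
begin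

text \<open>Here \<open>H0\<close> starts at the height \<open>H0 r > rs'\<close> with infinite slope, which for \<open>p = 1\<close> means that the flux tends to \<open>r\<close>.
  By the energy gap every competitor has at least the energy of \<open>H0\<close> plus the cost \<open>2 \<pi> r (H0 r - rs')\<close>
  of the jump, and the steep layers approach this value. A minimizer would realize it, hence agree with \<open>H0\<close> in
  the open annulus, which contradicts its boundary value at the inner circle.\<close>

theorem no_minimizer_if_jump:
  assumes p1: "p = 1" and ar: "a = r" and cont: "continuous_on {r..R} H0"
    and mono: "\<And>\<rho>. r < \<rho> \<Longrightarrow> \<rho> < R \<Longrightarrow> 0 \<le> H0' \<rho>"
    and steep: "(flux \<longlongrightarrow> r) (at_right r)"
    and jump: "0 \<le> rs'" "rs' < H0 r"
  shows "\<not> is_arg_min (energy 1 (annulus r R)) (\<lambda>g. g \<in> radial_monotone_maps 1 r R rs' (H0 R)) h"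
proof
  assume min: "is_arg_min (energy 1 (annulus r R)) (\<lambda>g. g \<in> radial_monotone_maps 1 r R rs' (H0 R)) h"
  then have hC: "h \<in> radial_monotone_maps 1 r R rs' (H0 R)" by (simp add: is_arg_min_def)
  have le: "energy 1 (annulus r R) h \<le> energy 1 (annulus r R) g" if "g \<in> radial_monotone_maps 1 r R rs' (H0 R)" for g
    using min that by (auto simp: is_arg_min_def not_less)
  obtain H g1 g2 where H: "radial_on (annulus r R) H h" "continuous_on {r..R} H" "H \<in> {r..R} \<rightarrow> {rs'..H0 R}"
      "H r = rs'" "H R = H0 R"
    and g: "has_weak_partial (annulus r R) h 1 g1" "has_weak_partial (annulus r R) h \<i> g2"
    and int: "set_integrable lebesgue (annulus r R) (\<lambda>x. norm (g1 x, g2 x) powr 1)"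
    and E: "energy 1 (annulus r R) h = (LINT x:annulus r R|lebesgue. norm (g1 x, g2 x) powr 1)"
    by (rule radial_monotone_mapsE[OF hC zero_le_one])
  have flux_le: "flux \<rho> \<le> R" if \<rho>: "r < \<rho>" "\<rho> < R" for \<rho>
  proof -
    have "H0' \<rho> \<le> gradient_norm H0 H0' \<rho>" unfolding gradient_norm_def by (rule real_le_rsqrt) simp
    then have "H0' \<rho> / gradient_norm H0 H0' \<rho> * \<rho> \<le> 1 * \<rho>"
      using gradient_norm_pos[OF \<rho>] \<rho> rR by (intro mult_right_mono) auto
    moreover have "gradient_norm H0 H0' \<rho> powr (p - 2) = 1 / gradient_norm H0 H0' \<rho>"
      using gradient_norm_pos[OF \<rho>] by (simp add: p1 powr_minus_divide)
    then have "flux \<rho> = H0' \<rho> / gradient_norm H0 H0' \<rho> * \<rho>" by (simp add: flux_def)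
    ultimately show ?thesis using \<rho> by simp
  qed
  have p2: "p < 2" using p1 by simp
  define h0 where "h0 x = H0 (norm x) *\<^sub>R (x /\<^sub>R norm x)" for x :: complex
  have h0: "radial_on (annulus r R) H0 h0" by (simp add: radial_on_def h0_def)
  note W = radial_sobolev[OF cont mono p p2 extremal_growth[OF p2 cont mono flux_le] h0]
  have Hc: "continuous_on {r<..<R} H" by (rule continuous_on_subset[OF H(2)]) auto
  have ge: "rs \<le> H \<rho>" if "r < \<rho>" "\<rho> \<le> a" for \<rho> using that ar by simp
  have d: "((\<lambda>\<rho>. H \<rho> - H0 \<rho>) \<longlongrightarrow> rs' - H0 r) (at_right r)" "((\<lambda>\<rho>. H \<rho> - H0 \<rho>) \<longlongrightarrow> 0) (at_left R)"
    using tendsto_diff[OF Icc_limits(1)[OF H(2)] Icc_limits(1)[OF cont]] tendsto_diff[OF Icc_limits(2)[OF H(2)] Icc_limits(2)[OF cont]] H by auto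
  have B: "((\<lambda>\<rho>. flux \<rho> * (H \<rho> - H0 \<rho>)) \<longlongrightarrow> r * (rs' - H0 r)) (at_right r)"
    by (rule tendsto_mult[OF steep d(1)])
  have B0: "((\<lambda>\<rho>. flux \<rho> * (H \<rho> - H0 \<rho>)) \<longlongrightarrow> 0) (at_left R)"
    using flux_times_tendsto_0[OF p2 cont mono flux_le, of "\<lambda>\<rho>. H \<rho> - H0 \<rho>" "at_left R"] d(2) eventually_between(2)
    by auto
  note gap = energy_gap[OF H(1) g Hc h0 ge int[folded p1] W(2) B B0]
  let ?E0 = "LINT x:annulus r R|lebesgue. norm (M0 x)"
  have up: "energy 1 (annulus r R) h \<le> ?E0 + 2 * pi * (r + 2 * e) * (H0 r - rs')" if e: "0 < e" "e < R - r" for e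
  proof (rule steep_layer_competitor[OF cont mono jump e])
    fix g assume "g \<in> radial_monotone_maps 1 r R rs' (H0 R)"
      "energy 1 (annulus r R) g \<le> ?E0 + 2 * pi * (r + 2 * e) * (H0 r - rs')"
    then show ?thesis using le[of g] by linarith
  qed
  have "((\<lambda>e. ?E0 + 2 * pi * (r + 2 * e) * (H0 r - rs')) \<longlongrightarrow> ?E0 + 2 * pi * (r + 2 * 0) * (H0 r - rs')) (at_right 0)"
    by (intro tendsto_intros)
  moreover have "eventually (\<lambda>e. energy 1 (annulus r R) h \<le> ?E0 + 2 * pi * (r + 2 * e) * (H0 r - rs')) (at_right 0)"
    unfolding eventually_at_right_field using up rR by (intro exI[of _ "R - r"]) auto
  ultimately have "energy 1 (annulus r R) h \<le> ?E0 + 2 * pi * (r + 2 * 0) * (H0 r - rs')"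
    by (rule tendsto_lowerbound) simp
  then have "(LINT x:annulus r R|lebesgue. norm (g1 x, g2 x) powr p) =
       (LINT x:annulus r R|lebesgue. norm (M0 x) powr p) - 2 * pi * p * (r * (rs' - H0 r))"
    using gap(1) E by (simp add: p1 algebra_simps)
  then have ex: "AE x in lebesgue. x \<in> annulus r R \<longrightarrow> excess g1 g2 x = 0" using gap(2) by simp
  have HR: "H0 R > 0"
    using H0_pos[of "(r + R) / 2"] profile_mono[OF cont mono, of "(r + R) / 2" R] rR by simp
  have eq: "H \<rho> = H0 \<rho>" if "r < \<rho>" "\<rho> < R" for \<rho>
    using profile_eq_if_excess_0[OF H(1) g Hc h0 ex _ _ HR that] Icc_limits(2)[OF H(2)] Icc_limits(2)[OF cont] H(5) by simp
  have "eventually (\<lambda>\<rho>. H \<rho> - H0 \<rho> = 0) (at_right r)"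
    using eventually_at_right_real[OF rR(2)] by eventually_elim (simp add: eq)
  then have "((\<lambda>\<rho>. H \<rho> - H0 \<rho>) \<longlongrightarrow> 0) (at_right r)" by (rule tendsto_eventually)
  from tendsto_unique[OF trivial_limit_at_right_real this d(1)] show False using jump by simp
qed

end

section \<open>The flow of the elasticity quotient\<close>

text \<open>For an autonomous equation \<open>y' = 1 / w y\<close> started at \<open>0\<close>, \<open>T y\<close> below is the time at which the value \<open>y\<close> is reached and
  \<open>M\<close> is the solution. The lower bound makes \<open>w\<close> positive on \<open>(0, 1)\<close> and \<open>T\<close> unbounded near \<open>1\<close>, so
  the solution exists for all times and tends to \<open>1\<close>. It is assumed in this form because \<open>w 0\<close> may be \<open>0\<close>.\<close>

locale angle_flow =
  fixes w :: "real \<Rightarrow> real"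
  assumes w_cont: "continuous_on {0..<1} w"
    and w_lower: "\<And>y. 0 \<le> y \<Longrightarrow> y < 1 \<Longrightarrow> y / (2 * (1 - y)) \<le> w y"
begin

definition T :: "real \<Rightarrow> real" where "T y = integral {0..y} w"

definition M :: "real \<Rightarrow> real" where "M = the_inv_into {0..<1} T"

lemma w_pos: "0 < y \<Longrightarrow> y < 1 \<Longrightarrow> 0 < w y"
  using w_lower[of y] by (smt (verit) divide_pos_pos)

lemma T_0 [simp]: "T 0 = 0" by (simp add: T_def)

lemma T_deriv_within:
  assumes "0 \<le> y" "y < 1"
  shows "(T has_real_derivative w y) (at y within {0..<1})"
proof -
  have "(T has_real_derivative w y) (at y within {0..(1 + y) / 2})"
    unfolding T_def[abs_def]
    by (rule integral_has_real_derivative)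
      (use assms in \<open>auto intro!: continuous_on_subset[OF w_cont]\<close>)
  moreover have "at y within {0..(1 + y) / 2} = at y within {0..<1}"
    by (rule at_within_nhd[of _ "{..<(1 + y) / 2}"]) (use assms in auto)
  ultimately show ?thesis by simp
qed

lemma T_deriv: "0 < y \<Longrightarrow> y < 1 \<Longrightarrow> (T has_real_derivative w y) (at y)"
  using T_deriv_within[of y] at_within_interior[of y "{0..<1}"] by auto

lemma T_cont: "continuous_on {0..<1} T"
  using T_deriv_within by (intro DERIV_continuous_on) auto

lemma T_strict_mono:
  assumes "0 \<le> x" "x < y" "y < 1"
  shows "T x < T y"
proof (rule DERIV_pos_imp_increasing_open[OF assms(2)])
  show "\<exists>D. (T has_real_derivative D) (at z) \<and> 0 < D" if "x < z" "z < y" for z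
    using T_deriv[of z] w_pos[of z] that assms by auto
  show "continuous_on {x..y} T" by (rule continuous_on_subset[OF T_cont]) (use assms in auto)
qed

lemma T_inj: "inj_on T {0..<1}"
proof (rule inj_onI)
  fix x y assume "x \<in> {0..<1}" "y \<in> {0..<1}" "T x = T y"
  then show "x = y" using T_strict_mono[of x y] T_strict_mono[of y x]
    by (metis atLeastLessThan_iff less_irrefl linorder_neqE_linordered_idom)
qed

lemma T_nonneg: "0 \<le> y \<Longrightarrow> y < 1 \<Longrightarrow> 0 \<le> T y"
  using T_strict_mono[of 0 y] by (cases "y = 0") auto

lemma T_lower:
  assumes "0 \<le> y" "y < 1"
  shows "(- ln (1 - y) - y) / 2 \<le> T y"
proof -
  have "T 0 - (- ln (1 - 0) - 0) / 2 \<le> T y - (- ln (1 - y) - y) / 2"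
  proof (rule DERIV_nonneg_imp_increasing_open[OF assms(1)])
    show "continuous_on {0..y} (\<lambda>y. T y - (- ln (1 - y) - y) / 2)"
      using assms by (intro continuous_intros continuous_on_subset[OF T_cont]) auto
    fix z assume z: "0 < z" "z < y"
    then have "((\<lambda>y. T y - (- ln (1 - y) - y) / 2) has_real_derivative w z - z / (2 * (1 - z))) (at z)"
      using assms by (auto intro!: derivative_eq_intros T_deriv simp: field_simps)
    then show "\<exists>D. ((\<lambda>y. T y - (- ln (1 - y) - y) / 2) has_real_derivative D) (at z) \<and> 0 \<le> D"
      using w_lower[of z] z assms by (intro exI conjI) auto
  qed
  then show ?thesis by simp
qed

lemma T_surj:
  assumes "0 \<le> s"
  obtains y where "0 \<le> y" "y < 1" "T y = s"
proof -
  define y1 where "y1 = 1 - exp (- (2 * s + 1))"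
  have y1: "0 \<le> y1" "y1 < 1" using assms by (auto simp: y1_def)
  have "2 * s + 1 - y1 \<le> 2 * T y1" using T_lower[OF y1] by (simp add: y1_def)
  then have "s \<le> T y1" using y1 by simp
  moreover have "continuous_on {0..y1} T" by (rule continuous_on_subset[OF T_cont]) (use y1 in auto)
  ultimately have "\<exists>y\<ge>0. y \<le> y1 \<and> T y = s" using IVT'[of T 0 s y1] assms y1 by simp
  then obtain y where "0 \<le> y" "y \<le> y1" "T y = s" by blast
  then show thesis using that[of y] y1 by simp
qed

lemma M_T: "0 \<le> y \<Longrightarrow> y < 1 \<Longrightarrow> M (T y) = y"
  unfolding M_def by (rule the_inv_into_f_f[OF T_inj]) simp

lemma T_M: assumes "0 \<le> s" shows "T (M s) = s" "0 \<le> M s" "M s < 1"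
  using T_surj[OF assms] M_T by metis+

lemma M_0 [simp]: "M 0 = 0" using M_T[of 0] by simp

lemma M_strict_mono: "0 \<le> s \<Longrightarrow> s < t \<Longrightarrow> M s < M t"
  using T_M[of s] T_M[of t] T_strict_mono[of "M t" "M s"]
  by (metis less_asym less_le_trans linorder_neqE_linordered_idom order.strict_iff_not)

lemma M_pos: "0 < s \<Longrightarrow> 0 < M s"
  using M_strict_mono[of 0 s] by simp

lemma M_cont: "continuous_on {0..} M"
proof -
  have "continuous_on {0..b} M" if "0 \<le> b" for b
  proof -
    have "continuous_on (T ` {0..M b}) M"
      by (rule continuous_on_inv[OF continuous_on_subset[OF T_cont]])
        (use T_M[OF that] M_T in auto)
    moreover have "{0..b} \<subseteq> T ` {0..M b}"
    proof
      fix s assume s: "s \<in> {0..b}"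
      then have "M s \<le> M b" using M_strict_mono[of s b] by (cases "s = b") auto
      then show "s \<in> T ` {0..M b}" using s T_M[of s] by (intro image_eqI[of _ _ "M s"]) auto
    qed
    ultimately show ?thesis by (rule continuous_on_subset)
  qed
  then have "continuous (at s within {0..}) M" if "0 \<le> s" for s
  proof -
    have "continuous (at s within {0..s + 1}) M"
      using \<open>\<And>b. 0 \<le> b \<Longrightarrow> continuous_on {0..b} M\<close>[of "s + 1"] that
      by (simp add: continuous_on_eq_continuous_within)
    moreover have "at s within {0..s + 1} = at s within {0..}"
      by (rule at_within_nhd[of _ "{..<s + 1}"]) auto
    ultimately show ?thesis by simp
  qed
  then show ?thesis by (simp add: continuous_on_eq_continuous_within)
qed

lemma M_deriv:
  assumes s: "0 < s"
  shows "(M has_real_derivative inverse (w (M s))) (at s)"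
proof (rule DERIV_inverse_function[of T _ _ _ 0 "s + 1"])
  show "(T has_real_derivative w (M s)) (at (M s))"
    using T_M[of s] M_pos[OF s] s by (intro T_deriv) auto
  show "w (M s) \<noteq> 0" using w_pos[of "M s"] T_M[of s] M_pos[OF s] s by auto
  show "isCont M s"
    using continuous_on_interior[OF M_cont] s by (simp add: interior_Ici)
  show "T (M y) = y" if "0 < y" for y using T_M[of y] that by simp
qed (use s in auto)

lemma M_tendsto_1: "(M \<longlongrightarrow> 1) at_top"
proof (rule order_tendstoI)
  fix c :: real assume c: "c < 1"
  show "eventually (\<lambda>s. c < M s) at_top"
  proof (rule eventually_at_top_linorderI[of "T (max c 0) + 1"])
    fix s assume s: "T (max c 0) + 1 \<le> s"
    have "max c 0 = M (T (max c 0))" using c by (intro M_T[symmetric]) auto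
    also have "\<dots> < M s" using s c by (intro M_strict_mono T_nonneg) auto
    finally show "c < M s" by simp
  qed
next
  fix c :: real assume c: "1 < c"
  show "eventually (\<lambda>s. M s < c) at_top"
    by (rule eventually_at_top_linorderI[of 0]) (use T_M(3) c in force)
qed

end

text \<open>The quotient \<open>\<lambda> = \<rho> H'(\<rho>) / H(\<rho>)\<close> of a solution satisfies, as a function of \<open>ln \<rho>\<close>, an
  autonomous equation with the stationary point \<open>1\<close>. Below this point \<open>ln \<rho>\<close>, as a function of \<open>\<lambda>\<close>, has the
  derivative \<open>slow_time\<close>; above it \<open>ln \<rho>\<close>, as a function of \<open>1 / \<lambda>\<close>, has the derivative \<open>fast_time\<close>. In the
  second case \<open>1 / \<lambda>\<close> is used so that trajectories starting at \<open>\<lambda> = \<infinity>\<close> are included.\<close>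

definition slow_time :: "real \<Rightarrow> real \<Rightarrow> real" where
  "slow_time p y = (1 + (p - 1) * y\<^sup>2) / ((1 + y\<^sup>2) * (1 - y) * (1 + (p - 1) * y))"

definition fast_time :: "real \<Rightarrow> real \<Rightarrow> real" where
  "fast_time p y = (y\<^sup>2 + (p - 1)) / ((1 + y\<^sup>2) * (1 - y) * (y + (p - 1)))"

lemma angle_flow_slow:
  assumes p: "1 \<le> p" "p < 2"
  shows "angle_flow (slow_time p)"
proof
  define q where "q = p - 1"
  have q: "0 \<le> q" "q < 1" using p by (auto simp: q_def)
  have pos: "1 + y\<^sup>2 > 0" "1 + q * y > 0" if "0 \<le> y" for y :: real
    using that q by (auto intro: add_pos_nonneg)
  show "continuous_on {0..<1} (slow_time p)"
    unfolding slow_time_def[abs_def] q_def[symmetric]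
    using pos by (intro continuous_intros ballI) (force simp: less_imp_neq[symmetric])
  show "y / (2 * (1 - y)) \<le> slow_time p y" if y: "0 \<le> y" "y < 1" for y
  proof -
    have y2: "y\<^sup>2 \<le> 1" using y by (simp add: power_le_one)
    have "y * (1 + q * y) \<le> 1 + q * y\<^sup>2" using y by (simp add: algebra_simps power2_eq_square)
    then have "y * (1 + q * y) * (1 + y\<^sup>2) \<le> (1 + q * y\<^sup>2) * 2"
      using y2 y q by (intro mult_mono) auto
    then have "y / 2 \<le> (1 + q * y\<^sup>2) / ((1 + q * y) * (1 + y\<^sup>2))"
      using pos[OF y(1)] by (simp add: pos_le_divide_eq mult_ac)
    then have "y / 2 / (1 - y) \<le> (1 + q * y\<^sup>2) / ((1 + q * y) * (1 + y\<^sup>2)) / (1 - y)"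
      using y by (intro divide_right_mono) auto
    then show ?thesis unfolding slow_time_def q_def[symmetric] by (simp add: mult_ac)
  qed
qed

lemma angle_flow_fast:
  assumes p: "1 \<le> p" "p < 2"
  shows "angle_flow (fast_time p)"
proof
  define q where "q = p - 1"
  have q: "0 \<le> q" "q < 1" using p by (auto simp: q_def)
  have pos: "1 + y\<^sup>2 > 0" for y :: real by (auto intro: add_pos_nonneg)
  show "continuous_on {0..<1} (fast_time p)"
  proof (cases "q = 0")
    case True
    have "(1 + y\<^sup>2) * (1 - y) \<noteq> 0" if "y \<in> {0..<1}" for y :: real
      using pos[of y] that by simp
    then have "continuous_on {0..<1} (\<lambda>y::real. y / ((1 + y\<^sup>2) * (1 - y)))"
      by (intro continuous_intros) auto
    then show ?thesis
      by (rule continuous_on_eq)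
        (use True in \<open>auto simp: fast_time_def q_def[symmetric] power2_eq_square\<close>)
  next
    case False
    have "(1 + y\<^sup>2) * (1 - y) * (y + q) \<noteq> 0" if "y \<in> {0..<1}" for y
      using pos[of y] that q False by simp
    then show ?thesis
      unfolding fast_time_def[abs_def] q_def[symmetric]
      by (intro continuous_intros) auto
  qed
  show "y / (2 * (1 - y)) \<le> fast_time p y" if y: "0 \<le> y" "y < 1" for y
  proof (cases "y = 0")
    case True
    then show ?thesis using q by (simp add: fast_time_def q_def[symmetric])
  next
    case False
    then have y0: "y > 0" "y + q > 0" using y q by auto
    have y2: "y\<^sup>2 \<le> 1" using y by (simp add: power_le_one)
    have "y * (y + q) \<le> y\<^sup>2 + q" using y q by (simp add: algebra_simps power2_eq_square mult_left_le)
    then have "y * (y + q) * (1 + y\<^sup>2) \<le> (y\<^sup>2 + q) * 2"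
      using y2 y q by (intro mult_mono) auto
    then have "y / 2 \<le> (y\<^sup>2 + q) / ((y + q) * (1 + y\<^sup>2))"
      using pos[of y] y0 by (simp add: pos_le_divide_eq mult_ac)
    then have "y / 2 / (1 - y) \<le> (y\<^sup>2 + q) / ((y + q) * (1 + y\<^sup>2)) / (1 - y)"
      using y by (intro divide_right_mono) auto
    then show ?thesis unfolding fast_time_def q_def[symmetric] by (simp add: mult_ac)
  qed
qed

section \<open>The critical function\<close>

locale exponent =
  fixes p :: real
  assumes p: "1 \<le> p" "p < 2"
begin

sublocale slow: angle_flow "slow_time p" by (rule angle_flow_slow[OF p])
sublocale fast: angle_flow "fast_time p" by (rule angle_flow_fast[OF p])

text \<open>For \<open>t = sin\<^sup>2 \<theta>\<close> this is \<open>tan \<theta>\<close>. The substitution \<open>\<lambda> = angle t\<close> turns the integrand \<open>phi\<close> into \<open>slow_time\<close>.\<close>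

definition angle :: "real \<Rightarrow> real" where "angle t = sqrt t / sqrt (1 - t)"

lemma angle_deriv:
  assumes t: "0 < t" "t < 1"
  shows "(angle has_real_derivative 1 / (2 * sqrt t * sqrt (1 - t) * (1 - t))) (at t)"
proof -
  have s: "sqrt t > 0" "sqrt (1 - t) > 0" using t by auto
  have tt: "sqrt t * sqrt t = t" "sqrt (1 - t) * sqrt (1 - t) = 1 - t" using t by auto
  have "(angle has_real_derivative ((inverse (sqrt t) / 2) * sqrt (1 - t) - sqrt t * (- (inverse (sqrt (1 - t)) / 2)))
      / (sqrt (1 - t) * sqrt (1 - t))) (at t)"
    unfolding angle_def[abs_def] using t
    by (auto intro!: derivative_eq_intros simp: field_simps)
  also have "((inverse (sqrt t) / 2) * sqrt (1 - t) - sqrt t * (- (inverse (sqrt (1 - t)) / 2)))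
      / (sqrt (1 - t) * sqrt (1 - t)) = (sqrt (1 - t) * sqrt (1 - t) + sqrt t * sqrt t) / (2 * sqrt t * sqrt (1 - t)) / (1 - t)"
    using s tt(2) by (simp add: field_simps)
  also have "\<dots> = 1 / (2 * sqrt t * sqrt (1 - t) * (1 - t))"
    unfolding tt using t by simp
  finally show ?thesis .
qed

lemma angle_range: assumes "0 \<le> t" "t < 1/2" shows "0 \<le> angle t" "angle t < 1"
proof -
  show "0 \<le> angle t" using assms by (simp add: angle_def)
  have "sqrt t < sqrt (1 - t)" "sqrt (1 - t) > 0" using assms by auto
  then show "angle t < 1" by (simp add: angle_def)
qed

lemma Phi_eq:
  assumes t: "0 \<le> t" "t < 1/2"
  shows "Phi p t = slow.T (angle t)"
proof -
  have "(phi p has_integral slow.T (angle t) - slow.T (angle 0)) {0..t}"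
  proof (rule fundamental_theorem_of_calculus_interior[OF t(1)])
    have "continuous_on {0..t} angle"
      unfolding angle_def[abs_def] using t by (intro continuous_intros) auto
    then show "continuous_on {0..t} (\<lambda>t. slow.T (angle t))"
      by (rule continuous_on_compose2[OF slow.T_cont]) (use angle_range t in auto)
    fix x assume x: "x \<in> {0<..<t}"
    define y where "y = angle x"
    have s: "sqrt x > 0" "sqrt (1 - x) > 0" using x t by auto
    have y: "0 < y" "y < 1" using angle_range[of x] x t s by (auto simp: y_def angle_def)
    have "((\<lambda>t. slow.T (angle t)) has_real_derivative slow_time p y * (1 / (2 * sqrt x * sqrt (1 - x) * (1 - x)))) (at x)"
      unfolding y_def by (rule DERIV_chain2[OF slow.T_deriv angle_deriv]) (use x t y y_def in auto)
    moreover have "slow_time p y * (1 / (2 * sqrt x * sqrt (1 - x) * (1 - x))) = phi p x"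
    proof -
      define S where "S = sqrt x" define C where "C = sqrt (1 - x)"
      have SC: "S > 0" "C > 0" "S < C" using x t by (auto simp: S_def C_def)
      have S2: "x = S\<^sup>2" and C2: "1 - x = C\<^sup>2" using x t by (auto simp: S_def C_def)
      then have one: "S\<^sup>2 + C\<^sup>2 = 1" by simp
      have yS: "y = S / C" by (simp add: y_def angle_def S_def C_def)
      have f1: "1 + (p - 1) * y\<^sup>2 = (1 - (2 - p) * x) / C\<^sup>2"
      proof -
        have "1 + (p - 1) * y\<^sup>2 = (C\<^sup>2 + (p - 1) * S\<^sup>2) / C\<^sup>2" using SC by (simp add: yS power_divide field_simps)
        also have "C\<^sup>2 + (p - 1) * S\<^sup>2 = 1 - (2 - p) * x" unfolding C2[symmetric] S2[symmetric] by (simp add: algebra_simps)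
        finally show ?thesis .
      qed
      have f2: "1 + y\<^sup>2 = 1 / C\<^sup>2"
        using SC one by (simp add: yS power_divide field_simps)
      have f3: "(1 - y) * (1 + (p - 1) * y) = (1 - p * x - (2 - p) * S * C) / C\<^sup>2"
      proof -
        have "(1 - y) * (1 + (p - 1) * y) = ((C - S) * (C + (p - 1) * S)) / C\<^sup>2"
          using SC by (simp add: yS field_simps power2_eq_square)
        also have "(C - S) * (C + (p - 1) * S) = C\<^sup>2 - (p - 1) * S\<^sup>2 - (2 - p) * S * C"
          by (simp add: algebra_simps power2_eq_square)
        also have "\<dots> = 1 - p * x - (2 - p) * S * C"
          unfolding C2[symmetric] S2[symmetric] by (simp add: algebra_simps)
        finally show ?thesis .
      qed
      have cancel: "A / C\<^sup>2 / (1 / C\<^sup>2 * (B / C\<^sup>2)) = A * C\<^sup>2 / B"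
        "A / (2 * S * C * B) = A * C\<^sup>2 / B * (1 / (2 * S * C * C\<^sup>2))" for A B
        using SC by (cases "B = 0"; simp add: field_simps)+
      have "slow_time p y = (1 + (p - 1) * y\<^sup>2) / ((1 + y\<^sup>2) * ((1 - y) * (1 + (p - 1) * y)))"
        by (simp add: slow_time_def mult.assoc)
      also have "\<dots> = (1 - (2 - p) * x) * C\<^sup>2 / (1 - p * x - (2 - p) * S * C)"
        unfolding f1 f2 f3 by (rule cancel)
      finally have st: "slow_time p y = (1 - (2 - p) * x) * C\<^sup>2 / (1 - p * x - (2 - p) * S * C)" .
      have "phi p x = (1 - (2 - p) * x) / (2 * S * C * (1 - p * x - (2 - p) * S * C))"
        by (simp add: phi_def S_def C_def)
      also have "\<dots> = (1 - (2 - p) * x) * C\<^sup>2 / (1 - p * x - (2 - p) * S * C) * (1 / (2 * S * C * C\<^sup>2))"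
        by (rule cancel)
      finally have ph: "phi p x = (1 - (2 - p) * x) * C\<^sup>2 / (1 - p * x - (2 - p) * S * C) * (1 / (2 * S * C * C\<^sup>2))" .
      have "2 * sqrt x * sqrt (1 - x) * (1 - x) = 2 * S * C * C\<^sup>2"
        using C2 by (simp add: S_def C_def)
      then show ?thesis unfolding ph st by (simp only:)
    qed
    ultimately show "((\<lambda>t. slow.T (angle t)) has_vector_derivative phi p x) (at x)"
      by (simp add: has_real_derivative_iff_has_vector_derivative[symmetric])
  qed
  then show ?thesis by (simp add: Phi_def integral_unique angle_def)
qed

lemma Phi_inv_eq:
  assumes s: "0 \<le> s"
  shows "sqrt (Phi_inv p s) / sqrt (1 - Phi_inv p s) = slow.M s"
proof -
  define m where "m = slow.M s"
  have m: "0 \<le> m" "m < 1" "slow.T m = s" using slow.T_M[OF s] by (auto simp: m_def)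
  define t where "t = m\<^sup>2 / (1 + m\<^sup>2)"
  have m1: "1 + m\<^sup>2 > 0" by (auto intro: add_pos_nonneg)
  have m2: "m\<^sup>2 < 1" using m by (simp add: power_less_one_iff)
  have t: "0 \<le> t" "t < 1/2" using m2 m1 by (auto simp: t_def field_simps)
  have "1 - t = 1 / (1 + m\<^sup>2)" using m1 by (simp add: t_def field_simps)
  then have a: "angle t = m"
    using m m1 by (simp add: angle_def t_def real_sqrt_divide)
  have inj: "inj_on (Phi p) {0..<1/2}"
  proof (rule inj_onI)
    fix x y assume xy: "x \<in> {0..<1/2}" "y \<in> {0..<1/2}" "Phi p x = Phi p y"
    then have "slow.T (angle x) = slow.T (angle y)" using Phi_eq by auto
    then have "angle x = angle y"
      using slow.T_inj angle_range xy unfolding inj_on_def by (metis atLeastLessThan_iff)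
    then have "(angle x)\<^sup>2 = (angle y)\<^sup>2" by simp
    then have "x / (1 - x) = y / (1 - y)" using xy by (simp add: angle_def power_divide)
    then show "x = y" using xy by (simp add: field_simps)
  qed
  have "Phi p t = s" using Phi_eq[OF t] a m by simp
  then have "Phi_inv p s = t"
    unfolding Phi_inv_def using the_inv_into_f_f[OF inj, of t] t by auto
  then show ?thesis using a by (simp add: angle_def m_def)
qed

text \<open>The profile in logarithmic coordinates whose elasticity quotient is the slow trajectory; it is continued
  by the constant \<open>1\<close>, as required by a plateau.\<close>

definition grow :: "real \<Rightarrow> real" where
  "grow s = (if s \<le> 0 then 1 else exp (integral {0..s} slow.M))"

definition slope :: "real \<Rightarrow> real" where
  "slope s = (if s \<le> 0 then 0 else slow.M s)"

lemma slope_cont: "continuous_on UNIV slope"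
proof -
  have "continuous_on ({..0} \<union> {0..}) (\<lambda>s. if s \<le> 0 then 0 else slow.M s)"
    by (rule continuous_on_cases) (auto intro: slow.M_cont continuous_intros)
  moreover have "{..0} \<union> {0..} = (UNIV :: real set)" by auto
  ultimately show ?thesis unfolding slope_def[abs_def] by simp
qed

text \<open>With \<open>-1\<close> as the lower limit the integral can be differentiated on both sides of \<open>0\<close>.\<close>

lemma grow_alt: "-1 < s \<Longrightarrow> grow s = exp (integral {-1..s} slope)"
proof -
  have z: "integral {-1..u} slope = 0" if "u \<le> 0" for u
  proof -
    have "integral {-1..u} slope = integral {-1..u} (\<lambda>x::real. 0)"
      by (rule Henstock_Kurzweil_Integration.integral_cong) (use that in \<open>auto simp: slope_def\<close>)
    then show ?thesis by simp
  qed
  assume s: "-1 < s"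
  show ?thesis
  proof (cases "s \<le> 0")
    case False
    have "integral {-1..s} slope = integral {-1..0} slope + integral {0..s} slope"
      using False continuous_on_subset[OF slope_cont]
      by (intro Henstock_Kurzweil_Integration.integral_combine[symmetric] integrable_continuous_real) auto
    moreover have "integral {0..s} slope = integral {0..s} slow.M"
      by (rule Henstock_Kurzweil_Integration.integral_cong) (auto simp: slope_def)
    ultimately show ?thesis using False z[of 0] by (simp add: grow_def)
  qed (simp add: z grow_def)
qed

lemma grow_deriv: "(grow has_real_derivative slope s * grow s) (at s)"
proof (cases "s < 0")
  case True
  have "((\<lambda>s. 1) has_real_derivative slope s * grow s) (at s)" using True by (simp add: slope_def)
  then show ?thesis
    by (rule has_field_derivative_transform_within_open[of _ _ _ "{..<0}"]) (use True in \<open>auto simp: grow_def\<close>)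
next
  case False
  have "((\<lambda>s. integral {-1..s} slope) has_real_derivative slope s) (at s within {-1..s+1})"
    by (rule integral_has_real_derivative) (use False continuous_on_subset[OF slope_cont] in auto)
  then have "((\<lambda>s. integral {-1..s} slope) has_real_derivative slope s) (at s)"
    using False by (simp add: at_within_Icc_at)
  then have "((\<lambda>s. exp (integral {-1..s} slope)) has_real_derivative slope s * grow s) (at s)"
    using False by (auto intro!: derivative_eq_intros simp: grow_alt)
  then show ?thesis
    by (rule has_field_derivative_transform_within_open[of _ _ _ "{-1<..}"]) (use False in \<open>auto simp: grow_alt\<close>)
qed

lemma grow_pos: "grow s > 0" by (simp add: grow_def)

lemma grow_0 [simp]: "grow 0 = 1" by (simp add: grow_def)

lemma grow_cont: "continuous_on S grow"
  using grow_deriv by (auto intro!: continuous_at_imp_continuous_on DERIV_isCont)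

lemma slope_range: "0 \<le> slope s" "slope s < 1" "0 < s \<Longrightarrow> 0 < slope s"
  using slow.T_M[of s] slow.M_pos[of s] by (auto simp: slope_def)

lemma grow_strict_mono: "0 \<le> s \<Longrightarrow> s < t \<Longrightarrow> grow s < grow t"
proof (rule DERIV_pos_imp_increasing_open[of s t grow])
  show "\<exists>D. (grow has_real_derivative D) (at x) \<and> 0 < D" if "0 \<le> s" "s < x" for x
    using grow_deriv[of x] slope_range(3)[of x] grow_pos[of x] that
    by (intro exI[of _ "slope x * grow x"] conjI) auto
qed (auto intro: grow_cont)

lemma crit_eq:
  assumes x: "1 \<le> x"
  shows "crit p (ereal x) = ereal (grow (ln x))"
proof -
  have "((\<lambda>s. sqrt (Phi_inv p (ln s)) / (s * sqrt (1 - Phi_inv p (ln s)))) has_integral ln (grow (ln x)) - ln (grow (ln 1))) {1..x}"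
  proof (rule fundamental_theorem_of_calculus[OF x])
    fix s assume s: "s \<in> {1..x}"
    have "((\<lambda>s. ln (grow (ln s))) has_real_derivative inverse (grow (ln s)) * (slope (ln s) * grow (ln s) * inverse s)) (at s)"
      by (rule DERIV_chain2[OF DERIV_ln[OF grow_pos] DERIV_chain2[OF grow_deriv DERIV_ln]]) (use s in auto)
    moreover have "inverse (grow (ln s)) * (slope (ln s) * grow (ln s) * inverse s) =
        sqrt (Phi_inv p (ln s)) / (s * sqrt (1 - Phi_inv p (ln s)))"
    proof -
      have "slope (ln s) = slow.M (ln s)" using s by (auto simp: slope_def le_less)
      then have "slope (ln s) = sqrt (Phi_inv p (ln s)) / sqrt (1 - Phi_inv p (ln s))"
        using Phi_inv_eq[of "ln s"] s by simp
      moreover have "inverse (grow (ln s)) * (slope (ln s) * grow (ln s) * inverse s) = slope (ln s) / s"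
        using grow_pos[of "ln s"] by (simp add: field_simps)
      ultimately show ?thesis by (simp add: mult.commute)
    qed
    ultimately show "((\<lambda>s. ln (grow (ln s))) has_vector_derivative sqrt (Phi_inv p (ln s)) / (s * sqrt (1 - Phi_inv p (ln s)))) (at s within {1..x})"
      by (metis has_field_derivative_at_within has_real_derivative_iff_has_vector_derivative)
  qed
  then show ?thesis using grow_pos[of "ln x"] by (simp add: crit_def integral_unique)
qed

lemma crit_infinity [simp]: "crit p \<infinity> = \<infinity>" by (simp add: crit_def)

text \<open>Since \<open>slope\<close> tends to \<open>1\<close>, \<open>grow\<close> is unbounded, so \<open>crit p\<close> maps \<open>(1, \<infinity>]\<close> onto itself.\<close>

lemma slope_tendsto_1: "(slope \<longlongrightarrow> 1) at_top"
proof (rule Lim_transform_eventually[OF slow.M_tendsto_1])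
  show "eventually (\<lambda>s. slow.M s = slope s) at_top"
    by (rule eventually_at_top_linorderI[of 1]) (simp add: slope_def)
qed

lemma grow_surj:
  assumes y: "1 \<le> y"
  obtains s where "0 \<le> s" "grow s = y" "1 < y \<Longrightarrow> 0 < s"
proof -
  have "eventually (\<lambda>s. 1/2 < slope s) at_top"
    using order_tendstoD(1)[OF slope_tendsto_1, of "1/2"] by simp
  then obtain N0 where N0: "\<And>s. N0 \<le> s \<Longrightarrow> 1/2 < slope s"
    unfolding eventually_at_top_linorder by blast
  define N where "N = max N0 0"
  have lb: "grow N * exp (d / 2) \<le> grow (N + d)" if d: "0 \<le> d" for d
  proof -
    have "ln (grow (N + 0)) - 0 / 2 \<le> ln (grow (N + d)) - d / 2"
    proof (rule DERIV_nonneg_imp_nondecreasing[OF d])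
      fix x :: real assume x: "0 \<le> x"
      have "((\<lambda>d. ln (grow (N + d)) - d / 2) has_real_derivative slope (N + x) - 1/2) (at x)"
        using grow_pos[of "N + x"]
        by (auto intro!: derivative_eq_intros DERIV_chain2[OF grow_deriv])
      moreover have "N0 \<le> N + x" using x unfolding N_def by linarith
      then have "1/2 < slope (N + x)" by (rule N0)
      ultimately show "\<exists>D. ((\<lambda>d. ln (grow (N + d)) - d / 2) has_real_derivative D) (at x) \<and> 0 \<le> D"
        by (intro exI[of _ "slope (N + x) - 1/2"] conjI) simp_all
    qed
    then have "ln (grow N) + d / 2 \<le> ln (grow (N + d))" by simp
    then have "exp (ln (grow N) + d / 2) \<le> exp (ln (grow (N + d)))" by simp
    then show ?thesis using grow_pos by (simp add: exp_add)
  qed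
  have "N \<ge> 0" by (simp add: N_def)
  have "grow N \<ge> 1" using grow_strict_mono[of 0 N] \<open>N \<ge> 0\<close> by (cases "N = 0") auto
  have "y \<le> exp (ln y)" using y by simp
  also have "\<dots> \<le> grow N * exp (2 * ln y / 2)" using \<open>grow N \<ge> 1\<close> by simp
  also have "\<dots> \<le> grow (N + 2 * ln y)" using y by (intro lb) simp
  finally obtain s where s: "0 \<le> s" "grow s = y"
    using IVT'[of grow 0 y "N + 2 * ln y"] y \<open>N \<ge> 0\<close> grow_cont by auto
  moreover have "0 < s" if "1 < y" using s that by (cases "s = 0") auto
  ultimately show thesis using that by blast
qed

lemma crit_strict_mono: "strict_mono_on {1<..} (crit p)"
proof (rule strict_mono_onI)
  fix x y :: ereal assume xy: "x \<in> {1<..}" "y \<in> {1<..}" "x < y"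
  then obtain x' where x': "x = ereal x'" "1 < x'" by (cases x) auto
  show "crit p x < crit p y"
  proof (cases y)
    case (real y')
    then have "ln x' < ln y'" using xy x' by simp
    then have "grow (ln x') < grow (ln y')" using x' by (intro grow_strict_mono) auto
    then show ?thesis using x' real xy by (simp add: crit_eq)
  qed (use xy x' in \<open>auto simp: crit_eq\<close>)
qed

lemma crit_maps: "crit p \<in> {1<..} \<rightarrow> {1<..}"
proof
  fix x :: ereal assume x: "x \<in> {1<..}"
  show "crit p x \<in> {1<..}"
  proof (cases x)
    case (real x')
    then show ?thesis using x grow_strict_mono[of 0 "ln x'"] by (simp add: crit_eq)
  qed (use x in auto)
qed

lemma crit_inv_eq:
  assumes "0 < k"
  shows "crit_inv p (ereal (grow k)) = ereal (exp k)"
proof -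
  have "crit p (ereal (exp k)) = ereal (grow k)" using assms crit_eq[of "exp k"] by simp
  moreover have "ereal (exp k) \<in> {1<..}" using assms by simp
  ultimately show ?thesis
    unfolding crit_inv_def
    using the_inv_into_f_f[OF strict_mono_on_imp_inj_on[OF crit_strict_mono], of "ereal (exp k)"] by simp
qed

lemma crit_inv_infinity: "crit_inv p \<infinity> = \<infinity>"
  unfolding crit_inv_def
  using the_inv_into_f_f[OF strict_mono_on_imp_inj_on[OF crit_strict_mono], of \<infinity>] by simp

end

section \<open>Solutions of the Euler-Lagrange equation\<close>

text \<open>The right hand side of the autonomous equation for the elasticity quotient: \<open>1 / slow_time p l\<close>.\<close>

definition elasticity_rate :: "real \<Rightarrow> real \<Rightarrow> real" where
  "elasticity_rate p l = (1 - l) * (1 + (p - 1) * l) * (1 + l\<^sup>2) / (1 + (p - 1) * l\<^sup>2)"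

lemma has_derivative_at_left_end:
  fixes f g :: "real \<Rightarrow> real"
  assumes ab: "a < b" and f: "continuous_on {a..b} f" and g: "continuous_on {a..b} g"
    and f': "\<And>t. a < t \<Longrightarrow> t < b \<Longrightarrow> (f has_real_derivative g t) (at t)"
  shows "(f has_real_derivative g a) (at a within {a..})"
proof -
  have eq: "f t = f a + integral {a..t} g" if t: "t \<in> {a..b}" for t
  proof -
    have "(g has_integral f t - f a) {a..t}"
      by (rule fundamental_theorem_of_calculus_interior)
        (use t f' continuous_on_subset[OF f] in \<open>auto simp: has_real_derivative_iff_has_vector_derivative[symmetric]\<close>)
    then show ?thesis by (simp add: integral_unique)
  qed
  have "((\<lambda>t. integral {a..t} g) has_real_derivative g a) (at a within {a..b})"
    by (rule integral_has_real_derivative[OF g]) (use ab in auto)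
  from DERIV_add[OF DERIV_const this, of "f a"]
  have "((\<lambda>t. f a + integral {a..t} g) has_real_derivative g a) (at a within {a..b})" by simp
  then have "(f has_real_derivative g a) (at a within {a..b})"
  proof (rule has_field_derivative_transform_within[where d = 1])
    show "f a + integral {a..x} g = f x" if "x \<in> {a..b}" for x by (rule eq[OF that, symmetric])
  qed (use ab in auto)
  moreover have "at a within {a..b} = at a within {a..}"
    by (rule at_within_nhd[of _ "{..<b}"]) (use ab in auto)
  ultimately show ?thesis by simp
qed

text \<open>A profile given in logarithmic coordinates: \<open>H0 \<rho> = c E(ln (\<rho> / \<alpha>))\<close>, where \<open>L\<close> is the
  logarithmic derivative of \<open>E\<close>, hence the elasticity quotient of \<open>H0\<close>.\<close>

locale log_profile = exponent p for p +
  fixes r a c \<alpha> rs :: real and E L H0 :: "real \<Rightarrow> real"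
  assumes r0: "0 \<le> r" "r \<le> a" and c\<alpha>: "0 < c" "0 < \<alpha>"
    and H0: "\<And>\<rho>. r < \<rho> \<Longrightarrow> H0 \<rho> = c * E (ln (\<rho> / \<alpha>))"
    and E: "\<And>\<rho>. r < \<rho> \<Longrightarrow> (E has_real_derivative L (ln (\<rho> / \<alpha>)) * E (ln (\<rho> / \<alpha>))) (at (ln (\<rho> / \<alpha>)))"
      "\<And>\<rho>. r < \<rho> \<Longrightarrow> 0 < E (ln (\<rho> / \<alpha>))"
    and L: "\<And>\<rho>. r < \<rho> \<Longrightarrow> isCont L (ln (\<rho> / \<alpha>))" "\<And>\<rho>. r < \<rho> \<Longrightarrow> 0 \<le> L (ln (\<rho> / \<alpha>))"
      "\<And>\<rho>. a < \<rho> \<Longrightarrow> (L has_real_derivative elasticity_rate p (L (ln (\<rho> / \<alpha>)))) (at (ln (\<rho> / \<alpha>)))"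
    and flat_part: "\<And>\<rho>. r < \<rho> \<Longrightarrow> \<rho> \<le> a \<Longrightarrow> L (ln (\<rho> / \<alpha>)) = 0 \<and> H0 \<rho> = rs"
begin

definition lam :: "real \<Rightarrow> real" where "lam \<rho> = L (ln (\<rho> / \<alpha>))"

definition H0' :: "real \<Rightarrow> real" where "H0' \<rho> = lam \<rho> * H0 \<rho> / \<rho>"

definition log_flux :: "real \<Rightarrow> real" where
  "log_flux \<rho> = H0 \<rho> powr (p - 1) * \<rho> powr (2 - p) * (1 + (lam \<rho>)\<^sup>2) powr ((p - 2) / 2) * lam \<rho>"

lemma log_deriv: "0 < \<rho> \<Longrightarrow> ((\<lambda>\<rho>. ln (\<rho> / \<alpha>)) has_real_derivative 1 / \<rho>) (at \<rho>)"
  using c\<alpha> by (auto intro!: derivative_eq_intros simp: field_simps)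

lemma H0_pos': "r < \<rho> \<Longrightarrow> 0 < H0 \<rho>"
  using H0 E(2) c\<alpha> by simp

lemma H0_deriv:
  assumes \<rho>: "r < \<rho>"
  shows "(H0 has_real_derivative H0' \<rho>) (at \<rho>)"
proof -
  have "((\<lambda>\<rho>. c * E (ln (\<rho> / \<alpha>))) has_real_derivative c * (L (ln (\<rho> / \<alpha>)) * E (ln (\<rho> / \<alpha>)) * (1 / \<rho>))) (at \<rho>)"
    by (rule DERIV_cmult[OF DERIV_chain2[OF E(1)[OF \<rho>] log_deriv]]) (use \<rho> r0 in simp)
  then have "((\<lambda>\<rho>. c * E (ln (\<rho> / \<alpha>))) has_real_derivative H0' \<rho>) (at \<rho>)"
    by (simp add: H0'_def lam_def H0[OF \<rho>] mult_ac)
  then show ?thesis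
    by (rule has_field_derivative_transform_within_open[of _ _ _ "{r<..}"]) (use \<rho> H0 in auto)
qed

lemma lam_cont: "continuous_on {r<..} lam"
proof (intro continuous_at_imp_continuous_on ballI)
  fix \<rho> assume "\<rho> \<in> {r<..}"
  then have \<rho>: "r < \<rho>" "0 < \<rho>" using r0 by auto
  then show "isCont lam \<rho>"
    unfolding lam_def using isCont_o2[OF DERIV_isCont[OF log_deriv] L(1)] by blast
qed

lemma H0_cont: "continuous_on {r<..} H0"
  using H0_deriv by (auto intro!: continuous_at_imp_continuous_on DERIV_isCont)

lemma H0'_cont: "continuous_on {r<..} H0'"
  unfolding H0'_def[abs_def] using r0 by (intro continuous_intros lam_cont H0_cont) auto

lemma gradient_norm_log:
  assumes "r < \<rho>"
  shows "gradient_norm H0 H0' \<rho> = H0 \<rho> / \<rho> * sqrt (1 + (lam \<rho>)\<^sup>2)"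
proof -
  have pos: "H0 \<rho> > 0" "\<rho> > 0" using H0_pos'[OF assms] assms r0 by auto
  have "(H0' \<rho>)\<^sup>2 + (H0 \<rho> / \<rho>)\<^sup>2 = (H0 \<rho> / \<rho>)\<^sup>2 * (1 + (lam \<rho>)\<^sup>2)"
    by (simp add: H0'_def power_mult_distrib power_divide add_divide_distrib algebra_simps)
  then show ?thesis unfolding gradient_norm_def using pos by (simp add: real_sqrt_mult)
qed

lemma gradient_norm_powr:
  assumes \<rho>: "r < \<rho>"
  shows "gradient_norm H0 H0' \<rho> powr (p - 2) * H0 \<rho> =
    H0 \<rho> powr (p - 1) * \<rho> powr (2 - p) * (1 + (lam \<rho>)\<^sup>2) powr ((p - 2) / 2)"
proof -
  have pos: "0 < H0 \<rho>" "0 < \<rho>" using H0_pos'[OF \<rho>] \<rho> r0 by auto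
  have one: "1 + (lam \<rho>)\<^sup>2 > 0" by (auto intro: add_pos_nonneg)
  have "sqrt (1 + (lam \<rho>)\<^sup>2) powr (p - 2) = (1 + (lam \<rho>)\<^sup>2) powr ((p - 2) / 2)"
    using one by (simp add: powr_half_sqrt[symmetric] powr_powr)
  moreover have "(H0 \<rho> / \<rho>) powr (p - 2) = H0 \<rho> powr (p - 2) * \<rho> powr (2 - p)"
    using pos powr_minus_divide[of \<rho> "p - 2"] by (simp add: powr_divide)
  moreover have "H0 \<rho> powr (p - 2) * H0 \<rho> = H0 \<rho> powr (p - 1)"
    using powr_mult_base[of "H0 \<rho>" "p - 2"] pos by (simp add: mult.commute)
  moreover have "gradient_norm H0 H0' \<rho> powr (p - 2) = (H0 \<rho> / \<rho>) powr (p - 2) * sqrt (1 + (lam \<rho>)\<^sup>2) powr (p - 2)"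
    unfolding gradient_norm_log[OF \<rho>] using pos one by (subst powr_mult) auto
  ultimately show ?thesis by (simp add: mult_ac)
qed

lemma flux_log: "r < \<rho> \<Longrightarrow> gradient_norm H0 H0' \<rho> powr (p - 2) * H0' \<rho> * \<rho> = log_flux \<rho>"
  using gradient_norm_powr[of \<rho>] r0 by (simp add: H0'_def log_flux_def)

lemma hoop_log:
  "r < \<rho> \<Longrightarrow> gradient_norm H0 H0' \<rho> powr (p - 2) * H0 \<rho> / \<rho> =
    H0 \<rho> powr (p - 1) * \<rho> powr (2 - p) * (1 + (lam \<rho>)\<^sup>2) powr ((p - 2) / 2) / \<rho>"
  using gradient_norm_powr[of \<rho>] by simp

text \<open>Taking the logarithmic derivative of the flux, the Euler-Lagrange equation turns into the
  autonomous equation for the elasticity quotient.\<close>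

lemma log_flux_deriv:
  assumes \<rho>: "a < \<rho>"
  shows "(log_flux has_real_derivative gradient_norm H0 H0' \<rho> powr (p - 2) * H0 \<rho> / \<rho>) (at \<rho>)"
proof -
  have r\<rho>: "r < \<rho>" "0 < \<rho>" using \<rho> r0 by auto
  define l where "l = lam \<rho>"
  define l' where "l' = elasticity_rate p l / \<rho>"
  define A where "A = H0 \<rho> powr (p - 1)"
  define B where "B = \<rho> powr (2 - p)"
  define C where "C = (1 + l\<^sup>2) powr ((p - 2) / 2)"
  have H: "0 < H0 \<rho>" by (rule H0_pos'[OF r\<rho>(1)])
  have one: "1 + l\<^sup>2 > 0" by (auto intro: add_pos_nonneg)
  have two: "1 + (p - 1) * l\<^sup>2 > 0" using p by (auto intro: add_pos_nonneg)
  have pw: "((\<lambda>z. z powr k) has_real_derivative k * (z powr k) / z) (at z)" if "z > 0" for k z :: real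
    using that by (auto intro!: derivative_eq_intros simp: powr_diff)
  have dl: "(lam has_real_derivative l') (at \<rho>)"
    unfolding lam_def[abs_def] l'_def l_def
    using DERIV_chain2[OF L(3)[OF \<rho>] log_deriv[OF r\<rho>(2)]] by (simp add: lam_def)
  have dA: "((\<lambda>\<rho>. H0 \<rho> powr (p - 1)) has_real_derivative (p - 1) * A * l / \<rho>) (at \<rho>)"
    by (rule DERIV_cong[OF DERIV_chain2[OF pw[OF H, of "p - 1"] H0_deriv[OF r\<rho>(1)]]])
      (use H in \<open>simp add: A_def H0'_def l_def\<close>)
  have dB: "((\<lambda>\<rho>. \<rho> powr (2 - p)) has_real_derivative (2 - p) * B / \<rho>) (at \<rho>)"
    unfolding B_def by (rule pw[OF r\<rho>(2)])
  have "((\<lambda>\<rho>. 1 + (lam \<rho>)\<^sup>2) has_real_derivative 2 * l * l') (at \<rho>)"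
    by (auto intro!: derivative_eq_intros dl simp: l_def)
  from DERIV_chain2[OF pw[OF one, of "(p - 2) / 2", unfolded l_def] this]
  have dC: "((\<lambda>\<rho>. (1 + (lam \<rho>)\<^sup>2) powr ((p - 2) / 2)) has_real_derivative (p - 2) * C * l * l' / (1 + l\<^sup>2)) (at \<rho>)"
    by (rule DERIV_cong) (use one in \<open>simp add: C_def l_def field_simps\<close>)
  have "(log_flux has_real_derivative
     (((p - 1) * A * l / \<rho> * B + (2 - p) * B / \<rho> * A) * C + (p - 2) * C * l * l' / (1 + l\<^sup>2) * (A * B)) * l + l' * (A * B * C)) (at \<rho>)"
    unfolding log_flux_def[abs_def]
    using DERIV_mult[OF DERIV_mult[OF DERIV_mult[OF dA dB] dC] dl] by (simp add: A_def B_def C_def l_def)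
  moreover have "(((p - 1) * A * l / \<rho> * B + (2 - p) * B / \<rho> * A) * C + (p - 2) * C * l * l' / (1 + l\<^sup>2) * (A * B)) * l + l' * (A * B * C)
     = A * B * C / \<rho>"
  proof -
    have "(((p - 1) * A * l / \<rho> * B + (2 - p) * B / \<rho> * A) * C + (p - 2) * C * l * l' / (1 + l\<^sup>2) * (A * B)) * l + l' * (A * B * C)
      = A * B * C / \<rho> * (((p - 1) * l + (2 - p)) * l) + A * B * C * (l' * (1 + (p - 2) * l\<^sup>2 / (1 + l\<^sup>2)))"
      by (simp add: algebra_simps power2_eq_square add_divide_distrib diff_divide_distrib)
    also have "1 + (p - 2) * l\<^sup>2 / (1 + l\<^sup>2) = (1 + (p - 1) * l\<^sup>2) / (1 + l\<^sup>2)"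
      using one by (simp add: field_simps)
    also have "l' * ((1 + (p - 1) * l\<^sup>2) / (1 + l\<^sup>2)) = (1 - l) * (1 + (p - 1) * l) / \<rho>"
      using one two by (simp add: l'_def elasticity_rate_def)
    finally show ?thesis by (simp add: algebra_simps power2_eq_square add_divide_distrib diff_divide_distrib)
  qed
  ultimately show ?thesis
    unfolding hoop_log[OF r\<rho>(1)] by (simp add: A_def B_def C_def l_def)
qed

lemma log_flux_cont: "continuous_on {r<..} log_flux"
proof -
  have "1 + (lam \<rho>)\<^sup>2 \<noteq> 0" for \<rho> using add_pos_nonneg[of 1 "(lam \<rho>)\<^sup>2"] by simp
  then show ?thesis
    unfolding log_flux_def[abs_def] using r0 H0_pos'
    by (intro continuous_intros lam_cont H0_cont) (auto simp: less_imp_neq[symmetric])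
qed

lemma hoop_log_cont: "continuous_on {r<..} (\<lambda>\<rho>. gradient_norm H0 H0' \<rho> powr (p - 2) * H0 \<rho> / \<rho>)"
proof -
  have "1 + (lam \<rho>)\<^sup>2 \<noteq> 0" for \<rho> using add_pos_nonneg[of 1 "(lam \<rho>)\<^sup>2"] by simp
  then have "continuous_on {r<..} (\<lambda>\<rho>. H0 \<rho> powr (p - 1) * \<rho> powr (2 - p) * (1 + (lam \<rho>)\<^sup>2) powr ((p - 2) / 2) / \<rho>)"
    using r0 H0_pos'
    by (intro continuous_intros lam_cont H0_cont) (auto simp: less_imp_neq[symmetric])
  then show ?thesis by (rule continuous_on_eq) (simp add: hoop_log)
qed

lemma log_flux_mono:
  assumes "r < x" "x \<le> y"
  shows "log_flux x \<le> log_flux y"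
proof (cases "x \<le> a")
  case True
  then have "log_flux x = 0" using flat_part[of x] assms by (simp add: log_flux_def lam_def)
  moreover have "0 \<le> log_flux y" using L(2)[of y] assms by (simp add: log_flux_def lam_def)
  ultimately show ?thesis by simp
next
  case False
  show ?thesis
  proof (rule DERIV_nonneg_imp_nondecreasing[OF assms(2)])
    fix z assume z: "x \<le> z"
    then have "0 \<le> gradient_norm H0 H0' z powr (p - 2) * H0 z / z"
      using H0_pos'[of z] assms r0 by auto
    then show "\<exists>D. (log_flux has_real_derivative D) (at z) \<and> 0 \<le> D"
      using log_flux_deriv[of z] False z by force
  qed
qed

lemma extremal:
  assumes R: "a < R"
  shows "radial_extremal r R H0 H0' p a rs"
proof
  show "0 \<le> r" "r < R" "1 \<le> p" "r \<le> a" "a < R" using r0 R p by auto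
  show "(H0 has_real_derivative H0' \<rho>) (at \<rho>)" if "r < \<rho>" for \<rho> by (rule H0_deriv[OF that])
  show "continuous_on {r<..<R} H0'" by (rule continuous_on_subset[OF H0'_cont]) auto
  show "0 < H0 \<rho>" if "r < \<rho>" for \<rho> by (rule H0_pos'[OF that])
  show "H0' \<rho> = 0 \<and> H0 \<rho> = rs" if "r < \<rho>" "\<rho> \<le> a" for \<rho>
    using flat_part[OF that] by (simp add: H0'_def lam_def)
  fix \<rho> assume \<rho>: "r < \<rho>" "a \<le> \<rho>" "\<rho> < R"
  let ?h = "\<lambda>\<rho>. gradient_norm H0 H0' \<rho> powr (p - 2) * H0 \<rho> / \<rho>"
  have "(log_flux has_real_derivative ?h \<rho>) (at \<rho> within {a..})"
  proof (cases "a = \<rho>")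
    case True
    have "(log_flux has_real_derivative ?h a) (at a within {a..})"
    proof (rule has_derivative_at_left_end[OF R])
      show "continuous_on {a..R} log_flux" by (rule continuous_on_subset[OF log_flux_cont]) (use True \<rho> in auto)
      show "continuous_on {a..R} ?h" by (rule continuous_on_subset[OF hoop_log_cont]) (use True \<rho> in auto)
    qed (rule log_flux_deriv)
    then show ?thesis using True by simp
  next
    case False
    then show ?thesis using \<rho> by (intro has_field_derivative_at_within[OF log_flux_deriv]) simp
  qed
  moreover have "eventually (\<lambda>x. log_flux x = gradient_norm H0 H0' x powr (p - 2) * H0' x * x) (nhds \<rho>)"
    using eventually_nhds_in_open[of "{r<..}" \<rho>] \<rho>(1) by (auto elim!: eventually_mono simp: flux_log)
  then have "eventually (\<lambda>x. log_flux x = gradient_norm H0 H0' x powr (p - 2) * H0' x * x) (at \<rho> within {a..})"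
    by (auto simp: eventually_at_filter elim: eventually_mono)
  ultimately show "((\<lambda>\<rho>. gradient_norm H0 H0' \<rho> powr (p - 2) * H0' \<rho> * \<rho>) has_real_derivative ?h \<rho>) (at \<rho> within {a..})"
    using \<rho> by (subst (asm) has_field_derivative_cong_eventually) (auto simp: flux_log)
qed

theorem log_profile_minimizer:
  assumes R: "a < R" and cont: "continuous_on {r..R} H0" and ends: "H0 r = rs" "H0 R = Rs" and rs: "0 \<le> rs"
  defines "h0 \<equiv> \<lambda>x :: complex. H0 (norm x) *\<^sub>R (x /\<^sub>R norm x)"
  shows "is_unique_minimizer (annulus r R) (energy p (annulus r R)) (radial_monotone_maps p r R rs Rs) h0"
    "h0 \<in> radial_monotone_maps p r R rs Rs"
    "(\<And>\<rho>. r < \<rho> \<Longrightarrow> \<rho> < R \<Longrightarrow> 0 < lam \<rho>) \<Longrightarrow> h0 \<in> radial_homeos p r R rs Rs"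
proof -
  interpret X: radial_extremal r R H0 H0' p a rs by (rule extremal[OF R])
  have mono: "0 \<le> H0' \<rho>" if "r < \<rho>" "\<rho> < R" for \<rho>
    using L(2)[of \<rho>] H0_pos'[of \<rho>] that r0 by (auto simp: H0'_def lam_def)
  have F: "X.flux \<rho> \<le> log_flux R" if "r < \<rho>" "\<rho> < R" for \<rho>
    unfolding X.flux_def flux_log[OF that(1)] using that by (intro log_flux_mono) auto
  have h0: "radial_on (annulus r R) H0 h0" by (simp add: radial_on_def h0_def)
  show min: "is_unique_minimizer (annulus r R) (energy p (annulus r R)) (radial_monotone_maps p r R rs Rs) h0"
    using X.extremal_unique_minimizer[OF p(2) cont mono F ends h0] by simp
  then show C: "h0 \<in> radial_monotone_maps p r R rs Rs"
    by (simp add: is_unique_minimizer_def is_arg_min_def)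
  assume pos: "\<And>\<rho>. r < \<rho> \<Longrightarrow> \<rho> < R \<Longrightarrow> 0 < lam \<rho>"
  show "h0 \<in> radial_homeos p r R rs Rs"
  proof (rule radial_homeoI[OF X.rR rs cont _ ends h0])
    show "h0 \<in> sobolev_W1 p (annulus r R)" using C by (simp add: radial_monotone_maps_def)
    show "strict_mono_on {r..R} H0"
    proof (rule strict_mono_onI)
      fix x y assume xy: "x \<in> {r..R}" "y \<in> {r..R}" "x < y"
      show "H0 x < H0 y"
      proof (rule DERIV_pos_imp_increasing_open[OF xy(3)])
        show "continuous_on {x..y} H0" by (rule continuous_on_subset[OF cont]) (use xy in auto)
        fix z assume z: "x < z" "z < y"
        then have "r < z" "z < R" using xy by auto
        then have "0 < H0' z" using pos[of z] H0_pos'[of z] r0 by (auto simp: H0'_def)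
        then show "\<exists>D. (H0 has_real_derivative D) (at z) \<and> 0 < D"
          using H0_deriv[of z] \<open>r < z\<close> by blast
      qed
    qed
  qed
qed

end

section \<open>The five regimes\<close>

text \<open>The logarithmic derivative of \<open>E\<close> tends to \<open>1\<close>, so far out \<open>E\<close> grows by the factor \<open>exp l\<close> over a distance \<open>l\<close>,
  as the linear profile does.\<close>

lemma quotient_shift_tendsto:
  fixes E L :: "real \<Rightarrow> real"
  assumes E: "\<And>s. 0 < s \<Longrightarrow> (E has_real_derivative L s * E s) (at s)" "\<And>s. 0 < s \<Longrightarrow> 0 < E s"
    and L: "(L \<longlongrightarrow> 1) at_top" and l: "0 < l"
  shows "((\<lambda>s. E s / E (s + l)) \<longlongrightarrow> exp (- l)) at_top"
proof -
  have "((\<lambda>s. ln (E (s + l)) - ln (E s)) \<longlongrightarrow> l) at_top"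
  proof (rule tendstoI)
    fix e :: real assume e: "e > 0"
    have "eventually (\<lambda>s. dist (L s) 1 < e / l) at_top" using tendstoD[OF L, of "e / l"] e l by simp
    then obtain N where N: "\<And>s. N \<le> s \<Longrightarrow> dist (L s) 1 < e / l" unfolding eventually_at_top_linorder by blast
    show "eventually (\<lambda>s. dist (ln (E (s + l)) - ln (E s)) l < e) at_top"
    proof (rule eventually_at_top_linorderI[of "max N 1"])
      fix s assume s: "max N 1 \<le> s"
      have d: "((\<lambda>s. ln (E s)) has_real_derivative L x) (at x)" if "s \<le> x" for x
      proof -
        have "x > 0" using that s by simp
        then show ?thesis
          using E(2)[of x] by (intro DERIV_cong[OF DERIV_chain2[OF DERIV_ln[OF E(2)[of x]] E(1)[of x]]]) auto
      qed
      obtain z where z: "s < z" "z < s + l" "ln (E (s + l)) - ln (E s) = (s + l - s) * L z"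
        using MVT2[of s "s + l" "\<lambda>s. ln (E s)" L] d l by auto
      have "ln (E (s + l)) - ln (E s) - l = l * (L z - 1)" using z(3) by (simp add: algebra_simps)
      then have "dist (ln (E (s + l)) - ln (E s)) l = l * dist (L z) 1"
        using l by (simp add: dist_real_def abs_mult)
      also have "\<dots> < l * (e / l)" using N[of z] z s l by (intro mult_strict_left_mono) auto
      finally show "dist (ln (E (s + l)) - ln (E s)) l < e" using l by simp
    qed
  qed
  then have "((\<lambda>s. exp (- (ln (E (s + l)) - ln (E s)))) \<longlongrightarrow> exp (- l)) at_top"
    by (intro tendsto_intros)
  then show ?thesis
  proof (rule Lim_transform_eventually)
    show "eventually (\<lambda>s. exp (- (ln (E (s + l)) - ln (E s))) = E s / E (s + l)) at_top"
    proof (rule eventually_at_top_linorderI[of 1])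
      fix s :: real assume "1 \<le> s"
      then show "exp (- (ln (E (s + l)) - ln (E s))) = E s / E (s + l)"
        using E(2)[of s] E(2)[of "s + l"] l by (simp add: exp_diff)
    qed
  qed
qed

text \<open>The ratio of the boundary values of a translated profile depends continuously on the translation and
  runs from its value without translation to that of the linear profile.\<close>

lemma quotient_shift_attains:
  fixes E L :: "real \<Rightarrow> real"
  assumes E: "\<And>s. 0 < s \<Longrightarrow> (E has_real_derivative L s * E s) (at s)" "\<And>s. 0 < s \<Longrightarrow> 0 < E s"
    and L: "(L \<longlongrightarrow> 1) at_top" and l: "0 < l" and cont: "continuous_on {0..} E"
    and k: "(E 0 / E l \<le> k \<and> k < exp (- l)) \<or> (exp (- l) < k \<and> k \<le> E 0 / E l)"
  obtains s where "0 \<le> s" "E s / E (s + l) = k"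
proof -
  let ?Q = "\<lambda>s. E s / E (s + l)"
  note T = quotient_shift_tendsto[OF E L l]
  have "continuous_on {0..} (\<lambda>s. E (s + l))"
    by (rule continuous_on_compose2[OF cont]) (use l in \<open>auto intro!: continuous_intros\<close>)
  then have "continuous_on {0..} ?Q"
    using cont E(2) l by (intro continuous_intros) (auto simp: less_imp_neq[symmetric])
  then have c: "continuous_on {0..N} ?Q" for N by (rule continuous_on_subset) auto
  have "\<exists>s\<ge>0. ?Q s = k"
    using k
  proof
    assume k: "E 0 / E l \<le> k \<and> k < exp (- l)"
    then have "eventually (\<lambda>s. k < ?Q s) at_top" using order_tendstoD(1)[OF T] by blast
    then obtain N where N: "\<And>s. N \<le> s \<Longrightarrow> k < ?Q s" unfolding eventually_at_top_linorder by blast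
    show ?thesis using IVT'[of ?Q 0 k "max N 0"] c k N[of "max N 0"] by auto
  next
    assume k: "exp (- l) < k \<and> k \<le> E 0 / E l"
    then have "eventually (\<lambda>s. ?Q s < k) at_top" using order_tendstoD(2)[OF T] by blast
    then obtain N where N: "\<And>s. N \<le> s \<Longrightarrow> ?Q s < k" unfolding eventually_at_top_linorder by blast
    show ?thesis using IVT2'[of ?Q "max N 0" k 0] c k N[of "max N 0"] by auto
  qed
  then show thesis using that by blast
qed

context exponent
begin

abbreviation unique_min :: "real \<Rightarrow> real \<Rightarrow> real \<Rightarrow> real \<Rightarrow> (complex \<Rightarrow> complex) \<Rightarrow> bool" where
  "unique_min r R rs Rs h \<equiv>
    is_unique_minimizer (annulus r R) (energy p (annulus r R)) (radial_monotone_maps p r R rs Rs) h"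

lemma slope_deriv:
  assumes s: "0 < s"
  shows "(slope has_real_derivative elasticity_rate p (slope s)) (at s)"
proof -
  have "inverse (slow_time p (slow.M s)) = elasticity_rate p (slope s)"
    using s by (simp add: slow_time_def elasticity_rate_def slope_def mult_ac)
  then have "(slow.M has_real_derivative elasticity_rate p (slope s)) (at s)"
    using slow.M_deriv[OF s] by simp
  then show ?thesis
    by (rule has_field_derivative_transform_within_open[of _ _ _ "{0<..}"]) (use s in \<open>auto simp: slope_def\<close>)
qed

lemma slope_isCont: "isCont slope s"
  using slope_cont by (simp add: continuous_on_eq_continuous_at)

text \<open>The plateau ends at the radius \<open>a\<close> with \<open>grow (ln (R / a)) = Rs / rs\<close>, which lies in the annulus precisely because
  the ratio \<open>Rs / rs\<close> is below the critical value, which is infinite for \<open>r = 0\<close>. A mapping with a plateau takes values of norm \<open>rs\<close> inside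
  the annulus, so it does not map into the open target.\<close>

lemma plateau_regime:
  assumes r: "0 \<le> r" "r < R" and rs: "0 < rs" "rs < Rs"
    and small: "0 < r \<Longrightarrow> Rs / rs < grow (ln (R / r))"
  shows "\<exists>h. unique_min r R rs Rs h \<and> h \<in> radial_monotone_maps p r R rs Rs - radial_homeos p r R rs Rs"
proof -
  obtain k where k: "0 < k" "grow k = Rs / rs"
    using grow_surj[of "Rs / rs"] rs by auto
  define a where "a = R * exp (- k)"
  have R0: "R > 0" using r by simp
  have a: "0 < a" "a < R" using k R0 by (auto simp: a_def)
  have "R / a = exp k" using R0 by (simp add: a_def exp_minus field_simps)
  then have lnRa: "ln (R / a) = k" by simp
  have ra: "r < a"
  proof (cases "r = 0")
    case False
    then have "grow k < grow (ln (R / r))" using small k r by simp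
    moreover have "0 < ln (R / r)" "0 < R / r" using r False by auto
    ultimately have "k < ln (R / r)"
      using grow_strict_mono[of "ln (R / r)" k] by (metis less_asym less_imp_le less_irrefl linorder_neqE_linordered_idom)
    then have "exp k < exp (ln (R / r))" by simp
    then have "exp k < R / r" using \<open>0 < R / r\<close> by simp
    then show ?thesis using r False by (simp add: a_def exp_minus field_simps)
  qed (use a in simp)
  define H0 where "H0 \<rho> = rs * grow (ln (\<rho> / a))" for \<rho>
  have low: "ln (\<rho> / a) \<le> 0" if "0 \<le> \<rho>" "\<rho> \<le> a" for \<rho> using that a by (cases "\<rho> = 0") auto
  have H0_low: "H0 \<rho> = rs" if "0 \<le> \<rho>" "\<rho> \<le> a" for \<rho> using low[OF that] by (simp add: H0_def grow_def)
  interpret X: log_profile p r a rs a rs grow slope H0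
  proof
    show "(slope has_real_derivative elasticity_rate p (slope (ln (\<rho> / a)))) (at (ln (\<rho> / a)))" if "a < \<rho>" for \<rho>
      using that a by (intro slope_deriv) simp
    show "slope (ln (\<rho> / a)) = 0 \<and> H0 \<rho> = rs" if "r < \<rho>" "\<rho> \<le> a" for \<rho>
      using that r low[of \<rho>] H0_low[of \<rho>] by (simp add: slope_def)
  qed (use r ra a rs grow_deriv grow_pos slope_range slope_isCont in \<open>auto simp: H0_def\<close>)
  have "continuous_on ({r..a} \<union> {a..R}) H0"
  proof (rule continuous_on_closed_Un)
    show "continuous_on {r..a} H0"
      by (rule continuous_on_eq[of _ "\<lambda>x. rs"]) (use H0_low r in auto)
    show "continuous_on {a..R} H0"
      unfolding H0_def by (intro continuous_intros continuous_on_compose2[OF grow_cont[of UNIV]]) (use a in auto)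
  qed auto
  moreover have "{r..a} \<union> {a..R} = {r..R}" using ra a by auto
  ultimately have cont: "continuous_on {r..R} H0" by simp
  have ends: "H0 r = rs" "H0 R = Rs" using H0_low[of r] r ra k rs by (auto simp: H0_def lnRa)
  note res = X.log_profile_minimizer[OF a(2) cont ends less_imp_le[OF rs(1)]]
  let ?h = "\<lambda>x :: complex. H0 (norm x) *\<^sub>R (x /\<^sub>R norm x)"
  have "?h \<notin> radial_homeos p r R rs Rs"
  proof
    assume "?h \<in> radial_homeos p r R rs Rs"
    then obtain g where g: "homeomorphism (annulus r R) (annulus rs Rs) ?h g"
      by (auto simp: radial_homeos_def sobolev_homeos_def)
    define x where "x = complex_of_real ((r + a) / 2)"
    have nx: "norm x = (r + a) / 2" using r ra unfolding x_def norm_of_real by simp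
    then have "x \<in> annulus r R" using ra a by (simp add: annulus_def)
    then have "?h x \<in> annulus rs Rs" using homeomorphism_image1[OF g] by blast
    moreover have "x \<noteq> 0" using nx r ra by auto
    then have "norm (?h x) = \<bar>H0 (norm x)\<bar>" by (simp add: abs_mult)
    then have "norm (?h x) = rs" unfolding nx using r ra H0_low[of "(r + a) / 2"] rs by simp
    ultimately show False by (simp add: annulus_def)
  qed
  then show ?thesis using res(1,2) by blast
qed

text \<open>The shift \<open>\<sigma>\<close> places the annulus on the trajectory: its inner radius corresponds to the time \<open>\<sigma>\<close>.\<close>

lemma shifted_regime:
  assumes r: "0 < r" "r < R" and rs: "0 \<le> rs" "rs < Rs"
    and E: "\<And>s. 0 < s \<Longrightarrow> (E has_real_derivative L s * E s) (at s)" "\<And>s. 0 < s \<Longrightarrow> 0 < E s"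
    and L: "\<And>s. 0 < s \<Longrightarrow> (L has_real_derivative elasticity_rate p (L s)) (at s)" "\<And>s. 0 < s \<Longrightarrow> 0 < L s"
    and cont: "continuous_on {0..} E"
    and \<sigma>: "0 \<le> \<sigma>" "E \<sigma> / E (\<sigma> + ln (R / r)) = rs / Rs"
  shows "\<exists>h. unique_min r R rs Rs h \<and> h \<in> radial_homeos p r R rs Rs"
proof -
  define \<alpha> where "\<alpha> = r * exp (- \<sigma>)"
  define c where "c = Rs / E (\<sigma> + ln (R / r))"
  define H0 where "H0 \<rho> = c * E (ln (\<rho> / \<alpha>))" for \<rho>
  have l: "0 < ln (R / r)" using r by simp
  have Epos: "0 < E (\<sigma> + ln (R / r))" using E(2) \<sigma> l by simp
  have c\<alpha>: "0 < c" "0 < \<alpha>" using Epos rs r by (auto simp: c_def \<alpha>_def)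
  have ln_eq: "ln (\<rho> / \<alpha>) = \<sigma> + ln (\<rho> / r)" if "0 < \<rho>" for \<rho>
  proof -
    have "\<rho> / \<alpha> = exp \<sigma> * (\<rho> / r)" using r by (simp add: \<alpha>_def exp_minus field_simps)
    then have "ln (\<rho> / \<alpha>) = ln (exp \<sigma> * (\<rho> / r))" by (simp only:)
    also have "\<dots> = \<sigma> + ln (\<rho> / r)" by (subst ln_mult) (use that r in auto)
    finally show ?thesis .
  qed
  have pos: "0 < ln (\<rho> / \<alpha>)" if "r < \<rho>" for \<rho>
    using ln_eq[of \<rho>] that r \<sigma> by (simp add: add_nonneg_pos)
  interpret X: log_profile p r r c \<alpha> rs E L H0
  proof
    show "H0 \<rho> = c * E (ln (\<rho> / \<alpha>))" for \<rho> by (simp add: H0_def)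
    show "(E has_real_derivative L (ln (\<rho> / \<alpha>)) * E (ln (\<rho> / \<alpha>))) (at (ln (\<rho> / \<alpha>)))"
      "0 < E (ln (\<rho> / \<alpha>))" "isCont L (ln (\<rho> / \<alpha>))" "0 \<le> L (ln (\<rho> / \<alpha>))"
      "(L has_real_derivative elasticity_rate p (L (ln (\<rho> / \<alpha>)))) (at (ln (\<rho> / \<alpha>)))" if "r < \<rho>" for \<rho>
      using E[OF pos[OF that]] L[OF pos[OF that]] DERIV_isCont by auto
  qed (use r c\<alpha> in auto)
  have nonneg: "0 \<le> ln (\<rho> / \<alpha>)" if "\<rho> \<in> {r..R}" for \<rho>
    using ln_eq[of \<rho>] that r \<sigma> by simp
  have cont0: "continuous_on {r..R} H0"
    unfolding H0_def using c\<alpha> r nonneg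
    by (intro continuous_intros continuous_on_compose2[OF cont]) auto
  have ends: "H0 r = rs" "H0 R = Rs"
    using ln_eq[of r] ln_eq[of R] r \<sigma>(2) Epos rs by (auto simp: H0_def c_def field_simps)
  show ?thesis
    using X.log_profile_minimizer[OF r(2) cont0 ends rs(1)] L(2) pos by (auto simp: X.lam_def)
qed

lemma slow_regime:
  assumes r: "0 < r" "r < R" and rs: "0 < rs" "rs < Rs"
    and k: "grow (ln (R / r)) \<le> Rs / rs" "Rs / rs < R / r"
  shows "\<exists>h. unique_min r R rs Rs h \<and> h \<in> radial_homeos p r R rs Rs"
proof -
  have l: "0 < ln (R / r)" using r by simp
  have "exp (- ln (R / r)) = r / R" using r by (simp add: exp_minus)
  moreover have "r / R < rs / Rs"
  proof -
    have "Rs * r < R * rs" using k(2) r rs by (simp add: field_simps)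
    then show ?thesis using r rs by (simp add: field_simps)
  qed
  moreover have "rs / Rs \<le> grow 0 / grow (ln (R / r))"
  proof -
    have "grow (ln (R / r)) * rs \<le> Rs" using k(1) rs by (simp add: pos_le_divide_eq)
    then show ?thesis using rs grow_pos[of "ln (R / r)"] by (simp add: divide_le_eq pos_le_divide_eq mult.commute)
  qed
  ultimately have "exp (- ln (R / r)) < rs / Rs \<and> rs / Rs \<le> grow 0 / grow (ln (R / r))" by simp
  then obtain \<sigma> where "0 \<le> \<sigma>" "grow \<sigma> / grow (\<sigma> + ln (R / r)) = rs / Rs"
    using quotient_shift_attains[OF grow_deriv grow_pos slope_tendsto_1 l grow_cont] by metis
  then show ?thesis
    using shifted_regime[OF r less_imp_le[OF rs(1)] rs(2) grow_deriv grow_pos slope_deriv slope_range(3) grow_cont] by blast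
qed

lemma linear_regime:
  assumes r: "0 \<le> r" "r < R" and rs: "0 \<le> rs" "rs < Rs" and eq: "rs * R = r * Rs"
  shows "\<exists>h. unique_min r R rs Rs h \<and> h \<in> radial_homeos p r R rs Rs"
proof -
  define H0 where "H0 \<rho> = Rs / R * \<rho>" for \<rho>
  interpret X: log_profile p r r "Rs / R" 1 rs exp "\<lambda>s. 1" H0
    by unfold_locales (use r rs in \<open>auto simp: H0_def elasticity_rate_def intro!: derivative_eq_intros\<close>)
  have "continuous_on {r..R} H0" unfolding H0_def by (intro continuous_intros)
  moreover have "H0 r = rs" "H0 R = Rs" using eq r rs by (auto simp: H0_def field_simps)
  ultimately show ?thesis
    using X.log_profile_minimizer[OF r(2) _ _ _ rs(1)] by (auto simp: X.lam_def)
qed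

text \<open>The profile in logarithmic coordinates with elasticity quotient \<open>1 / fast.M\<close>. Its logarithm is an antiderivative of
  \<open>fast_time p m / m\<close> with respect to \<open>m = fast.M s\<close>. For \<open>p > 1\<close> it follows from partial fractions, where the multiple of
  \<open>s\<close> replaces an arctangent, and the integrand behaves like \<open>1 / m\<close> near \<open>0\<close>, so the profile starts at \<open>0\<close>.
  For \<open>p = 1\<close> the integrand is \<open>slow_time p m\<close>, which is bounded near \<open>0\<close>, so the profile starts at a positive value.\<close>

definition fast_grow :: "real \<Rightarrow> real" where
  "fast_grow s = (if p = 1 then exp (slow.T (fast.M s)) else
     fast.M s * exp ((- (2 - p) * s + (1 - p / 2) * ln (1 + (fast.M s)\<^sup>2) - ln (1 - fast.M s) - ln (fast.M s + (p - 1))) / p))"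

lemma fast_time_one: "p = 1 \<Longrightarrow> 0 < y \<Longrightarrow> fast_time p y = y * slow_time p y"
  by (simp add: fast_time_def slow_time_def power2_eq_square)

lemma fast_grow_one: "p = 1 \<Longrightarrow> fast_grow = (\<lambda>s. exp (slow.T (fast.M s)))"
  unfolding fast_grow_def[abs_def] by (rule ext) (rule if_P)

definition fast_slope :: "real \<Rightarrow> real" where
  "fast_slope s = inverse (fast.M s)"

lemma fast_M: "0 < s \<Longrightarrow> 0 < fast.M s" "0 < s \<Longrightarrow> fast.M s < 1"
  using fast.M_pos[of s] fast.T_M[of s] by auto

lemma fast_grow_pos: "0 < s \<Longrightarrow> 0 < fast_grow s"
  using fast_M[of s] by (simp add: fast_grow_def)

lemma fast_slope_pos: "0 < s \<Longrightarrow> 0 < fast_slope s"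
  using fast_M[of s] by (simp add: fast_slope_def)

lemma fast_slope_deriv:
  assumes s: "0 < s"
  shows "(fast_slope has_real_derivative elasticity_rate p (fast_slope s)) (at s)"
proof -
  define m where "m = fast.M s"
  define q where "q = p - 1"
  have m: "0 < m" "m < 1" using fast_M[OF s] by (auto simp: m_def)
  have q: "0 \<le> q" using p by (simp add: q_def)
  have nz: "m\<^sup>2 + q > 0" "m + q > 0" "1 + m\<^sup>2 > 0" using m q by (auto intro: add_pos_nonneg)
  have "(fast_slope has_real_derivative - (inverse m * inverse (fast_time p m) * inverse m)) (at s)"
    unfolding fast_slope_def[abs_def] m_def using DERIV_inverse'[OF fast.M_deriv[OF s]] m by (simp add: m_def)
  moreover have "- (inverse m * inverse (fast_time p m) * inverse m) = elasticity_rate p (inverse m)"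
  proof -
    have "1 - inverse m = - (1 - m) / m" "1 + q * inverse m = (m + q) / m" "1 + (inverse m)\<^sup>2 = (1 + m\<^sup>2) / m\<^sup>2"
      "1 + q * (inverse m)\<^sup>2 = (m\<^sup>2 + q) / m\<^sup>2"
      using m by (auto simp: field_simps power2_eq_square)
    then have "elasticity_rate p (inverse m) = (- (1 - m) / m) * ((m + q) / m) * ((1 + m\<^sup>2) / m\<^sup>2) / ((m\<^sup>2 + q) / m\<^sup>2)"
      unfolding elasticity_rate_def q_def[symmetric] by simp
    also have "\<dots> = - ((1 - m) * (m + q) * (1 + m\<^sup>2) / (m\<^sup>2 + q)) * inverse m * inverse m"
    proof -
      have "- N / m * (C / m) * (A / m\<^sup>2) / (D / m\<^sup>2) = - (N * C * A / D) * inverse m * inverse m" for N C A D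
        using m by (simp add: field_simps power2_eq_square)
      then show ?thesis .
    qed
    finally show ?thesis
      unfolding fast_time_def q_def[symmetric] by (simp add: mult_ac)
  qed
  ultimately show ?thesis by (simp add: fast_slope_def m_def)
qed

lemma fast_grow_deriv:
  assumes s: "0 < s"
  shows "(fast_grow has_real_derivative fast_slope s * fast_grow s) (at s)"
proof -
  define m where "m = fast.M s"
  define q where "q = p - 1"
  define d where "d = inverse (fast_time p m)"
  have m: "0 < m" "m < 1" using fast_M[OF s] by (auto simp: m_def)
  have q: "0 \<le> q" "q < 1" using p by (auto simp: q_def)
  have nz: "m\<^sup>2 + q > 0" "m + q > 0" "1 + m\<^sup>2 > 0" "1 - m > 0" using m q by (auto intro: add_pos_nonneg)
  have dM: "(fast.M has_real_derivative d) (at s)" using fast.M_deriv[OF s] by (simp add: d_def m_def)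
  show ?thesis
  proof (cases "p = 1")
    case True
    have "((\<lambda>s. exp (slow.T (fast.M s))) has_real_derivative exp (slow.T m) * (slow_time p m * d)) (at s)"
      unfolding m_def using m
      by (intro DERIV_chain2[OF DERIV_exp] DERIV_chain2[OF slow.T_deriv dM]) (auto simp: m_def)
    moreover have "slow_time p m * d = inverse m"
      using slow.w_pos[OF m] unfolding d_def fast_time_one[OF True m(1)] by (simp add: field_simps)
    ultimately show ?thesis
      unfolding fast_grow_one[OF True] by (simp add: fast_slope_def m_def mult.commute)
  next
    case False
    define F where "F s = (- (2 - p) * s + (1 - p / 2) * ln (1 + (fast.M s)\<^sup>2) - ln (1 - fast.M s) - ln (fast.M s + (p - 1))) / p" for s
    define F' where "F' = (- (2 - p) * 1 + (1 - p / 2) * (inverse (1 + m\<^sup>2) * (2 * m * d))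
      - inverse (1 - m) * (- d) - inverse (m + q) * d) / p"
    have nz': "1 + (fast.M s)\<^sup>2 > 0" "1 - fast.M s > 0" "fast.M s + (p - 1) > 0" using nz by (auto simp: m_def q_def)
    have i1: "((\<lambda>s. 1 + (fast.M s)\<^sup>2) has_real_derivative 2 * m * d) (at s)"
      and i2: "((\<lambda>s. 1 - fast.M s) has_real_derivative - d) (at s)"
      and i3: "((\<lambda>s. fast.M s + (p - 1)) has_real_derivative d) (at s)"
      by (auto intro!: derivative_eq_intros dM simp: m_def)
    have "(F has_real_derivative F') (at s)"
      unfolding F_def[abs_def] F'_def m_def q_def
      by (intro DERIV_cdivide DERIV_diff DERIV_add DERIV_cmult DERIV_ident
          DERIV_chain2[OF DERIV_ln] i1[unfolded m_def] i2 i3 nz')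
    then have "((\<lambda>s. fast.M s * exp (F s)) has_real_derivative d * exp (F s) + exp (F s) * F' * m) (at s)"
      unfolding m_def by (intro DERIV_mult dM DERIV_chain2[OF DERIV_exp])
    \<comment> \<open>The derivative of \<open>m exp F\<close> has to be \<open>exp F\<close>.\<close>
    moreover have "d + F' * m = 1"
    proof -
      define A B C D where "A = 1 + m\<^sup>2" and "B = 1 - m" and "C = m + q" and "D = m\<^sup>2 + q"
      have ABCD: "A > 0" "B > 0" "C > 0" "D > 0" using nz by (auto simp: A_def B_def C_def D_def)
      have pq: "p = 1 + q" by (simp add: q_def)
      have d: "d = A * B * C / D" unfolding d_def fast_time_def q_def[symmetric] by (simp add: A_def B_def C_def D_def)
      have "1 - p / 2 = (1 - q) / 2" using pq by argo
      then have "(1 - p / 2) * (inverse A * (2 * m * d)) = (1 - q) * (m * d / A)"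
        by (simp only: divide_inverse) simp
      moreover have "p * F' = - (2 - p) * 1 + (1 - p / 2) * (inverse A * (2 * m * d)) - inverse B * (- d) - inverse C * d"
        using p by (simp add: F'_def A_def B_def C_def)
      moreover have "inverse B * (- d) = - (d / B)" "inverse C * d = d / C" "- (2 - p) * 1 = - (1 - q)"
        by (simp_all add: divide_inverse mult.commute pq)
      ultimately have "p * F' = - (1 - q) + (1 - q) * (m * d / A) + d / B - d / C"
        by linarith
      moreover have "p * (d + F' * m) = p * d + m * (p * F')" by (simp add: algebra_simps)
      ultimately have "p * (d + F' * m) = p * d + m * (- (1 - q) + (1 - q) * (m * d / A) + d / B - d / C)"
        by simp
      also have "\<dots> = (p * (A * B * C) + m * (- (1 - q) * D + (1 - q) * m * B * C + A * C - A * B)) / D"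
      proof -
        define u where "u = inverse D"
        have "m * d / A = m * B * C * u" "d / B = A * C * u" "d / C = A * B * u" "d = A * B * C * u" "D * u = 1"
          using ABCD by (auto simp: d u_def divide_inverse)
        moreover have "- (1 - q) = - (1 - q) * (D * u)" using \<open>D * u = 1\<close> by simp
        ultimately have "p * d + m * (- (1 - q) + (1 - q) * (m * d / A) + d / B - d / C) =
            p * (A * B * C * u) + m * (- (1 - q) * (D * u) + (1 - q) * (m * B * C * u) + A * C * u - A * B * u)"
          by metis
        then show ?thesis by (simp add: divide_inverse u_def[symmetric] algebra_simps)
      qed
      also have "p * (A * B * C) + m * (- (1 - q) * D + (1 - q) * m * B * C + A * C - A * B) = p * D"
        unfolding A_def B_def C_def D_def pq by (simp add: algebra_simps power2_eq_square)
      finally show ?thesis using ABCD p by simp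
    qed
    then have "d * exp (F s) + exp (F s) * F' * m = exp (F s)"
      by (metis distrib_left mult.assoc mult.commute mult.right_neutral)
    ultimately have "((\<lambda>s. fast.M s * exp (F s)) has_real_derivative exp (F s)) (at s)" by simp
    moreover have fg: "fast_grow = (\<lambda>s. fast.M s * exp (F s))"
      using False by (simp add: fast_grow_def[abs_def] F_def[abs_def])
    have val: "fast_slope s * fast_grow s = exp (F s)"
      unfolding fg using m by (simp add: fast_slope_def m_def)
    ultimately show ?thesis unfolding val unfolding fg by simp
  qed
qed

lemma fast_grow_cont: "continuous_on {0..} fast_grow"
proof (cases "p = 1")
  case True
  have "continuous_on {0..} (\<lambda>s. exp (slow.T (fast.M s)))"
    by (intro continuous_intros continuous_on_compose2[OF slow.T_cont fast.M_cont]) (use fast.T_M in auto)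
  then show ?thesis unfolding fast_grow_one[OF True] .
next
  case False
  have m: "0 \<le> fast.M s" "fast.M s < 1" if "s \<in> {0..}" for s using fast.T_M[of s] that by auto
  have "1 + (fast.M s)\<^sup>2 \<noteq> 0" "1 - fast.M s \<noteq> 0" "fast.M s + (p - 1) \<noteq> 0" if "s \<in> {0..}" for s
    using m[OF that] False p add_pos_nonneg[of 1 "(fast.M s)\<^sup>2"] by auto
  then show ?thesis
    using False p unfolding fast_grow_def[abs_def] by (auto intro!: continuous_intros fast.M_cont)
qed

lemma fast_slope_tendsto_1: "(fast_slope \<longlongrightarrow> 1) at_top"
  unfolding fast_slope_def[abs_def] using tendsto_inverse[OF fast.M_tendsto_1] by simp

lemma fast_regime:
  assumes r: "0 < r" "r < R" and rs: "0 \<le> rs" "rs < Rs"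
    and k: "fast_grow 0 / fast_grow (ln (R / r)) \<le> rs / Rs" "rs / Rs < r / R"
  shows "\<exists>h. unique_min r R rs Rs h \<and> h \<in> radial_homeos p r R rs Rs"
proof -
  have l: "0 < ln (R / r)" using r by simp
  have "exp (- ln (R / r)) = r / R" using r by (simp add: exp_minus)
  then obtain \<sigma> where "0 \<le> \<sigma>" "fast_grow \<sigma> / fast_grow (\<sigma> + ln (R / r)) = rs / Rs"
    using quotient_shift_attains[OF fast_grow_deriv fast_grow_pos fast_slope_tendsto_1 l fast_grow_cont] k by metis
  then show ?thesis
    using shifted_regime[OF r rs fast_grow_deriv fast_grow_pos fast_slope_deriv fast_slope_pos fast_grow_cont] by blast
qed

lemma fast_grow_0: "1 < p \<Longrightarrow> fast_grow 0 = 0"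
  by (simp add: fast_grow_def)

text \<open>For \<open>p = 1\<close> the energy \<open>2 \<pi> \<integral> sqrt (\<rho>\<^sup>2 dH\<^sup>2 + H\<^sup>2 d\<rho>\<^sup>2)\<close> is symmetric in \<open>\<rho>\<close> and \<open>H\<close>. Passing to the
  inverse profile replaces \<open>\<lambda>\<close> by \<open>1 / \<lambda>\<close> and interchanges the slow and the fast trajectory; in formulas,
  \<open>fast_time p y = y * slow_time p y\<close>.\<close>

lemma duality:
  assumes p1: "p = 1" and l: "0 < l"
  shows "fast_grow 0 = 1" "crit_inv p (ereal (exp l)) = ereal (fast_grow l)"
proof -
  show "fast_grow 0 = 1" by (simp add: fast_grow_one[OF p1])
  define k where "k = slow.T (fast.M l)"
  have m: "0 < fast.M l" "fast.M l < 1" using fast_M[OF l] by auto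
  have k: "0 < k" using slow.T_strict_mono[of 0 "fast.M l"] m by (simp add: k_def)
  have eq: "ln (grow s) = fast.T (slow.M s)" if s: "0 < s" for s
  proof -
    have "ln (grow s) - fast.T (slow.M s) = ln (grow 0) - fast.T (slow.M 0)"
    proof (rule DERIV_isconst_end[OF s])
      have "continuous_on {0..s} (\<lambda>s. fast.T (slow.M s))"
        by (rule continuous_on_compose2[OF fast.T_cont continuous_on_subset[OF slow.M_cont]]) (use slow.T_M in auto)
      moreover have "continuous_on {0..s} (\<lambda>s. ln (grow s))"
        using grow_pos by (intro continuous_intros grow_cont) (auto simp: less_imp_neq[symmetric])
      ultimately show "continuous_on {0..s} (\<lambda>s. ln (grow s) - fast.T (slow.M s))"
        by (rule continuous_on_diff[rotated])
      fix x assume x: "0 < x" "x < s"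
      define y where "y = slow.M x"
      have y: "0 < y" "y < 1" using slow.M_pos[OF x(1)] slow.T_M[of x] x by (auto simp: y_def)
      have 1: "((\<lambda>s. ln (grow s)) has_real_derivative y) (at x)"
        by (rule DERIV_cong[OF DERIV_chain2[OF DERIV_ln[OF grow_pos] grow_deriv]])
          (use grow_pos[of x] x in \<open>simp add: slope_def y_def\<close>)
      have "((\<lambda>s. fast.T (slow.M s)) has_real_derivative fast_time p y * inverse (slow_time p y)) (at x)"
        using DERIV_chain2[OF fast.T_deriv slow.M_deriv[OF x(1)]] y by (simp add: y_def)
      moreover have "fast_time p y * inverse (slow_time p y) = y"
        using slow.w_pos[OF y] unfolding fast_time_one[OF p1 y(1)] by simp
      ultimately show "((\<lambda>s. ln (grow s) - fast.T (slow.M s)) has_real_derivative 0) (at x)"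
        using DERIV_diff[OF 1] by force
    qed
    then show ?thesis by simp
  qed
  have "ln (grow k) = fast.T (fast.M l)"
    unfolding eq[OF k] by (simp add: k_def slow.M_T m less_imp_le)
  then have "grow k = exp l" using fast.T_M[of l] l grow_pos[of k] by (metis exp_ln less_imp_le)
  then show "crit_inv p (ereal (exp l)) = ereal (fast_grow l)"
    using crit_inv_eq[OF k] by (simp add: fast_grow_one[OF p1] k_def)
qed

text \<open>The untranslated fast trajectory that ends at \<open>Rs\<close> starts above \<open>rs\<close>, with infinite slope.\<close>

lemma no_minimizer_regime:
  assumes p1: "p = 1" and r: "0 < r" "r < R" and rs: "0 \<le> rs" "rs < Rs"
    and k: "rs / Rs < 1 / fast_grow (ln (R / r))"
  shows "\<not> is_arg_min (energy 1 (annulus r R)) (\<lambda>g. g \<in> radial_monotone_maps 1 r R rs Rs) h"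
proof -
  have l: "0 < ln (R / r)" using r by simp
  define c where "c = Rs / fast_grow (ln (R / r))"
  define H0 where "H0 \<rho> = c * fast_grow (ln (\<rho> / r))" for \<rho>
  have c: "0 < c" using fast_grow_pos[OF l] rs by (simp add: c_def)
  have pos: "0 < ln (\<rho> / r)" if "r < \<rho>" for \<rho> using that r by simp
  interpret X: log_profile p r r c r rs fast_grow fast_slope H0
  proof
    show "H0 \<rho> = c * fast_grow (ln (\<rho> / r))" for \<rho> by (simp add: H0_def)
    show "(fast_grow has_real_derivative fast_slope (ln (\<rho> / r)) * fast_grow (ln (\<rho> / r))) (at (ln (\<rho> / r)))"
      "0 < fast_grow (ln (\<rho> / r))" "isCont fast_slope (ln (\<rho> / r))" "0 \<le> fast_slope (ln (\<rho> / r))"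
      "(fast_slope has_real_derivative elasticity_rate p (fast_slope (ln (\<rho> / r)))) (at (ln (\<rho> / r)))" if "r < \<rho>" for \<rho>
      using fast_grow_deriv[OF pos[OF that]] fast_grow_pos[OF pos[OF that]] fast_slope_deriv[OF pos[OF that]]
        fast_slope_pos[OF pos[OF that]] DERIV_isCont by auto
  qed (use r c in auto)
  interpret Y: radial_extremal r R H0 X.H0' p r rs by (rule X.extremal[OF r(2)])
  have cont: "continuous_on {r..R} H0"
    unfolding H0_def using r by (intro continuous_intros continuous_on_compose2[OF fast_grow_cont]) auto
  have H0r: "H0 r = c" using duality(1)[OF p1 l] r by (simp add: H0_def)
  have H0R: "H0 R = Rs" using fast_grow_pos[OF l] by (simp add: H0_def c_def)
  have jump: "rs < H0 r" unfolding H0r c_def using k rs fast_grow_pos[OF l] by (simp add: field_simps)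
  have mono: "0 \<le> X.H0' \<rho>" if "r < \<rho>" "\<rho> < R" for \<rho>
    using X.L(2)[of \<rho>] X.H0_pos'[of \<rho>] that r by (simp add: X.H0'_def X.lam_def)
  have "(Y.flux \<longlongrightarrow> r / sqrt (1 + (fast.M 0)\<^sup>2)) (at_right r)"
  proof (rule Lim_transform_eventually)
    have "((\<lambda>\<rho>. fast.M (ln (\<rho> / r))) \<longlongrightarrow> fast.M (ln (r / r))) (at_right r)"
    proof -
      have "continuous_on {r..R} (\<lambda>\<rho>. fast.M (ln (\<rho> / r)))"
        using r by (intro continuous_on_compose2[OF fast.M_cont] continuous_intros) auto
      then show ?thesis using r by (intro continuous_on_Icc_at_rightD) auto
    qed
    then show "((\<lambda>\<rho>. \<rho> / sqrt (1 + (fast.M (ln (\<rho> / r)))\<^sup>2)) \<longlongrightarrow> r / sqrt (1 + (fast.M 0)\<^sup>2)) (at_right r)"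
      using r by (intro tendsto_intros) auto
    have "\<rho> / sqrt (1 + (fast.M (ln (\<rho> / r)))\<^sup>2) = Y.flux \<rho>" if \<rho>: "r < \<rho>" for \<rho>
    proof -
      define m where "m = fast.M (ln (\<rho> / r))"
      have m: "m > 0" using fast_M(1)[OF pos[OF \<rho>]] by (simp add: m_def)
      have one: "1 + m\<^sup>2 > 0" by (auto intro: add_pos_nonneg)
      have lam: "X.lam \<rho> = inverse m" by (simp add: X.lam_def fast_slope_def m_def)
      have "1 + (inverse m)\<^sup>2 = (1 + m\<^sup>2) / m\<^sup>2" using m by (simp add: field_simps)
      then have sq: "sqrt (1 + (inverse m)\<^sup>2) = sqrt (1 + m\<^sup>2) / m" using m by (simp add: real_sqrt_divide)
      have "(1 + (inverse m)\<^sup>2) powr ((p - 2) / 2) = 1 / sqrt (1 + (inverse m)\<^sup>2)"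
        using one by (simp add: p1 powr_minus_divide powr_half_sqrt add_pos_nonneg)
      then have "X.log_flux \<rho> = \<rho> / sqrt (1 + m\<^sup>2)"
        unfolding X.log_flux_def lam sq using X.H0_pos'[OF \<rho>] \<rho> r m by (simp add: p1)
      then show ?thesis unfolding Y.flux_def X.flux_log[OF \<rho>] m_def by simp
    qed
    then show "eventually (\<lambda>\<rho>. \<rho> / sqrt (1 + (fast.M (ln (\<rho> / r)))\<^sup>2) = Y.flux \<rho>) (at_right r)"
      using r by (auto simp: eventually_at_right_field)
  qed
  then have "(Y.flux \<longlongrightarrow> r) (at_right r)" by simp
  from Y.no_minimizer_if_jump[OF p1 refl cont mono this rs(1) jump] show ?thesis unfolding H0R by simp
qed

end

section \<open>Existence and non-existence of minimizers\<close>

lemma (in exponent) homeo_regime: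
  assumes r: "0 < r" "r < R" and rs: "0 \<le> rs" "rs < Rs"
    and slow: "0 < rs \<Longrightarrow> grow (ln (R / r)) \<le> Rs / rs"
    and fast: "fast_grow 0 / fast_grow (ln (R / r)) \<le> rs / Rs"
  shows "\<exists>h. unique_min r R rs Rs h \<and> h \<in> radial_homeos p r R rs Rs"
proof -
  consider (slow) "r * Rs < rs * R" | (linear) "rs * R = r * Rs" | (fast) "rs * R < r * Rs" by linarith
  then show ?thesis
  proof cases
    case slow
    have "0 < r * Rs" using r rs by (intro mult_pos_pos) auto
    then have "0 < rs * R" using slow by linarith
    then have rs0: "0 < rs" using r by (simp add: zero_less_mult_iff)
    have "Rs / rs < R / r" using slow r rs0 by (simp add: field_simps)
    then show ?thesis using slow_regime[OF r rs0 rs(2) assms(5)[OF rs0]] by blast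
  next
    case linear
    then show ?thesis using linear_regime[OF less_imp_le[OF r(1)] r(2) rs] by blast
  next
    case fast
    have "rs / Rs < r / R" using fast r rs by (simp add: field_simps)
    then show ?thesis using fast_regime[OF r rs assms(6)] by blast
  qed
qed

lemma radii_ratio_pos: "0 < a \<Longrightarrow> radii_ratio a b = ereal (b / a)"
  by (simp add: radii_ratio_def)

lemma radii_ratio_zero: "radii_ratio 0 b = \<infinity>"
  by (simp add: radii_ratio_def)

theorem theorem1p4:
  fixes p :: real
  assumes "1 \<le> p" and "p < 2"
  shows "crit p \<in> {1<..} \<rightarrow> {1<..} \<and> strict_mono_on {1<..} (crit p) \<and>
    (\<forall>r R rs Rs :: real. 0 \<le> r \<and> r < R \<and> 0 \<le> rs \<and> rs < Rs \<longrightarrow>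
      (1 < p \<longrightarrow>
        (\<exists>h. is_unique_minimizer (annulus r R) (energy p (annulus r R))
               (radial_monotone_maps p r R rs Rs) h \<and>
             (crit p (radii_ratio r R) \<le> radii_ratio rs Rs \<longrightarrow>
               h \<in> radial_homeos p r R rs Rs))) \<and>
      (p = 1 \<longrightarrow>
        (radii_ratio rs Rs < crit 1 (radii_ratio r R) \<longrightarrow>
          (\<exists>h. is_unique_minimizer (annulus r R) (energy 1 (annulus r R))
                 (radial_monotone_maps 1 r R rs Rs) h \<and>
               h \<in> radial_monotone_maps 1 r R rs Rs - radial_homeos 1 r R rs Rs)) \<and>
        (crit 1 (radii_ratio r R) \<le> radii_ratio rs Rs \<and>
         radii_ratio rs Rs \<le> crit_inv 1 (radii_ratio r R) \<longrightarrow>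
          (\<exists>h. is_unique_minimizer (annulus r R) (energy 1 (annulus r R))
                 (radial_monotone_maps 1 r R rs Rs) h \<and>
               h \<in> radial_homeos 1 r R rs Rs)) \<and>
        (crit_inv 1 (radii_ratio r R) < radii_ratio rs Rs \<longrightarrow>
          \<not> (\<exists>h. is_arg_min (energy 1 (annulus r R))
                   (\<lambda>g. g \<in> radial_monotone_maps 1 r R rs Rs) h))))"
proof (intro conjI allI impI)
  interpret exponent p using assms by unfold_locales
  show "crit p \<in> {1<..} \<rightarrow> {1<..}" by (rule crit_maps)
  show "strict_mono_on {1<..} (crit p)" by (rule crit_strict_mono)
  fix r R rs Rs :: real
  assume "0 \<le> r \<and> r < R \<and> 0 \<le> rs \<and> rs < Rs"
  then have r: "0 \<le> r" "r < R" and rs: "0 \<le> rs" "rs < Rs" by auto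
  have plateau: "0 < rs \<and> (0 < r \<longrightarrow> Rs / rs < grow (ln (R / r)))"
    if "radii_ratio rs Rs < crit p (radii_ratio r R)"
    using that rs r by (cases "rs = 0"; cases "r = 0") (auto simp: radii_ratio_zero radii_ratio_pos crit_eq)
  have beyond: "grow (ln (R / r)) \<le> Rs / rs"
    if "crit p (radii_ratio r R) \<le> radii_ratio rs Rs" "0 < r" "0 < rs"
    using that r by (simp add: radii_ratio_pos crit_eq)
  \<comment> \<open>The critical value is infinite for a punctured disk.\<close>
  have punctured: "rs = 0"
    if "crit p (radii_ratio r R) \<le> radii_ratio rs Rs" "r = 0"
    using that rs by (cases "rs = 0") (auto simp: radii_ratio_zero radii_ratio_pos)
  {
    assume p1: "1 < p"
    show "\<exists>h. unique_min r R rs Rs h \<and>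
      (crit p (radii_ratio r R) \<le> radii_ratio rs Rs \<longrightarrow> h \<in> radial_homeos p r R rs Rs)"
    proof (cases "radii_ratio rs Rs < crit p (radii_ratio r R)")
      case True
      then obtain h where "unique_min r R rs Rs h"
        using plateau_regime[OF r _ rs(2)] plateau by blast
      then show ?thesis using True by (intro exI[of _ h]) auto
    next
      case False
      then have ge: "crit p (radii_ratio r R) \<le> radii_ratio rs Rs" by simp
      have "\<exists>h. unique_min r R rs Rs h \<and> h \<in> radial_homeos p r R rs Rs"
      proof (cases "r = 0")
        case True
        then show ?thesis using linear_regime[OF r rs] punctured[OF ge] by simp
      next
        case False
        then have "0 < r" using r by simp
        then show ?thesis
          using homeo_regime[OF _ r(2) rs] beyond[OF ge] fast_grow_0[OF p1] rs by simp
      qed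
      then show ?thesis by blast
    qed
  }
  {
    assume p1: "p = 1"
    have inv: "crit_inv 1 (radii_ratio r R) = ereal (fast_grow (ln (R / r)))" and fg: "fast_grow (ln (R / r)) > 0"
      if "0 < r"
    proof -
      have "0 < ln (R / r)" using that r by simp
      then show "crit_inv 1 (radii_ratio r R) = ereal (fast_grow (ln (R / r)))" "fast_grow (ln (R / r)) > 0"
        using duality(2)[OF p1, of "ln (R / r)"] that r fast_grow_pos p1 by (auto simp: radii_ratio_pos)
    qed
    show "\<exists>h. is_unique_minimizer (annulus r R) (energy 1 (annulus r R)) (radial_monotone_maps 1 r R rs Rs) h \<and>
        h \<in> radial_monotone_maps 1 r R rs Rs - radial_homeos 1 r R rs Rs"
      if "radii_ratio rs Rs < crit 1 (radii_ratio r R)"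
      using plateau_regime[OF r _ rs(2)] plateau that unfolding p1 by blast
    show "\<exists>h. is_unique_minimizer (annulus r R) (energy 1 (annulus r R)) (radial_monotone_maps 1 r R rs Rs) h \<and>
        h \<in> radial_homeos 1 r R rs Rs"
      if *: "crit 1 (radii_ratio r R) \<le> radii_ratio rs Rs \<and> radii_ratio rs Rs \<le> crit_inv 1 (radii_ratio r R)"
    proof -
      have ge: "crit p (radii_ratio r R) \<le> radii_ratio rs Rs" using * p1 by simp
      have "\<exists>h. unique_min r R rs Rs h \<and> h \<in> radial_homeos p r R rs Rs"
      proof (cases "r = 0")
        case True
        then show ?thesis using linear_regime[OF r rs] punctured[OF ge] by simp
      next
        case False
        then have r0: "0 < r" using r by simp
        have rs0: "0 < rs" and le: "Rs / rs \<le> fast_grow (ln (R / r))"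
          using * rs inv[OF r0] by (cases "rs = 0"; simp add: radii_ratio_zero radii_ratio_pos)+
        have "1 / fast_grow (ln (R / r)) \<le> rs / Rs"
          using le fg[OF r0] rs0 rs by (simp add: field_simps)
        then show ?thesis
          using homeo_regime[OF r0 r(2) rs] beyond[OF ge r0] duality(1)[OF p1, of 1] by simp
      qed
      then show ?thesis unfolding p1 .
    qed
    show "\<not> (\<exists>h. is_arg_min (energy 1 (annulus r R)) (\<lambda>g. g \<in> radial_monotone_maps 1 r R rs Rs) h)"
      if *: "crit_inv 1 (radii_ratio r R) < radii_ratio rs Rs"
    proof -
      have r0: "0 < r" using * r crit_inv_infinity p1 by (cases "r = 0") (auto simp: radii_ratio_zero)
      have "rs / Rs < 1 / fast_grow (ln (R / r))"
      proof (cases "rs = 0")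
        case True
        then show ?thesis using fg[OF r0] by simp
      next
        case False
        then have rs0: "0 < rs" using rs by simp
        then have "fast_grow (ln (R / r)) < Rs / rs" using * inv[OF r0] by (simp add: radii_ratio_pos)
        then show ?thesis using fg[OF r0] rs0 rs by (simp add: field_simps)
      qed
      then show ?thesis using no_minimizer_regime[OF p1 r0 r(2) rs] by blast
    qed
  }
qed

end
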